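(* Let $S$ and $T$ be arithmetically definable theories extending $\mathsf{ACA}_0$ which are both $\Pi^1_1$-sound. Then \[ |S|_{\Pi^1_1} < |T|_{\Pi^1_1} \iff T \vdash^{\Sigma^1_1} \mathsf{RFN}_{\Pi^1_1}(S). \]
   Context: Theories are sets of sentences in the language of second-order arithmetic (number variables and set/real variables); "extension of $U$" means a theory containing $U$; "true" means true in the standard model. A theory is arithmetically definable if its set of (codes of) axioms is definable by an arithmetical formula, and provability $\mathsf{Prv}_T$ is formalized using that definition. For a complexity class $\Gamma$, $\mathsf{True}_\Gamma$ is a fixed universal $\Gamma$-formula, and $\mathsf{RFN}_\Gamma(T)$ is the sentence $\forall^0 \phi\in\Gamma\,[\mathsf{Prv}_T(\phi)\to \mathsf{True}_\Gamma(\phi)]$. $T$ is $\Gamma$-sound if every $\Gamma$-sentence provable in $T$ is true. $T\vdash^{\Gamma}\phi$ means there is a true $\Gamma$-sentence $\theta$ with $T+\theta\vdash\phi$. For a $\Pi^1_1$-sound extension $T$ of $\mathsf{ACA}_0$, the proof-theoretic ordinal is $|T|_{\Pi^1_1}=\sup\{\alpha : \alpha \text{ a recursive well-order and } T\vdash \mathsf{WO}(\alpha)\}$, where $\mathsf{WO}(\alpha)$ is the sentence "the recursive linear order $\alpha$ is well-ordered" and recursive well-orders are identified with their order types. *)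

theory Defs
  imports Main
begin

section \<open>The language of second-order arithmetic and its standard model\<close>

text \<open>
  Number variables and set variables are two separate families of de Bruijn indices;
  \<open>All0\<close> binds a number variable and \<open>All1\<close> binds a set variable.  In \<open>Mem t i\<close>, \<open>i\<close> is a
  set variable.
\<close>

datatype tm = Var nat | Zero | One | Add tm tm | Mul tm tm

datatype fm = Eq tm tm | Less tm tm | Mem tm nat | Neg fm | Imp fm fm | All0 fm | All1 fm

definition Conj :: "fm \<Rightarrow> fm \<Rightarrow> fm" where "Conj p q = Neg (Imp p (Neg q))"
definition Disj :: "fm \<Rightarrow> fm \<Rightarrow> fm" where "Disj p q = Imp (Neg p) q"
definition Iff :: "fm \<Rightarrow> fm \<Rightarrow> fm" where "Iff p q = Conj (Imp p q) (Imp q p)"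
definition Ex0 :: "fm \<Rightarrow> fm" where "Ex0 p = Neg (All0 (Neg p))"
definition Ex1 :: "fm \<Rightarrow> fm" where "Ex1 p = Neg (All1 (Neg p))"
definition Top :: fm where "Top = Eq Zero Zero"
definition Bot :: fm where "Bot = Neg Top"

definition conjs :: "fm list \<Rightarrow> fm" where "conjs ps = foldr Conj ps Top"
definition disjs :: "fm list \<Rightarrow> fm" where "disjs ps = foldr Disj ps Bot"

primrec evalt :: "(nat \<Rightarrow> nat) \<Rightarrow> tm \<Rightarrow> nat" where
  "evalt e (Var i) = e i"
| "evalt e Zero = 0"
| "evalt e One = 1"
| "evalt e (Add s t) = evalt e s + evalt e t"
| "evalt e (Mul s t) = evalt e s * evalt e t"

primrec sat :: "(nat \<Rightarrow> nat) \<Rightarrow> (nat \<Rightarrow> nat set) \<Rightarrow> fm \<Rightarrow> bool" where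
  "sat e E (Eq s t) \<longleftrightarrow> evalt e s = evalt e t"
| "sat e E (Less s t) \<longleftrightarrow> evalt e s < evalt e t"
| "sat e E (Mem t i) \<longleftrightarrow> evalt e t \<in> E i"
| "sat e E (Neg p) \<longleftrightarrow> \<not> sat e E p"
| "sat e E (Imp p q) \<longleftrightarrow> (sat e E p \<longrightarrow> sat e E q)"
| "sat e E (All0 p) \<longleftrightarrow> (\<forall>n. sat (case_nat n e) E p)"
| "sat e E (All1 p) \<longleftrightarrow> (\<forall>X. sat e (case_nat X E) p)"

definition true_std :: "fm \<Rightarrow> bool" where
  "true_std p \<longleftrightarrow> (\<forall>e E. sat e E p)"

primrec lift_tm :: "nat \<Rightarrow> tm \<Rightarrow> tm" where
  "lift_tm k (Var i) = Var (if i < k then i else i + 1)"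
| "lift_tm k Zero = Zero"
| "lift_tm k One = One"
| "lift_tm k (Add s t) = Add (lift_tm k s) (lift_tm k t)"
| "lift_tm k (Mul s t) = Mul (lift_tm k s) (lift_tm k t)"

primrec subst_tm :: "nat \<Rightarrow> tm \<Rightarrow> tm \<Rightarrow> tm" where
  "subst_tm k r (Var i) = (if i < k then Var i else if i = k then r else Var (i - 1))"
| "subst_tm k r Zero = Zero"
| "subst_tm k r One = One"
| "subst_tm k r (Add s t) = Add (subst_tm k r s) (subst_tm k r t)"
| "subst_tm k r (Mul s t) = Mul (subst_tm k r s) (subst_tm k r t)"

primrec lift0 :: "nat \<Rightarrow> fm \<Rightarrow> fm" where
  "lift0 k (Eq s t) = Eq (lift_tm k s) (lift_tm k t)"
| "lift0 k (Less s t) = Less (lift_tm k s) (lift_tm k t)"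
| "lift0 k (Mem t i) = Mem (lift_tm k t) i"
| "lift0 k (Neg p) = Neg (lift0 k p)"
| "lift0 k (Imp p q) = Imp (lift0 k p) (lift0 k q)"
| "lift0 k (All0 p) = All0 (lift0 (k + 1) p)"
| "lift0 k (All1 p) = All1 (lift0 k p)"

primrec subst0 :: "nat \<Rightarrow> tm \<Rightarrow> fm \<Rightarrow> fm" where
  "subst0 k r (Eq s t) = Eq (subst_tm k r s) (subst_tm k r t)"
| "subst0 k r (Less s t) = Less (subst_tm k r s) (subst_tm k r t)"
| "subst0 k r (Mem t i) = Mem (subst_tm k r t) i"
| "subst0 k r (Neg p) = Neg (subst0 k r p)"
| "subst0 k r (Imp p q) = Imp (subst0 k r p) (subst0 k r q)"
| "subst0 k r (All0 p) = All0 (subst0 (k + 1) (lift_tm 0 r) p)"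
| "subst0 k r (All1 p) = All1 (subst0 k r p)"

primrec lift1 :: "nat \<Rightarrow> fm \<Rightarrow> fm" where
  "lift1 k (Eq s t) = Eq s t"
| "lift1 k (Less s t) = Less s t"
| "lift1 k (Mem t i) = Mem t (if i < k then i else i + 1)"
| "lift1 k (Neg p) = Neg (lift1 k p)"
| "lift1 k (Imp p q) = Imp (lift1 k p) (lift1 k q)"
| "lift1 k (All0 p) = All0 (lift1 k p)"
| "lift1 k (All1 p) = All1 (lift1 (k + 1) p)"

primrec subst1 :: "nat \<Rightarrow> nat \<Rightarrow> fm \<Rightarrow> fm" where
  "subst1 k j (Eq s t) = Eq s t"
| "subst1 k j (Less s t) = Less s t"
| "subst1 k j (Mem t i) = Mem t (if i < k then i else if i = k then j else i - 1)"
| "subst1 k j (Neg p) = Neg (subst1 k j p)"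
| "subst1 k j (Imp p q) = Imp (subst1 k j p) (subst1 k j q)"
| "subst1 k j (All0 p) = All0 (subst1 k j p)"
| "subst1 k j (All1 p) = All1 (subst1 (k + 1) (j + 1) p)"

text \<open>\<open>bd0 p\<close> and \<open>bd1 p\<close> are the least strict upper bounds of the free number and set variables.\<close>

primrec bd_tm :: "tm \<Rightarrow> nat" where
  "bd_tm (Var i) = i + 1"
| "bd_tm Zero = 0"
| "bd_tm One = 0"
| "bd_tm (Add s t) = max (bd_tm s) (bd_tm t)"
| "bd_tm (Mul s t) = max (bd_tm s) (bd_tm t)"

primrec bd0 :: "fm \<Rightarrow> nat" where
  "bd0 (Eq s t) = max (bd_tm s) (bd_tm t)"
| "bd0 (Less s t) = max (bd_tm s) (bd_tm t)"
| "bd0 (Mem t i) = bd_tm t"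
| "bd0 (Neg p) = bd0 p"
| "bd0 (Imp p q) = max (bd0 p) (bd0 q)"
| "bd0 (All0 p) = bd0 p - 1"
| "bd0 (All1 p) = bd0 p"

primrec bd1 :: "fm \<Rightarrow> nat" where
  "bd1 (Eq s t) = 0"
| "bd1 (Less s t) = 0"
| "bd1 (Mem t i) = i + 1"
| "bd1 (Neg p) = bd1 p"
| "bd1 (Imp p q) = max (bd1 p) (bd1 q)"
| "bd1 (All0 p) = bd1 p"
| "bd1 (All1 p) = bd1 p - 1"

primrec arithmetical :: "fm \<Rightarrow> bool" where
  "arithmetical (Eq s t) = True"
| "arithmetical (Less s t) = True"
| "arithmetical (Mem t i) = True"
| "arithmetical (Neg p) = arithmetical p"
| "arithmetical (Imp p q) = (arithmetical p \<and> arithmetical q)"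
| "arithmetical (All0 p) = arithmetical p"
| "arithmetical (All1 p) = False"

definition sentence :: "fm \<Rightarrow> bool" where
  "sentence p \<longleftrightarrow> bd0 p = 0 \<and> bd1 p = 0"

definition closure :: "fm \<Rightarrow> fm" where
  "closure p = (All0 ^^ bd0 p) ((All1 ^^ bd1 p) p)"

text \<open>Prenex with a single set quantifier; blocks of like quantifiers contract by pairing.\<close>

definition Pi11 :: "fm set" where
  "Pi11 = {All1 p | p. arithmetical p}"

definition Sigma11 :: "fm set" where
  "Sigma11 = {Ex1 p | p. arithmetical p}"


section \<open>Theories and provability\<close>

definition is_theory :: "fm set \<Rightarrow> bool" where
  "is_theory T \<longleftrightarrow> (\<forall>p\<in>T. sentence p)"

text \<open>
  A Hilbert calculus for two-sorted first-order logic with equality on numbers.  Since the axioms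
  in \<open>T\<close> are sentences, the generalization rules need no side condition.
\<close>

inductive prv :: "fm set \<Rightarrow> fm \<Rightarrow> bool"  (infix "\<turnstile>" 50) for T where
  Ax: "p \<in> T \<Longrightarrow> T \<turnstile> p"
| K: "T \<turnstile> Imp p (Imp q p)"
| S: "T \<turnstile> Imp (Imp p (Imp q r)) (Imp (Imp p q) (Imp p r))"
| N: "T \<turnstile> Imp (Imp (Neg p) (Neg q)) (Imp q p)"
| All0E: "T \<turnstile> Imp (All0 p) (subst0 0 t p)"
| All0D: "T \<turnstile> Imp (All0 (Imp (lift0 0 p) q)) (Imp p (All0 q))"
| All1E: "T \<turnstile> Imp (All1 p) (subst1 0 j p)"
| All1D: "T \<turnstile> Imp (All1 (Imp (lift1 0 p) q)) (Imp p (All1 q))"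
| Refl: "T \<turnstile> Eq t t"
| Leib: "T \<turnstile> Imp (Eq s t) (Imp (subst0 0 s p) (subst0 0 t p))"
| MP: "T \<turnstile> Imp p q \<Longrightarrow> T \<turnstile> p \<Longrightarrow> T \<turnstile> q"
| Gen0: "T \<turnstile> p \<Longrightarrow> T \<turnstile> All0 p"
| Gen1: "T \<turnstile> p \<Longrightarrow> T \<turnstile> All1 p"

definition prv_with :: "fm set \<Rightarrow> fm set \<Rightarrow> fm \<Rightarrow> bool"  ("_ \<turnstile>\<^bsub>_\<^esub> _" [51, 0, 51] 50) where
  "T \<turnstile>\<^bsub>\<Gamma>\<^esub> p \<longleftrightarrow> (\<exists>q\<in>\<Gamma>. sentence q \<and> true_std q \<and> insert q T \<turnstile> p)"

definition sound_for :: "fm set \<Rightarrow> fm set \<Rightarrow> bool" where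
  "sound_for \<Gamma> T \<longleftrightarrow> (\<forall>p\<in>\<Gamma>. sentence p \<longrightarrow> T \<turnstile> p \<longrightarrow> true_std p)"

definition basic_axioms :: "fm set" where
  "basic_axioms = (let m = Var 1; n = Var 0 in
    {Neg (Eq (Add n One) Zero),
     Imp (Eq (Add m One) (Add n One)) (Eq m n),
     Eq (Add m Zero) m,
     Eq (Add m (Add n One)) (Add (Add m n) One),
     Eq (Mul m Zero) Zero,
     Eq (Mul m (Add n One)) (Add (Mul m n) m),
     Neg (Less m Zero),
     Iff (Less m (Add n One)) (Disj (Less m n) (Eq m n))})"

definition induction_axiom :: fm where
  "induction_axiom =
     Imp (Conj (Mem Zero 0) (All0 (Imp (Mem (Var 0) 0) (Mem (Add (Var 0) One) 0))))
         (All0 (Mem (Var 0) 0))"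

definition comprehension :: "fm \<Rightarrow> fm" where
  "comprehension p = Ex1 (All0 (Iff (Mem (Var 0) 0) (lift1 0 p)))"

definition ACA0 :: "fm set" where
  "ACA0 = closure ` (basic_axioms \<union> {induction_axiom} \<union> {comprehension p | p. arithmetical p})"


section \<open>Goedel numbering\<close>

primrec num :: "nat \<Rightarrow> tm" where
  "num 0 = Zero"
| "num (Suc n) = Add (num n) One"

definition pair :: "nat \<Rightarrow> nat \<Rightarrow> nat" where
  "pair a b = (a + b) * (a + b) + a"

primrec tcode :: "tm \<Rightarrow> nat" where
  "tcode (Var i) = pair 0 i"
| "tcode Zero = pair 1 0"
| "tcode One = pair 2 0"
| "tcode (Add s t) = pair 3 (pair (tcode s) (tcode t))"
| "tcode (Mul s t) = pair 4 (pair (tcode s) (tcode t))"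

primrec fcode :: "fm \<Rightarrow> nat" where
  "fcode (Eq s t) = pair 0 (pair (tcode s) (tcode t))"
| "fcode (Less s t) = pair 1 (pair (tcode s) (tcode t))"
| "fcode (Mem t i) = pair 2 (pair (tcode t) i)"
| "fcode (Neg p) = pair 3 (fcode p)"
| "fcode (Imp p q) = pair 4 (pair (fcode p) (fcode q))"
| "fcode (All0 p) = pair 5 (fcode p)"
| "fcode (All1 p) = pair 6 (fcode p)"

text \<open>\<open>\<sigma>\<close> is an arithmetical formula with free variable \<open>Var 0\<close> that defines the axioms of \<open>T\<close>.\<close>

definition defines_axioms :: "fm \<Rightarrow> fm set \<Rightarrow> bool" where
  "defines_axioms \<sigma> T \<longleftrightarrow> arithmetical \<sigma> \<and> bd0 \<sigma> \<le> 1 \<and> bd1 \<sigma> = 0 \<and>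
     (\<forall>n e E. sat (case_nat n e) E \<sigma> \<longleftrightarrow> n \<in> fcode ` T)"

definition arith_definable :: "fm set \<Rightarrow> bool" where
  "arith_definable T \<longleftrightarrow> (\<exists>\<sigma>. defines_axioms \<sigma> T)"


section \<open>Formalized provability\<close>

definition up :: "nat \<Rightarrow> tm \<Rightarrow> tm" where
  "up k t = (lift_tm 0 ^^ k) t"

text \<open>Goedel's beta function: \<open>v\<close> is the remainder of \<open>a\<close> modulo \<open>1 + (i + 1) * b\<close>.\<close>

definition beta_fm :: "tm \<Rightarrow> tm \<Rightarrow> tm \<Rightarrow> tm \<Rightarrow> fm" where
  "beta_fm a b i v = (let d = Add One (Mul (Add i One) b) in
     Conj (Less v d) (Ex0 (Eq (up 1 a) (Add (Mul (Var 0) (up 1 d)) (up 1 v)))))"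

text \<open>
  A finite system of rules for an inductive definition on the natural numbers.  A rule \<open>(c, ps, s)\<close>
  has conclusion \<open>c\<close>, premises \<open>ps\<close> and side condition \<open>s\<close>; its metavariables are \<open>Var 0\<close>, ...,
  \<open>Var 7\<close>.  \<open>der_fm rs x\<close> says that \<open>x\<close> is the last entry of a finite sequence (coded by \<open>a\<close>, \<open>b\<close>
  via the beta function) each of whose entries follows from earlier ones by a rule.  Inside the
  eight metavariable quantifiers the current position is \<open>Var 8\<close>, the length \<open>Var 9\<close>, and \<open>b\<close>, \<open>a\<close>
  are \<open>Var 10\<close>, \<open>Var 11\<close>.
\<close>

type_synonym rule = "tm \<times> tm list \<times> fm"

definition prev_fm :: "tm \<Rightarrow> fm" where
  "prev_fm t = Ex0 (Conj (Less (Var 0) (Var 9)) (beta_fm (Var 12) (Var 11) (Var 0) (up 1 t)))"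

definition step_fm :: "rule \<Rightarrow> fm" where
  "step_fm r = (case r of (c, ps, s) \<Rightarrow>
     Conj (beta_fm (Var 11) (Var 10) (Var 8) c) (Conj s (conjs (map prev_fm ps))))"

definition der_fm :: "rule list \<Rightarrow> tm \<Rightarrow> fm" where
  "der_fm rs x = Ex0 (Ex0 (Ex0 (Conj (beta_fm (Var 2) (Var 1) (Var 0) (up 3 x))
     (All0 (Imp (Less (Var 0) (Add (Var 1) One)) ((Ex0 ^^ 8) (disjs (map step_fm rs))))))))"

definition qpair :: "tm \<Rightarrow> tm \<Rightarrow> tm" where
  "qpair a b = Add (Mul (Add a b) (Add a b)) a"

definition "qVar i = qpair (num 0) i"
definition "qZero = qpair (num 1) (num 0)"
definition "qOne = qpair (num 2) (num 0)"
definition "qAdd s t = qpair (num 3) (qpair s t)"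
definition "qMul s t = qpair (num 4) (qpair s t)"

definition "qEq s t = qpair (num 0) (qpair s t)"
definition "qLess s t = qpair (num 1) (qpair s t)"
definition "qMem t i = qpair (num 2) (qpair t i)"
definition "qNeg p = qpair (num 3) p"
definition "qImp p q = qpair (num 4) (qpair p q)"
definition "qAll0 p = qpair (num 5) p"
definition "qAll1 p = qpair (num 6) p"

text \<open>
  Judgements: \<open>p\<close>, \<open>p'\<close> are formulas, \<open>t\<close>, \<open>t'\<close>, \<open>r\<close> terms.
  \<open>jT n t\<close>: the variables of \<open>t\<close> are below \<open>n\<close>;
  \<open>jF c n m p\<close>: the free number (set) variables of \<open>p\<close> are below \<open>n\<close> (\<open>m\<close>), and \<open>p\<close> is arithmetical
  in case \<open>c = 0\<close>;
  \<open>jLT k t t'\<close>: \<open>t' = lift_tm k t\<close>;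
  \<open>jST k r t t'\<close>: \<open>t' = subst_tm k r t\<close>;
  \<open>jL0\<close>, \<open>jS0\<close>, \<open>jL1\<close>, \<open>jS1\<close>: likewise for \<open>lift0\<close>, \<open>subst0\<close>, \<open>lift1\<close>, \<open>subst1\<close>;
  \<open>jP p\<close>: \<open>p\<close> is provable.
\<close>

definition "jT n t = qpair (num 0) (qpair n t)"
definition "jF c n m p = qpair (num 1) (qpair c (qpair n (qpair m p)))"
definition "jLT k t t' = qpair (num 2) (qpair k (qpair t t'))"
definition "jST k r t t' = qpair (num 3) (qpair k (qpair r (qpair t t')))"
definition "jL0 k p p' = qpair (num 4) (qpair k (qpair p p'))"
definition "jS0 k r p p' = qpair (num 5) (qpair k (qpair r (qpair p p')))"
definition "jL1 k p p' = qpair (num 6) (qpair k (qpair p p'))"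
definition "jS1 k j p p' = qpair (num 7) (qpair k (qpair j (qpair p p')))"
definition "jP p = qpair (num 8) p"

definition form_rules :: "rule list" where
  "form_rules =
  (let x = Var 0; y = Var 1; k = Var 5; m = Var 6; c = Var 7; suc = (\<lambda>t. Add t One) in
   [(jT k (qVar x), [], Less x k),
    (jT k qZero, [], Top),
    (jT k qOne, [], Top),
    (jT k (qAdd x y), [jT k x, jT k y], Top),
    (jT k (qMul x y), [jT k x, jT k y], Top),
    (jF c k m (qEq x y), [jT k x, jT k y], Top),
    (jF c k m (qLess x y), [jT k x, jT k y], Top),
    (jF c k m (qMem x y), [jT k x], Less y m),
    (jF c k m (qNeg x), [jF c k m x], Top),
    (jF c k m (qImp x y), [jF c k m x, jF c k m y], Top),
    (jF c k m (qAll0 x), [jF c (suc k) m x], Top),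
    (jF One k m (qAll1 x), [jF One k (suc m) x], Top)])"

definition subst_rules :: "rule list" where
  "subst_rules =
  (let x = Var 0; y = Var 1; z = Var 2; x' = Var 3; y' = Var 4; k = Var 5; m = Var 6;
     suc = (\<lambda>t. Add t One) in
   [(jLT k (qVar x) (qVar x), [], Less x k),
    (jLT k (qVar x) (qVar (suc x)), [], Neg (Less x k)),
    (jLT k qZero qZero, [], Top),
    (jLT k qOne qOne, [], Top),
    (jLT k (qAdd x y) (qAdd x' y'), [jLT k x x', jLT k y y'], Top),
    (jLT k (qMul x y) (qMul x' y'), [jLT k x x', jLT k y y'], Top),

    (jST k m (qVar x) (qVar x), [], Less x k),
    (jST k m (qVar k) m, [], Top),
    (jST k m (qVar (suc x)) (qVar x), [], Neg (Less x k)),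
    (jST k m qZero qZero, [], Top),
    (jST k m qOne qOne, [], Top),
    (jST k m (qAdd x y) (qAdd x' y'), [jST k m x x', jST k m y y'], Top),
    (jST k m (qMul x y) (qMul x' y'), [jST k m x x', jST k m y y'], Top),

    (jL0 k (qEq x y) (qEq x' y'), [jLT k x x', jLT k y y'], Top),
    (jL0 k (qLess x y) (qLess x' y'), [jLT k x x', jLT k y y'], Top),
    (jL0 k (qMem x y) (qMem x' y), [jLT k x x'], Top),
    (jL0 k (qNeg x) (qNeg x'), [jL0 k x x'], Top),
    (jL0 k (qImp x y) (qImp x' y'), [jL0 k x x', jL0 k y y'], Top),
    (jL0 k (qAll0 x) (qAll0 x'), [jL0 (suc k) x x'], Top),
    (jL0 k (qAll1 x) (qAll1 x'), [jL0 k x x'], Top),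

    (jS0 k m (qEq x y) (qEq x' y'), [jST k m x x', jST k m y y'], Top),
    (jS0 k m (qLess x y) (qLess x' y'), [jST k m x x', jST k m y y'], Top),
    (jS0 k m (qMem x y) (qMem x' y), [jST k m x x'], Top),
    (jS0 k m (qNeg x) (qNeg x'), [jS0 k m x x'], Top),
    (jS0 k m (qImp x y) (qImp x' y'), [jS0 k m x x', jS0 k m y y'], Top),
    (jS0 k m (qAll0 x) (qAll0 x'), [jLT Zero m z, jS0 (suc k) z x x'], Top),
    (jS0 k m (qAll1 x) (qAll1 x'), [jS0 k m x x'], Top),

    (jL1 k (qEq x y) (qEq x y), [], Top),
    (jL1 k (qLess x y) (qLess x y), [], Top),
    (jL1 k (qMem x y) (qMem x y), [], Less y k),
    (jL1 k (qMem x y) (qMem x (suc y)), [], Neg (Less y k)),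
    (jL1 k (qNeg x) (qNeg x'), [jL1 k x x'], Top),
    (jL1 k (qImp x y) (qImp x' y'), [jL1 k x x', jL1 k y y'], Top),
    (jL1 k (qAll0 x) (qAll0 x'), [jL1 k x x'], Top),
    (jL1 k (qAll1 x) (qAll1 x'), [jL1 (suc k) x x'], Top),

    (jS1 k m (qEq x y) (qEq x y), [], Top),
    (jS1 k m (qLess x y) (qLess x y), [], Top),
    (jS1 k m (qMem x y) (qMem x y), [], Less y k),
    (jS1 k m (qMem x k) (qMem x m), [], Top),
    (jS1 k m (qMem x (suc y)) (qMem x y), [], Neg (Less y k)),
    (jS1 k m (qNeg x) (qNeg x'), [jS1 k m x x'], Top),
    (jS1 k m (qImp x y) (qImp x' y'), [jS1 k m x x', jS1 k m y y'], Top),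
    (jS1 k m (qAll0 x) (qAll0 x'), [jS1 k m x x'], Top),
    (jS1 k m (qAll1 x) (qAll1 x'), [jS1 (suc k) (suc m) x x'], Top)])"

definition logic_rule :: "tm \<Rightarrow> tm list \<Rightarrow> rule" where
  "logic_rule p ps = (jP p, jF One (Var 5) (Var 6) p # ps, Top)"

definition prv_rules :: "fm \<Rightarrow> rule list" where
  "prv_rules \<sigma> = form_rules @ subst_rules @
  (let x = Var 0; y = Var 1; z = Var 2; x' = Var 3; y' = Var 4; k = Var 5; m = Var 6;
     suc = (\<lambda>t. Add t One) in
   [(jP x, [jF One Zero Zero x], \<sigma>),
    logic_rule (qImp x (qImp y x)) [],
    logic_rule (qImp (qImp x (qImp y z)) (qImp (qImp x y) (qImp x z))) [],
    logic_rule (qImp (qImp (qNeg x) (qNeg y)) (qImp y x)) [],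
    logic_rule (qImp (qAll0 x) x') [jT k y, jS0 Zero y x x'],
    logic_rule (qImp (qAll0 (qImp x' y)) (qImp x (qAll0 y))) [jL0 Zero x x'],
    logic_rule (qImp (qAll1 x) x') [jS1 Zero y x x'],
    logic_rule (qImp (qAll1 (qImp x' y)) (qImp x (qAll1 y))) [jL1 Zero x x'],
    logic_rule (qEq x x) [],
    logic_rule (qImp (qEq x y) (qImp x' y'))
      [jF One (suc k) m z, jS0 Zero x z x', jS0 Zero y z y'],
    (jP y, [jP (qImp x y), jP x], Top),
    (jP (qAll0 x), [jP x], Top),
    (jP (qAll1 x), [jP x], Top)])"

text \<open>\<open>t\<close> is the code of a formula provable in the theory whose axioms are defined by \<open>\<sigma>\<close>.\<close>

definition Prv_fm :: "fm \<Rightarrow> tm \<Rightarrow> fm" where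
  "Prv_fm \<sigma> t = der_fm (prv_rules \<sigma>) (jP t)"

definition Pi11_sentence_fm :: "tm \<Rightarrow> fm" where
  "Pi11_sentence_fm t =
     Ex0 (Conj (Eq (up 1 t) (qAll1 (Var 0))) (der_fm form_rules (jF Zero Zero One (Var 0))))"

text \<open>
  The truth definition \<open>True\<close> for \<open>Pi11\<close> is a parameter: it may be any universal \<open>Pi11\<close>-formula, i.e.
  any \<open>Pi11\<close>-formula \<open>U\<close> with free variable \<open>Var 0\<close> for which \<open>ACA0\<close> proves
  \<open>p \<longleftrightarrow> U(\<lceil>p\<rceil>)\<close> for every \<open>Pi11\<close>-sentence \<open>p\<close>.
\<close>

definition universal_Pi11 :: "fm \<Rightarrow> bool" where
  "universal_Pi11 U \<longleftrightarrow> U \<in> Pi11 \<and> bd0 U \<le> 1 \<and> bd1 U = 0 \<and>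
     (\<forall>p\<in>Pi11. sentence p \<longrightarrow> ACA0 \<turnstile> Iff p (subst0 0 (num (fcode p)) U))"

definition RFN_Pi11 :: "fm \<Rightarrow> fm \<Rightarrow> fm" where
  "RFN_Pi11 U \<sigma> = All0 (Imp (Pi11_sentence_fm (Var 0)) (Imp (Prv_fm \<sigma> (Var 0)) U))"


section \<open>Recursive well-orders\<close>

datatype recf = ZeroF | SuccF | Proj nat | Comp recf "recf list" | PrimRec recf recf | Mu recf

inductive computes :: "recf \<Rightarrow> nat list \<Rightarrow> nat \<Rightarrow> bool" where
  "computes ZeroF xs 0"
| "computes SuccF [n] (Suc n)"
| "i < length xs \<Longrightarrow> computes (Proj i) xs (xs ! i)"
| "list_all2 (\<lambda>g. computes g xs) gs ys \<Longrightarrow> computes f ys n \<Longrightarrow> computes (Comp f gs) xs n"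
| "computes f xs n \<Longrightarrow> computes (PrimRec f g) (0 # xs) n"
| "computes (PrimRec f g) (i # xs) n \<Longrightarrow> computes g (i # n # xs) l \<Longrightarrow>
   computes (PrimRec f g) (Suc i # xs) l"
| "computes f (n # xs) 0 \<Longrightarrow> (\<And>i. i < n \<Longrightarrow> \<exists>l>0. computes f (i # xs) l) \<Longrightarrow>
   computes (Mu f) xs n"

text \<open>
  \<open>graph_fm f ts v\<close> says that \<open>f\<close> yields \<open>v\<close> on the arguments \<open>ts\<close>.  For \<open>PrimRec\<close>, the sequence of
  intermediate values is coded via the beta function.
\<close>

primrec graph_fm :: "recf \<Rightarrow> tm list \<Rightarrow> tm \<Rightarrow> fm" where
  "graph_fm ZeroF ts v = Eq v Zero"
| "graph_fm SuccF ts v = (case ts of [t] \<Rightarrow> Eq v (Add t One) | _ \<Rightarrow> Bot)"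
| "graph_fm (Proj i) ts v = (if i < length ts then Eq v (ts ! i) else Bot)"
| "graph_fm (Comp f gs) ts v = (let l = length gs; zs = map Var [0..<l] in
     (Ex0 ^^ l) (Conj (conjs (map2 (\<lambda>G. G (map (up l) ts)) (map graph_fm gs) zs))
                      (graph_fm f zs (up l v))))"
| "graph_fm (PrimRec f g) ts v = (case ts of [] \<Rightarrow> Bot | t # ts \<Rightarrow>
     Ex0 (Ex0 (Conj (beta_fm (Var 1) (Var 0) (up 2 t) (up 2 v))
       (Conj (Ex0 (Conj (beta_fm (Var 2) (Var 1) Zero (Var 0))
                        (graph_fm f (map (up 3) ts) (Var 0))))
             (All0 (Imp (Less (Var 0) (up 3 t))
               (Ex0 (Ex0 (Conj (Conj (beta_fm (Var 4) (Var 3) (Var 2) (Var 1))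
                                     (beta_fm (Var 4) (Var 3) (Add (Var 2) One) (Var 0)))
                               (graph_fm g (Var 2 # Var 1 # map (up 5) ts) (Var 0)))))))))))"
| "graph_fm (Mu f) ts v =
     Conj (graph_fm f (v # ts) Zero)
          (All0 (Imp (Less (Var 0) (up 1 v))
            (Ex0 (Conj (Less Zero (Var 0)) (graph_fm f (Var 1 # map (up 2) ts) (Var 0))))))"

text \<open>
  A recursive relation is given by a program \<open>f\<close> for its characteristic function; a recursive
  linear order is presented by such a program, and its sentence \<open>WO_fm f\<close> mentions the order
  through the formula \<open>graph_fm f\<close> for the graph of \<open>f\<close>.
\<close>

definition decides :: "recf \<Rightarrow> bool" where
  "decides f \<longleftrightarrow> (\<forall>a b. computes f [a, b] 0 \<or> computes f [a, b] 1)"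

definition rel_of :: "recf \<Rightarrow> nat rel" where
  "rel_of f = {(a, b). computes f [a, b] 1}"

definition recursive_wo :: "recf \<Rightarrow> bool" where
  "recursive_wo f \<longleftrightarrow> decides f \<and> Well_order (rel_of f)"

text \<open>
  As in \<^const>\<open>Well_order\<close>, orders are reflexive and their field consists of the \<open>n\<close> with \<open>n \<le> n\<close>.
\<close>

definition LO_fm :: "recf \<Rightarrow> fm" where
  "LO_fm f = (let le = (\<lambda>s t. graph_fm f [s, t] One); a = Var 2; b = Var 1; c = Var 0 in
     All0 (All0 (All0 (conjs
       [Imp (le a b) (Conj (le a a) (le b b)),
        Imp (Conj (le a b) (le b c)) (le a c),
        Imp (Conj (le a b) (le b a)) (Eq a b),
        Imp (Conj (le a a) (le b b)) (Disj (le a b) (le b a))]))))"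

definition WF_fm :: "recf \<Rightarrow> fm" where
  "WF_fm f = (let le = (\<lambda>s t. graph_fm f [s, t] One);
                  In = (\<lambda>t. Conj (Mem t 0) (le t t)) in
     All1 (Imp (Ex0 (In (Var 0)))
       (Ex0 (Conj (In (Var 0)) (All0 (Imp (In (Var 0)) (le (Var 1) (Var 0))))))))"

definition WO_fm :: "recf \<Rightarrow> fm" where
  "WO_fm f = Conj (LO_fm f) (WF_fm f)"


section \<open>Countable ordinals and the proof-theoretic ordinal\<close>

text \<open>
  Countable ordinals: well-orders of subsets of \<open>nat\<close> modulo isomorphism.  They suffice, since
  the supremum of countably many countable ordinals is countable.
\<close>

quotient_type cord = "nat rel" / partial: "\<lambda>r s. (r, s) \<in> ordIso"
proof (rule part_equivpI)
  have "Well_order ({} :: nat rel)"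
    by (simp add: well_order_on_def linear_order_on_def partial_order_on_def preorder_on_def
        refl_on_def trans_def antisym_def total_on_def)
  then show "\<exists>r::nat rel. (r, r) \<in> ordIso" by (blast intro: ordIso_reflexive)
  show "symp (\<lambda>r s :: nat rel. (r, s) \<in> ordIso)"
    by (auto intro!: sympI ordIso_symmetric)
  show "transp (\<lambda>r s :: nat rel. (r, s) \<in> ordIso)"
    by (auto intro!: transpI intro: ordIso_transitive)
qed

instantiation cord :: wellorder
begin

lift_definition less_eq_cord :: "cord \<Rightarrow> cord \<Rightarrow> bool" is "\<lambda>r s. (r, s) \<in> ordLeq"
  by (meson ordIso_ordLeq_trans ordLeq_ordIso_trans ordIso_symmetric)

lift_definition less_cord :: "cord \<Rightarrow> cord \<Rightarrow> bool" is "\<lambda>r s. (r, s) \<in> ordLess"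
  by (meson ordIso_ordLess_trans ordLess_ordIso_trans ordIso_symmetric)

instance
proof
  have wo: "Well_order r" if "(r, r) \<in> ordIso" for r :: "nat rel"
    using that by (simp add: ordIso_def)
  fix a b d :: cord
  show "a < b \<longleftrightarrow> a \<le> b \<and> \<not> b \<le> a"
    by transfer (metis wo not_ordLess_ordLeq ordLess_imp_ordLeq ordLess_or_ordLeq)
  show "a \<le> a"
    by transfer (metis ordIso_iff_ordLeq)
  show "a \<le> b \<Longrightarrow> b \<le> d \<Longrightarrow> a \<le> d"
    by transfer (metis ordLeq_transitive)
  show "a \<le> b \<Longrightarrow> b \<le> a \<Longrightarrow> a = b"
    by transfer (metis ordIso_iff_ordLeq)
  show "a \<le> b \<or> b \<le> a"
    by transfer (metis wo ordLess_imp_ordLeq ordLess_or_ordLeq)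
next
  fix P :: "cord \<Rightarrow> bool" and a :: cord
  assume step: "\<And>b. (\<And>d. d < b \<Longrightarrow> P d) \<Longrightarrow> P b"
  have "wf (inv_image ordLess rep_cord)"
    by (rule wf_inv_image[OF wf_ordLess])
  moreover have "{(d, b). d < b} \<subseteq> inv_image ordLess rep_cord"
    by (auto simp: inv_image_def less_cord_def)
  ultimately have "wf {(d, b :: cord). d < b}"
    by (rule wf_subset)
  then show "P a"
    by (induction a rule: wf_induct_rule) (auto intro: step)
qed

end

definition ordertype :: "nat rel \<Rightarrow> cord" where
  "ordertype r = abs_cord r"

definition pto :: "fm set \<Rightarrow> cord" where
  "pto T = (LEAST \<beta>. \<forall>f. recursive_wo f \<and> T \<turnstile> WO_fm f \<longrightarrow> ordertype (rel_of f) \<le> \<beta>)"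

end

theory Submission
  imports Defs "HOL-Library.Countable_Set"
begin

text \<open>
  Over \<open>ACA\<^sub>0\<close>, a \<open>\<Pi>\<^sup>1\<^sub>1\<close>-formula \<open>\<forall>X. p(x, X)\<close> is a statement about a recursive tree of attempts to build a
  counterexample, and it holds at \<open>x\<close> iff the Kleene-Brouwer order of the tree for \<open>x\<close> is a well-order.

  If \<open>pto S < pto T\<close>, then \<open>T\<close> proves that some recursive order \<open>g\<close> longer than \<open>pto S\<close> is a well-order, and
  there is a set \<open>F\<close> of embeddings into \<open>g\<close> of the Kleene-Brouwer orders of all \<open>\<Pi>\<^sup>1\<^sub>1\<close>-theorems of \<open>S\<close>. The
  existence of \<open>F\<close> is a true \<open>\<Sigma>\<^sup>1\<^sub>1\<close>-sentence from which \<open>T\<close> infers that these theorems are true.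

  Conversely let \<open>T\<close> prove the reflection principle from a true \<open>\<Sigma>\<^sup>1\<^sub>1\<close>-sentence \<open>\<theta>\<close>, and let \<open>pto T \<le> pto S\<close>.
  Then \<open>\<theta> \<longrightarrow> RFN(S)\<close> is a \<open>\<Pi>\<^sup>1\<^sub>1\<close>-theorem of \<open>T\<close> whose Kleene-Brouwer order, without its roots, is shorter than
  \<open>pto S\<close>. An embedding of it into a provable well-order of \<open>S\<close> is a true \<open>\<Sigma>\<^sup>1\<^sub>1\<close>-fact from which, together with
  \<open>\<theta>\<close>, \<open>S\<close> proves its own reflection principle, which a form of Goedel's second theorem rules out.

  Provability is handled semantically: by a completeness theorem for countable models of \<open>ACA\<^sub>0\<close>, only truth in
  such models has to be considered.
\<close>


section \<open>Henkin structures and parallel substitution\<close>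

text \<open>The roots are removed for the sake of strictness. A supremum of provable well-orders
  need not be attained, so an order of length at most \<open>pto S\<close> need not embed into a
  well-order that \<open>S\<close> proves. All nonempty attempts lie below a root, hence within a
  proper initial segment, which is shorter than \<open>pto S\<close> and therefore does embed. This
  is enough, because a counterexample yields a descending sequence of nonempty attempts.

  The Goedel argument avoids them: reflection itself turns provability of the diagonal sentence into
  its truth. The Sigma11 hypothesis is made an antecedent of that sentence, so that \<open>S\<close>
  alone proves it and Pi11-soundness applies.

  A model may contain nonstandard theorems of \<open>S\<close>. The trees are therefore given by one
  bounded formula with a parameter \<open>x\<close>, and the link between counterexamples and paths
  is established in every model, for nonstandard \<open>x\<close> and nonstandard nodes too.\<close>

record 'a str =
  szero :: 'a
  sone :: 'a
  sadd :: "'a \<Rightarrow> 'a \<Rightarrow> 'a"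
  smul :: "'a \<Rightarrow> 'a \<Rightarrow> 'a"
  sless :: "'a \<Rightarrow> 'a \<Rightarrow> bool"
  ssets :: "'a set set"

primrec ev :: "'a str \<Rightarrow> (nat \<Rightarrow> 'a) \<Rightarrow> tm \<Rightarrow> 'a" where
  "ev M e (Var i) = e i"
| "ev M e Zero = szero M"
| "ev M e One = sone M"
| "ev M e (Add s t) = sadd M (ev M e s) (ev M e t)"
| "ev M e (Mul s t) = smul M (ev M e s) (ev M e t)"

primrec sats :: "'a str \<Rightarrow> (nat \<Rightarrow> 'a) \<Rightarrow> (nat \<Rightarrow> 'a set) \<Rightarrow> fm \<Rightarrow> bool" where
  "sats M e E (Eq s t) \<longleftrightarrow> ev M e s = ev M e t"
| "sats M e E (Less s t) \<longleftrightarrow> sless M (ev M e s) (ev M e t)"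
| "sats M e E (Mem t i) \<longleftrightarrow> ev M e t \<in> E i"
| "sats M e E (Neg p) \<longleftrightarrow> \<not> sats M e E p"
| "sats M e E (Imp p q) \<longleftrightarrow> (sats M e E p \<longrightarrow> sats M e E q)"
| "sats M e E (All0 p) \<longleftrightarrow> (\<forall>n. sats M (case_nat n e) E p)"
| "sats M e E (All1 p) \<longleftrightarrow> (\<forall>X\<in>ssets M. sats M e (case_nat X E) p)"

text \<open>A structure whose family of sets is empty has no assignments, so every formula is valid
  in it vacuously; the locale \<open>aca\<close> excludes this case and \<open>prv_by_models\<close>
  treats it apart.\<close>

definition valid :: "'a str \<Rightarrow> fm \<Rightarrow> bool" where
  "valid M p \<longleftrightarrow> (\<forall>e E. (\<forall>i. E i \<in> ssets M) \<longrightarrow> sats M e E p)"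

definition std :: "nat str" where
  "std = \<lparr>szero = 0, sone = 1, sadd = (+), smul = (*), sless = (<), ssets = UNIV\<rparr>"

lemma ev_std [simp]: "ev std e t = evalt e t"
  by (induction t) (auto simp: std_def)

lemma sats_std [simp]: "sats std e E p = sat e E p"
  by (induction p arbitrary: e E) (simp_all add: std_def[THEN arg_cong[of _ _ sless]] std_def[THEN arg_cong[of _ _ ssets]])

lemma valid_std: "valid std p \<longleftrightarrow> true_std p"
  by (auto simp: valid_def true_std_def std_def[THEN arg_cong[of _ _ ssets]])

lemma sats_connectives [simp]:
  "sats M e E (Conj p q) \<longleftrightarrow> sats M e E p \<and> sats M e E q"
  "sats M e E (Disj p q) \<longleftrightarrow> sats M e E p \<or> sats M e E q"
  "sats M e E (Iff p q) \<longleftrightarrow> (sats M e E p \<longleftrightarrow> sats M e E q)"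
  "sats M e E (Ex0 p) \<longleftrightarrow> (\<exists>n. sats M (case_nat n e) E p)"
  "sats M e E (Ex1 p) \<longleftrightarrow> (\<exists>X\<in>ssets M. sats M e (case_nat X E) p)"
  "sats M e E Top"
  "\<not> sats M e E Bot"
  by (auto simp: Conj_def Disj_def Iff_def Ex0_def Ex1_def Top_def Bot_def)

lemma sats_conjs [simp]: "sats M e E (conjs ps) \<longleftrightarrow> (\<forall>p\<in>set ps. sats M e E p)"
  by (induction ps) (auto simp: conjs_def)

lemma sats_disjs [simp]: "sats M e E (disjs ps) \<longleftrightarrow> (\<exists>p\<in>set ps. sats M e E p)"
  by (induction ps) (auto simp: disjs_def)

section \<open>Parallel substitution in both sorts\<close>

primrec tsub :: "(nat \<Rightarrow> tm) \<Rightarrow> tm \<Rightarrow> tm" where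
  "tsub s (Var i) = s i"
| "tsub s Zero = Zero"
| "tsub s One = One"
| "tsub s (Add t u) = Add (tsub s t) (tsub s u)"
| "tsub s (Mul t u) = Mul (tsub s t) (tsub s u)"

definition ups :: "(nat \<Rightarrow> tm) \<Rightarrow> nat \<Rightarrow> tm" where
  "ups s = case_nat (Var 0) (\<lambda>i. lift_tm 0 (s i))"

definition upj :: "(nat \<Rightarrow> nat) \<Rightarrow> nat \<Rightarrow> nat" where
  "upj j = case_nat 0 (\<lambda>i. Suc (j i))"

text \<open>The operations \<open>lift0\<close>, \<open>subst0\<close>, \<open>lift1\<close> and
  \<open>subst1\<close> of the calculus are instances of this one. Their commutation laws then
  follow from \<open>psub_psub\<close> and a pointwise comparison by \<open>psub_cong\<close>,
  without an induction for each pair of operations. Set variables are only ever replaced by set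
  variables, so a renaming \<open>j\<close> suffices for that sort.\<close>

primrec psub :: "(nat \<Rightarrow> tm) \<Rightarrow> (nat \<Rightarrow> nat) \<Rightarrow> fm \<Rightarrow> fm" where
  "psub s j (Eq t u) = Eq (tsub s t) (tsub s u)"
| "psub s j (Less t u) = Less (tsub s t) (tsub s u)"
| "psub s j (Mem t i) = Mem (tsub s t) (j i)"
| "psub s j (Neg p) = Neg (psub s j p)"
| "psub s j (Imp p q) = Imp (psub s j p) (psub s j q)"
| "psub s j (All0 p) = All0 (psub (ups s) j p)"
| "psub s j (All1 p) = All1 (psub s (upj j) p)"

lemma tsub_tsub: "tsub s (tsub r t) = tsub (\<lambda>i. tsub s (r i)) t"
  by (induction t) auto

lemma tsub_Var [simp]: "tsub Var t = t"
  by (induction t) auto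

lemma lift_tm_tsub: "lift_tm k t = tsub (\<lambda>i. Var (if i < k then i else Suc i)) t"
  by (induction t) auto

lemma subst_tm_tsub:
  "subst_tm k r t = tsub (\<lambda>i. if i < k then Var i else if i = k then r else Var (i - 1)) t"
  by (induction t) auto

lemma ups_Var [simp]: "ups Var = Var"
  by (auto simp: ups_def fun_eq_iff split: nat.splits)

lemma upj_id [simp]: "upj id = id" "upj (\<lambda>i. i) = (\<lambda>i. i)"
  by (auto simp: upj_def fun_eq_iff split: nat.splits)

lemma ups_tsub: "(\<lambda>i. tsub (ups s) (ups r i)) = ups (\<lambda>i. tsub s (r i))"
  by (auto simp: ups_def fun_eq_iff lift_tm_tsub tsub_tsub split: nat.splits)

lemma upj_comp: "(\<lambda>i. upj j (upj k i)) = upj (\<lambda>i. j (k i))"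
  by (auto simp: upj_def fun_eq_iff split: nat.splits)

lemma psub_psub: "psub s j (psub r k p) = psub (\<lambda>i. tsub s (r i)) (\<lambda>i. j (k i)) p"
  by (induction p arbitrary: s j r k) (simp_all add: tsub_tsub ups_tsub upj_comp)

lemma lift0_psub: "lift0 k p = psub (\<lambda>i. Var (if i < k then i else Suc i)) (\<lambda>i. i) p"
proof (induction p arbitrary: k)
  case (All0 p)
  have "ups (\<lambda>i. Var (if i < k then i else Suc i)) = (\<lambda>i. Var (if i < Suc k then i else Suc i))"
    by (auto simp: ups_def fun_eq_iff split: nat.splits)
  with All0 show ?case by simp
qed (auto simp: lift_tm_tsub)

lemma subst0_psub:
  "subst0 k r p = psub (\<lambda>i. if i < k then Var i else if i = k then r else Var (i - 1)) (\<lambda>i. i) p"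
proof (induction p arbitrary: k r)
  case (All0 p)
  have "ups (\<lambda>i. if i < k then Var i else if i = k then r else Var (i - 1)) =
      (\<lambda>i. if i < Suc k then Var i else if i = Suc k then lift_tm 0 r else Var (i - 1))"
    by (auto simp: ups_def fun_eq_iff split: nat.splits)
  with All0 show ?case by simp
qed (auto simp: subst_tm_tsub)

lemma lift1_psub: "lift1 k p = psub Var (\<lambda>i. if i < k then i else Suc i) p"
proof (induction p arbitrary: k)
  case (All1 p)
  have "upj (\<lambda>i. if i < k then i else Suc i) = (\<lambda>i. if i < Suc k then i else Suc i)"
    by (auto simp: upj_def fun_eq_iff split: nat.splits)
  with All1 show ?case by simp
qed auto

lemma subst1_psub: "subst1 k j p = psub Var (\<lambda>i. if i < k then i else if i = k then j else i - 1) p"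
proof (induction p arbitrary: k j)
  case (All1 p)
  have "upj (\<lambda>i. if i < k then i else if i = k then j else i - 1) =
     (\<lambda>i. if i < Suc k then i else if i = Suc k then Suc j else i - 1)"
    by (auto simp: upj_def fun_eq_iff split: nat.splits)
  with All1 show ?case by simp
qed auto

lemma tsub_cong: "(\<And>i. i < bd_tm t \<Longrightarrow> s i = r i) \<Longrightarrow> tsub s t = tsub r t"
  by (induction t) auto

lemma psub_cong:
  assumes "\<And>i. i < bd0 p \<Longrightarrow> s i = r i" and "\<And>i. i < bd1 p \<Longrightarrow> j i = k i"
  shows "psub s j p = psub r k p"
  using assms
proof (induction p arbitrary: s j r k)
  case (All0 p)
  have "psub (ups s) j p = psub (ups r) k p"
    using All0.prems by (intro All0.IH) (auto simp: ups_def split: nat.splits)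
  then show ?case by simp
next
  case (All1 p)
  have "psub s (upj j) p = psub r (upj k) p"
    using All1.prems by (intro All1.IH) (auto simp: upj_def split: nat.splits)
  then show ?case by simp
next
  case (Neg p)
  show ?case using Neg.prems Neg.IH[of s r j k] by simp
next
  case (Imp p q)
  show ?case using Imp.prems Imp.IH(1)[of s r j k] Imp.IH(2)[of s r j k] by simp
next
  case (Eq t u)
  then show ?case using tsub_cong[of t s r] tsub_cong[of u s r] by simp
next
  case (Less t u)
  then show ?case using tsub_cong[of t s r] tsub_cong[of u s r] by simp
next
  case (Mem t i)
  then show ?case using tsub_cong[of t s r] by simp
qed

lemma psub_Var [simp]: "psub Var (\<lambda>i. i) p = p"
  by (induction p) auto

lemma psub_sentence: "sentence p \<Longrightarrow> psub s j p = p"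
  using psub_cong[of p s Var j "\<lambda>i. i"] by (auto simp: sentence_def)

lemma ev_tsub: "ev M e (tsub s t) = ev M (\<lambda>i. ev M e (s i)) t"
  by (induction t) auto

lemma ev_lift [simp]: "ev M (case_nat n e) (lift_tm 0 t) = ev M e t"
  by (induction t) auto

lemma sats_psub: "sats M e E (psub s j p) = sats M (\<lambda>i. ev M e (s i)) (\<lambda>i. E (j i)) p"
proof (induction p arbitrary: e E s j)
  case (All0 p)
  have "(\<lambda>i. ev M (case_nat n e) (ups s i)) = case_nat n (\<lambda>i. ev M e (s i))" for n
    by (auto simp: ups_def fun_eq_iff split: nat.splits)
  with All0 show ?case by simp
next
  case (All1 p)
  have "(\<lambda>i. case_nat X E (upj j i)) = case_nat X (\<lambda>i. E (j i))" for X
    by (auto simp: upj_def fun_eq_iff split: nat.splits)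
  with All1 show ?case by simp
qed (auto simp: ev_tsub)

lemma sats_lift0 [simp]: "sats M (case_nat n e) E (lift0 0 p) = sats M e E p"
  by (simp add: lift0_psub sats_psub)

lemma sats_lift1 [simp]: "sats M e (case_nat X E) (lift1 0 p) = sats M e E p"
  by (simp add: lift1_psub sats_psub)

lemma sats_subst0: "sats M e E (subst0 0 t p) = sats M (case_nat (ev M e t) e) E p"
  unfolding subst0_psub sats_psub by (rule arg_cong[where f = "\<lambda>e. sats M e E p"]) (auto simp: fun_eq_iff split: nat.splits)

lemma sats_subst1: "sats M e E (subst1 0 j p) = sats M e (case_nat (E j) E) p"
  unfolding subst1_psub sats_psub ev.simps
  by (rule arg_cong[where f = "\<lambda>E :: nat \<Rightarrow> _. sats M e E p"]) (auto simp: fun_eq_iff split: nat.splits)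

lemma ev_cong: "(\<And>i. i < bd_tm t \<Longrightarrow> e i = e' i) \<Longrightarrow> ev M e t = ev M e' t"
  by (induction t) auto

lemma sats_cong:
  assumes "\<And>i. i < bd0 p \<Longrightarrow> e i = e' i" and "\<And>i. i < bd1 p \<Longrightarrow> E i = E' i"
  shows "sats M e E p = sats M e' E' p"
  using assms
proof (induction p arbitrary: e e' E E')
  case (Eq s t)
  then show ?case using ev_cong[of s e e' M] ev_cong[of t e e' M] by simp
next
  case (Less s t)
  then show ?case using ev_cong[of s e e' M] ev_cong[of t e e' M] by simp
next
  case (Mem t i)
  then show ?case using ev_cong[of t e e' M] by simp
next
  case (Neg p)
  show ?case using Neg.prems Neg.IH[of e e' E E'] by simp
next
  case (Imp p q)
  show ?case using Imp.prems Imp.IH(1)[of e e' E E'] Imp.IH(2)[of e e' E E'] by simp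
next
  case (All0 p)
  have "sats M (case_nat n e) E p = sats M (case_nat n e') E' p" for n
    using All0.prems by (intro All0.IH) (auto split: nat.splits)
  then show ?case by simp
next
  case (All1 p)
  have "sats M e (case_nat X E) p = sats M e' (case_nat X E') p" for X
    using All1.prems by (intro All1.IH) (auto split: nat.splits)
  then show ?case by simp
qed

lemma sats_sentence: "sentence p \<Longrightarrow> sats M e E p = sats M e' E' p"
  by (rule sats_cong) (auto simp: sentence_def)

lemma case_nat_eta: "case_nat (f 0) (\<lambda>i. f (Suc i)) = f"
  by (auto simp: fun_eq_iff split: nat.splits)

lemma valid_All0: "valid M (All0 p) \<longleftrightarrow> valid M p"
  unfolding valid_def sats.simps by (metis case_nat_eta)

lemma valid_All1: "valid (M :: 'a str) (All1 p) \<longleftrightarrow> valid M p"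
proof
  assume *: "valid M (All1 p)"
  show "valid M p"
    unfolding valid_def
  proof (intro allI impI)
    fix e :: "nat \<Rightarrow> 'a" and E :: "nat \<Rightarrow> 'a set" assume "\<forall>i. E i \<in> ssets M"
    then show "sats M e E p"
      using *[unfolded valid_def, rule_format, of "\<lambda>i. E (Suc i)" e] case_nat_eta[of E]
      by (metis sats.simps(7))
  qed
next
  assume *: "valid M p"
  show "valid M (All1 p)"
    using *[unfolded valid_def, rule_format] by (auto simp: valid_def split: nat.splits)
qed

lemma valid_closure: "valid M (closure p) \<longleftrightarrow> valid M p"
proof -
  have "valid M ((All0 ^^ n) q) \<longleftrightarrow> valid M q" "valid M ((All1 ^^ n) q) \<longleftrightarrow> valid M q" for n q
    by (induction n) (auto simp: valid_All0 valid_All1)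
  then show ?thesis by (simp add: closure_def)
qed

theorem soundness: "T \<turnstile> p \<Longrightarrow> (\<And>q. q \<in> T \<Longrightarrow> valid M q) \<Longrightarrow> valid M p"
proof (induction rule: prv.induct)
  case (All0E p t)
  then show ?case by (auto simp: valid_def sats_subst0)
next
  case (All1E p t)
  then show ?case by (auto simp: valid_def sats_subst1)
next
  case (Leib s t p)
  then show ?case by (auto simp: valid_def sats_subst0)
next
  case (Gen0 p)
  then show ?case by (simp add: valid_All0)
next
  case (Gen1 p)
  then show ?case by (simp add: valid_All1)
qed (auto simp: valid_def)

section \<open>Completeness\<close>

text \<open>The axioms of \<open>T\<close> are sentences and so are fixed by every substitution; all
  other axioms are schemes closed under it. Eigenvariable arguments rest on this renaming.\<close>

lemma prv_psub:
  assumes "T \<turnstile> p" and T: "is_theory T"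
  shows "T \<turnstile> psub s j p"
  using assms(1)
proof (induction arbitrary: s j rule: prv.induct)
  case (Ax p)
  then show ?case using T by (simp add: psub_sentence is_theory_def prv.Ax)
next
  case (All0E p t)
  have "psub s j (subst0 0 t p) = subst0 0 (tsub s t) (psub (ups s) j p)"
    unfolding subst0_psub psub_psub
    by (rule psub_cong) (auto simp: ups_def lift_tm_tsub tsub_tsub split: nat.splits)
  then show ?case by (simp add: prv.All0E)
next
  case (All0D p q)
  have "psub (ups s) j (lift0 0 p) = lift0 0 (psub s j p)"
    unfolding lift0_psub psub_psub by (rule psub_cong) (auto simp: ups_def lift_tm_tsub)
  then show ?case by (simp add: prv.All0D)
next
  case (All1E p k)
  have "psub s j (subst1 0 k p) = subst1 0 (j k) (psub s (upj j) p)"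
    unfolding subst1_psub psub_psub by (rule psub_cong) (auto simp: upj_def split: nat.splits)
  then show ?case by (simp add: prv.All1E)
next
  case (All1D p q)
  have "psub s (upj j) (lift1 0 p) = lift1 0 (psub s j p)"
    unfolding lift1_psub psub_psub by (rule psub_cong) (auto simp: upj_def)
  then show ?case by (simp add: prv.All1D)
next
  case (Leib t u p)
  have "psub s j (subst0 0 t p) = subst0 0 (tsub s t) (psub (ups s) j p)" for t
    unfolding subst0_psub psub_psub
    by (rule psub_cong) (auto simp: ups_def lift_tm_tsub tsub_tsub split: nat.splits)
  then show ?case by (simp add: prv.Leib)
next
  case (MP p q)
  then show ?case by (metis prv.MP psub.simps(5))
qed (auto intro: prv.intros)

section \<open>Derivations from open assumptions\<close>

inductive loc :: "fm set \<Rightarrow> fm set \<Rightarrow> fm \<Rightarrow> bool" for T \<Gamma> where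
  base: "T \<turnstile> p \<Longrightarrow> loc T \<Gamma> p"
| asm: "p \<in> \<Gamma> \<Longrightarrow> loc T \<Gamma> p"
| mp: "loc T \<Gamma> (Imp p q) \<Longrightarrow> loc T \<Gamma> p \<Longrightarrow> loc T \<Gamma> q"

lemma loc_mono: "loc T \<Gamma> p \<Longrightarrow> \<Gamma> \<subseteq> \<Delta> \<Longrightarrow> loc T \<Delta> p"
  by (induction rule: loc.induct) (auto intro: loc.intros)

lemma prv_refl: "T \<turnstile> Imp p p"
  using prv.MP[OF prv.MP[OF prv.S[of T p "Imp p p" p] prv.K] prv.K] .

lemma loc_K: "loc T \<Gamma> p \<Longrightarrow> loc T \<Gamma> (Imp q p)"
  by (meson loc.base loc.mp prv.K)

text \<open>In \<open>loc\<close> the open assumptions are combined by modus ponens only, while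
  generalization is confined to derivations from \<open>T\<close>. The deduction theorem therefore
  carries no condition on free variables; generalization over an assumption would break it.\<close>

lemma deduct: "loc T (insert q \<Gamma>) p \<Longrightarrow> loc T \<Gamma> (Imp q p)"
proof (induction rule: loc.induct)
  case (asm p)
  then show ?case by (metis insertE loc.asm loc.base loc_K prv_refl)
next
  case (mp p r)
  then show ?case by (meson loc.base loc.mp prv.S)
qed (simp add: loc.base loc_K)

lemma loc_empty: "loc T {} p \<Longrightarrow> T \<turnstile> p"
  by (induction rule: loc.induct) (auto intro: prv.MP)

lemma deduct_conv: "loc T \<Gamma> (Imp q p) \<longleftrightarrow> loc T (insert q \<Gamma>) p"
  by (meson deduct insertI1 loc.asm loc.mp loc_mono subset_insertI)

lemma loc_ex_falso: "loc T \<Gamma> (Neg p) \<Longrightarrow> loc T \<Gamma> p \<Longrightarrow> loc T \<Gamma> q"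
  by (meson loc.base loc.mp loc_K prv.N)

lemma loc_Neg_Neg: "loc T \<Gamma> (Neg (Neg p)) \<Longrightarrow> loc T \<Gamma> p"
proof -
  assume "loc T \<Gamma> (Neg (Neg p))"
  then have "loc T (insert (Neg p) \<Gamma>) (Neg (Imp p p))"
    by (meson insertI1 loc.asm loc_ex_falso loc_mono subset_insertI)
  then have "loc T \<Gamma> (Imp (Imp p p) p)"
    by (meson deduct loc.base loc.mp prv.N)
  then show ?thesis
    by (meson loc.base loc.mp prv_refl)
qed

lemma loc_contra:
  assumes "\<And>q. loc T (insert (Neg p) \<Gamma>) q" shows "loc T \<Gamma> p"
proof -
  have "loc T \<Gamma> (Imp (Neg p) (Neg (Imp p p)))"
    using assms deduct by blast
  then show ?thesis
    by (meson loc.base loc.mp prv.N prv_refl)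
qed

lemma loc_contra':
  assumes "\<And>q. loc T (insert p \<Gamma>) q" shows "loc T \<Gamma> (Neg p)"
proof (rule loc_contra)
  fix q
  have "loc T (insert (Neg (Neg p)) \<Gamma>) p"
    by (simp add: loc.asm loc_Neg_Neg)
  moreover have "loc T (insert (Neg (Neg p)) \<Gamma>) (Imp p q)"
    using assms by (meson deduct loc_mono subset_insertI)
  ultimately show "loc T (insert (Neg (Neg p)) \<Gamma>) q"
    using loc.mp by blast
qed

lemma loc_psub: "loc T \<Gamma> p \<Longrightarrow> is_theory T \<Longrightarrow> loc T (psub s j ` \<Gamma>) (psub s j p)"
proof (induction rule: loc.induct)
  case (mp p q)
  then show ?case using loc.mp by (metis psub.simps(5))
qed (auto intro: loc.intros prv_psub)

lemma subst0_lift0_1: "subst0 0 (Var 0) (lift0 1 p) = p"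
proof -
  have "subst0 0 (Var 0) (lift0 1 p) = psub Var (\<lambda>i. i) p"
    unfolding subst0_psub lift0_psub psub_psub by (rule psub_cong) (auto)
  then show ?thesis by simp
qed

lemma subst1_lift1_1: "subst1 0 0 (lift1 1 p) = p"
proof -
  have "subst1 0 0 (lift1 1 p) = psub Var (\<lambda>i. i) p"
    unfolding subst1_psub lift1_psub psub_psub by (rule psub_cong) (auto)
  then show ?thesis by simp
qed

text \<open>The calculus only has the axiom that pulls a vacuous hypothesis out of a quantifier. A
  universal assumption, lifted past the new variable, is instantiated at that variable itself:
  \<open>lift0 0 (All0 p)\<close> is \<open>All0 (lift0 1 p)\<close>, and
  \<open>subst0_lift0_1\<close> returns \<open>p\<close>.\<close>

lemma prv_All0_K: "T \<turnstile> Imp (All0 (Imp p q)) (Imp (All0 p) (All0 q))"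
proof -
  let ?\<Gamma> = "{lift0 0 (All0 p), lift0 0 (All0 (Imp p q))}"
  have "loc T ?\<Gamma> (All0 (lift0 1 p))" "loc T ?\<Gamma> (All0 (lift0 1 (Imp p q)))"
    by (auto intro: loc.asm)
  then have "loc T ?\<Gamma> p" "loc T ?\<Gamma> (Imp p q)"
    by (metis loc.base loc.mp prv.All0E subst0_lift0_1)+
  then have "loc T ?\<Gamma> q" by (rule loc.mp[rotated])
  then have "T \<turnstile> Imp (lift0 0 (All0 (Imp p q))) (Imp (lift0 0 (All0 p)) q)"
    by (intro loc_empty deduct)
  then have *: "T \<turnstile> Imp (All0 (Imp p q)) (All0 (Imp (lift0 0 (All0 p)) q))"
    by (meson prv.All0D prv.Gen0 prv.MP)
  show ?thesis
    by (intro loc_empty deduct) (metis * deduct_conv loc.base loc.mp prv.All0D)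
qed

lemma prv_All1_K: "T \<turnstile> Imp (All1 (Imp p q)) (Imp (All1 p) (All1 q))"
proof -
  let ?\<Gamma> = "{lift1 0 (All1 p), lift1 0 (All1 (Imp p q))}"
  have "loc T ?\<Gamma> (All1 (lift1 1 p))" "loc T ?\<Gamma> (All1 (lift1 1 (Imp p q)))"
    by (auto intro: loc.asm)
  then have "loc T ?\<Gamma> p" "loc T ?\<Gamma> (Imp p q)"
    by (metis loc.base loc.mp prv.All1E subst1_lift1_1)+
  then have "loc T ?\<Gamma> q" by (rule loc.mp[rotated])
  then have "T \<turnstile> Imp (lift1 0 (All1 (Imp p q))) (Imp (lift1 0 (All1 p)) q)"
    by (intro loc_empty deduct)
  then have *: "T \<turnstile> Imp (All1 (Imp p q)) (All1 (Imp (lift1 0 (All1 p)) q))"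
    by (meson prv.All1D prv.Gen1 prv.MP)
  show ?thesis
    by (intro loc_empty deduct) (metis * deduct_conv loc.base loc.mp prv.All1D)
qed

text \<open>The eigenvariable condition takes the form of a lifted context: variable 0 is free in
  none of its formulas.\<close>

lemma loc_Gen0: "loc T (lift0 0 ` \<Gamma>) p \<Longrightarrow> loc T \<Gamma> (All0 p)"
proof (induction rule: loc.induct)
  case (base p)
  then show ?case by (simp add: loc.base prv.Gen0)
next
  case (asm p)
  then obtain q where "q \<in> \<Gamma>" "p = lift0 0 q" by auto
  moreover have "T \<turnstile> Imp q (All0 (lift0 0 q))"
    by (meson prv.All0D prv.Gen0 prv.MP prv_refl)
  ultimately show ?case by (meson loc.asm loc.base loc.mp)
next
  case (mp p q)
  then show ?case by (meson loc.base loc.mp prv_All0_K)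
qed

lemma loc_Gen1: "loc T (lift1 0 ` \<Gamma>) p \<Longrightarrow> loc T \<Gamma> (All1 p)"
proof (induction rule: loc.induct)
  case (base p)
  then show ?case by (simp add: loc.base prv.Gen1)
next
  case (asm p)
  then obtain q where "q \<in> \<Gamma>" "p = lift1 0 q" by auto
  moreover have "T \<turnstile> Imp q (All1 (lift1 0 q))"
    by (meson prv.All1D prv.Gen1 prv.MP prv_refl)
  ultimately show ?case by (meson loc.asm loc.base loc.mp)
next
  case (mp p q)
  then show ?case by (meson loc.base loc.mp prv_All1_K)
qed

lemma bd_fresh:
  assumes "finite \<Gamma>" obtains v where "\<And>p. p \<in> \<Gamma> \<Longrightarrow> bd0 p \<le> v \<and> bd1 p \<le> v"
proof (rule that[of "\<Sum>p\<in>\<Gamma>. bd0 p + bd1 p"])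
  fix p assume "p \<in> \<Gamma>"
  then have "bd0 p + bd1 p \<le> (\<Sum>p\<in>\<Gamma>. bd0 p + bd1 p)"
    using assms by (intro member_le_sum) auto
  then show "bd0 p \<le> (\<Sum>p\<in>\<Gamma>. bd0 p + bd1 p) \<and> bd1 p \<le> (\<Sum>p\<in>\<Gamma>. bd0 p + bd1 p)" by simp
qed

text \<open>Of the infinitely many instances one is enough, the one at a variable \<open>v\<close>
  that is free neither in \<open>r\<close> nor in the finitely many assumptions: it can be renamed
  into the premise of a generalization.\<close>

lemma loc_fresh0:
  assumes T: "is_theory T" and "finite \<Gamma>" and all: "\<And>t. loc T \<Gamma> (subst0 0 t r)"
  shows "loc T \<Gamma> (All0 r)"
proof (rule loc_Gen0)
  obtain v where v: "\<And>p. p \<in> insert r \<Gamma> \<Longrightarrow> bd0 p \<le> v \<and> bd1 p \<le> v"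
    using bd_fresh[of "insert r \<Gamma>"] assms(2) by auto
  \<comment> \<open>\<open>s\<close> is the lifting, except that the fresh variable goes to 0. It
    acts on the assumptions as \<open>lift0 0\<close> and turns the instance at \<open>v\<close>
    back into \<open>r\<close>.\<close>
  define s where "s = (\<lambda>i. if i = v then Var 0 else Var (Suc i))"
  have "psub s (\<lambda>i. i) p = lift0 0 p" if "p \<in> \<Gamma>" for p
    unfolding lift0_psub using v[of p] that by (intro psub_cong) (auto simp: s_def)
  then have 1: "psub s (\<lambda>i. i) ` \<Gamma> = lift0 0 ` \<Gamma>" by (auto simp: image_def)
  have "psub s (\<lambda>i. i) (subst0 0 (Var v) r) = psub Var (\<lambda>i. i) r"
    unfolding subst0_psub psub_psub using v[of r] by (intro psub_cong) (auto simp: s_def)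
  then show "loc T (lift0 0 ` \<Gamma>) r"
    using loc_psub[OF all[of "Var v"] T, of s "\<lambda>i. i"] 1 by simp
qed

lemma loc_fresh1:
  assumes T: "is_theory T" and "finite \<Gamma>" and all: "\<And>j. loc T \<Gamma> (subst1 0 j r)"
  shows "loc T \<Gamma> (All1 r)"
proof (rule loc_Gen1)
  obtain v where v: "\<And>p. p \<in> insert r \<Gamma> \<Longrightarrow> bd0 p \<le> v \<and> bd1 p \<le> v"
    using bd_fresh[of "insert r \<Gamma>"] assms(2) by auto
  define s where "s = (\<lambda>i. if i = v then 0 else Suc i)"
  have "psub Var s p = lift1 0 p" if "p \<in> \<Gamma>" for p
    unfolding lift1_psub using v[of p] that by (intro psub_cong) (auto simp: s_def)
  then have 1: "psub Var s ` \<Gamma> = lift1 0 ` \<Gamma>" by (auto simp: image_def)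
  have "psub Var s (subst1 0 v r) = psub Var (\<lambda>i. i) r"
    unfolding subst1_psub psub_psub using v[of r] by (intro psub_cong) (auto simp: s_def)
  then show "loc T (lift1 0 ` \<Gamma>) r"
    using loc_psub[OF all[of v] T, of Var s] 1 by simp
qed

section \<open>Maximal consistent sets with witnesses\<close>

definition consistent :: "fm set \<Rightarrow> fm set \<Rightarrow> bool" where
  "consistent T \<Gamma> \<longleftrightarrow> (\<exists>p. \<not> loc T \<Gamma> p)"

lemma not_consistentD: "\<not> consistent T \<Gamma> \<Longrightarrow> loc T \<Gamma> p"
  by (auto simp: consistent_def)

text \<open>No constants are added to the language: at each stage only finitely many formulas have
  been collected, so a variable outside them can serve as a witness. Hence a suitable term or set
  variable exists, and one is chosen.\<close>

definition henkin_witness :: "fm set \<Rightarrow> fm set \<Rightarrow> fm \<Rightarrow> fm set" where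
  "henkin_witness T \<Gamma> p = (case p of
      All0 r \<Rightarrow> insert (Neg (subst0 0 (SOME t. consistent T (insert (Neg (subst0 0 t r)) \<Gamma>)) r)) \<Gamma>
    | All1 r \<Rightarrow> insert (Neg (subst1 0 (SOME j. consistent T (insert (Neg (subst1 0 j r)) \<Gamma>)) r)) \<Gamma>
    | _ \<Rightarrow> \<Gamma>)"

definition henkin_step :: "fm set \<Rightarrow> fm set \<Rightarrow> fm \<Rightarrow> fm set" where
  "henkin_step T \<Gamma> p = (if consistent T (insert p \<Gamma>) then insert p \<Gamma> else henkin_witness T \<Gamma> p)"

lemma loc_cut: "loc T \<Gamma> q \<Longrightarrow> \<not> consistent T (insert q \<Gamma>) \<Longrightarrow> \<not> consistent T \<Gamma>"
  unfolding consistent_def by (metis deduct loc.mp)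

lemma henkin_witness_consistent:
  assumes T: "is_theory T" and fin: "finite \<Gamma>" and con: "consistent T \<Gamma>"
    and p: "\<not> consistent T (insert p \<Gamma>)"
  shows "consistent T (henkin_witness T \<Gamma> p)"
proof (cases p)
  case (All0 r)
  have "\<exists>t. consistent T (insert (Neg (subst0 0 t r)) \<Gamma>)"
  proof (rule ccontr)
    assume *: "\<not> ?thesis"
    have "loc T \<Gamma> (subst0 0 t r)" for t
      by (rule loc_contra, rule not_consistentD) (use * in blast)
    then have "loc T \<Gamma> (All0 r)"
      by (rule loc_fresh0[OF T fin])
    from loc_cut[OF this p[unfolded All0]] con show False by contradiction
  qed
  from someI_ex[OF this] All0 show ?thesis by (simp add: henkin_witness_def)
next
  case (All1 r)
  have "\<exists>j. consistent T (insert (Neg (subst1 0 j r)) \<Gamma>)"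
  proof (rule ccontr)
    assume *: "\<not> ?thesis"
    have "loc T \<Gamma> (subst1 0 j r)" for j
      by (rule loc_contra, rule not_consistentD) (use * in blast)
    then have "loc T \<Gamma> (All1 r)"
      by (rule loc_fresh1[OF T fin])
    from loc_cut[OF this p[unfolded All1]] con show False by contradiction
  qed
  from someI_ex[OF this] All1 show ?thesis by (simp add: henkin_witness_def)
qed (use con in \<open>simp_all add: henkin_witness_def\<close>)

lemma henkin_step:
  assumes T: "is_theory T" and fin: "finite \<Gamma>" and con: "consistent T \<Gamma>"
  shows "finite (henkin_step T \<Gamma> p)" "\<Gamma> \<subseteq> henkin_step T \<Gamma> p" "consistent T (henkin_step T \<Gamma> p)"
    "consistent T (insert p \<Gamma>) \<Longrightarrow> p \<in> henkin_step T \<Gamma> p"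
    "\<not> consistent T (insert (All0 r) \<Gamma>) \<Longrightarrow> \<exists>t. Neg (subst0 0 t r) \<in> henkin_step T \<Gamma> (All0 r)"
    "\<not> consistent T (insert (All1 r) \<Gamma>) \<Longrightarrow> \<exists>j. Neg (subst1 0 j r) \<in> henkin_step T \<Gamma> (All1 r)"
proof -
  show "finite (henkin_step T \<Gamma> p)"
    using fin by (cases p) (simp_all add: henkin_step_def henkin_witness_def)
  show "\<Gamma> \<subseteq> henkin_step T \<Gamma> p"
    by (cases p) (auto simp: henkin_step_def henkin_witness_def)
  show "consistent T (henkin_step T \<Gamma> p)"
    using henkin_witness_consistent[OF assms] by (simp add: henkin_step_def)
  show "consistent T (insert p \<Gamma>) \<Longrightarrow> p \<in> henkin_step T \<Gamma> p"
    by (simp add: henkin_step_def)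
  show "\<not> consistent T (insert (All0 r) \<Gamma>) \<Longrightarrow> \<exists>t. Neg (subst0 0 t r) \<in> henkin_step T \<Gamma> (All0 r)"
    "\<not> consistent T (insert (All1 r) \<Gamma>) \<Longrightarrow> \<exists>j. Neg (subst1 0 j r) \<in> henkin_step T \<Gamma> (All1 r)"
    by (auto simp: henkin_step_def henkin_witness_def)
qed

text \<open>The code lies between the square of \<open>a + b\<close> and the next square, so it
  determines first the sum and then \<open>a\<close>.\<close>

lemma pair_inj: "pair a b = pair c d \<longleftrightarrow> a = c \<and> b = d"
proof
  assume eq: "pair a b = pair c d"
  have less: "pair x y < pair z w" if "x + y < z + w" for x y z w :: nat
  proof -
    have "pair x y < (x + y + 1) * (x + y + 1)" by (simp add: pair_def algebra_simps)
    also have "\<dots> \<le> (z + w) * (z + w)" using that by (intro mult_mono) auto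
    finally show ?thesis by (simp add: pair_def)
  qed
  have "a + b = c + d"
    using less[of a b c d] less[of c d a b] eq by (metis less_irrefl nat_neq_iff)
  then show "a = c \<and> b = d" using eq by (simp add: pair_def)
qed auto

lemma tcode_inj: "tcode s = tcode t \<longleftrightarrow> s = t"
  by (induction s arbitrary: t; case_tac t) (auto simp: pair_inj)

lemma fcode_inj: "fcode p = fcode q \<longleftrightarrow> p = q"
  by (induction p arbitrary: q; case_tac q) (auto simp: pair_inj tcode_inj)

definition decode_fm :: "nat \<Rightarrow> fm" where
  "decode_fm n = (SOME p. fcode p = n)"

lemma decode_fcode [simp]: "decode_fm (fcode p) = p"
  unfolding decode_fm_def by (rule some_equality) (auto simp: fcode_inj)

primrec henkin_seq :: "fm set \<Rightarrow> fm set \<Rightarrow> nat \<Rightarrow> fm set" where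
  "henkin_seq T \<Gamma> 0 = \<Gamma>"
| "henkin_seq T \<Gamma> (Suc n) = henkin_step T (henkin_seq T \<Gamma> n) (decode_fm n)"

text \<open>Each formula is treated at the stage given by its code. A stage whose number codes no
  formula treats an arbitrary one, which does no harm because every step preserves
  consistency.\<close>

lemma henkin_extension:
  assumes T: "is_theory T" and fin: "finite \<Gamma>" and con: "consistent T \<Gamma>"
  obtains G where "\<Gamma> \<subseteq> G" "\<And>p. loc T G p \<Longrightarrow> p \<in> G" "\<And>p. Neg p \<in> G \<longleftrightarrow> p \<notin> G"
    "\<And>r. (\<And>t. subst0 0 t r \<in> G) \<Longrightarrow> All0 r \<in> G" "\<And>r. (\<And>j. subst1 0 j r \<in> G) \<Longrightarrow> All1 r \<in> G"
proof -
  let ?H = "henkin_seq T \<Gamma>"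
  define G where "G = (\<Union>n. ?H n)"
  have H: "finite (?H n)" "consistent T (?H n)" for n
    using fin con henkin_step(1,3)[OF T] by (induction n) auto
  note step = henkin_step[OF T H]
  have mono: "?H m \<subseteq> ?H n" if "m \<le> n" for m n
    using that by (rule lift_Suc_mono_le[of ?H, rotated]) (simp add: step(2))
  have HG: "?H n \<subseteq> G" for n by (auto simp: G_def)
  have compact: "\<exists>n. loc T (?H n) p" if "loc T G p" for p
    using that
  proof induction
    case (base p)
    then show ?case by (blast intro: loc.base)
  next
    case (asm p)
    then obtain n where "p \<in> ?H n" unfolding G_def by blast
    then show ?case using loc.asm by blast
  next
    case (mp p q)
    then obtain m n where "loc T (?H m) (Imp p q)" "loc T (?H n) p" by auto
    then have "loc T (?H (max m n)) (Imp p q)" "loc T (?H (max m n)) p"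
      using loc_mono[OF _ mono[of m "max m n"]] loc_mono[OF _ mono[of n "max m n"]] by simp_all
    then show ?case by (blast intro: loc.mp)
  qed
  have Gcon: "consistent T G"
  proof (rule ccontr)
    assume *: "\<not> ?thesis"
    obtain m n where mn: "loc T (?H m) (Neg Top)" "loc T (?H n) Top"
      using compact[OF not_consistentD[OF *]] by blast
    have "loc T (?H (max m n)) (Neg Top)" "loc T (?H (max m n)) Top"
      using loc_mono[OF mn(1) mono[of m "max m n"]] loc_mono[OF mn(2) mono[of n "max m n"]] by simp_all
    then have "loc T (?H (max m n)) p" for p
      by (rule loc_ex_falso)
    then show False using H(2)[of "max m n"] unfolding consistent_def by blast
  qed
  have incon: "\<not> consistent T (insert p (?H (fcode p)))" if "p \<notin> G" for p
    using step(4)[of p "fcode p"] HG[of "Suc (fcode p)"] that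
    unfolding henkin_seq.simps decode_fcode by blast
  have closed: "p \<in> G" if "loc T G p" for p
  proof (rule ccontr)
    assume "p \<notin> G"
    from not_consistentD[OF incon[OF this]] have "loc T (insert p G) q" for q
      by (rule loc_mono) (use HG in blast)
    then have "\<not> consistent T (insert p G)" by (simp add: consistent_def)
    with loc_cut[OF that] Gcon show False by blast
  qed
  have dec: "loc T G (Neg p)" if "p \<notin> G" for p
    by (rule loc_mono[OF loc_contra' HG, OF not_consistentD[OF incon[OF that]]])
  show ?thesis
  proof (rule that[of G])
    show "\<Gamma> \<subseteq> G" using HG[of 0] by simp
    show neg: "Neg p \<in> G \<longleftrightarrow> p \<notin> G" for p
    proof
      assume "Neg p \<in> G"
      show "p \<notin> G"
      proof
        assume "p \<in> G"
        then have "loc T G q" for q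
          by (rule loc_ex_falso[OF loc.asm[OF \<open>Neg p \<in> G\<close>] loc.asm])
        then show False using Gcon unfolding consistent_def by blast
      qed
    qed (rule closed[OF dec])
    show "All0 r \<in> G" if "\<And>t. subst0 0 t r \<in> G" for r
    proof (rule ccontr)
      assume "All0 r \<notin> G"
      from step(5)[OF incon[OF this]] obtain t where "Neg (subst0 0 t r) \<in> ?H (Suc (fcode (All0 r)))"
        unfolding henkin_seq.simps decode_fcode by blast
      then show False using that[of t] neg HG by blast
    qed
    show "All1 r \<in> G" if "\<And>j. subst1 0 j r \<in> G" for r
    proof (rule ccontr)
      assume "All1 r \<notin> G"
      from step(6)[OF incon[OF this]] obtain j where "Neg (subst1 0 j r) \<in> ?H (Suc (fcode (All1 r)))"
        unfolding henkin_seq.simps decode_fcode by blast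
      then show False using that[of j] neg HG by blast
    qed
  qed (rule closed)
qed

section \<open>The term model\<close>

instance tm :: countable
proof
  show "\<exists>to_nat :: tm \<Rightarrow> nat. inj to_nat"
    by (rule exI[of _ tcode]) (simp add: inj_def tcode_inj)
qed

lemma subst0_lift_cancel: "subst_tm 0 t (lift_tm 0 s) = s"
  by (induction s) auto

text \<open>The carrier is to be all of \<open>nat\<close>, with equality interpreted as identity.
  The axioms of \<open>ACA0\<close> make the numerals pairwise distinct, so there are infinitely
  many classes of terms modulo equality, and these countably many classes can be renamed to be
  exactly the natural numbers.\<close>

theorem completeness:
  assumes T: "is_theory T" and ACA: "ACA0 \<subseteq> T" and p: "sentence p"
    and models: "\<And>M :: nat str. (\<And>q. q \<in> T \<Longrightarrow> valid M q) \<Longrightarrow> valid M p"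
  shows "T \<turnstile> p"
proof (rule ccontr)
  assume np: "\<not> T \<turnstile> p"
  have "consistent T {Neg p}"
  proof (rule ccontr)
    assume "\<not> consistent T {Neg p}"
    then have "loc T {} p" by (rule loc_contra[OF not_consistentD])
    then show False using np loc_empty by blast
  qed
  then obtain G where "{Neg p} \<subseteq> G" and closed: "\<And>p. loc T G p \<Longrightarrow> p \<in> G"
    and neg: "\<And>p. Neg p \<in> G \<longleftrightarrow> p \<notin> G"
    and all0: "\<And>r. (\<And>t. subst0 0 t r \<in> G) \<Longrightarrow> All0 r \<in> G"
    and all1: "\<And>r. (\<And>j. subst1 0 j r \<in> G) \<Longrightarrow> All1 r \<in> G"
    using henkin_extension[OF T, of "{Neg p}"] by auto
  have TG: "q \<in> G" if "T \<turnstile> q" for q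
    using that by (simp add: closed loc.base)
  have mpG: "q \<in> G" if "Imp r q \<in> G" "r \<in> G" for q r
    using that by (meson closed loc.asm loc.mp)
  have impG: "Imp q r \<in> G \<longleftrightarrow> (q \<in> G \<longrightarrow> r \<in> G)" for q r
  proof
    assume "q \<in> G \<longrightarrow> r \<in> G"
    then consider "r \<in> G" | "Neg q \<in> G" using neg by auto
    then show "Imp q r \<in> G"
    proof cases
      case 1 then show ?thesis by (simp add: closed loc.asm loc_K)
    next
      case 2
      then have "loc T (insert q G) r"
        by (meson insertI1 insertI2 loc.asm loc_ex_falso)
      then show ?thesis using closed deduct by blast
    qed
  qed (use mpG in auto)
  have all0G: "All0 r \<in> G \<longleftrightarrow> (\<forall>t. subst0 0 t r \<in> G)" for r
    using all0 mpG TG prv.All0E by meson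
  have all1G: "All1 r \<in> G \<longleftrightarrow> (\<forall>t. subst1 0 t r \<in> G)" for r
    using all1 mpG TG prv.All1E by meson
  have leib: "subst0 0 t r \<in> G" if "Eq s t \<in> G" "subst0 0 s r \<in> G" for s t r
    using that TG[OF prv.Leib[of T s t r]] mpG by blast
  have refl: "Eq t t \<in> G" for t using TG prv.Refl by blast
  have sym: "Eq t s \<in> G" if "Eq s t \<in> G" for s t
    using leib[OF that, of "Eq (Var 0) (lift_tm 0 s)"] refl by (simp add: subst0_lift_cancel)
  have trans: "Eq s u \<in> G" if "Eq s t \<in> G" "Eq t u \<in> G" for s t u
    using leib[OF that(2), of "Eq (lift_tm 0 s) (Var 0)"] that(1) by (simp add: subst0_lift_cancel)
  define R where "R = {(s, t). Eq s t \<in> G}"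
  have R: "equiv UNIV R"
    by (rule equivI) (auto simp: R_def refl_on_def sym_def trans_def intro: refl sym trans)
  have cls: "R `` {s} = R `` {t} \<longleftrightarrow> Eq s t \<in> G" for s t
    using eq_equiv_class_iff[OF R, of s t] by (simp add: R_def)
  have ax: "T \<turnstile> closure q" if "q \<in> basic_axioms" for q
    using that ACA by (auto simp: ACA0_def intro: prv.Ax)
  have succ_ne: "Eq (Add t One) Zero \<notin> G" for t
  proof -
    have "T \<turnstile> All0 (Neg (Eq (Add (Var 0) One) Zero))"
      using ax[of "Neg (Eq (Add (Var 0) One) Zero)"]
      by (simp add: basic_axioms_def closure_def Let_def)
    then show ?thesis using TG all0G neg by fastforce
  qed
  have succ_inj: "Eq s t \<in> G" if "Eq (Add s One) (Add t One) \<in> G" for s t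
  proof -
    have "T \<turnstile> All0 (All0 (Imp (Eq (Add (Var 1) One) (Add (Var 0) One)) (Eq (Var 1) (Var 0))))"
      using ax[of "Imp (Eq (Add (Var 1) One) (Add (Var 0) One)) (Eq (Var 1) (Var 0))"]
      by (simp add: basic_axioms_def closure_def Let_def numeral_2_eq_2)
    from TG[OF this] have "Imp (Eq (Add s One) (Add t One)) (Eq s t) \<in> G"
      using all0G by (auto simp: subst0_lift_cancel dest!: spec[of _ s] spec[of _ t])
    then show ?thesis using that mpG by blast
  qed
  have num_inj: "Eq (num i) (num j) \<in> G \<longleftrightarrow> i = j" for i j
  proof
    show "i = j" if "Eq (num i) (num j) \<in> G"
      using that
    proof (induction i arbitrary: j)
      case 0
      then show ?case using succ_ne sym by (cases j) auto
    next
      case (Suc i)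
      then show ?case using succ_ne succ_inj by (cases j) auto
    qed
  qed (simp add: refl)
  let ?D = "range (\<lambda>t. R `` {t})"
  have "inj (\<lambda>i. R `` {num i})" by (auto simp: inj_def cls num_inj)
  then have "infinite (range (\<lambda>i. R `` {num i}))" using finite_imageD by blast
  moreover have "range (\<lambda>i. R `` {num i}) \<subseteq> ?D" by auto
  ultimately have inf: "infinite ?D" using finite_subset by blast
  have bij: "bij_betw (to_nat_on ?D) ?D UNIV"
    by (rule to_nat_on_infinite[OF _ inf]) simp
  define h where "h t = to_nat_on ?D (R `` {t})" for t
  have h: "h s = h t \<longleftrightarrow> Eq s t \<in> G" for s t
    unfolding h_def using inj_on_eq_iff[OF bij_betw_imp_inj_on[OF bij] rangeI rangeI] cls by simp
  have "range h = UNIV"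
    using bij_betw_imp_surj_on[OF bij] unfolding h_def[abs_def] image_image .
  then have hr: "h (inv h x) = x" for x by (simp add: f_inv_into_f)
  define M :: "nat str" where "M = \<lparr>szero = h Zero, sone = h One,
     sadd = (\<lambda>x y. h (Add (inv h x) (inv h y))), smul = (\<lambda>x y. h (Mul (inv h x) (inv h y))),
     sless = (\<lambda>x y. Less (inv h x) (inv h y) \<in> G),
     ssets = range (\<lambda>j. {x. Mem (inv h x) j \<in> G})\<rparr>"
  have rh: "Eq (inv h (h t)) t \<in> G" for t using h hr by blast
  \<comment> \<open>The axiom of Leibniz replaces at one variable at a time, so the two arguments
    are exchanged in two steps.\<close>
  have cong2: "f (inv h (h s)) (inv h (h t)) \<in> G \<longleftrightarrow> f s t \<in> G"
    if f: "\<And>s t u v. subst0 0 u (f s t) = f (subst_tm 0 u s) (subst_tm 0 u t)" for f s t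
  proof
    have step1: "f v t \<in> G" if "Eq u v \<in> G" "f u t \<in> G" for u v t
      using leib[OF that(1), of "f (Var 0) (lift_tm 0 t)"] that(2) by (simp add: f subst0_lift_cancel)
    have step2: "f t v \<in> G" if "Eq u v \<in> G" "f t u \<in> G" for u v t
      using leib[OF that(1), of "f (lift_tm 0 t) (Var 0)"] that(2) by (simp add: f subst0_lift_cancel)
    show "f s t \<in> G" if "f (inv h (h s)) (inv h (h t)) \<in> G"
      using step1[OF rh step2[OF rh that]] .
    show "f (inv h (h s)) (inv h (h t)) \<in> G" if "f s t \<in> G"
      using step1[OF sym[OF rh] step2[OF sym[OF rh] that]] .
  qed
  have add: "h (Add (inv h (h s)) (inv h (h t))) = h (Add s t)"
    and mul: "h (Mul (inv h (h s)) (inv h (h t))) = h (Mul s t)" for s t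
  proof -
    have "Eq (Add s t) (Add (inv h (h s)) (inv h (h t))) \<in> G"
      using leib[OF sym[OF rh[of s]], of "Eq (lift_tm 0 (Add s t)) (Add (Var 0) (lift_tm 0 t))"]
        leib[OF sym[OF rh[of t]], of "Eq (lift_tm 0 (Add s t)) (Add (lift_tm 0 (inv h (h s))) (Var 0))"] refl
      by (simp add: subst0_lift_cancel)
    then show "h (Add (inv h (h s)) (inv h (h t))) = h (Add s t)" using h sym by blast
    have "Eq (Mul s t) (Mul (inv h (h s)) (inv h (h t))) \<in> G"
      using leib[OF sym[OF rh[of s]], of "Eq (lift_tm 0 (Mul s t)) (Mul (Var 0) (lift_tm 0 t))"]
        leib[OF sym[OF rh[of t]], of "Eq (lift_tm 0 (Mul s t)) (Mul (lift_tm 0 (inv h (h s))) (Var 0))"] refl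
      by (simp add: subst0_lift_cancel)
    then show "h (Mul (inv h (h s)) (inv h (h t))) = h (Mul s t)" using h sym by blast
  qed
  have evM: "ev M (\<lambda>i. h (s i)) t = h (tsub s t)" for s t
    by (induction t) (simp_all add: M_def add mul)
  have less: "Less (inv h (h s)) (inv h (h t)) \<in> G \<longleftrightarrow> Less s t \<in> G" for s t
    by (rule cong2) simp
  have mem: "Mem (inv h (h t)) j \<in> G \<longleftrightarrow> Mem t j \<in> G" for t j
    using leib[OF rh[of t], of "Mem (Var 0) j"] leib[OF sym[OF rh[of t]], of "Mem (Var 0) j"] by auto
  define A where "A j = {x. Mem (inv h x) j \<in> G}" for j :: nat
  \<comment> \<open>All assignments of terms and of named sets are covered, since the substitution
    changes under a quantifier. The sets of the model are exactly those named by a set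
    variable.\<close>
  have truth: "sats M (\<lambda>i. h (s i)) (\<lambda>i. A (j i)) q \<longleftrightarrow> psub s j q \<in> G" for s j q
  proof (induction q arbitrary: s j)
    case (Eq t u)
    then show ?case by (simp add: evM h)
  next
    case (Less t u)
    then show ?case by (simp add: evM) (simp add: M_def less)
  next
    case (Mem t i)
    then show ?case by (simp add: evM A_def mem)
  next
    case (All0 q)
    have "sats M (case_nat n (\<lambda>i. h (s i))) (\<lambda>i. A (j i)) q \<longleftrightarrow>
        psub (case_nat (inv h n) s) j q \<in> G" for n
    proof -
      have "case_nat n (\<lambda>i. h (s i)) = (\<lambda>i. h (case_nat (inv h n) s i))"
        by (auto simp: fun_eq_iff hr split: nat.splits)
      then show ?thesis using All0 by presburger
    qed
    moreover have "subst0 0 t (psub (ups s) j q) = psub (case_nat t s) j q" for t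
      unfolding subst0_psub psub_psub
      by (rule psub_cong) (auto simp: ups_def lift_tm_tsub tsub_tsub split: nat.splits)
    \<comment> \<open>The model supplies only the chosen representatives as instances; any other
      term is equal in \<open>G\<close> to the representative of its class.\<close>
    moreover have "psub (case_nat t s) j q \<in> G" if "\<forall>n. psub (case_nat (inv h n) s) j q \<in> G" for t
    proof -
      have "subst0 0 (inv h (h t)) (psub (ups s) j q) \<in> G"
        using that calculation(2) by simp
      then show ?thesis using leib[OF rh[of t]] calculation(2) by metis
    qed
    ultimately show ?case by (auto simp: all0G)
  next
    case (All1 q)
    have "sats M (\<lambda>i. h (s i)) (case_nat (A k) (\<lambda>i. A (j i))) q \<longleftrightarrow>
        psub s (case_nat k j) q \<in> G" for k
    proof -
      have "case_nat (A k) (\<lambda>i. A (j i)) = (\<lambda>i. A (case_nat k j i))"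
        by (auto simp: fun_eq_iff split: nat.splits)
      then show ?thesis using All1 by presburger
    qed
    moreover have "subst1 0 k (psub s (upj j) q) = psub s (case_nat k j) q" for k
      unfolding subst1_psub psub_psub
      by (rule psub_cong) (auto simp: upj_def split: nat.splits)
    moreover have "ssets M = range A" by (simp add: M_def A_def[abs_def])
    ultimately show ?case by (auto simp: all1G)
  qed (simp_all add: neg impG)
  have sent: "valid M q \<longleftrightarrow> q \<in> G" if "sentence q" for q
  proof -
    have "sats M e E q \<longleftrightarrow> q \<in> G" for e E
      using truth[of Var "\<lambda>i. i" q] sats_sentence[OF that] by (metis psub_Var)
    moreover have "\<exists>E :: nat \<Rightarrow> nat set. \<forall>i. E i \<in> ssets M"
      by (rule exI[of _ A]) (simp add: M_def A_def[abs_def])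
    ultimately show ?thesis by (auto simp: valid_def)
  qed
  have "valid M q" if "q \<in> T" for q
    using that T sent TG prv.Ax by (metis is_theory_def)
  then have "p \<in> G" using models sent p by blast
  then show False using neg \<open>{Neg p} \<subseteq> G\<close> by auto
qed

section \<open>Definability and arithmetic in models of arithmetical comprehension\<close>

lemma arithmetical_psub [simp]: "arithmetical (psub s j p) = arithmetical p"
  by (induction p arbitrary: s j) auto

locale aca =
  fixes M :: "'a str"
  assumes ACA0_valid: "q \<in> ACA0 \<Longrightarrow> valid M q" and ssets_nonempty: "ssets M \<noteq> {}"
begin

abbreviation zeroM ("\<zero>") where "\<zero> \<equiv> szero M"
abbreviation oneM ("\<one>") where "\<one> \<equiv> sone M"
abbreviation addM (infixl "\<oplus>" 65) where "x \<oplus> y \<equiv> sadd M x y"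
abbreviation mulM (infixl "\<otimes>" 70) where "x \<otimes> y \<equiv> smul M x y"
abbreviation lessM (infix "\<prec>" 50) where "x \<prec> y \<equiv> sless M x y"

definition leM (infix "\<preceq>" 50) where "x \<preceq> y \<longleftrightarrow> x \<prec> y \<or> x = y"

text \<open>Arithmetical definability with set parameters, as a property of predicates on
  assignments. The closure rules collected in \<open>ad\<close> replace writing down a formula
  whenever comprehension or induction is applied. Number parameters are hidden in singleton sets by
  \<open>FD_const\<close>.\<close>

definition AD :: "((nat \<Rightarrow> 'a) \<Rightarrow> bool) \<Rightarrow> bool" where
  "AD P \<longleftrightarrow> (\<exists>p E. arithmetical p \<and> (\<forall>i. E i \<in> ssets M) \<and> (\<forall>e. P e \<longleftrightarrow> sats M e E p))"

definition FD :: "((nat \<Rightarrow> 'a) \<Rightarrow> 'a) \<Rightarrow> bool" where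
  "FD F \<longleftrightarrow> AD (\<lambda>e. e 0 = F (\<lambda>i. e (Suc i)))"

lemma some_env: "\<exists>E :: nat \<Rightarrow> 'a set. \<forall>i. E i \<in> ssets M"
proof -
  obtain X where "X \<in> ssets M" using ssets_nonempty by blast
  then show ?thesis by (intro exI[of _ "\<lambda>_. X"]) simp
qed

lemma AD_atom:
  assumes "arithmetical p" "\<And>e E. (\<forall>i. E i \<in> ssets M) \<Longrightarrow> P e \<longleftrightarrow> sats M e E p"
  shows "AD P"
  using assms some_env unfolding AD_def by metis

lemma basic: "q \<in> basic_axioms \<Longrightarrow> \<exists>E. sats M e E q"
proof -
  assume "q \<in> basic_axioms"
  then have "valid M q" using ACA0_valid[of "closure q"] by (auto simp: ACA0_def valid_closure)
  then show ?thesis using some_env unfolding valid_def by blast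
qed

lemma comprehension_param:
  assumes "arithmetical p" "\<And>i. E i \<in> ssets M" shows "{n. sats M (case_nat n e) E p} \<in> ssets M"
proof -
  have "valid M (comprehension p)"
    using ACA0_valid[of "closure (comprehension p)"] assms(1) by (auto simp: ACA0_def valid_closure)
  then have "sats M e E (comprehension p)" using assms(2) by (simp add: valid_def)
  then obtain X where X: "X \<in> ssets M" and "\<forall>n. n \<in> X \<longleftrightarrow> sats M (case_nat n e) E p"
    by (auto simp: comprehension_def)
  then have "X = {n. sats M (case_nat n e) E p}" by blast
  then show ?thesis using X by simp
qed

lemma comprehension:
  assumes "AD (\<lambda>e. P (e 0))" shows "{n. P n} \<in> ssets M"
proof -
  obtain p E where p: "arithmetical p" "\<And>i. E i \<in> ssets M" "\<And>e. P (e 0) \<longleftrightarrow> sats M e E p"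
    using assms unfolding AD_def by metis
  show ?thesis
    using comprehension_param[of p E "\<lambda>_. \<zero>", OF p(1,2)] by (simp add: p(3)[symmetric])
qed

lemma singleton_in: "{c} \<in> ssets M"
proof -
  obtain E :: "nat \<Rightarrow> 'a set" where "\<forall>i. E i \<in> ssets M" using some_env by blast
  then show ?thesis using comprehension_param[of "Eq (Var 0) (Var 1)" E "\<lambda>_. c"] by simp
qed

named_theorems ad

lemma AD_mem [ad]: "X \<in> ssets M \<Longrightarrow> AD (\<lambda>e. e i \<in> X)"
  unfolding AD_def by (rule exI[of _ "Mem (Var i) 0"], rule exI[of _ "\<lambda>_. X"]) simp

lemma AD_neg [ad]: "AD P \<Longrightarrow> AD (\<lambda>e. \<not> P e)"
  unfolding AD_def by (metis arithmetical.simps(4) sats.simps(4))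

lemma AD_imp [ad]:
  assumes "AD P" "AD Q" shows "AD (\<lambda>e. P e \<longrightarrow> Q e)"
proof -
  obtain p E q F where p: "arithmetical p" "\<And>i. E i \<in> ssets M" "\<And>e. P e \<longleftrightarrow> sats M e E p"
    and q: "arithmetical q" "\<And>i. F i \<in> ssets M" "\<And>e. Q e \<longleftrightarrow> sats M e F q"
    using assms unfolding AD_def by metis
  \<comment> \<open>The parameters of the two formulas are interleaved on even and odd set
    variables, so that one assignment serves both.\<close>
  let ?G = "\<lambda>i. if even i then E (i div 2) else F (i div 2)"
  have "sats M e ?G (Imp (psub Var (\<lambda>i. 2 * i) p) (psub Var (\<lambda>i. 2 * i + 1) q)) \<longleftrightarrow> (P e \<longrightarrow> Q e)" for e
    by (simp add: sats_psub p q)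
  then show ?thesis
    using p(1,2) q(1,2) unfolding AD_def
    by (intro exI[of _ "Imp (psub Var (\<lambda>i. 2 * i) p) (psub Var (\<lambda>i. 2 * i + 1) q)"] exI[of _ ?G])
      (auto)
qed

lemma AD_conj [ad]: "AD P \<Longrightarrow> AD Q \<Longrightarrow> AD (\<lambda>e. P e \<and> Q e)"
  using AD_neg[OF AD_imp[OF _ AD_neg], of P Q] by simp

lemma AD_disj [ad]: "AD P \<Longrightarrow> AD Q \<Longrightarrow> AD (\<lambda>e. P e \<or> Q e)"
  using AD_imp[OF AD_neg, of P Q] by (simp add: imp_conv_disj)

lemma AD_iff [ad]: "AD P \<Longrightarrow> AD Q \<Longrightarrow> AD (\<lambda>e. P e \<longleftrightarrow> Q e)"
  using AD_conj[OF AD_imp AD_imp, of P Q Q P] by (simp add: iff_conv_conj_imp)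

lemma AD_all [ad]:
  assumes "AD (\<lambda>e. P (e 0) (\<lambda>i. e (Suc i)))" shows "AD (\<lambda>e. \<forall>n. P n e)"
proof -
  obtain p E where p: "arithmetical p" "\<And>i. E i \<in> ssets M"
    "\<And>e. P (e 0) (\<lambda>i. e (Suc i)) \<longleftrightarrow> sats M e E p"
    using assms unfolding AD_def by metis
  have "sats M e E (All0 p) \<longleftrightarrow> (\<forall>n. P n e)" for e
    using p(3)[of "case_nat _ e"] by simp
  then show ?thesis
    using p(1,2) unfolding AD_def by (intro exI[of _ "All0 p"] exI[of _ E]) auto
qed

lemma AD_ex [ad]: "AD (\<lambda>e. P (e 0) (\<lambda>i. e (Suc i))) \<Longrightarrow> AD (\<lambda>e. \<exists>n. P n e)"
  using AD_neg[OF AD_all[OF AD_neg]] by simp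

lemma AD_eqv: "AD (\<lambda>e. e i = e j)"
  by (rule AD_atom[of "Eq (Var i) (Var j)"]) auto

lemma AD_bool [ad]: "AD (\<lambda>e. b)"
  by (rule AD_atom[of "if b then Top else Bot"]) (auto simp: Top_def Bot_def)

lemma AD_ren: "AD P \<Longrightarrow> AD (\<lambda>e. P (\<lambda>i. e (r i)))"
proof -
  assume "AD P"
  then obtain p E where p: "arithmetical p" "\<And>i. E i \<in> ssets M" "\<And>e. P e \<longleftrightarrow> sats M e E p"
    unfolding AD_def by metis
  then show ?thesis
    unfolding AD_def
    by (intro exI[of _ "psub (\<lambda>i. Var (r i)) (\<lambda>i. i) p"] exI[of _ E]) (auto simp: sats_psub)
qed

lemma FD_ren: "FD F \<Longrightarrow> FD (\<lambda>e. F (\<lambda>i. e (r i)))"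
  unfolding FD_def
  by (drule AD_ren[where r = "case_nat 0 (\<lambda>i. Suc (r i))"]) simp

lemma FD_var [ad]: "FD (\<lambda>e. e i)"
  unfolding FD_def by (rule AD_eqv)

lemma FD_const [ad]: "FD (\<lambda>e. c)"
  unfolding FD_def using AD_mem[OF singleton_in, of 0 c] by simp

text \<open>Substitution of a definable function is expressed by quantifying over its value;
  arithmetical formulas are closed under number quantifiers.\<close>

lemma AD_rel1:
  assumes R: "AD (\<lambda>e. R (e 0))" and F: "FD F"
  shows "AD (\<lambda>e. R (F e))"
proof -
  have "AD (\<lambda>e. \<exists>x. x = F e \<and> R x)"
    by (intro AD_ex AD_conj F[unfolded FD_def] R)
  then show ?thesis by simp
qed

lemma AD_rel2:
  assumes R: "AD (\<lambda>e. R (e 0) (e 1))" and F: "FD F" and G: "FD G"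
  shows "AD (\<lambda>e. R (F e) (G e))"
proof -
  have "AD (\<lambda>e. \<exists>y. y = G e \<and> (\<exists>x. x = F e \<and> R x y))"
    using R by (intro AD_ex AD_conj G[unfolded FD_def] FD_ren[OF F, unfolded FD_def]) simp
  then show ?thesis by simp
qed

lemma AD_rel3:
  assumes R: "AD (\<lambda>e. R (e 0) (e 1) (e 2))" and F: "FD F" and G: "FD G" and H: "FD H"
  shows "AD (\<lambda>e. R (F e) (G e) (H e))"
proof -
  have "AD (\<lambda>e. \<exists>z. z = H e \<and> R (F e) (G e) z)"
  proof (intro AD_ex AD_conj H[unfolded FD_def])
    have "AD (\<lambda>e. \<exists>y. y = G (\<lambda>i. e (Suc i)) \<and> (\<exists>x. x = F (\<lambda>i. e (Suc i)) \<and> R x y (e 0)))"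
      using R by (intro AD_ex AD_conj FD_ren[OF G, unfolded FD_def] FD_ren[OF F, unfolded FD_def])
        (simp add: numeral_2_eq_2)
    then show "AD (\<lambda>e. R (F (\<lambda>i. e (Suc i))) (G (\<lambda>i. e (Suc i))) (e 0))" by simp
  qed
  then show ?thesis by simp
qed

lemma AD_eq [ad]: "FD F \<Longrightarrow> FD G \<Longrightarrow> AD (\<lambda>e. F e = G e)"
  using AD_rel2[where R = "(=)", OF AD_eqv] .

lemma AD_less [ad]: "FD F \<Longrightarrow> FD G \<Longrightarrow> AD (\<lambda>e. F e \<prec> G e)"
  by (rule AD_rel2[where R = "(\<prec>)", OF AD_atom[of "Less (Var 0) (Var 1)"]]) auto

lemma AD_le [ad]: "FD F \<Longrightarrow> FD G \<Longrightarrow> AD (\<lambda>e. F e \<preceq> G e)"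
  unfolding leM_def by (intro ad)

lemma AD_memb [ad]: "X \<in> ssets M \<Longrightarrow> FD F \<Longrightarrow> AD (\<lambda>e. F e \<in> X)"
  using AD_rel1[where R = "\<lambda>x. x \<in> X", OF AD_mem] .

lemma FD_fun1:
  assumes f: "AD (\<lambda>e. e 0 = f (e 1))" and F: "FD F"
  shows "FD (\<lambda>e. f (F e))"
  unfolding FD_def using AD_rel2[OF f FD_var FD_ren[OF F, where r = Suc]] by simp

lemma FD_fun2:
  assumes f: "AD (\<lambda>e. e 0 = f (e 1) (e 2))" and F: "FD F" and G: "FD G"
  shows "FD (\<lambda>e. f (F e) (G e))"
  unfolding FD_def
  using AD_rel3[OF f FD_var FD_ren[OF F, where r = Suc] FD_ren[OF G, where r = Suc]] by simp

lemma FD_add [ad]: "FD F \<Longrightarrow> FD G \<Longrightarrow> FD (\<lambda>e. F e \<oplus> G e)"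
  by (rule FD_fun2[where f = "(\<oplus>)", OF AD_atom[of "Eq (Var 0) (Add (Var 1) (Var 2))"]]) auto

lemma FD_mul [ad]: "FD F \<Longrightarrow> FD G \<Longrightarrow> FD (\<lambda>e. F e \<otimes> G e)"
  by (rule FD_fun2[where f = "(\<otimes>)", OF AD_atom[of "Eq (Var 0) (Mul (Var 1) (Var 2))"]]) auto


section \<open>Peano arithmetic in the model\<close>

lemma succ_ne: "x \<oplus> \<one> \<noteq> \<zero>"
  using basic[of "Neg (Eq (Add (Var 0) One) Zero)" "\<lambda>_. x"] by (auto simp: basic_axioms_def Let_def)

lemma succ_inj: "x \<oplus> \<one> = y \<oplus> \<one> \<Longrightarrow> x = y"
  using basic[of "Imp (Eq (Add (Var 1) One) (Add (Var 0) One)) (Eq (Var 1) (Var 0))" "case_nat y (\<lambda>_. x)"]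
  by (auto simp: basic_axioms_def Let_def)

lemma add_0: "x \<oplus> \<zero> = x"
  using basic[of "Eq (Add (Var 1) Zero) (Var 1)" "case_nat x (\<lambda>_. x)"]
  by (auto simp: basic_axioms_def Let_def)

lemma add_succ: "x \<oplus> (y \<oplus> \<one>) = x \<oplus> y \<oplus> \<one>"
  using basic[of "Eq (Add (Var 1) (Add (Var 0) One)) (Add (Add (Var 1) (Var 0)) One)" "case_nat y (\<lambda>_. x)"]
  by (auto simp: basic_axioms_def Let_def)

lemma mul_0: "x \<otimes> \<zero> = \<zero>"
  using basic[of "Eq (Mul (Var 1) Zero) Zero" "case_nat x (\<lambda>_. x)"]
  by (auto simp: basic_axioms_def Let_def)

lemma mul_succ: "x \<otimes> (y \<oplus> \<one>) = x \<otimes> y \<oplus> x"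
  using basic[of "Eq (Mul (Var 1) (Add (Var 0) One)) (Add (Mul (Var 1) (Var 0)) (Var 1))" "case_nat y (\<lambda>_. x)"]
  by (auto simp: basic_axioms_def Let_def)

lemma not_less_0: "\<not> x \<prec> \<zero>"
  using basic[of "Neg (Less (Var 1) Zero)" "case_nat x (\<lambda>_. x)"]
  by (auto simp: basic_axioms_def Let_def)

lemma less_succ: "x \<prec> y \<oplus> \<one> \<longleftrightarrow> x \<prec> y \<or> x = y"
  using basic[of "Iff (Less (Var 1) (Add (Var 0) One)) (Disj (Less (Var 1) (Var 0)) (Eq (Var 1) (Var 0)))"
      "case_nat y (\<lambda>_. x)"]
  by (auto simp: basic_axioms_def Let_def)

theorem ind [case_names AD zero suc]:
  assumes "AD (\<lambda>e. P (e 0))" and "P \<zero>" and "\<And>n. P n \<Longrightarrow> P (n \<oplus> \<one>)"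
  shows "P n"
proof -
  have "valid M induction_axiom"
    using ACA0_valid[of "closure induction_axiom"] by (auto simp: ACA0_def valid_closure)
  then have "\<zero> \<in> X \<Longrightarrow> (\<And>n. n \<in> X \<Longrightarrow> n \<oplus> \<one> \<in> X) \<Longrightarrow> n \<in> X" if "X \<in> ssets M" for X n
    using that by (auto simp: valid_def induction_axiom_def dest!: spec[of _ "\<lambda>_. X"])
  from this[OF comprehension[OF assms(1)]] assms(2,3) show ?thesis by auto
qed

lemma zero_add: "\<zero> \<oplus> x = x"
proof (induction x rule: ind)
  case AD show ?case by (intro ad)
next
  case (suc n) then show ?case by (metis add_succ)
qed (rule add_0)

lemma add_assoc: "x \<oplus> y \<oplus> z = x \<oplus> (y \<oplus> z)"
proof (induction z rule: ind)
  case AD show ?case by (intro ad)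
next
  case (suc n) then show ?case by (metis add_succ)
qed (simp add: add_0)

lemma succ_add: "x \<oplus> \<one> \<oplus> y = x \<oplus> y \<oplus> \<one>"
proof (induction y rule: ind)
  case AD show ?case by (intro ad)
next
  case (suc n) then show ?case by (metis add_succ)
qed (simp add: add_0)

lemma add_comm: "x \<oplus> y = y \<oplus> x"
proof (induction y rule: ind)
  case AD show ?case by (intro ad)
next
  case (suc n) then show ?case by (metis add_succ succ_add)
qed (simp add: add_0 zero_add)

lemma mul_add: "x \<otimes> (y \<oplus> z) = x \<otimes> y \<oplus> x \<otimes> z"
proof (induction z rule: ind)
  case AD show ?case by (intro ad)
next
  case (suc n) then show ?case by (metis add_succ mul_succ add_assoc)
qed (simp add: add_0 mul_0)

lemma mul_assoc: "x \<otimes> y \<otimes> z = x \<otimes> (y \<otimes> z)"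
proof (induction z rule: ind)
  case AD show ?case by (intro ad)
next
  case (suc n) then show ?case by (metis mul_succ mul_add)
qed (simp add: mul_0)

lemma zero_mul: "\<zero> \<otimes> x = \<zero>"
proof (induction x rule: ind)
  case AD show ?case by (intro ad)
next
  case (suc n) then show ?case by (metis mul_succ add_0)
qed (rule mul_0)

lemma succ_mul: "(x \<oplus> \<one>) \<otimes> y = x \<otimes> y \<oplus> y"
proof (induction y rule: ind)
  case AD show ?case by (intro ad)
next
  case (suc n) then show ?case by (metis mul_succ add_assoc add_comm add_succ)
qed (simp add: add_0 mul_0)

lemma mul_comm: "x \<otimes> y = y \<otimes> x"
proof (induction y rule: ind)
  case AD show ?case by (intro ad)
next
  case (suc n) then show ?case by (metis mul_succ succ_mul)
qed (simp add: mul_0 zero_mul)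

lemma mul_one: "x \<otimes> \<one> = x"
  by (metis mul_succ mul_0 zero_add)

lemma add_right_cancel: "x \<oplus> z = y \<oplus> z \<Longrightarrow> x = y"
proof (induction z rule: ind)
  case AD show ?case by (intro ad)
next
  case (suc n) then show ?case by (metis add_succ succ_inj)
qed (simp add: add_0)

lemma zero_or_succ: "x = \<zero> \<or> (\<exists>y. x = y \<oplus> \<one>)"
  by (induction x rule: ind) (intro ad, auto)

lemma less_iff: "x \<prec> y \<longleftrightarrow> (\<exists>z. y = x \<oplus> (z \<oplus> \<one>))"
proof (induction y rule: ind)
  case AD show ?case by (intro ad)
next
  case zero then show ?case by (metis add_succ not_less_0 succ_ne)
next
  case (suc n)
  show ?case
    unfolding less_succ suc by (metis add_0 add_succ succ_inj zero_or_succ)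
qed

lemma le_iff: "x \<preceq> y \<longleftrightarrow> (\<exists>z. y = x \<oplus> z)"
  unfolding leM_def less_iff by (metis add_0 zero_or_succ)

lemma add_eq_0: "x \<oplus> y = \<zero> \<longleftrightarrow> x = \<zero> \<and> y = \<zero>"
  by (metis add_0 add_succ succ_ne zero_or_succ)

lemma linear: "x \<preceq> y \<or> y \<preceq> x"
proof (induction x rule: ind)
  case AD show ?case by (intro ad)
next
  case zero show ?case by (metis le_iff zero_add)
next
  case (suc n)
  then consider z where "n = y \<oplus> z" | "y = n" | z where "y = n \<oplus> (z \<oplus> \<one>)"
    unfolding leM_def less_iff le_iff by (metis add_0)
  then show ?case
  proof cases
    case 1 then show ?thesis unfolding le_iff by (metis add_succ)
  next
    case 2 then show ?thesis unfolding le_iff by metis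
  next
    case 3 then show ?thesis unfolding le_iff by (metis add_succ succ_add)
  qed
qed

lemma mul_eq_0: "x \<otimes> y = \<zero> \<Longrightarrow> x = \<zero> \<or> y = \<zero>"
  by (metis mul_succ add_eq_0 zero_or_succ)

definition monusM (infixl "\<ominus>" 65) where
  "x \<ominus> y = (if y \<preceq> x then (THE z. x = y \<oplus> z) else \<zero>)"

lemma monus_eq: "(y \<oplus> z) \<ominus> y = z"
proof -
  have "(THE w. y \<oplus> z = y \<oplus> w) = z"
    by (rule the_equality) (simp, metis add_comm add_right_cancel)
  moreover have "y \<preceq> y \<oplus> z" unfolding le_iff by blast
  ultimately show ?thesis by (simp add: monusM_def)
qed

lemma monus_0: "\<not> y \<preceq> x \<Longrightarrow> x \<ominus> y = \<zero>"
  by (simp add: monusM_def)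

lemma le_antisym: "x \<preceq> y \<Longrightarrow> y \<preceq> x \<Longrightarrow> x = y"
proof -
  assume "x \<preceq> y" "y \<preceq> x"
  then obtain u v where u: "y = x \<oplus> u" and v: "x = y \<oplus> v" unfolding le_iff by auto
  then have "(u \<oplus> v) \<oplus> x = \<zero> \<oplus> x" by (metis add_assoc add_comm zero_add)
  then show ?thesis using add_right_cancel add_eq_0 v add_0 by metis
qed

lemma less_irrefl: "\<not> x \<prec> x"
proof
  assume "x \<prec> x"
  then obtain z where "x \<oplus> (z \<oplus> \<one>) = x" unfolding less_iff by metis
  then have "(z \<oplus> \<one>) \<oplus> x = \<zero> \<oplus> x" by (metis add_comm zero_add)
  then show False using add_right_cancel succ_ne by metis
qed

lemma less_le_not_le: "x \<prec> y \<longleftrightarrow> x \<preceq> y \<and> \<not> y \<preceq> x"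
  by (metis le_antisym leM_def less_irrefl linear)

lemma zero_monus: "\<zero> \<ominus> z = \<zero>"
proof (cases "z = \<zero>")
  case True
  then show ?thesis using monus_eq[of z "\<zero>"] by (simp add: add_0)
next
  case False
  then have "\<not> z \<preceq> \<zero>" unfolding le_iff by (metis add_eq_0)
  then show ?thesis by (rule monus_0)
qed

lemma monus_monus: "x \<ominus> y \<ominus> z = x \<ominus> (y \<oplus> z)"
proof (cases "y \<preceq> x")
  case True
  then obtain u where u: "x = y \<oplus> u" unfolding le_iff by auto
  show ?thesis
  proof (cases "z \<preceq> u")
    case True
    then show ?thesis unfolding u le_iff by (metis add_assoc monus_eq)
  next
    case False
    then have "\<not> y \<oplus> z \<preceq> y \<oplus> u"
      unfolding le_iff by (metis add_assoc add_comm add_right_cancel)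
    with False show ?thesis by (simp add: u monus_eq monus_0)
  qed
next
  case False
  then have "\<not> y \<oplus> z \<preceq> x" unfolding le_iff by (metis add_assoc)
  with False show ?thesis by (simp add: monus_0 zero_monus)
qed

lemma mul_monus: "x \<otimes> (y \<ominus> z) = x \<otimes> y \<ominus> x \<otimes> z"
proof (cases "z \<preceq> y")
  case True
  then show ?thesis unfolding le_iff by (metis monus_eq mul_add)
next
  case False
  then obtain w where w: "z = y \<oplus> w" using linear le_iff by blast
  have "x \<otimes> y \<ominus> x \<otimes> z = \<zero>"
    unfolding w mul_add monus_monus[symmetric] by (metis add_0 monus_eq zero_monus)
  with False show ?thesis by (simp add: monus_0 mul_0)
qed

text \<open>From here on the ring and order lemmas of the library apply to the possibly nonstandard
  numbers of the model. Truncated subtraction was introduced because this class of semirings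
  contains it; it also serves later to decide the order by a program.\<close>

sublocale num: linordered_semidom "(\<oplus>)" "(\<ominus>)" "(\<preceq>)" "(\<prec>)" "\<zero>" "(\<otimes>)" "\<one>"
proof
  fix a b c
  show "a \<otimes> b \<otimes> c = a \<otimes> (b \<otimes> c)" by (rule mul_assoc)
  show "a \<otimes> b = b \<otimes> a" by (rule mul_comm)
  show "\<one> \<otimes> a = a" by (metis mul_comm mul_one)
  show "a \<oplus> b \<oplus> c = a \<oplus> (b \<oplus> c)" by (rule add_assoc)
  show "a \<oplus> b = b \<oplus> a" by (rule add_comm)
  show "\<zero> \<oplus> a = a" by (rule zero_add)
  show "(a \<oplus> b) \<otimes> c = a \<otimes> c \<oplus> b \<otimes> c" by (metis mul_comm mul_add)
  show "\<zero> \<noteq> \<one>" by (metis succ_ne zero_add)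
  show "a \<oplus> b \<ominus> a = b" by (rule monus_eq)
  show "a \<ominus> b \<ominus> c = a \<ominus> (b \<oplus> c)" by (rule monus_monus)
  show "a \<noteq> \<zero> \<Longrightarrow> b \<noteq> \<zero> \<Longrightarrow> a \<otimes> b \<noteq> \<zero>" using mul_eq_0 by blast
  show "(a \<prec> b) = (a \<preceq> b \<and> \<not> b \<preceq> a)" by (rule less_le_not_le)
  show "a \<preceq> a" by (simp add: leM_def)
  show "a \<preceq> b \<Longrightarrow> b \<preceq> c \<Longrightarrow> a \<preceq> c" by (metis le_iff add_assoc)
  show "a \<preceq> b \<Longrightarrow> b \<preceq> a \<Longrightarrow> a = b" by (rule le_antisym)
  show "a \<preceq> b \<or> b \<preceq> a" by (rule linear)
  show "a \<preceq> b \<Longrightarrow> c \<oplus> a \<preceq> c \<oplus> b" by (metis le_iff add_assoc)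
  show "\<zero> \<prec> \<one>" by (metis less_succ zero_add)
  show "b \<preceq> a \<Longrightarrow> a \<ominus> b \<oplus> b = a" by (metis le_iff monus_eq add_comm)
  assume "a \<prec> b" "\<zero> \<prec> c"
  then obtain u v where "b = a \<oplus> (u \<oplus> \<one>)" "c = v \<oplus> \<one>"
    unfolding less_iff by (metis zero_add)
  moreover have "c \<otimes> (u \<oplus> \<one>) = c \<otimes> u \<oplus> v \<oplus> \<one>" if "c = v \<oplus> \<one>"
    using that by (metis mul_succ add_succ)
  ultimately show "c \<otimes> a \<prec> c \<otimes> b"
    unfolding less_iff by (metis mul_add)
qed (simp_all add: zero_mul mul_0 mul_add mul_monus)

end

context aca
begin

subsection \<open>Goedel's beta function\<close>

lemmas ring = num.distrib_left num.distrib_right num.mult.assoc num.mult.commute num.mult.left_commute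
  num.add.assoc num.add.commute num.add.left_commute num.mult_1_left num.mult_1_right

lemma succ_le: "x \<oplus> \<one> \<preceq> y \<longleftrightarrow> x \<prec> y"
  by (metis less_succ num.not_le leM_def)

lemma less_succ_le: "x \<prec> y \<oplus> \<one> \<longleftrightarrow> x \<preceq> y"
  by (simp add: less_succ leM_def)

lemma pos_iff: "\<zero> \<prec> x \<longleftrightarrow> x \<noteq> \<zero>"
  by (metis zero_add le_iff num.order.not_eq_order_implies_strict num.less_irrefl)

lemma zero_le [simp]: "\<zero> \<preceq> x"
  by (metis zero_add le_iff)

theorem least:
  assumes P [THEN AD_rel1, ad]: "AD (\<lambda>e. P (e 0))" and "P x"
  obtains y where "P y" "\<And>z. z \<prec> y \<Longrightarrow> \<not> P z"
proof -
  have "(\<exists>x. x \<prec> n \<and> P x) \<longrightarrow> (\<exists>y. P y \<and> (\<forall>z. z \<prec> y \<longrightarrow> \<not> P z))" for n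
  proof (induction n rule: ind)
    case AD show ?case by (intro ad)
  next
    case (suc n)
    then show ?case by (metis less_succ)
  qed (simp add: not_less_0)
  then show ?thesis using that \<open>P x\<close> by (metis less_succ)
qed

lemma FD_if [ad]:
  assumes "AD P" "FD F" "FD G" shows "FD (\<lambda>e. if P e then F e else G e)"
proof -
  have "AD (\<lambda>e. P (\<lambda>i. e (Suc i)) \<and> e 0 = F (\<lambda>i. e (Suc i)) \<or> \<not> P (\<lambda>i. e (Suc i)) \<and> e 0 = G (\<lambda>i. e (Suc i)))"
    by (intro AD_conj AD_disj AD_neg AD_ren[OF assms(1)] assms(2,3)[unfolded FD_def])
  moreover have "(\<lambda>e. P (\<lambda>i. e (Suc i)) \<and> e 0 = F (\<lambda>i. e (Suc i)) \<or> \<not> P (\<lambda>i. e (Suc i)) \<and> e 0 = G (\<lambda>i. e (Suc i)))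
    = (\<lambda>e. e 0 = (if P (\<lambda>i. e (Suc i)) then F (\<lambda>i. e (Suc i)) else G (\<lambda>i. e (Suc i))))"
    by auto
  ultimately show ?thesis unfolding FD_def by simp
qed

lemma div_ex:
  assumes "d \<noteq> \<zero>" shows "\<exists>r. r \<prec> d \<and> (\<exists>q. a = q \<otimes> d \<oplus> r)"
proof (induction a rule: ind)
  case AD show ?case by (intro ad)
next
  case zero
  have "\<zero> = \<zero> \<otimes> d \<oplus> \<zero>" by (simp add: zero_mul zero_add)
  then show ?case using assms pos_iff by blast
next
  case (suc n)
  then obtain r q where r: "r \<prec> d" "n = q \<otimes> d \<oplus> r" by blast
  show ?case
  proof (cases "r \<oplus> \<one> = d")
    case True
    then have "n \<oplus> \<one> = (q \<oplus> \<one>) \<otimes> d \<oplus> \<zero>" by (simp add: r add_assoc succ_mul add_0)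
    then show ?thesis using assms pos_iff by blast
  next
    case False
    then have "r \<oplus> \<one> \<prec> d" using r(1) by (metis leM_def succ_le)
    moreover have "n \<oplus> \<one> = q \<otimes> d \<oplus> (r \<oplus> \<one>)" by (simp add: r add_assoc)
    ultimately show ?thesis by blast
  qed
qed

lemma div_unique:
  assumes "q \<otimes> d \<oplus> r = q' \<otimes> d \<oplus> r'" "r \<prec> d" "r' \<prec> d" shows "r = r'"
proof -
  have *: "r = r'" if eq: "q \<otimes> d \<oplus> r = q' \<otimes> d \<oplus> r'" and "r \<prec> d" and "q \<preceq> q'" for q r q' r'
  proof -
    obtain u where u: "q' = q \<oplus> u" using \<open>q \<preceq> q'\<close> le_iff by blast
    have "q \<otimes> d \<oplus> r = q \<otimes> d \<oplus> (u \<otimes> d \<oplus> r')" using eq by (simp add: u num.distrib_right add_assoc)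
    then have r: "r = u \<otimes> d \<oplus> r'" by simp
    have "u = \<zero>"
    proof (rule ccontr)
      assume "u \<noteq> \<zero>"
      then obtain w where "u = w \<oplus> \<one>" using zero_or_succ by blast
      then have "r = d \<oplus> (w \<otimes> d \<oplus> r')" using r by (simp add: succ_mul ring)
      then have "d \<preceq> r" using le_iff by blast
      then show False using \<open>r \<prec> d\<close> num.not_le by blast
    qed
    then show ?thesis using r by (simp add: zero_mul zero_add)
  qed
  show ?thesis
    using *[OF assms(1,2)] *[OF assms(1)[symmetric] assms(3)] linear by metis
qed

definition modulus where "modulus b i = \<one> \<oplus> (i \<oplus> \<one>) \<otimes> b"

definition beta where "beta a b i = (THE v. v \<prec> modulus b i \<and> (\<exists>q. a = q \<otimes> modulus b i \<oplus> v))"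

lemma FD_modulus [ad]: "FD F \<Longrightarrow> FD G \<Longrightarrow> FD (\<lambda>e. modulus (F e) (G e))"
  unfolding modulus_def by (intro ad)

lemma modulus_ne: "modulus b i \<noteq> \<zero>"
  unfolding modulus_def by (metis add_comm succ_ne)

lemma beta_iff: "v = beta a b i \<longleftrightarrow> v \<prec> modulus b i \<and> (\<exists>q. a = q \<otimes> modulus b i \<oplus> v)"
proof -
  have "\<exists>!v. v \<prec> modulus b i \<and> (\<exists>q. a = q \<otimes> modulus b i \<oplus> v)"
    using div_ex[OF modulus_ne[of b i], of a] div_unique by (intro ex_ex1I) blast+
  note ex1 = this
  show ?thesis
  proof
    assume "v = beta a b i"
    then show "v \<prec> modulus b i \<and> (\<exists>q. a = q \<otimes> modulus b i \<oplus> v)"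
      unfolding beta_def using theI'[OF ex1] by simp
  qed (unfold beta_def, rule the1_equality[OF ex1, symmetric])
qed

lemma FD_beta [ad]:
  assumes F: "FD F" and G: "FD G" and H: "FD H" shows "FD (\<lambda>e. beta (F e) (G e) (H e))"
  unfolding FD_def beta_iff
  by (intro ad FD_ren[OF F] FD_ren[OF G] FD_ren[OF H] FD_ren[OF FD_ren[OF F]] FD_ren[OF FD_ren[OF G]] FD_ren[OF FD_ren[OF H]])

lemma sats_beta_fm [simp]:
  "sats M e E (beta_fm a b i v) \<longleftrightarrow> ev M e v = beta (ev M e a) (ev M e b) (ev M e i)"
  by (simp add: beta_fm_def Let_def up_def beta_iff modulus_def)

text \<open>This says that \<open>x\<close> is invertible modulo \<open>d\<close>. The multiples of
  \<open>d\<close> on both sides replace the subtraction that a semiring lacks.\<close>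

definition cop where "cop x d \<longleftrightarrow> (\<exists>u v w. u \<otimes> x \<oplus> v \<otimes> d = \<one> \<oplus> w \<otimes> d)"

lemma AD_cop [ad]: 
  assumes F: "FD F" and G: "FD G" shows "AD (\<lambda>e. cop (F e) (G e))"
proof -
  have "AD (\<lambda>e. cop (e 0) (e 1))" unfolding cop_def by (intro ad)
  then show ?thesis using F G by (rule AD_rel2)
qed

lemma cop_mul:
  assumes "cop x d" "cop y d" shows "cop (x \<otimes> y) d"
proof -
  obtain u v w u' v' w' where 1: "u \<otimes> x \<oplus> v \<otimes> d = \<one> \<oplus> w \<otimes> d" "u' \<otimes> y \<oplus> v' \<otimes> d = \<one> \<oplus> w' \<otimes> d"
    using assms unfolding cop_def by blast
  have "(u \<otimes> u') \<otimes> (x \<otimes> y) \<oplus> (u \<otimes> x \<otimes> v' \<oplus> v \<otimes> u' \<otimes> y \<oplus> v \<otimes> v' \<otimes> d) \<otimes> d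
      = (u \<otimes> x \<oplus> v \<otimes> d) \<otimes> (u' \<otimes> y \<oplus> v' \<otimes> d)" by (simp add: ring)
  also have "\<dots> = (\<one> \<oplus> w \<otimes> d) \<otimes> (\<one> \<oplus> w' \<otimes> d)" unfolding 1 ..
  also have "\<dots> = \<one> \<oplus> (w \<oplus> w' \<oplus> w \<otimes> w' \<otimes> d) \<otimes> d" by (simp add: ring)
  finally show ?thesis unfolding cop_def by blast
qed

lemma cop_factor:
  assumes "cop (x \<otimes> y) d" shows "cop x d"
proof -
  obtain u v w where "u \<otimes> (x \<otimes> y) \<oplus> v \<otimes> d = \<one> \<oplus> w \<otimes> d" using assms unfolding cop_def by blast
  then have "(u \<otimes> y) \<otimes> x \<oplus> v \<otimes> d = \<one> \<oplus> w \<otimes> d" by (simp add: ring)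
  then show ?thesis unfolding cop_def by blast
qed

lemma modulus_succ: "modulus b j = (j \<oplus> \<one>) \<otimes> b \<oplus> \<one>"
  by (simp add: modulus_def add_comm)

text \<open>Modulo \<open>d = (j + 1) b + 1\<close> the number \<open>c = (j + 1) b\<close> is -1,
  so \<open>(j + 1) c\<close> is an inverse of \<open>b\<close>: their product is the square of
  \<open>c\<close>.\<close>

lemma cop_base: "cop b (modulus b j)"
proof -
  define c d where "c = (j \<oplus> \<one>) \<otimes> b" and "d = modulus b j"
  have d: "d = c \<oplus> \<one>" by (simp add: c_def d_def modulus_succ)
  have "((j \<oplus> \<one>) \<otimes> c) \<otimes> b = c \<otimes> c" by (simp add: c_def ring)
  moreover have "c \<otimes> c \<oplus> (\<one> \<oplus> \<one>) \<otimes> d = \<one> \<oplus> d \<otimes> d"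
    unfolding d by (simp only: ring)
  ultimately show ?thesis unfolding cop_def d_def[symmetric] by metis
qed

text \<open>The two moduli differ by \<open>k b\<close>, and \<open>k\<close> divides
  \<open>b\<close>, so \<open>k b\<close> is invertible modulo \<open>modulus b j\<close>. The first
  modulus is congruent to \<open>k b\<close> or to its negative; in the latter case the inverse is
  multiplied by \<open>c\<close>, which stands for -1.\<close>

lemma cop_modulus:
  assumes k: "b = k \<otimes> k'" and ij: "j = i \<oplus> k \<or> i = j \<oplus> k"
  shows "cop (modulus b i) (modulus b j)"
proof -
  define m where "m = modulus b j"
  have "cop k m" unfolding m_def by (rule cop_factor[of k k']) (simp add: cop_base k[symmetric])
  then have "cop (k \<otimes> b) m" unfolding m_def using cop_base by (intro cop_mul) auto
  then obtain y v w where y: "y \<otimes> (k \<otimes> b) \<oplus> v \<otimes> m = \<one> \<oplus> w \<otimes> m" unfolding cop_def by blast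
  from ij show ?thesis
  proof
    assume j: "j = i \<oplus> k"
    define c where "c = (j \<oplus> \<one>) \<otimes> b"
    have m: "m = c \<oplus> \<one>" "m = modulus b i \<oplus> k \<otimes> b"
      by (simp_all add: c_def m_def modulus_def j ring)
    have "\<one> \<oplus> (c \<otimes> y \<oplus> c \<otimes> v) \<otimes> m = \<one> \<oplus> (c \<otimes> y \<otimes> (modulus b i \<oplus> k \<otimes> b) \<oplus> c \<otimes> (v \<otimes> m))"
      unfolding m(2)[symmetric] by (simp add: ring)
    also have "\<dots> = \<one> \<oplus> (c \<otimes> y \<otimes> modulus b i \<oplus> c \<otimes> (y \<otimes> (k \<otimes> b) \<oplus> v \<otimes> m))" by (simp add: ring)
    also have "\<dots> = c \<otimes> y \<otimes> modulus b i \<oplus> (c \<oplus> \<one> \<oplus> c \<otimes> w \<otimes> m)" unfolding y by (simp add: ring)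
    also have "\<dots> = (c \<otimes> y) \<otimes> modulus b i \<oplus> (\<one> \<oplus> c \<otimes> w) \<otimes> m"
      unfolding m(1)[symmetric] by (simp add: ring)
    finally show ?thesis unfolding cop_def m_def by metis
  next
    assume i: "i = j \<oplus> k"
    have "modulus b i = m \<oplus> k \<otimes> b" by (simp add: m_def modulus_def i ring)
    then have "y \<otimes> modulus b i \<oplus> v \<otimes> m = y \<otimes> m \<oplus> (y \<otimes> (k \<otimes> b) \<oplus> v \<otimes> m)" by (simp add: ring)
    also have "\<dots> = \<one> \<oplus> (y \<oplus> w) \<otimes> m" unfolding y by (simp add: ring)
    finally show ?thesis unfolding cop_def m_def by metis
  qed
qed

text \<open>A substitute for the factorial, whose definition by recursion would presuppose the
  coding of sequences that is being built here.\<close>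

lemma common_multiple: "\<exists>B. B \<noteq> \<zero> \<and> (\<forall>k. k \<prec> n \<longrightarrow> (\<exists>q. B = (k \<oplus> \<one>) \<otimes> q))"
proof (induction n rule: ind)
  case AD show ?case by (intro ad)
next
  case zero
  show ?case by (intro exI[of _ \<one>]) (simp add: not_less_0)
next
  case (suc n)
  then obtain B where B: "B \<noteq> \<zero>" "\<And>k. k \<prec> n \<Longrightarrow> \<exists>q. B = (k \<oplus> \<one>) \<otimes> q" by blast
  have "\<exists>q. B \<otimes> (n \<oplus> \<one>) = (k \<oplus> \<one>) \<otimes> q" if "k \<prec> n \<oplus> \<one>" for k
    using that B(2)[of k] unfolding less_succ by (metis mul_assoc mul_comm)
  moreover have "B \<otimes> (n \<oplus> \<one>) \<noteq> \<zero>" using B(1) succ_ne mul_eq_0 by blast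
  ultimately show ?case by blast
qed

lemma bounded_image:
  assumes g: "AD (\<lambda>e. e 0 = g (e 1))" shows "\<exists>B. \<forall>i. i \<prec> n \<longrightarrow> g i \<preceq> B"
proof (induction n rule: ind)
  case AD show ?case by (intro ad FD_fun1[OF g])
next
  case (suc n)
  then obtain B where "\<And>i. i \<prec> n \<Longrightarrow> g i \<preceq> B" by blast
  then have "g i \<preceq> B \<oplus> g n" if "i \<prec> n \<oplus> \<one>" for i
    using that le_iff unfolding less_succ by (metis add_assoc add_comm)
  then show ?case by blast
qed (simp add: not_less_0)

text \<open>The Chinese remainder theorem in the model. With \<open>b = B C\<close> the moduli are
  pairwise coprime, as differences of indices divide \<open>B\<close>, and they exceed all values,
  as these are at most \<open>C\<close>. The product of the first \<open>k\<close> moduli enters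
  only as a number \<open>P\<close> divisible by these and coprime to the later ones, so its
  existence is a plain induction.\<close>

theorem beta_exists:
  assumes g: "AD (\<lambda>e. e 0 = g (e 1))"
  shows "\<exists>a b. \<forall>i. i \<prec> n \<longrightarrow> beta a b i = g i"
proof -
  note [ad] = FD_fun1[OF g]
  obtain B where B: "B \<noteq> \<zero>" "\<And>k. k \<prec> n \<Longrightarrow> \<exists>q. B = (k \<oplus> \<one>) \<otimes> q" using common_multiple by blast
  obtain C where C: "\<And>i. i \<prec> n \<Longrightarrow> g i \<preceq> C" using bounded_image[OF g] by blast
  define b where "b = B \<otimes> C"
  let ?d = "modulus b"
  have "C \<preceq> b"
    using B(1) zero_or_succ[of B] unfolding b_def by (metis succ_mul add_comm le_iff)
  then have gb: "g i \<prec> ?d i" if "i \<prec> n" for i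
    using C[OF that] unfolding modulus_def
    by (metis add_comm le_iff less_succ_le num.order_trans succ_mul)
  have dvd: "\<exists>q. b = k \<otimes> q" if k: "k \<prec> n \<oplus> \<one>" "k \<noteq> \<zero>" for k
  proof -
    obtain k' where k': "k = k' \<oplus> \<one>"
      using k(2) zero_or_succ[of k] by blast
    moreover have "k' \<prec> n" using k(1) by (simp add: k')
    ultimately show ?thesis using B(2) unfolding b_def by (metis mul_assoc)
  qed
  have cop: "cop (?d i) (?d j)" if ij: "i \<prec> n" "j \<prec> n" "i \<noteq> j" for i j
  proof -
    obtain k where k: "j = i \<oplus> k \<or> i = j \<oplus> k" using linear[of i j] le_iff by blast
    then have "k \<preceq> i \<or> k \<preceq> j" by (metis add_comm le_iff)
    then have "k \<prec> n \<oplus> \<one>" using ij by (metis less_succ num.le_less_trans)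
    moreover have "k \<noteq> \<zero>" using k ij(3) add_0 by metis
    ultimately obtain k' where "b = k \<otimes> k'" using dvd by blast
    then show ?thesis using k by (rule cop_modulus)
  qed
  have P: "k \<preceq> n \<longrightarrow> (\<exists>P. (\<forall>i. i \<prec> k \<longrightarrow> (\<exists>q. P = q \<otimes> ?d i)) \<and> (\<forall>j. k \<preceq> j \<and> j \<prec> n \<longrightarrow> cop P (?d j)))" for k
  proof (induction k rule: ind)
    case AD show ?case by (intro ad)
  next
    case zero
    have "cop \<one> (?d j)" for j unfolding cop_def by (metis mul_one)
    then show ?case using not_less_0 by blast
  next
    case (suc k)
    show ?case
    proof
      assume "k \<oplus> \<one> \<preceq> n"
      then have kn: "k \<prec> n" by (simp add: succ_le)
      then obtain P where P: "\<And>i. i \<prec> k \<Longrightarrow> \<exists>q. P = q \<otimes> ?d i" "\<And>j. k \<preceq> j \<Longrightarrow> j \<prec> n \<Longrightarrow> cop P (?d j)"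
        using suc leM_def by blast
      have "\<exists>q. P \<otimes> ?d k = q \<otimes> ?d i" if "i \<prec> k \<oplus> \<one>" for i
        using that P(1)[of i] unfolding less_succ by (metis mul_assoc mul_comm)
      moreover have "cop (P \<otimes> ?d k) (?d j)" if "k \<oplus> \<one> \<preceq> j" "j \<prec> n" for j
        using that P(2)[of j] cop[OF kn that(2)] unfolding succ_le
        by (intro cop_mul) (auto simp: leM_def less_irrefl)
      ultimately show "\<exists>P. (\<forall>i. i \<prec> k \<oplus> \<one> \<longrightarrow> (\<exists>q. P = q \<otimes> ?d i)) \<and> (\<forall>j. k \<oplus> \<one> \<preceq> j \<and> j \<prec> n \<longrightarrow> cop P (?d j))"
        by blast
    qed
  qed
  have "k \<preceq> n \<longrightarrow> (\<exists>a. \<forall>i. i \<prec> k \<longrightarrow> beta a b i = g i)" for k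
  proof (induction k rule: ind)
    case AD show ?case by (intro ad)
  next
    case zero
    then show ?case using not_less_0 by blast
  next
    case (suc k)
    show ?case
    proof
      assume "k \<oplus> \<one> \<preceq> n"
      then have "k \<prec> n" by (simp only: succ_le)
      then have kn: "k \<prec> n" "k \<preceq> n" unfolding leM_def by blast+
      then obtain a where a: "\<And>i. i \<prec> k \<Longrightarrow> beta a b i = g i" using suc by blast
      obtain P where P: "\<And>i. i \<prec> k \<Longrightarrow> \<exists>q. P = q \<otimes> ?d i" "cop P (?d k)"
        using P[of k] kn by (auto simp: leM_def)
      define d c r where "d = ?d k" and "c = (k \<oplus> \<one>) \<otimes> b" and "r = g k"
      obtain u v w where u: "u \<otimes> P \<oplus> v \<otimes> d = \<one> \<oplus> w \<otimes> d" using P(2) unfolding cop_def d_def by blast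
      have d: "d = c \<oplus> \<one>" by (simp add: d_def c_def modulus_succ)
      \<comment> \<open>The aim is to make \<open>a + P t\<close> congruent to \<open>r\<close>
        modulo \<open>d\<close>. As \<open>u\<close> inverts \<open>P\<close> and \<open>c\<close>
        is -1 modulo \<open>d\<close>, this \<open>t\<close> is \<open>u (r - a)\<close> written
        without subtraction.\<close>
      define t where "t = u \<otimes> (r \<oplus> a \<otimes> c)"
      have "(a \<oplus> P \<otimes> t) \<oplus> v \<otimes> (r \<oplus> a \<otimes> c) \<otimes> d = a \<oplus> (u \<otimes> P \<oplus> v \<otimes> d) \<otimes> (r \<oplus> a \<otimes> c)"
        unfolding t_def by (simp add: ring)
      also have "\<dots> = (r \<oplus> a \<otimes> (c \<oplus> \<one>)) \<oplus> w \<otimes> (r \<oplus> a \<otimes> c) \<otimes> d" unfolding u by (simp add: ring)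
      also have "\<dots> = (a \<oplus> w \<otimes> (r \<oplus> a \<otimes> c)) \<otimes> d \<oplus> r" unfolding d[symmetric] by (simp add: ring)
      finally have eq: "(a \<oplus> P \<otimes> t) \<oplus> v \<otimes> (r \<oplus> a \<otimes> c) \<otimes> d = (a \<oplus> w \<otimes> (r \<oplus> a \<otimes> c)) \<otimes> d \<oplus> r" .
      have "beta (a \<oplus> P \<otimes> t) b k = r"
      proof -
        obtain q where q: "a \<oplus> P \<otimes> t = q \<otimes> d \<oplus> beta (a \<oplus> P \<otimes> t) b k" and lt: "beta (a \<oplus> P \<otimes> t) b k \<prec> d"
          using beta_iff unfolding d_def by blast
        have "(q \<oplus> v \<otimes> (r \<oplus> a \<otimes> c)) \<otimes> d \<oplus> beta (a \<oplus> P \<otimes> t) b k = (a \<oplus> P \<otimes> t) \<oplus> v \<otimes> (r \<oplus> a \<otimes> c) \<otimes> d"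
          by (subst (2) q) (simp add: ring)
        then show ?thesis
          unfolding eq by (rule div_unique) (use lt gb[OF kn(1)] in \<open>simp_all add: d_def r_def\<close>)
      qed
      moreover have "beta (a \<oplus> P \<otimes> t) b i = g i" if i: "i \<prec> k" for i
      proof -
        obtain q where q: "P = q \<otimes> ?d i" using P(1)[OF i] by blast
        obtain q' where q': "a = q' \<otimes> ?d i \<oplus> g i" "g i \<prec> ?d i" using a[OF i] beta_iff by metis
        have "a \<oplus> P \<otimes> t = (q' \<oplus> q \<otimes> t) \<otimes> ?d i \<oplus> g i" unfolding q q'(1) by (simp add: ring)
        then show ?thesis using q'(2) beta_iff by metis
      qed
      ultimately show "\<exists>a. \<forall>i. i \<prec> k \<oplus> \<one> \<longrightarrow> beta a b i = g i"
        unfolding less_succ r_def by blast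
    qed
  qed
  from this[of n] show ?thesis by (auto simp: leM_def)
qed

corollary beta_append:
  "\<exists>a' b'. (\<forall>i. i \<prec> n \<longrightarrow> beta a' b' i = beta a b i) \<and> beta a' b' n = v"
proof -
  have "AD (\<lambda>e. e 0 = (if e 1 \<prec> n then beta a b (e 1) else v))" by (intro ad)
  from beta_exists[OF this, of "n \<oplus> \<one>"] show ?thesis
    unfolding less_succ using less_irrefl by metis
qed

section \<open>Pairing in the model\<close>

definition pr where "pr x y = (x \<oplus> y) \<otimes> (x \<oplus> y) \<oplus> x"

lemma FD_pr [ad]: "FD F \<Longrightarrow> FD G \<Longrightarrow> FD (\<lambda>e. pr (F e) (G e))"
  unfolding pr_def by (intro ad)

lemma pr_less:
  assumes "x \<oplus> y \<prec> x' \<oplus> y'" shows "pr x y \<prec> pr x' y'"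
proof -
  let ?w = "x \<oplus> y" and ?w' = "x' \<oplus> y'"
  have "pr x y \<preceq> ?w \<otimes> ?w \<oplus> ?w" unfolding pr_def le_iff by (metis add_assoc)
  also have "\<dots> \<prec> (?w \<oplus> \<one>) \<otimes> (?w \<oplus> \<one>)" unfolding less_iff by (rule exI[of _ ?w]) (simp add: ring)
  also have "\<dots> \<preceq> ?w' \<otimes> ?w'" using assms by (intro num.mult_mono) (simp_all add: succ_le)
  also have "\<dots> \<preceq> pr x' y'" unfolding pr_def le_iff by blast
  finally show ?thesis .
qed

lemma pr_inj: "pr x y = pr x' y' \<longleftrightarrow> x = x' \<and> y = y'"
proof
  assume eq: "pr x y = pr x' y'"
  then have "x \<oplus> y = x' \<oplus> y'" using pr_less by (metis num.less_linear num.less_irrefl)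
  then show "x = x' \<and> y = y'" using eq unfolding pr_def by (metis num.add_left_cancel)
qed auto

lemma pr_ge: "x \<preceq> pr x y" "y \<preceq> pr x y"
proof -
  show "x \<preceq> pr x y" unfolding pr_def le_iff by (metis add_comm)
  have "y \<preceq> (x \<oplus> y) \<otimes> (x \<oplus> y)"
  proof (cases "x \<oplus> y = \<zero>")
    case True then show ?thesis by (simp add: add_eq_0)
  next
    case False
    then obtain w where "x \<oplus> y = w \<oplus> \<one>" using zero_or_succ by blast
    then have "(x \<oplus> y) \<otimes> (x \<oplus> y) = y \<oplus> (x \<oplus> w \<otimes> (x \<oplus> y))" by (metis succ_mul add_comm add_assoc)
    then show ?thesis using le_iff by blast
  qed
  then show "y \<preceq> pr x y" unfolding pr_def by (metis le_iff add_assoc)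
qed

lemma ev_qpair [simp]: "ev M e (qpair s t) = pr (ev M e s) (ev M e t)"
  by (simp add: qpair_def pr_def)

end

section \<open>Programs and bounded formulas in models\<close>

definition app :: "'b list \<Rightarrow> (nat \<Rightarrow> 'b) \<Rightarrow> nat \<Rightarrow> 'b" where
  "app zs e i = (if i < length zs then zs ! i else e (i - length zs))"

lemma app_Nil [simp]: "app [] e = e"
  by (simp add: app_def fun_eq_iff)

lemma app_snoc: "app (zs @ [n]) e = app zs (case_nat n e)"
  by (auto simp: app_def fun_eq_iff nth_append diff_Suc split: nat.splits)

lemma app_Cons: "app (n # zs) e = case_nat n (app zs e)"
  by (auto simp: app_def fun_eq_iff split: nat.splits)

lemma sats_Ex0_power:
  "sats M e E ((Ex0 ^^ l) p) \<longleftrightarrow> (\<exists>zs. length zs = l \<and> sats M (app zs e) E p)"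
proof (induction l arbitrary: e)
  case (Suc l)
  have "sats M e E ((Ex0 ^^ Suc l) p) \<longleftrightarrow> (\<exists>n zs. length zs = l \<and> sats M (app (zs @ [n]) e) E p)"
    by (simp add: Suc app_snoc)
  also have "\<dots> \<longleftrightarrow> (\<exists>zs. length zs = Suc l \<and> sats M (app zs e) E p)"
    by (metis length_append_singleton length_Suc_conv_rev)
  finally show ?case .
qed simp

lemma ev_up_app: "length zs = k \<Longrightarrow> ev M (app zs e) (up k t) = ev M e t"
proof -
  have up: "up k t = tsub (\<lambda>i. Var (i + k)) t"
    by (induction k) (simp_all add: up_def lift_tm_tsub tsub_tsub)
  assume "length zs = k"
  then show ?thesis unfolding up ev_tsub by (simp add: app_def)
qed

lemma ev_up [simp]:
  "ev M (case_nat x e) (up (Suc 0) t) = ev M e t"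
  "ev M (case_nat x e) (up 1 t) = ev M e t"
  "ev M (case_nat x (case_nat y e)) (up 2 t) = ev M e t"
  "ev M (case_nat x (case_nat y (case_nat z e))) (up 3 t) = ev M e t"
  "ev M (case_nat x (case_nat y (case_nat z (case_nat u (case_nat v e))))) (up 5 t) = ev M e t"
  by (simp_all add: up_def numeral_eq_Suc)

lemma arithmetical_connectives [simp]:
  "arithmetical (Conj p q) = (arithmetical p \<and> arithmetical q)"
  "arithmetical (Disj p q) = (arithmetical p \<and> arithmetical q)"
  "arithmetical (Iff p q) = (arithmetical p \<and> arithmetical q)"
  "arithmetical (Ex0 p) = arithmetical p"
  "arithmetical Top" "arithmetical Bot"
  "arithmetical (conjs ps) = (\<forall>p\<in>set ps. arithmetical p)"
  "arithmetical (disjs ps) = (\<forall>p\<in>set ps. arithmetical p)"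
  "arithmetical ((Ex0 ^^ l) p) = arithmetical p"
  "arithmetical (beta_fm a b i v)"
proof -
  show *: "arithmetical (Conj p q) = (arithmetical p \<and> arithmetical q)"
    "arithmetical (Disj p q) = (arithmetical p \<and> arithmetical q)"
    "arithmetical (Iff p q) = (arithmetical p \<and> arithmetical q)"
    "arithmetical (Ex0 p) = arithmetical p"
    "arithmetical Top" "arithmetical Bot" for p q
    by (auto simp: Conj_def Disj_def Iff_def Ex0_def Top_def Bot_def)
  show "arithmetical (conjs ps) = (\<forall>p\<in>set ps. arithmetical p)"
    "arithmetical (disjs ps) = (\<forall>p\<in>set ps. arithmetical p)"
    by (induction ps) (auto simp: conjs_def disjs_def *)
  show "arithmetical ((Ex0 ^^ l) p) = arithmetical p"
    by (induction l) (auto simp: *)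
  show "arithmetical (beta_fm a b i v)" by (simp add: beta_fm_def Let_def *)
qed

lemma arithmetical_graph_fm [simp]: "arithmetical (graph_fm f ts v)"
proof (induction f arbitrary: ts v)
  case SuccF
  then show ?case by (auto split: list.splits)
next
  case (Comp f gs)
  then show ?case by (auto simp: Let_def set_zip)
next
  case (PrimRec f g)
  then show ?case by (auto split: list.splits)
qed auto

context aca
begin

text \<open>The relation that \<open>graph_fm\<close> expresses in the model. A recursion is
  certified by one beta-coded sequence, whose length may be nonstandard.\<close>

primrec gr :: "recf \<Rightarrow> 'a list \<Rightarrow> 'a \<Rightarrow> bool" where
  "gr ZeroF ts v \<longleftrightarrow> v = \<zero>"
| "gr SuccF ts v \<longleftrightarrow> (\<exists>t. ts = [t] \<and> v = t \<oplus> \<one>)"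
| "gr (Proj i) ts v \<longleftrightarrow> i < length ts \<and> v = ts ! i"
| "gr (Comp f gs) ts v \<longleftrightarrow> (\<exists>zs. list_all2 (\<lambda>G z. G ts z) (map gr gs) zs \<and> gr f zs v)"
| "gr (PrimRec f g) ts v \<longleftrightarrow> (\<exists>t us. ts = t # us \<and> (\<exists>a b. v = beta a b t \<and> gr f us (beta a b \<zero>) \<and>
     (\<forall>i. i \<prec> t \<longrightarrow> gr g (i # beta a b i # us) (beta a b (i \<oplus> \<one>)))))"
| "gr (Mu f) ts v \<longleftrightarrow> gr f (v # ts) \<zero> \<and> (\<forall>i. i \<prec> v \<longrightarrow> (\<exists>l. \<zero> \<prec> l \<and> gr f (i # ts) l))"

theorem sats_graph_fm [simp]:
  "sats M e E (graph_fm f ts v) \<longleftrightarrow> gr f (map (ev M e) ts) (ev M e v)"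
proof (induction f arbitrary: ts v e)
  case SuccF
  then show ?case by (auto split: list.splits)
next
  case (Comp f gs)
  define l where "l = length gs"
  have "sats M e E (graph_fm (Comp f gs) ts v) \<longleftrightarrow> (\<exists>zs. length zs = l \<and>
     (\<forall>i<l. gr (gs ! i) (map (ev M e) ts) (zs ! i)) \<and> gr f zs (ev M e v))"
    unfolding graph_fm.simps Let_def l_def[symmetric] sats_Ex0_power
  proof (intro ex_cong1 conj_cong refl, unfold sats_connectives, intro conj_cong)
    fix zs :: "'a list" assume l: "length zs = l"
    have up: "map (ev M (app zs e)) (map (up l) ts) = map (ev M e) ts"
      using ev_up_app[OF l] by simp
    have z: "ev M (app zs e) (Var i) = zs ! i" if "i < l" for i using that l by (simp add: app_def)
    have IH: "sats M (app zs e) E (graph_fm (gs ! i) (map (up l) ts) (Var i)) \<longleftrightarrow> gr (gs ! i) (map (ev M e) ts) (zs ! i)"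
      if "i < l" for i
      using Comp.IH(2)[of "gs ! i" "app zs e" "map (up l) ts" "Var i"] that unfolding up z[OF that]
      by (simp add: l_def)
    have "sats M (app zs e) E (conjs (map2 (\<lambda>G. G (map (up l) ts)) (map graph_fm gs) (map Var [0..<l])))
      \<longleftrightarrow> (\<forall>i<l. sats M (app zs e) E (graph_fm (gs ! i) (map (up l) ts) (Var i)))"
      unfolding sats_conjs all_set_conv_all_nth by (simp add: l_def)
    then show "sats M (app zs e) E (conjs (map2 (\<lambda>G. G (map (up l) ts)) (map graph_fm gs) (map Var [0..<l])))
      \<longleftrightarrow> (\<forall>i<l. gr (gs ! i) (map (ev M e) ts) (zs ! i))" using IH by auto
    have "map (ev M (app zs e)) (map Var [0..<l]) = zs"
      using l by (auto simp: list_eq_iff_nth_eq app_def)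
    then show "sats M (app zs e) E (graph_fm f (map Var [0..<l]) (up l v)) \<longleftrightarrow> gr f zs (ev M e v)"
      using Comp.IH(1) ev_up_app[OF l] by metis
  qed
  also have "\<dots> \<longleftrightarrow> gr (Comp f gs) (map (ev M e) ts) (ev M e v)"
    by (auto simp: list_all2_conv_all_nth l_def) metis
  finally show ?case .
next
  case (PrimRec f g)
  show ?case
  proof (cases ts)
    case (Cons t us)
    then show ?thesis
      by (simp add: PrimRec.IH o_def)
  qed simp
next
  case (Mu f)
  then show ?case by (simp add: o_def)
qed auto

text \<open>The arguments are replaced by variables one after another, each at the price of one
  quantifier; \<open>is\<close> lists the variables introduced so far.\<close>

lemma AD_list:
  assumes R: "\<And>is. length is = n \<Longrightarrow> AD (\<lambda>e. R (map e is))"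
    and Fs: "\<forall>F\<in>set Fs. FD F" and len: "length Fs = n"
  shows "AD (\<lambda>e. R (map (\<lambda>F. F e) Fs))"
proof -
  have "AD (\<lambda>e. R (map e is @ map (\<lambda>F. F e) Fs))"
    if "length is + length Fs = n" "\<forall>F\<in>set Fs. FD F" "length Fs = m" for "is" Fs m
    using that
  proof (induction m arbitrary: "is" Fs)
    case 0
    then show ?case using R by simp
  next
    case (Suc m)
    then obtain F Gs where Fs: "Fs = F # Gs" by (cases Fs) auto
    let ?Gs = "map (\<lambda>F e. F (\<lambda>i. e (Suc i))) Gs"
    have "AD (\<lambda>e. R (map e (map Suc is @ [0]) @ map (\<lambda>F. F e) ?Gs))"
      using Suc.prems by (intro Suc.IH) (auto simp: Fs intro: FD_ren)
    moreover have "AD (\<lambda>e. e 0 = F (\<lambda>i. e (Suc i)))" using Suc.prems(2) by (simp add: Fs FD_def)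
    ultimately have "AD (\<lambda>e. \<exists>y. y = F e \<and> R (map e is @ y # map (\<lambda>F. F e) Gs))"
      by (intro AD_ex AD_conj) (simp_all add: o_def)
    then show ?case by (simp add: Fs)
  qed
  from this[of "[]"] show ?thesis using Fs len by simp
qed

lemma AD_gr_list:
  assumes "\<forall>F\<in>set Fs. FD F" and "FD G"
  shows "AD (\<lambda>e. gr f (map (\<lambda>F. F e) Fs) (G e))"
proof -
  have "AD (\<lambda>e. gr f (tl (map e is)) (hd (map e is)))" if len: "length is = Suc (length Fs)" for "is"
  proof -
    obtain j js where "is": "is = j # js" using len by (cases "is") auto
    show ?thesis by (rule AD_atom[of "graph_fm f (map Var js) (Var j)"]) (simp_all add: "is" o_def)
  qed
  from AD_list[OF this, where Fs = "G # Fs"] assms show ?thesis by simp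
qed

lemma AD_gr [ad]:
  "FD F \<Longrightarrow> FD G \<Longrightarrow> AD (\<lambda>e. gr f (F e # ts) (G e))"
  "FD F \<Longrightarrow> FD H \<Longrightarrow> FD G \<Longrightarrow> AD (\<lambda>e. gr f (F e # H e # ts) (G e))"
  using AD_gr_list[of "F # map (\<lambda>t e. t) ts" G f] AD_gr_list[of "F # H # map (\<lambda>t e. t) ts" G f]
  by (auto simp: o_def FD_const)

text \<open>Two certificates of the same recursion are compared by induction inside the model, the
  number of steps being possibly nonstandard.\<close>

lemma gr_det: "gr f ts v \<Longrightarrow> gr f ts w \<Longrightarrow> v = w"
proof (induction f arbitrary: ts v w)
  case (Comp f gs)
  then obtain zs ws where z: "list_all2 (\<lambda>g. gr g ts) gs zs" "gr f zs v" "list_all2 (\<lambda>g. gr g ts) gs ws" "gr f ws w"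
    by (auto simp: list.rel_map)
  have "zs ! i = ws ! i" if "i < length gs" for i
    using that z(1,3) Comp.IH(2)[of "gs ! i" ts "zs ! i" "ws ! i"] by (simp add: list_all2_conv_all_nth)
  then have "zs = ws"
    using z(1,3) by (intro nth_equalityI) (auto simp: list_all2_conv_all_nth)
  then show ?case using z Comp.IH(1) by blast
next
  case (PrimRec f g)
  then obtain t us a b a' b' where ts: "ts = t # us"
    and v: "v = beta a b t" "gr f us (beta a b \<zero>)"
      "\<And>i. i \<prec> t \<Longrightarrow> gr g (i # beta a b i # us) (beta a b (i \<oplus> \<one>))"
    and w: "w = beta a' b' t" "gr f us (beta a' b' \<zero>)"
      "\<And>i. i \<prec> t \<Longrightarrow> gr g (i # beta a' b' i # us) (beta a' b' (i \<oplus> \<one>))"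
    by fastforce
  have "i \<preceq> t \<longrightarrow> beta a b i = beta a' b' i" for i
  proof (induction i rule: ind)
    case AD show ?case by (intro ad)
  next
    case zero show ?case using PrimRec.IH(1)[OF v(2) w(2)] by simp
  next
    case (suc i)
    show ?case
    proof
      assume "i \<oplus> \<one> \<preceq> t"
      then have i: "i \<prec> t" by (simp only: succ_le)
      with suc have "beta a b i = beta a' b' i" by (simp add: leM_def)
      then show "beta a b (i \<oplus> \<one>) = beta a' b' (i \<oplus> \<one>)"
        using PrimRec.IH(2)[OF v(3)[OF i]] w(3)[OF i] by simp
    qed
  qed
  then show ?case using v(1) w(1) by (simp add: leM_def)
next
  case (Mu f)
  have "\<not> v' \<prec> w'" if vw: "gr (Mu f) ts v'" "gr (Mu f) ts w'" for v' w'
  proof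
    assume "v' \<prec> w'"
    then obtain l where "\<zero> \<prec> l" "gr f (v' # ts) l" using vw(2) by auto
    moreover have "gr f (v' # ts) \<zero>" using vw(1) by simp
    ultimately show False using Mu.IH less_irrefl by metis
  qed
  then show ?case using Mu.prems num.less_linear by blast
qed auto

section \<open>Programs for total functions\<close>

definition rep :: "recf \<Rightarrow> nat \<Rightarrow> ('a list \<Rightarrow> 'a) \<Rightarrow> bool" where
  "rep f k F \<longleftrightarrow> (\<forall>ts v. length ts = k \<longrightarrow> (gr f ts v \<longleftrightarrow> v = F ts))"

lemma repI: "(\<And>ts. length ts = k \<Longrightarrow> gr f ts (F ts)) \<Longrightarrow> rep f k F"
  unfolding rep_def using gr_det by blast

lemma rep_Comp1: "rep f 1 F \<Longrightarrow> rep g k G \<Longrightarrow> rep (Comp f [g]) k (\<lambda>ts. F [G ts])"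
  by (auto simp: rep_def list_all2_Cons1)

lemma rep_Comp2:
  "rep f 2 F \<Longrightarrow> rep g k G \<Longrightarrow> rep h k H \<Longrightarrow> rep (Comp f [g, h]) k (\<lambda>ts. F [G ts, H ts])"
  by (auto simp: rep_def list_all2_Cons1)

text \<open>Totality is an induction in the model on the recursion argument; each step extends the
  certifying sequence by one entry with \<open>beta_append\<close>.\<close>

lemma rep_PrimRec:
  assumes f: "rep f k F" and g: "rep g (Suc (Suc k)) G"
  obtains H where "rep (PrimRec f g) (Suc k) H" "\<And>ts. length ts = k \<Longrightarrow> H (\<zero> # ts) = F ts"
    "\<And>i ts. length ts = k \<Longrightarrow> H ((i \<oplus> \<one>) # ts) = G (i # H (i # ts) # ts)"
proof -
  let ?P = "PrimRec f g"
  have 0: "gr ?P (\<zero> # ts) (F ts)" if ts: "length ts = k" for ts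
  proof -
    obtain a b where ab: "F ts = beta a b \<zero>" using beta_append by metis
    moreover have "gr f ts (beta a b \<zero>)" using f ts by (simp add: rep_def ab)
    ultimately show ?thesis by (auto simp: not_less_0)
  qed
  have step: "gr ?P ((i \<oplus> \<one>) # ts) (G (i # v # ts))" if ts: "length ts = k" and v: "gr ?P (i # ts) v" for i ts v
  proof -
    obtain a b where v: "v = beta a b i" "gr f ts (beta a b \<zero>)"
      "\<And>j. j \<prec> i \<Longrightarrow> gr g (j # beta a b j # ts) (beta a b (j \<oplus> \<one>))"
      using v by auto
    obtain a' b' where a': "\<And>j. j \<prec> i \<oplus> \<one> \<Longrightarrow> beta a' b' j = beta a b j" "beta a' b' (i \<oplus> \<one>) = G (i # v # ts)"
      using beta_append by metis
    have "gr g (j # beta a' b' j # ts) (beta a' b' (j \<oplus> \<one>))" if "j \<prec> i \<oplus> \<one>" for j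
    proof (cases "j = i")
      case True
      then show ?thesis using a' v(1) g ts by (simp add: rep_def less_succ)
    next
      case False
      then have j: "j \<prec> i" using that by (simp add: less_succ)
      then have "j \<oplus> \<one> \<prec> i \<oplus> \<one>" by simp
      then show ?thesis using a'(1)[OF that] a'(1)[of "j \<oplus> \<one>"] v(3)[OF j] by simp
    qed
    moreover have "beta a' b' \<zero> = beta a b \<zero>" by (rule a') (simp add: less_succ_le)
    ultimately have "G (i # v # ts) = beta a' b' (i \<oplus> \<one>) \<and> gr f ts (beta a' b' \<zero>) \<and>
        (\<forall>j. j \<prec> i \<oplus> \<one> \<longrightarrow> gr g (j # beta a' b' j # ts) (beta a' b' (j \<oplus> \<one>)))"
      using v(2) a'(2) by simp
    then show ?thesis by auto
  qed
  define H where "H ts = (THE v. gr ?P ts v)" for ts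
  have ex: "\<exists>v. gr ?P (t # ts) v" if ts: "length ts = k" for t ts
  proof (induction t rule: ind)
    case AD show ?case by (intro ad)
  next
    case zero show ?case using 0[OF ts] by (rule exI)
  next
    case (suc n)
    then obtain v where "gr ?P (n # ts) v" by blast
    from step[OF ts this] show ?case by (rule exI)
  qed
  have H: "gr ?P (t # ts) (H (t # ts))" if "length ts = k" for t ts
    using ex[OF that, of t] gr_det[of ?P] unfolding H_def by (metis theI)
  show ?thesis
  proof (rule that)
    show "rep ?P (Suc k) H" using H by (intro repI) (auto simp: length_Suc_conv simp del: gr.simps)
  qed (use gr_det[OF H] 0 step H in blast)+
qed

lemma rep_PrimRec0:
  assumes "rep f 0 F" and "rep g (Suc (Suc 0)) G"
  shows "\<exists>H. rep (PrimRec f g) 1 H \<and> H [\<zero>] = F [] \<and> (\<forall>i. H [i \<oplus> \<one>] = G [i, H [i]])"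
  by (rule rep_PrimRec[OF assms]) (metis One_nat_def list.size(3))

lemma rep_PrimRec1:
  assumes "rep f (Suc 0) F" and "rep g (Suc (Suc (Suc 0))) G"
  shows "\<exists>H. rep (PrimRec f g) 2 H \<and> (\<forall>y. H [\<zero>, y] = F [y]) \<and> (\<forall>i y. H [i \<oplus> \<one>, y] = G [i, H [i, y], y])"
proof (rule rep_PrimRec[OF assms])
  fix H assume "rep (PrimRec f g) (Suc (Suc 0)) H" "\<And>ts. length ts = Suc 0 \<Longrightarrow> H (\<zero> # ts) = F ts"
    "\<And>i ts. length ts = Suc 0 \<Longrightarrow> H ((i \<oplus> \<one>) # ts) = G (i # H (i # ts) # ts)"
  then show ?thesis by (intro exI[of _ H]) (simp add: numeral_2_eq_2)
qed

lemma rep_Mu: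
  assumes f: "rep f (Suc k) F" and ex: "\<And>ts. length ts = k \<Longrightarrow> \<exists>y. F (y # ts) = \<zero>"
  shows "\<exists>m. rep (Mu f) k m \<and> (\<forall>ts. length ts = k \<longrightarrow>
    F (m ts # ts) = \<zero> \<and> (\<forall>i. i \<prec> m ts \<longrightarrow> F (i # ts) \<noteq> \<zero>))"
proof -
  have "\<exists>y. F (y # ts) = \<zero> \<and> (\<forall>i. i \<prec> y \<longrightarrow> F (i # ts) \<noteq> \<zero>)" if ts: "length ts = k" for ts
  proof -
    obtain x where "F (x # ts) = \<zero>" using ex[OF ts] by blast
    then have x: "gr f (x # ts) \<zero>" using f ts by (simp add: rep_def)
    have "AD (\<lambda>e. gr f (e 0 # ts) \<zero>)" by (intro ad)
    from least[of "\<lambda>x. gr f (x # ts) \<zero>", OF this x]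
    obtain y where "gr f (y # ts) \<zero>" "\<And>z. z \<prec> y \<Longrightarrow> \<not> gr f (z # ts) \<zero>" by blast
    then show ?thesis using f ts unfolding rep_def by (metis length_Cons)
  qed
  then obtain m where m: "\<And>ts. length ts = k \<Longrightarrow> F (m ts # ts) = \<zero>"
    "\<And>ts i. length ts = k \<Longrightarrow> i \<prec> m ts \<Longrightarrow> F (i # ts) \<noteq> \<zero>" by metis
  have "rep (Mu f) k m"
    using f m by (intro repI) (auto simp: rep_def pos_iff)
  then show ?thesis using m by blast
qed

end

definition "onef = Comp SuccF [ZeroF]"
definition "addf = PrimRec (Proj 0) (Comp SuccF [Proj 1])"
definition "mulf = PrimRec ZeroF (Comp addf [Proj 1, Proj 2])"
definition "predf = PrimRec ZeroF (Proj 0)"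
text \<open>The recursion is on the first argument, so the program subtracts its first argument from
  its second; \<open>lessf\<close> relies on this order.\<close>

definition "monusf = PrimRec (Proj 0) (Comp predf [Proj 1])"
definition "zerof = PrimRec onef ZeroF"
definition "lessf = Comp zerof [Comp zerof [monusf]]"

context aca
begin

abbreviation bool01 :: "bool \<Rightarrow> 'a" where "bool01 b \<equiv> (if b then \<one> else \<zero>)"

lemma rep_ZeroF: "rep ZeroF k (\<lambda>ts. \<zero>)" by (simp add: rep_def)
lemma rep_Proj: "i < k \<Longrightarrow> rep (Proj i) k (\<lambda>ts. ts ! i)" by (simp add: rep_def)
lemma rep_SuccF: "rep SuccF 1 (\<lambda>ts. ts ! 0 \<oplus> \<one>)"
  by (auto simp: rep_def length_Suc_conv)
lemma rep_onef: "rep onef k (\<lambda>ts. \<one>)"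
  using rep_Comp1[OF rep_SuccF rep_ZeroF] by (simp add: onef_def zero_add)

lemma rep_cong: "rep f k F \<Longrightarrow> (\<And>ts. length ts = k \<Longrightarrow> F ts = G ts) \<Longrightarrow> rep f k G"
  by (auto simp: rep_def)

lemma length_1_2: "length ts = Suc 0 \<longleftrightarrow> (\<exists>x. ts = [x])" "length ts = 2 \<longleftrightarrow> (\<exists>x y. ts = [x, y])"
  by (auto simp: length_Suc_conv numeral_2_eq_2)

lemma rep_addf: "rep addf 2 (\<lambda>ts. ts ! 0 \<oplus> ts ! 1)"
proof -
  obtain H where H: "rep addf 2 H" "\<And>y. H [\<zero>, y] = y" "\<And>i y. H [i \<oplus> \<one>, y] = H [i, y] \<oplus> \<one>"
    using rep_PrimRec1[OF rep_Proj[of 0 "Suc 0"] rep_Comp1[OF rep_SuccF rep_Proj[of 1 "Suc (Suc (Suc 0))"]]]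
    unfolding addf_def by auto
  have gr: "gr addf [x, y] (H [x, y])" for x y using H(1) by (simp add: rep_def)
  have "gr addf [x, y] (x \<oplus> y)" for x y
  proof (induction x rule: ind)
    case AD show ?case by (intro ad)
  next
    case zero show ?case using gr[of \<zero> y] H(2) by (simp add: zero_add)
  next
    case (suc n)
    then have "H [n, y] = n \<oplus> y" using gr gr_det by blast
    then show ?case using gr[of "n \<oplus> \<one>" y] H(3) by (simp add: succ_add)
  qed
  then show ?thesis by (intro repI) (auto simp: length_1_2)
qed

lemma rep_mulf: "rep mulf 2 (\<lambda>ts. ts ! 0 \<otimes> ts ! 1)"
proof -
  obtain H where H: "rep mulf 2 H" "\<And>y. H [\<zero>, y] = \<zero>" "\<And>i y. H [i \<oplus> \<one>, y] = H [i, y] \<oplus> y"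
    using rep_PrimRec1[OF rep_ZeroF[of "Suc 0"] rep_Comp2[OF rep_addf rep_Proj[of 1 "Suc (Suc (Suc 0))"] rep_Proj[of 2 "Suc (Suc (Suc 0))"]]]
    unfolding mulf_def by auto
  have gr: "gr mulf [x, y] (H [x, y])" for x y using H(1) by (simp add: rep_def)
  have "gr mulf [x, y] (x \<otimes> y)" for x y
  proof (induction x rule: ind)
    case AD show ?case by (intro ad)
  next
    case zero show ?case using gr[of \<zero> y] H(2) by (simp add: zero_mul)
  next
    case (suc n)
    then have "H [n, y] = n \<otimes> y" using gr gr_det by blast
    then show ?case using gr[of "n \<oplus> \<one>" y] H(3) by (simp add: succ_mul)
  qed
  then show ?thesis by (intro repI) (auto simp: length_1_2)
qed

lemma rep_predf: "rep predf 1 (\<lambda>ts. ts ! 0 \<ominus> \<one>)"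
proof -
  obtain H where H: "rep predf 1 H" "H [\<zero>] = \<zero>" "\<And>i. H [i \<oplus> \<one>] = i"
    using rep_PrimRec0[OF rep_ZeroF[of 0] rep_Proj[of 0 "Suc (Suc 0)"]]
    unfolding predf_def by auto
  have "H [x] = x \<ominus> \<one>" for x
    using zero_or_succ[of x] H by (auto simp: zero_monus)
  then show ?thesis by (intro rep_cong[OF H(1)]) (auto simp: length_1_2)
qed

lemma rep_zerof: "rep zerof 1 (\<lambda>ts. bool01 (ts ! 0 = \<zero>))"
proof -
  obtain H where H: "rep zerof 1 H" "H [\<zero>] = \<one>" "\<And>i. H [i \<oplus> \<one>] = \<zero>"
    using rep_PrimRec0[OF rep_onef[of 0] rep_ZeroF[of "Suc (Suc 0)"]]
    unfolding zerof_def by auto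
  have "H [x] = bool01 (x = \<zero>)" for x
    using zero_or_succ[of x] H succ_ne by auto
  then show ?thesis by (intro rep_cong[OF H(1)]) (auto simp: length_1_2)
qed

lemma monus_iff: "z = y \<ominus> x \<longleftrightarrow> y = x \<oplus> z \<or> (\<not> x \<preceq> y \<and> z = \<zero>)"
proof (cases "x \<preceq> y")
  case True
  then obtain u where "y = x \<oplus> u" unfolding le_iff by blast
  then show ?thesis using True monus_eq by auto
next
  case False
  then show ?thesis using monus_0[OF False] le_iff by metis
qed

lemma rep_monusf: "rep monusf 2 (\<lambda>ts. ts ! 1 \<ominus> ts ! 0)"
proof -
  obtain H where H: "rep monusf 2 H" "\<And>y. H [\<zero>, y] = y" "\<And>i y. H [i \<oplus> \<one>, y] = H [i, y] \<ominus> \<one>"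
    using rep_PrimRec1[OF rep_Proj[of 0 "Suc 0"] rep_Comp1[OF rep_predf rep_Proj[of 1 "Suc (Suc (Suc 0))"]]]
    unfolding monusf_def by auto
  have gr: "gr monusf [x, y] (H [x, y])" for x y using H(1) by (simp add: rep_def)
  have mz: "y \<ominus> \<zero> = y" for y using monus_eq[of \<zero> y] by (simp add: zero_add)
  have "FD (\<lambda>e. y \<ominus> e 0)" for y
  proof -
    have "AD (\<lambda>e. e 0 = y \<ominus> e 1)"
    proof -
      have "(\<lambda>e :: nat \<Rightarrow> 'a. e 0 = y \<ominus> e 1) = (\<lambda>e. y = e 1 \<oplus> e 0 \<or> (\<not> e 1 \<preceq> y \<and> e 0 = \<zero>))"
        unfolding monus_iff by blast
      then show ?thesis by (simp only:) (intro ad)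
    qed
    from FD_fun1[OF this FD_var] show ?thesis .
  qed
  note [ad] = this
  have "gr monusf [x, y] (y \<ominus> x)" for x y
  proof (induction x rule: ind)
    case AD show ?case by (intro ad)
  next
    case zero show ?case using gr[of \<zero> y] H(2) by (simp add: mz)
  next
    case (suc n)
    then have "H [n, y] = y \<ominus> n" using gr gr_det by blast
    then show ?case using gr[of "n \<oplus> \<one>" y] H(3) by (simp add: monus_monus)
  qed
  then show ?thesis by (intro repI) (auto simp: length_1_2)
qed

lemma rep_lessf: "rep lessf 2 (\<lambda>ts. bool01 (ts ! 0 \<prec> ts ! 1))"
proof -
  have "x \<prec> y \<longleftrightarrow> y \<ominus> x \<noteq> \<zero>" for x y
  proof (cases "x \<preceq> y")
    case True
    then show ?thesis unfolding le_iff less_iff by (metis monus_eq succ_ne zero_or_succ)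
  next
    case False
    then show ?thesis using monus_0 leM_def by blast
  qed
  then show ?thesis
    unfolding lessf_def
    by (intro rep_cong[OF rep_Comp1[OF rep_zerof rep_Comp1[OF rep_zerof rep_monusf]]]) auto
qed

end

section \<open>Bounded formulas and their decision programs\<close>

datatype bfm = BLess tm tm | BNeg bfm | BImp bfm bfm | BAll tm bfm

primrec to_fm :: "bfm \<Rightarrow> fm" where
  "to_fm (BLess s t) = Less s t"
| "to_fm (BNeg b) = Neg (to_fm b)"
| "to_fm (BImp b c) = Imp (to_fm b) (to_fm c)"
| "to_fm (BAll t b) = All0 (Imp (Less (Var 0) (lift_tm 0 t)) (to_fm b))"

lemma arithmetical_to_fm [simp]: "arithmetical (to_fm b)"
  by (induction b) auto

primrec bdb :: "bfm \<Rightarrow> nat" where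
  "bdb (BLess s t) = max (bd_tm s) (bd_tm t)"
| "bdb (BNeg b) = bdb b"
| "bdb (BImp b c) = max (bdb b) (bdb c)"
| "bdb (BAll t b) = max (bd_tm t) (bdb b - 1)"

primrec comp_tm :: "tm \<Rightarrow> recf" where
  "comp_tm (Var i) = Proj i"
| "comp_tm Zero = ZeroF"
| "comp_tm One = onef"
| "comp_tm (Add s t) = Comp addf [comp_tm s, comp_tm t]"
| "comp_tm (Mul s t) = Comp mulf [comp_tm s, comp_tm t]"

text \<open>A bounded quantifier is decided by searching for the least counterexample below the bound.\<close>

primrec comp_bfm :: "bfm \<Rightarrow> recf" where
  "comp_bfm (BLess s t) = Comp lessf [comp_tm s, comp_tm t]"
| "comp_bfm (BNeg b) = Comp zerof [comp_bfm b]"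
| "comp_bfm (BImp b c) = Comp zerof [Comp mulf [comp_bfm b, Comp zerof [comp_bfm c]]]"
| "comp_bfm (BAll t b) = Comp zerof [Comp lessf
     [Mu (Comp mulf [Comp lessf [Proj 0, comp_tm (lift_tm 0 t)], comp_bfm b]), comp_tm t]]"

lemma bd_tm_lift: "bd_tm (lift_tm 0 t) \<le> Suc (bd_tm t)"
  by (induction t) auto

context aca
begin

primrec satb :: "(nat \<Rightarrow> 'a) \<Rightarrow> bfm \<Rightarrow> bool" where
  "satb e (BLess s t) \<longleftrightarrow> ev M e s \<prec> ev M e t"
| "satb e (BNeg b) \<longleftrightarrow> \<not> satb e b"
| "satb e (BImp b c) \<longleftrightarrow> (satb e b \<longrightarrow> satb e c)"
| "satb e (BAll t b) \<longleftrightarrow> (\<forall>n. n \<prec> ev M e t \<longrightarrow> satb (case_nat n e) b)"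

lemma sats_to_fm [simp]: "sats M e E (to_fm b) \<longleftrightarrow> satb e b"
  by (induction b arbitrary: e) auto

lemma rep_comp_tm: "bd_tm t \<le> k \<Longrightarrow> rep (comp_tm t) k (\<lambda>ts. ev M (app ts e) t)"
proof (induction t)
  case (Var i)
  then have "rep (Proj i) k (\<lambda>ts. ts ! i)" by (intro rep_Proj) auto
  then show ?case using Var by (auto intro: rep_cong simp: app_def)
next
  case (Add s t)
  then show ?case using rep_Comp2[OF rep_addf, of "comp_tm s" k _ "comp_tm t"] by simp
next
  case (Mul s t)
  then show ?case using rep_Comp2[OF rep_mulf, of "comp_tm s" k _ "comp_tm t"] by simp
qed (simp_all add: rep_ZeroF rep_onef)

text \<open>Program and formula agree in every model, also on nonstandard numbers. An order
  presented by such a program can thus be studied through a bounded formula.\<close>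

theorem rep_comp_bfm: "bdb b \<le> k \<Longrightarrow> rep (comp_bfm b) k (\<lambda>ts. bool01 (satb (app ts e) b))"
proof (induction b arbitrary: k)
  case (BLess s t)
  then show ?case using rep_Comp2[OF rep_lessf rep_comp_tm[of s k e] rep_comp_tm[of t k e]] by simp
next
  case (BNeg b)
  then have "rep (comp_bfm (BNeg b)) k (\<lambda>ts. bool01 (bool01 (satb (app ts e) b) = \<zero>))"
    using rep_Comp1[OF rep_zerof BNeg.IH] by simp
  then show ?case by (rule rep_cong) auto
next
  case (BImp b c)
  then have "rep (comp_bfm (BImp b c)) k (\<lambda>ts. bool01 (bool01 (satb (app ts e) b) \<otimes> bool01 (bool01 (satb (app ts e) c) = \<zero>) = \<zero>))"
    using rep_Comp1[OF rep_zerof rep_Comp2[OF rep_mulf, of "comp_bfm b" k _ "Comp zerof [comp_bfm c]"]]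
      rep_Comp1[OF rep_zerof, of "comp_bfm c" k] by simp
  then show ?case by (rule rep_cong) (auto simp: mul_0 zero_mul)
next
  case (BAll t b)
  define F where "F ts = bool01 (ts ! 0 \<prec> ev M (app ts e) (lift_tm 0 t)) \<otimes> bool01 (satb (app ts e) b)" for ts
  have repF: "rep (Comp mulf [Comp lessf [Proj 0, comp_tm (lift_tm 0 t)], comp_bfm b]) (Suc k) F"
    using rep_Comp2[OF rep_mulf rep_Comp2[OF rep_lessf rep_Proj[of 0 "Suc k"] rep_comp_tm[of "lift_tm 0 t" "Suc k" e]]
      BAll.IH[of "Suc k"]] BAll.prems bd_tm_lift[of t]
    by (auto simp: F_def[abs_def])
  have F: "F (y # ts) = bool01 (y \<prec> ev M (app ts e) t \<and> satb (case_nat y (app ts e)) b)" for y ts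
    by (simp add: F_def app_Cons mul_0)
  \<comment> \<open>The bound itself is a zero of \<open>F\<close>, so the search always ends, and
    it ends below the bound only at a counterexample.\<close>
  have ex: "\<exists>y. F (y # ts) = \<zero>" for ts
    unfolding F by (rule exI[of _ "ev M (app ts e) t"]) (simp add: less_irrefl)
  obtain m where m: "rep (Mu (Comp mulf [Comp lessf [Proj 0, comp_tm (lift_tm 0 t)], comp_bfm b])) k m"
    "\<And>ts. length ts = k \<Longrightarrow> F (m ts # ts) = \<zero>" "\<And>ts i. length ts = k \<Longrightarrow> i \<prec> m ts \<Longrightarrow> F (i # ts) \<noteq> \<zero>"
    using rep_Mu[OF repF ex] by auto
  have m_iff: "m ts \<prec> ev M (app ts e) t \<longleftrightarrow> \<not> satb (app ts e) (BAll t b)" if ts: "length ts = k" for ts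
  proof
    assume "m ts \<prec> ev M (app ts e) t"
    then have "\<not> satb (case_nat (m ts) (app ts e)) b"
      using m(2)[OF ts] unfolding F by (auto split: if_splits)
    then show "\<not> satb (app ts e) (BAll t b)" using \<open>m ts \<prec> _\<close> by auto
  next
    assume "\<not> satb (app ts e) (BAll t b)"
    then obtain n where n: "n \<prec> ev M (app ts e) t" "\<not> satb (case_nat n (app ts e)) b" by auto
    then have "\<not> n \<prec> m ts" using m(3)[OF ts, of n] unfolding F by auto
    then show "m ts \<prec> ev M (app ts e) t" using n(1) num.less_linear num.less_trans by metis
  qed
  have "rep (comp_bfm (BAll t b)) k (\<lambda>ts. bool01 (bool01 (m ts \<prec> ev M (app ts e) t) = \<zero>))"
    using rep_Comp1[OF rep_zerof rep_Comp2[OF rep_lessf m(1) rep_comp_tm[of t k e]]] BAll.prems by simp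
  then show ?case by (rule rep_cong) (simp add: m_iff)
qed

end

lemma std_simps [simp]:
  "szero std = 0" "sone std = 1" "sadd std = (+)" "smul std = (*)" "sless std = (<)" "ssets std = UNIV"
  by (simp_all add: std_def)

lemmas sat_connectives [simp] = sats_connectives[of std, unfolded sats_std std_simps]

text \<open>Whatever is proved about the models in \<open>aca\<close> thereby holds of standard
  truth as well.\<close>

lemma aca_std: "aca std"
proof
  have "true_std q" if "q \<in> basic_axioms" for q
    using that by (auto simp: basic_axioms_def Let_def true_std_def)
  moreover have "true_std induction_axiom"
    unfolding true_std_def induction_axiom_def
  proof (intro allI)
    fix e E
    show "sat e E (Imp (Conj (Mem Zero 0) (All0 (Imp (Mem (Var 0) 0) (Mem (Add (Var 0) One) 0)))) (All0 (Mem (Var 0) 0)))"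
      using nat_induct[of "\<lambda>n. n \<in> E 0"] by auto
  qed
  moreover have "true_std (comprehension p)" for p
    unfolding true_std_def comprehension_def
  proof (intro allI)
    fix e E
    show "sat e E (Ex1 (All0 (Iff (Mem (Var 0) 0) (lift1 0 p))))"
      by (simp add: sats_lift1[of std, unfolded sats_std]) (rule exI[of _ "{n. sat (case_nat n e) E p}"], simp)
  qed
  ultimately have "\<exists>p. q = closure p \<and> true_std p" if "q \<in> ACA0" for q
    using that by (auto simp: ACA0_def)
  then show "valid std q" if "q \<in> ACA0" for q
    using that
  proof -
    have "\<exists>p. q = closure p \<and> true_std p" using that \<open>\<And>q. q \<in> ACA0 \<Longrightarrow> _\<close> by blast
    then show ?thesis by (auto simp: valid_closure simp flip: valid_std)
  qed
qed simp

section \<open>The Kleene-Brouwer order of a tree of attempts\<close>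

text \<open>A clause \<open>(ps, r)\<close> constrains a function \<open>G\<close>: whenever
  \<open>G\<close> takes the value \<open>v\<close> at \<open>t\<close> for all
  \<open>(t, v)\<close> in \<open>ps\<close>, then \<open>r\<close> holds. A violation shows in
  finitely many values of \<open>G\<close>, so the functions that satisfy a list of clauses are the
  paths of a tree.\<close>

type_synonym clause = "(tm \<times> tm) list \<times> bfm"

definition "BConj p q = BNeg (BImp p (BNeg q))"
definition "BDisj p q = BImp (BNeg p) q"
definition "BEx t p = BNeg (BAll t (BNeg p))"
definition "BEq s t = BConj (BNeg (BLess s t)) (BNeg (BLess t s))"
definition "BConjs ps = foldr BConj ps (BEq Zero Zero)"
definition "Bmod b i = Add One (Mul (Add i One) b)"
definition "Bbeta a b i v = BConj (BLess v (Bmod b i))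
  (BEx (Add a One) (BEq (lift_tm 0 a) (Add (Mul (Var 0) (lift_tm 0 (Bmod b i))) (lift_tm 0 v))))"
text \<open>The language has no function symbol for beta, so the two entries are bound to variables;
  the moduli serve as bounds because an entry is a remainder.\<close>

definition "Bcmp r a b a' b' j = BEx (Bmod b j) (BConj (Bbeta (lift_tm 0 a) (lift_tm 0 b) (lift_tm 0 j) (Var 0))
  (BEx (lift_tm 0 (Bmod b' j)) (BConj
    (Bbeta (lift_tm 0 (lift_tm 0 a')) (lift_tm 0 (lift_tm 0 b')) (lift_tm 0 (lift_tm 0 j)) (Var 0))
    (r (Var 1) (Var 0)))))"

primrec ball :: "nat \<Rightarrow> nat \<Rightarrow> bfm \<Rightarrow> bfm" where
  "ball 0 j p = p"
| "ball (Suc k) j p = BAll (Var j) (ball k (Suc j) p)"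

definition clauseF :: "nat \<Rightarrow> nat \<Rightarrow> nat \<Rightarrow> clause \<Rightarrow> bfm" where
  "clauseF a b l c = (case c of (ps, r) \<Rightarrow> BImp (BConjs (map (\<lambda>(t, v).
     BConj (BLess t (Var l)) (Bbeta (Var a) (Var b) t v)) ps)) r)"

text \<open>The node's label is rebound so that it directly follows the \<open>N\<close> clause variables.\<close>

definition nodeF :: "nat \<Rightarrow> clause list \<Rightarrow> nat \<Rightarrow> nat \<Rightarrow> nat \<Rightarrow> nat \<Rightarrow> bfm" where
  "nodeF N cls x a b l = BEx (Add (Var x) One) (BConj (BEq (Var 0) (Var (Suc x)))
     (ball N (Suc l) (BConjs (map (clauseF (N + Suc a) (N + Suc b) (N + Suc l)) cls))))"

text \<open>A node is a number \<open>pr (pr a b) l\<close>, standing for the sequence of length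
  \<open>l\<close> coded by \<open>a\<close> and \<open>b\<close>; all three are bounded by the
  number. Inside the scope, \<open>a\<close>, \<open>b\<close> and \<open>l\<close> are the
  variables 2, 1 and 0.\<close>

definition BDec :: "nat \<Rightarrow> bfm \<Rightarrow> bfm" where
  "BDec i p = BEx (Add (Var i) One) (BEx (Add (Var (Suc i)) One) (BEx (Add (Var (Suc (Suc i))) One)
     (BConj (BEq (Var (Suc (Suc (Suc i)))) (qpair (qpair (Var 2) (Var 1)) (Var 0))) p)))"

text \<open>Variables 0, 1 and 2 are the parameter and the two nodes. Decoding the first node shifts
  the second from index 2 to index 5.\<close>

definition ordF :: "nat \<Rightarrow> clause list \<Rightarrow> bfm" where
  "ordF N cls = BDec 1 (BDec 5 (BConjs
     [nodeF N cls 6 5 4 3, nodeF N cls 6 2 1 0,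
      BDisj
       (BEx (Var 3) (BConj
          (BAll (Var 0) (BConj (BLess (Var 0) (Var 2)) (Bcmp BEq (Var 7) (Var 6) (Var 4) (Var 3) (Var 0))))
          (BDisj (BNeg (BLess (Var 0) (Var 1))) (Bcmp BLess (Var 6) (Var 5) (Var 3) (Var 2) (Var 0)))))
       (BConjs [BEq (Var 3) (Var 0), BAll (Var 3) (Bcmp BEq (Var 6) (Var 5) (Var 3) (Var 2) (Var 0)),
          BNeg (BLess (Var 8) (Var 7))])]))"

definition clause_bd :: "nat \<Rightarrow> clause \<Rightarrow> bool" where
  "clause_bd n c = (case c of (ps, r) \<Rightarrow> (\<forall>(t, v)\<in>set ps. bd_tm t \<le> n \<and> bd_tm v \<le> n) \<and> bdb r \<le> n)"

context aca
begin

lemma finite_bound: "finite A \<Longrightarrow> \<exists>k. \<forall>x\<in>A. x \<prec> k"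
proof (induction A rule: finite_induct)
  case (insert x A)
  then obtain k where k: "\<forall>x\<in>A. x \<prec> k" by blast
  have "y \<prec> x \<oplus> k \<oplus> \<one>" if "y \<in> insert x A" for y
  proof (cases "y = x")
    case True
    then show ?thesis unfolding less_succ_le le_iff by blast
  next
    case False
    then have "y \<preceq> k" using that k leM_def by blast
    then show ?thesis unfolding less_succ_le le_iff by (metis add_assoc add_comm)
  qed
  then show ?case by blast
qed auto

lemma not_less_eq: "\<not> x \<prec> y \<and> \<not> y \<prec> x \<longleftrightarrow> x = y"
  using num.less_linear less_irrefl by blast

lemma satb_connectives [simp]:
  "satb e (BConj p q) \<longleftrightarrow> satb e p \<and> satb e q"
  "satb e (BDisj p q) \<longleftrightarrow> satb e p \<or> satb e q"
  "satb e (BEx t p) \<longleftrightarrow> (\<exists>n. n \<prec> ev M e t \<and> satb (case_nat n e) p)"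
  "satb e (BEq s t) \<longleftrightarrow> ev M e s = ev M e t"
  using not_less_eq by (auto simp: BConj_def BDisj_def BEx_def BEq_def)

lemma satb_BConjs [simp]: "satb e (BConjs ps) \<longleftrightarrow> (\<forall>p\<in>set ps. satb e p)"
  by (induction ps) (auto simp: BConjs_def)

lemma ev_Bmod [simp]: "ev M e (Bmod b i) = modulus (ev M e b) (ev M e i)"
  by (simp add: Bmod_def modulus_def)

lemma satb_Bbeta [simp]: "satb e (Bbeta a b i v) \<longleftrightarrow> ev M e v = beta (ev M e a) (ev M e b) (ev M e i)"
proof -
  \<comment> \<open>The modulus is at least 1, so a quotient never exceeds the dividend and the
    bound in \<open>Bbeta\<close> loses nothing.\<close>
  have "q \<preceq> q \<otimes> modulus b i \<oplus> v" for q b i v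
    unfolding modulus_def le_iff
    by (rule exI[of _ "q \<otimes> ((i \<oplus> \<one>) \<otimes> b) \<oplus> v"]) (simp add: ring)
  then have "(\<exists>q. q \<preceq> a \<and> a = q \<otimes> modulus b i \<oplus> v) \<longleftrightarrow> (\<exists>q. a = q \<otimes> modulus b i \<oplus> v)" for a b i v
    by blast
  then show ?thesis
    unfolding Bbeta_def beta_iff by (simp add: less_succ_le)
qed

lemma satb_BDec:
  "satb e (BDec i p) \<longleftrightarrow> (\<exists>a b l. e i = pr (pr a b) l \<and> satb (case_nat l (case_nat b (case_nat a e))) p)"
proof -
  have "a \<preceq> pr (pr a b) l" "b \<preceq> pr (pr a b) l" "l \<preceq> pr (pr a b) l" for a b l
    using pr_ge num.order_trans by blast+
  then have "(\<exists>a. a \<preceq> s \<and> (\<exists>b. b \<preceq> s \<and> (\<exists>l. l \<preceq> s \<and> s = pr (pr a b) l \<and> Q a b l))) \<longleftrightarrow>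
      (\<exists>a b l. s = pr (pr a b) l \<and> Q a b l)" for s Q
    by blast
  then show ?thesis unfolding BDec_def by (simp add: less_succ_le)
qed

lemma satb_Bcmp [simp]:
  assumes "\<And>e. satb e (r (Var 1) (Var 0)) \<longleftrightarrow> R (e 1) (e 0)"
  shows "satb e (Bcmp r a b a' b' j) \<longleftrightarrow>
    R (beta (ev M e a) (ev M e b) (ev M e j)) (beta (ev M e a') (ev M e b') (ev M e j))"
proof -
  have lt: "beta a b j \<prec> modulus b j" for a b j using beta_iff by blast
  show ?thesis unfolding Bcmp_def by (auto simp: assms[unfolded One_nat_def] lt)
qed

lemma satb_Bcmp_eq [simp]: "satb e (Bcmp BEq a b a' b' j) \<longleftrightarrow>
    beta (ev M e a) (ev M e b) (ev M e j) = beta (ev M e a') (ev M e b') (ev M e j)"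
  by (rule satb_Bcmp) simp

lemma satb_Bcmp_less [simp]: "satb e (Bcmp BLess a b a' b' j) \<longleftrightarrow>
    beta (ev M e a) (ev M e b) (ev M e j) \<prec> beta (ev M e a') (ev M e b') (ev M e j)"
  by (rule satb_Bcmp) simp

lemma satb_ball:
  "satb e (ball k j p) \<longleftrightarrow> (\<forall>us. length us = k \<and> (\<forall>u\<in>set us. u \<prec> e j) \<longrightarrow> satb (app us e) p)"
proof (induction k arbitrary: e j)
  case (Suc k)
  have "satb e (ball (Suc k) j p) \<longleftrightarrow> (\<forall>n us. n \<prec> e j \<and> length us = k \<and> (\<forall>u\<in>set us. u \<prec> e j) \<longrightarrow>
      satb (app (us @ [n]) e) p)"
    by (auto simp: Suc app_snoc)
  also have "\<dots> \<longleftrightarrow> (\<forall>us. length us = Suc k \<and> (\<forall>u\<in>set us. u \<prec> e j) \<longrightarrow> satb (app us e) p)"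
    unfolding length_Suc_conv_rev by auto
  finally show ?case .
qed simp

lemma bd0_to_fm: "bd0 (to_fm b) \<le> bdb b"
  by (induction b) (use bd_tm_lift in \<open>auto simp: le_diff_conv max_def intro: order_trans\<close>)

lemma satb_cong: "(\<And>i. i < bdb b \<Longrightarrow> e i = e' i) \<Longrightarrow> satb e b = satb e' b"
  using sats_cong[of "to_fm b" e e' "\<lambda>_. {}" "\<lambda>_. {}" M] bd0_to_fm[of b]
    sats_to_fm by (metis order_less_le_trans sats_cong)

text \<open>Variables and queried positions are cut off at the length \<open>l\<close>. This makes
  the condition bounded, and it makes every initial segment of a path a node. The variable with
  index \<open>N\<close> holds the parameter.\<close>

definition node :: "nat \<Rightarrow> clause list \<Rightarrow> 'a \<Rightarrow> 'a \<Rightarrow> 'a \<Rightarrow> 'a \<Rightarrow> bool" where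
  "node N cls x a b l \<longleftrightarrow> (\<forall>u ps r. u N = x \<and> (\<forall>i<N. u i \<prec> l) \<and> (ps, r) \<in> set cls \<and>
     (\<forall>(t, v)\<in>set ps. ev M u t \<prec> l \<and> ev M u v = beta a b (ev M u t)) \<longrightarrow> satb u r)"

definition path :: "nat \<Rightarrow> clause list \<Rightarrow> 'a \<Rightarrow> ('a \<Rightarrow> 'a) \<Rightarrow> bool" where
  "path N cls x G \<longleftrightarrow> AD (\<lambda>e. e 0 = G (e 1)) \<and> (\<forall>u ps r. u N = x \<and> (ps, r) \<in> set cls \<and>
     (\<forall>(t, v)\<in>set ps. ev M u v = G (ev M u t)) \<longrightarrow> satb u r)"

lemma satb_nodeF:
  assumes "\<forall>c\<in>set cls. clause_bd (Suc N) c"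
  shows "satb e (nodeF N cls x a b l) \<longleftrightarrow> node N cls (e x) (e a) (e b) (e l)"
proof -
  let ?A = "\<lambda>u. \<forall>ps r. (ps, r) \<in> set cls \<and>
     (\<forall>(t, v)\<in>set ps. ev M u t \<prec> e l \<and> ev M u v = beta (e a) (e b) (ev M u t)) \<longrightarrow> satb u r"
  have cong: "?A u'" if eq: "\<And>i. i \<le> N \<Longrightarrow> u i = u' i" and A: "?A u" for u u'
  proof (intro allI impI, elim conjE)
    fix ps r assume c: "(ps, r) \<in> set cls"
      and prem: "\<forall>(t, v)\<in>set ps. ev M u' t \<prec> e l \<and> ev M u' v = beta (e a) (e b) (ev M u' t)"
    have bd: "\<forall>(t, v)\<in>set ps. bd_tm t \<le> Suc N \<and> bd_tm v \<le> Suc N" "bdb r \<le> Suc N"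
      using bspec[OF assms c] by (simp_all add: clause_bd_def)
    have "ev M u t = ev M u' t" if "bd_tm t \<le> Suc N" for t
      using that eq by (intro ev_cong) auto
    then have "\<forall>(t, v)\<in>set ps. ev M u t \<prec> e l \<and> ev M u v = beta (e a) (e b) (ev M u t)"
      using bspec[OF prem] bspec[OF bd(1)] by (intro ballI) fastforce
    then have "satb u r" using A c by blast
    moreover have "satb u r = satb u' r"
      using bd(2) eq by (intro satb_cong) auto
    ultimately show "satb u' r" by simp
  qed
  let ?f = "case_nat (e x) e"
  have clause: "satb (app us ?f) (clauseF (N + Suc a) (N + Suc b) (N + Suc l) (ps, r)) \<longleftrightarrow>
     ((\<forall>(t, v)\<in>set ps. ev M (app us ?f) t \<prec> e l \<and> ev M (app us ?f) v = beta (e a) (e b) (ev M (app us ?f) t))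
        \<longrightarrow> satb (app us ?f) r)" if "length us = N" for us ps r
    using that by (auto simp: clauseF_def app_def)
  have "e x \<prec> e x \<oplus> \<one>" by (simp add: less_succ)
  then have "satb e (nodeF N cls x a b l) \<longleftrightarrow> (\<forall>us. length us = N \<and> (\<forall>u\<in>set us. u \<prec> e l) \<longrightarrow>
      (\<forall>c\<in>set cls. satb (app us ?f) (clauseF (N + Suc a) (N + Suc b) (N + Suc l) c)))"
    unfolding nodeF_def satb_connectives satb_ball satb_BConjs by auto
  also have "\<dots> \<longleftrightarrow> (\<forall>us. length us = N \<and> (\<forall>u\<in>set us. u \<prec> e l) \<longrightarrow> ?A (app us ?f))"
    using clause by (intro all_cong1 imp_cong refl) (auto simp del: split_paired_All)
  also have "\<dots> \<longleftrightarrow> (\<forall>u. u N = e x \<and> (\<forall>i<N. u i \<prec> e l) \<longrightarrow> ?A u)"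
  proof (rule iffI)
    assume H: "\<forall>us. length us = N \<and> (\<forall>u\<in>set us. u \<prec> e l) \<longrightarrow> ?A (app us ?f)"
    show "\<forall>u. u N = e x \<and> (\<forall>i<N. u i \<prec> e l) \<longrightarrow> ?A u"
    proof (rule allI, rule impI)
      fix u assume u: "u N = e x \<and> (\<forall>i<N. u i \<prec> e l)"
      then have "length (map u [0..<N]) = N \<and> (\<forall>y\<in>set (map u [0..<N]). y \<prec> e l)" by auto
      from HOL.mp[OF spec[OF H] this] show "?A u"
        by (rule cong[of "app (map u [0..<N]) ?f" u, rotated]) (use u in \<open>simp add: app_def\<close>)
    qed
  next
    assume H: "\<forall>u. u N = e x \<and> (\<forall>i<N. u i \<prec> e l) \<longrightarrow> ?A u"
    show "\<forall>us. length us = N \<and> (\<forall>u\<in>set us. u \<prec> e l) \<longrightarrow> ?A (app us ?f)"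
    proof (rule allI, rule impI)
      fix us assume "length us = N \<and> (\<forall>u\<in>set us. u \<prec> e l)"
      then have "app us ?f N = e x \<and> (\<forall>i<N. app us ?f i \<prec> e l)" by (auto simp: app_def)
      from HOL.mp[OF spec[OF H] this] show "?A (app us ?f)" .
    qed
  qed
  also have "\<dots> \<longleftrightarrow> node N cls (e x) (e a) (e b) (e l)" unfolding node_def by blast
  finally show ?thesis .
qed

section \<open>The Kleene-Brouwer order\<close>

definition sq :: "'a \<Rightarrow> 'a \<Rightarrow> 'a option" where
  "sq s i = (case (SOME z. case z of (a, b, l) \<Rightarrow> s = pr (pr a b) l) of (a, b, l) \<Rightarrow>
     if i \<prec> l then Some (beta a b i) else None)"

lemma sq_pr [simp]: "sq (pr (pr a b) l) i = (if i \<prec> l then Some (beta a b i) else None)"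
proof -
  have "(SOME z. case z of (a', b', l') \<Rightarrow> pr (pr a b) l = pr (pr a' b') l') = (a, b, l)"
    by (rule some_equality) (auto simp: pr_inj)
  then show ?thesis by (simp add: sq_def)
qed

text \<open>A missing entry counts as larger than every number, so a proper extension precedes its
  initial segments.\<close>

definition lto :: "'a option \<Rightarrow> 'a option \<Rightarrow> bool" where
  "lto u v = (case u of None \<Rightarrow> False | Some x \<Rightarrow> (case v of None \<Rightarrow> True | Some y \<Rightarrow> x \<prec> y))"

definition kb :: "'a \<Rightarrow> 'a \<Rightarrow> bool" where
  "kb s t \<longleftrightarrow> (\<exists>i. (\<forall>j. j \<prec> i \<longrightarrow> sq s j = sq t j) \<and> lto (sq s i) (sq t i))"

definition isnode :: "nat \<Rightarrow> clause list \<Rightarrow> 'a \<Rightarrow> 'a \<Rightarrow> bool" where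
  "isnode N cls x s \<longleftrightarrow> (\<exists>a b l. s = pr (pr a b) l \<and> node N cls x a b l)"

text \<open>One sequence has many codes, and each of them is a node of its own. Codes of the same
  sequence are compared as numbers, which makes the order antisymmetric.\<close>

definition ord :: "nat \<Rightarrow> clause list \<Rightarrow> 'a \<Rightarrow> 'a \<Rightarrow> 'a \<Rightarrow> bool" where
  "ord N cls x s t \<longleftrightarrow> isnode N cls x s \<and> isnode N cls x t \<and>
     (kb s t \<or> (\<forall>j. sq s j = sq t j) \<and> s \<preceq> t)"

lemma same_iff:
  "(\<forall>j. sq (pr (pr a b) l) j = sq (pr (pr a' b') l') j) \<longleftrightarrow>
   l = l' \<and> (\<forall>j. j \<prec> l \<longrightarrow> beta a b j = beta a' b' j)"
proof
  assume *: "\<forall>j. sq (pr (pr a b) l) j = sq (pr (pr a' b') l') j"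
  then have **: "j \<prec> l \<longleftrightarrow> j \<prec> l'" for j by (metis option.distinct(1) sq_pr)
  then have "l = l'" using less_irrefl num.less_linear by metis
  moreover have "beta a b j = beta a' b' j" if "j \<prec> l" for j
    using *[rule_format, of j] that **[of j] by simp
  ultimately show "l = l' \<and> (\<forall>j. j \<prec> l \<longrightarrow> beta a b j = beta a' b' j)" by blast
qed auto

lemma kb_iff:
  "kb (pr (pr a b) l) (pr (pr a' b') l') \<longleftrightarrow> (\<exists>i. i \<prec> l \<and>
    (\<forall>j. j \<prec> i \<longrightarrow> j \<prec> l' \<and> beta a b j = beta a' b' j) \<and> (\<not> i \<prec> l' \<or> beta a b i \<prec> beta a' b' i))"
proof -
  have "(\<forall>j. j \<prec> i \<longrightarrow> sq (pr (pr a b) l) j = sq (pr (pr a' b') l') j) \<longleftrightarrow>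
    (\<forall>j. j \<prec> i \<longrightarrow> j \<prec> l' \<and> beta a b j = beta a' b' j)" if "i \<prec> l" for i
    using num.less_trans[OF _ that] by (auto split: if_splits)
  moreover have "lto (sq (pr (pr a b) l) i) (sq (pr (pr a' b') l') i) \<longleftrightarrow>
     i \<prec> l \<and> (\<not> i \<prec> l' \<or> beta a b i \<prec> beta a' b' i)" for i
    by (auto simp: lto_def)
  ultimately show ?thesis unfolding kb_def by blast
qed

theorem satb_ordF:
  assumes "\<forall>c\<in>set cls. clause_bd (Suc N) c"
  shows "satb e (ordF N cls) \<longleftrightarrow> ord N cls (e 0) (e 1) (e 2)"
proof -
  have "satb e (ordF N cls) \<longleftrightarrow> (\<exists>a b l. e 1 = pr (pr a b) l \<and> (\<exists>a' b' l'. e 2 = pr (pr a' b') l' \<and>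
     node N cls (e 0) a b l \<and> node N cls (e 0) a' b' l' \<and>
     (kb (pr (pr a b) l) (pr (pr a' b') l') \<or>
      (\<forall>j. sq (pr (pr a b) l) j = sq (pr (pr a' b') l') j) \<and> e 1 \<preceq> e 2)))"
    unfolding ordF_def kb_iff same_iff
    by (simp add: satb_nodeF[OF assms] satb_BDec num.not_less)
  also have "\<dots> \<longleftrightarrow> ord N cls (e 0) (e 1) (e 2)"
  proof
    assume "ord N cls (e 0) (e 1) (e 2)"
    then obtain a b l a' b' l' where "e 1 = pr (pr a b) l" "e 2 = pr (pr a' b') l'"
      unfolding ord_def isnode_def by blast
    with \<open>ord N cls (e 0) (e 1) (e 2)\<close>
    show "\<exists>a b l. e 1 = pr (pr a b) l \<and> (\<exists>a' b' l'. e 2 = pr (pr a' b') l' \<and>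
     node N cls (e 0) a b l \<and> node N cls (e 0) a' b' l' \<and>
     (kb (pr (pr a b) l) (pr (pr a' b') l') \<or>
      (\<forall>j. sq (pr (pr a b) l) j = sq (pr (pr a' b') l') j) \<and> e 1 \<preceq> e 2))"
      by (simp only: ord_def isnode_def pr_inj) blast
  next
    assume "\<exists>a b l. e 1 = pr (pr a b) l \<and> (\<exists>a' b' l'. e 2 = pr (pr a' b') l' \<and>
     node N cls (e 0) a b l \<and> node N cls (e 0) a' b' l' \<and>
     (kb (pr (pr a b) l) (pr (pr a' b') l') \<or>
      (\<forall>j. sq (pr (pr a b) l) j = sq (pr (pr a' b') l') j) \<and> e 1 \<preceq> e 2))"
    then show "ord N cls (e 0) (e 1) (e 2)"
      by (elim exE conjE) (simp only: ord_def isnode_def pr_inj, blast)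
  qed
  finally show ?thesis .
qed

end

section \<open>Linearity of the order; paths and descents\<close>

locale kb_tree = aca M for M :: "'a str" +
  fixes N :: nat and cls :: "clause list"
  assumes cls_bd: "\<forall>c\<in>set cls. clause_bd (Suc N) c"
begin

abbreviation "nod \<equiv> node N cls"
abbreviation "le \<equiv> ord N cls"

lemma AD_ord [ad]: "FD F \<Longrightarrow> FD G \<Longrightarrow> FD H \<Longrightarrow> AD (\<lambda>e. le (F e) (G e) (H e))"
  by (rule AD_rel3[where R = le, OF AD_atom[of "to_fm (ordF N cls)"]]) (auto simp: satb_ordF[OF cls_bd])

lemma lto_trans: "lto u v \<Longrightarrow> lto v w \<Longrightarrow> lto u w"
  by (auto simp: lto_def split: option.splits intro: num.less_trans)

lemma lto_irrefl: "\<not> lto u u"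
  by (auto simp: lto_def less_irrefl split: option.splits)

lemma lto_total: "u \<noteq> v \<Longrightarrow> lto u v \<or> lto v u"
  using num.less_linear by (cases u; cases v) (auto simp: lto_def)

lemma kb_trans: 
  assumes "kb s t" "kb t w" shows "kb s w"
proof -
  obtain i k where i: "\<And>j. j \<prec> i \<Longrightarrow> sq s j = sq t j" "lto (sq s i) (sq t i)"
    and k: "\<And>j. j \<prec> k \<Longrightarrow> sq t j = sq w j" "lto (sq t k) (sq w k)"
    using assms unfolding kb_def by blast
  consider "i \<prec> k" | "i = k" | "k \<prec> i" using num.less_linear by blast
  then show ?thesis
  proof cases
    case 1
    then have "lto (sq s i) (sq w i)" "\<And>j. j \<prec> i \<Longrightarrow> sq s j = sq w j"
      using i k(1) num.less_trans by metis+
    then show ?thesis unfolding kb_def by blast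
  next
    case 2
    then have "lto (sq s i) (sq w i)" "\<And>j. j \<prec> i \<Longrightarrow> sq s j = sq w j"
      using i k lto_trans by metis+
    then show ?thesis unfolding kb_def by blast
  next
    case 3
    then have "lto (sq s k) (sq w k)" "\<And>j. j \<prec> k \<Longrightarrow> sq s j = sq w j"
      using i(1) k num.less_trans by metis+
    then show ?thesis unfolding kb_def by blast
  qed
qed

lemma kb_irrefl: "(\<And>j. sq s j = sq t j) \<Longrightarrow> \<not> kb s t"
  unfolding kb_def using lto_irrefl by metis

lemma kb_cong: "(\<And>j. sq s j = sq s' j) \<Longrightarrow> (\<And>j. sq t j = sq t' j) \<Longrightarrow> kb s t = kb s' t'"
  unfolding kb_def by simp

text \<open>Nodes may have nonstandard length. A first difference exists because differing at a
  position is arithmetically definable, so that the least number principle of the model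
  applies.\<close>

lemma kb_total:
  assumes "sq (pr (pr a b) l) k \<noteq> sq (pr (pr a' b') l') k" (is "sq ?s k \<noteq> sq ?t k")
  shows "kb ?s ?t \<or> kb ?t ?s"
proof -
  have "AD (\<lambda>e. (e 0 \<prec> l) \<noteq> (e 0 \<prec> l') \<or> e 0 \<prec> l \<and> e 0 \<prec> l' \<and> beta a b (e 0) \<noteq> beta a' b' (e 0))"
    by (intro ad)
  moreover have "(sq ?s j \<noteq> sq ?t j) = ((j \<prec> l) \<noteq> (j \<prec> l') \<or> j \<prec> l \<and> j \<prec> l' \<and> beta a b j \<noteq> beta a' b' j)" for j
    by simp
  ultimately have AD: "AD (\<lambda>e. sq ?s (e 0) \<noteq> sq ?t (e 0))" by (simp only:)
  define D where "D j \<longleftrightarrow> sq ?s j \<noteq> sq ?t j" for j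
  have D: "AD (\<lambda>e. D (e 0))" "D k" unfolding D_def using AD assms by blast+
  obtain i where "D i" "\<And>j. j \<prec> i \<Longrightarrow> \<not> D j" using least[of D, OF D] by blast
  then have i: "sq ?s i \<noteq> sq ?t i" "\<And>j. j \<prec> i \<Longrightarrow> sq ?s j = sq ?t j"
    unfolding D_def by blast+
  from lto_total[OF i(1)] show ?thesis
  proof
    assume "lto (sq ?s i) (sq ?t i)"
    then have "kb ?s ?t" unfolding kb_def using i(2) by blast
    then show ?thesis ..
  next
    assume "lto (sq ?t i) (sq ?s i)"
    then have "kb ?t ?s" unfolding kb_def using i(2)[symmetric] by blast
    then show ?thesis ..
  qed
qed

lemma ord_refl: "le x s t \<Longrightarrow> le x s s \<and> le x t t"
  by (auto simp: ord_def)

lemma ord_trans: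
  assumes "le x s t" "le x t w" shows "le x s w"
proof -
  have "kb s w \<or> (\<forall>j. sq s j = sq w j) \<and> s \<preceq> w"
    using assms kb_trans[of s t w] kb_cong[of s t w w] kb_cong[of s s t w] num.order_trans[of s t w]
    unfolding ord_def by auto
  then show ?thesis using assms unfolding ord_def by blast
qed

lemma ord_antisym:
  assumes "le x s t" "le x t s" shows "s = t"
proof -
  have "\<not> kb s s" by (rule kb_irrefl) simp
  then show ?thesis
    using assms kb_trans[of s t s] kb_irrefl[of s t] kb_irrefl[of t s] num.order_antisym[of s t]
    unfolding ord_def by auto
qed

lemma ord_total:
  assumes "le x s s" "le x t t" shows "le x s t \<or> le x t s"
proof -
  obtain a b l a' b' l' where s: "s = pr (pr a b) l" and t: "t = pr (pr a' b') l'"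
    using assms unfolding ord_def isnode_def by blast
  have "kb s t \<or> kb t s \<or> (\<forall>j. sq s j = sq t j)"
    using kb_total[of a b l _ a' b' l'] unfolding s t by blast
  then show ?thesis using assms linear[of s t] unfolding ord_def by auto
qed

definition ext :: "'a \<Rightarrow> 'a \<Rightarrow> 'a \<Rightarrow> 'a \<Rightarrow> bool" where
  "ext z p q k \<longleftrightarrow> (\<exists>a b l. z = pr (pr a b) l \<and> k \<preceq> l \<and> (\<forall>j. j \<prec> k \<longrightarrow> beta a b j = beta p q j))"

definition extv :: "'a \<Rightarrow> 'a \<Rightarrow> 'a \<Rightarrow> 'a \<Rightarrow> 'a \<Rightarrow> bool" where
  "extv z p q i v \<longleftrightarrow> (\<exists>a b l. z = pr (pr a b) l \<and> i \<prec> l \<and> (\<forall>j. j \<prec> i \<longrightarrow> beta a b j = beta p q j) \<and> beta a b i = v)"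

text \<open>A set of nodes without least element determines a leftmost path.\<close>

theorem path_if_no_least:
  assumes Z: "Z \<in> ssets M" and ne: "z\<^sub>0 \<in> Z" "le x z\<^sub>0 z\<^sub>0"
    and nomin: "\<And>z. z \<in> Z \<Longrightarrow> le x z z \<Longrightarrow> \<exists>y\<in>Z. le x y y \<and> \<not> le x z y"
  shows "\<exists>G. path N cls x G"
proof -
  define P where "P z \<longleftrightarrow> z \<in> Z \<and> le x z z" for z
  have P_node: "\<exists>a b l. z = pr (pr a b) l \<and> nod x a b l" if "P z" for z
    using that by (auto simp: P_def ord_def isnode_def)
  \<comment> \<open>The first \<open>k\<close> entries coded by \<open>p\<close> and
    \<open>q\<close> begin the leftmost path: some member of \<open>Z\<close> extends them, and at
    no place does a member that agrees up to there have a smaller entry.\<close>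
  define good where "good p q k \<longleftrightarrow> (\<exists>z. P z \<and> ext z p q k) \<and>
     (\<forall>i. i \<prec> k \<longrightarrow> (\<forall>v. v \<prec> beta p q i \<longrightarrow> \<not> (\<exists>z. P z \<and> extv z p q i v)))" for p q k
  have ext_v: "extv z p q i (beta p q i)" if e: "ext z p q k" and ik: "i \<prec> k" for z p q k i
  proof -
    obtain a b l where "z = pr (pr a b) l" "k \<preceq> l" "\<And>j. j \<prec> k \<Longrightarrow> beta a b j = beta p q j"
      using e unfolding ext_def by blast
    moreover have "i \<prec> l" using \<open>i \<prec> k\<close> \<open>k \<preceq> l\<close> by (rule num.less_le_trans)
    moreover have "j \<prec> k" if "j \<prec> i" for j using that \<open>i \<prec> k\<close> by (rule num.less_trans)
    ultimately show ?thesis unfolding extv_def using \<open>i \<prec> k\<close> by blast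
  qed
  have extv_cong: "extv z p q i v \<longleftrightarrow> extv z p' q' i v" if "\<And>j. j \<prec> i \<Longrightarrow> beta p q j = beta p' q' j"
    for z p q p' q' i v
    using that unfolding extv_def by simp
  have ext_succ: "ext z p q (k \<oplus> \<one>)" if "extv z p q k v" "v = beta p q k" for z p q k v
    using that unfolding ext_def extv_def less_succ succ_le by blast
  \<comment> \<open>Otherwise every member of \<open>Z\<close> extending the given start has length
    exactly \<open>k\<close>. The one with the least code is then least in all of \<open>Z\<close>,
    because a member that does not extend the start either stops earlier or departs to the
    right.\<close>
  have step: "\<exists>z v. P z \<and> extv z p q k v" if g: "good p q k" for p q k
  proof (rule ccontr)
    assume no: "\<not> ?thesis"
    obtain z where z: "P z \<and> ext z p q k" using g unfolding good_def by blast
    have "AD (\<lambda>e. P (e 0) \<and> ext (e 0) p q k)" unfolding P_def ext_def by (intro ad Z)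
    from least[of "\<lambda>z. P z \<and> ext z p q k", OF this z] obtain z1 where
      z1: "P z1" "ext z1 p q k" and min: "\<And>y. y \<prec> z1 \<Longrightarrow> \<not> (P y \<and> ext y p q k)" by blast
    obtain a b l where ab: "z1 = pr (pr a b) l" "k \<preceq> l" "\<And>j. j \<prec> k \<Longrightarrow> beta a b j = beta p q j"
      using z1(2) unfolding ext_def by blast
    have len: "l' = k" if "y = pr (pr a' b') l'" "k \<preceq> l'" "\<And>j. j \<prec> k \<Longrightarrow> beta a' b' j = beta p q j" "P y"
      for y a' b' l'
    proof (rule ccontr)
      assume "l' \<noteq> k"
      then have "k \<prec> l'" using that(2) leM_def by auto
      then have "extv y p q k (beta a' b' k)" unfolding extv_def using that by blast
      then show False using no that(4) by blast
    qed
    have l: "l = k" using len[OF ab z1(1)] .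
    have "le x z1 y" if y: "P y" for y
    proof (cases "ext y p q k")
      case True
      then obtain a' b' l' where y': "y = pr (pr a' b') l'" "k \<preceq> l'" "\<And>j. j \<prec> k \<Longrightarrow> beta a' b' j = beta p q j"
        unfolding ext_def by blast
      have "l' = k" using len[OF y' y] .
      then have "\<forall>j. sq z1 j = sq y j" unfolding ab(1) y'(1) same_iff using l ab(3) y'(3) by simp
      moreover have "z1 \<preceq> y" using min[of y] y True num.not_less by blast
      ultimately show ?thesis using z1(1) y unfolding ord_def P_def by blast
    next
      case False
      obtain a' b' l' where y': "y = pr (pr a' b') l'" using P_node[OF y] by blast
      let ?Q = "\<lambda>i. i \<prec> k \<and> \<not> (i \<prec> l' \<and> beta a' b' i = beta p q i)"
      have "\<exists>i. ?Q i"
      proof (rule ccontr)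
        assume nq: "\<not> ?thesis"
        have "k \<preceq> l'" using nq less_irrefl num.not_less by blast
        then show False using nq False unfolding ext_def y' by blast
      qed
      then obtain i0 where i0: "?Q i0" by blast
      have "AD (\<lambda>e. ?Q (e 0))" by (intro ad)
      from least[of ?Q, OF this i0] obtain i where i: "?Q i" "\<And>j. j \<prec> i \<Longrightarrow> \<not> ?Q j" by blast
      have ji: "j \<prec> l' \<and> beta a' b' j = beta p q j" if "j \<prec> i" for j
        using i(2)[OF that] i(1) num.less_trans[OF that] by blast
      have "\<not> i \<prec> l' \<or> beta a b i \<prec> beta a' b' i"
      proof (rule ccontr)
        assume n: "\<not> ?thesis"
        then have "extv y p q i (beta a' b' i)" unfolding extv_def y' using ji by blast
        then have "\<not> beta a' b' i \<prec> beta p q i" using g i(1) y unfolding good_def by blast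
        then show False using n i(1) ab(3) num.less_linear by metis
      qed
      moreover have "beta a b j = beta a' b' j" if "j \<prec> i" for j
        using ab(3)[of j] ji[OF that] i(1) num.less_trans[OF that] by metis
      ultimately have "kb z1 y" unfolding ab(1) y' kb_iff using i(1) l ji by blast
      then show ?thesis using z1(1) y unfolding ord_def P_def by blast
    qed
    then show False using nomin[of z1] z1(1) unfolding P_def by blast
  qed
  have ex: "\<exists>p q. good p q k" for k
  proof (induction k rule: ind)
    case AD show ?case unfolding good_def P_def ext_def extv_def by (intro ad Z)
  next
    case zero
    obtain a b l where "z\<^sub>0 = pr (pr a b) l" using P_node ne unfolding P_def by blast
    then have "ext z\<^sub>0 a b \<zero>" unfolding ext_def using not_less_0 zero_le by blast
    then show ?case unfolding good_def P_def using ne not_less_0 by blast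
  next
    case (suc k)
    then obtain p q where g: "good p q k" by blast
    obtain z1 v1 where zv: "P z1 \<and> extv z1 p q k v1" using step[OF g] by blast
    have "AD (\<lambda>e. \<exists>z. P z \<and> extv z p q k (e 0))" unfolding P_def extv_def by (intro ad Z)
    moreover have "\<exists>z. P z \<and> extv z p q k v1" using zv by blast
    ultimately have "\<exists>v. (\<exists>z. P z \<and> extv z p q k v) \<and> (\<forall>w. w \<prec> v \<longrightarrow> \<not> (\<exists>z. P z \<and> extv z p q k w))"
      using least[of "\<lambda>v. \<exists>z. P z \<and> extv z p q k v"] by blast
    then obtain v z where
      v: "P z" "extv z p q k v" "\<And>w. w \<prec> v \<Longrightarrow> \<not> (\<exists>z. P z \<and> extv z p q k w)" by blast
    obtain p' q' where p': "\<And>i. i \<prec> k \<Longrightarrow> beta p' q' i = beta p q i" "beta p' q' k = v"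
      using beta_append by metis
    have "extv z p' q' k v" using v(2) extv_cong[of k p q p' q'] p'(1) by metis
    then have "ext z p' q' (k \<oplus> \<one>)" using ext_succ p'(2) by metis
    moreover have "\<not> (\<exists>z. P z \<and> extv z p' q' i w)" if "i \<prec> k \<oplus> \<one>" "w \<prec> beta p' q' i" for i w
    proof -
      have le: "i \<preceq> k" using that(1) by (simp add: less_succ_le)
      then have cong: "extv z p' q' i w \<longleftrightarrow> extv z p q i w" for z
        using p'(1) num.less_le_trans by (intro extv_cong) blast
      show ?thesis
      proof (cases "i = k")
        case True
        then show ?thesis using v(3) that(2) p'(2) unfolding cong by simp
      next
        case False
        then have "i \<prec> k" using le leM_def by blast
        then show ?thesis using g that(2) p'(1) unfolding cong good_def by metis
      qed
    qed
    ultimately show ?case unfolding good_def using v(1) by blast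
  qed
  have uniq1: "\<not> beta p q i \<prec> beta p' q' i"
    if g: "good p q k" "good p' q' k'" and i: "i \<prec> k" "i \<prec> k'"
      and eq: "\<And>j. j \<prec> i \<Longrightarrow> beta p q j = beta p' q' j" for p q k p' q' k' i
  proof
    assume lt: "beta p q i \<prec> beta p' q' i"
    obtain z where z: "P z" "ext z p q k" using g(1) unfolding good_def by blast
    have "extv z p' q' i (beta p q i)"
      using ext_v[OF z(2) i(1)] extv_cong[OF eq] by blast
    then show False using g(2) i(2) lt z(1) unfolding good_def by blast
  qed
  have uniq: "beta p q i = beta p' q' i" if g: "good p q k" "good p' q' k'" "i \<prec> k" "i \<prec> k'" for p q k p' q' k' i
  proof (rule ccontr)
    let ?Q = "\<lambda>i. i \<prec> k \<and> i \<prec> k' \<and> beta p q i \<noteq> beta p' q' i"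
    assume "beta p q i \<noteq> beta p' q' i"
    then have q: "?Q i" using that by blast
    have "AD (\<lambda>e. ?Q (e 0))" by (intro ad)
    from least[of ?Q, OF this q] obtain i where i: "?Q i" "\<And>j. j \<prec> i \<Longrightarrow> \<not> ?Q j" by blast
    have j: "beta p q j = beta p' q' j" if "j \<prec> i" for j
      using i(2)[OF that] i(1) num.less_trans[OF that] by blast
    then show False
      using uniq1[OF g(1,2), of i] uniq1[OF g(2,1), of i] i(1) num.less_linear by metis
  qed
  \<comment> \<open>Good starts agree wherever two of them are defined, so the limit is definable
    from \<open>Z\<close> by number quantifiers alone.\<close>
  define G where "G i = (THE v. \<exists>p q. good p q (i \<oplus> \<one>) \<and> v = beta p q i)" for i
  have lt: "i \<prec> i \<oplus> \<one>" for i by (simp add: less_succ)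
  have G: "G i = beta p q i" if g: "good p q k" "i \<prec> k" for p q k i
  proof -
    obtain p' q' where g': "good p' q' (i \<oplus> \<one>)" using ex by blast
    have "G i = beta p' q' i"
      unfolding G_def
    proof (rule the_equality)
      show "\<exists>p q. good p q (i \<oplus> \<one>) \<and> beta p' q' i = beta p q i" using g' by blast
      show "v = beta p' q' i" if "\<exists>p q. good p q (i \<oplus> \<one>) \<and> v = beta p q i" for v
        using that uniq[OF _ g' lt lt] by blast
    qed
    then show ?thesis using uniq[OF g' g(1) lt g(2)] by simp
  qed
  have AD_G: "AD (\<lambda>e. e 0 = G (e 1))"
  proof -
    have "(v = G i) \<longleftrightarrow> (\<exists>p q. good p q (i \<oplus> \<one>) \<and> v = beta p q i)" for v i
      using ex G[OF _ lt] by metis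
    moreover have "AD (\<lambda>e. \<exists>p q. good p q (e 1 \<oplus> \<one>) \<and> e 0 = beta p q (e 1))"
      unfolding good_def P_def ext_def extv_def by (intro ad Z)
    ultimately show ?thesis by simp
  qed
  have nodes: "\<exists>a b l. nod x a b l \<and> k \<preceq> l \<and> (\<forall>j. j \<prec> k \<longrightarrow> beta a b j = G j)" for k
  proof -
    obtain p q where g: "good p q k" using ex by blast
    then obtain z where z: "P z" "ext z p q k" unfolding good_def by blast
    then obtain a b l where abl: "z = pr (pr a b) l" "k \<preceq> l" "\<And>j. j \<prec> k \<Longrightarrow> beta a b j = beta p q j"
      unfolding ext_def by blast
    have "nod x a b l" using P_node[OF z(1)] unfolding abl(1) pr_inj by blast
    then show ?thesis using abl(2,3) G[OF g] by metis
  qed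
  have "satb u r" if u: "u N = x" and c: "(ps, r) \<in> set cls"
    and prem: "\<forall>(t, v)\<in>set ps. ev M u v = G (ev M u t)" for u ps r
  proof -
    \<comment> \<open>A clause involves only finitely many values and positions, so a sufficiently
      long node already tests it.\<close>
    obtain k where k: "\<forall>y\<in>u ` {..<N} \<union> (\<lambda>(t, v). ev M u t) ` set ps. y \<prec> k"
      using finite_bound[of "u ` {..<N} \<union> (\<lambda>(t, v). ev M u t) ` set ps"] by auto
    obtain a b l where abl: "nod x a b l" "k \<preceq> l" "\<And>j. j \<prec> k \<Longrightarrow> beta a b j = G j" using nodes by blast
    have "u i \<prec> l" if "i < N" for i using k that abl(2) num.less_le_trans by blast
    moreover have "ev M u t \<prec> l \<and> ev M u v = beta a b (ev M u t)" if "(t, v) \<in> set ps" for t v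
    proof -
      have tk: "ev M u t \<prec> k" using k that by fastforce
      then have "ev M u t \<prec> l" using abl(2) by (rule num.less_le_trans)
      then show ?thesis using abl(3)[OF tk] bspec[OF prem that] by simp
    qed
    ultimately show ?thesis using abl(1) u c unfolding node_def by blast
  qed
  then show ?thesis using AD_G unfolding path_def by blast
qed

lemma path_nodes:
  assumes G: "path N cls x G" and eq: "\<And>j. j \<prec> l \<Longrightarrow> beta a b j = G j"
  shows "nod x a b l"
  unfolding node_def
proof (intro allI impI, elim conjE)
  fix u ps r assume u: "u N = x" "\<forall>i<N. u i \<prec> l" and c: "(ps, r) \<in> set cls"
    and prem: "\<forall>(t, v)\<in>set ps. ev M u t \<prec> l \<and> ev M u v = beta a b (ev M u t)"
  have "\<forall>(t, v)\<in>set ps. ev M u v = G (ev M u t)"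
    using prem eq by fastforce
  then show "satb u r" using G u(1) c unfolding path_def by blast
qed

text \<open>The empty sequence has a code for every \<open>a\<close> and \<open>b\<close>, so there
  are many roots.\<close>

definition isroot :: "'a \<Rightarrow> bool" where
  "isroot s \<longleftrightarrow> (\<exists>a b. s = pr (pr a b) \<zero>)"

text \<open>The initial segments of a path form a descending set below the root.\<close>

lemma path_descends:
  assumes G: "path N cls x G"
  obtains Z z where "Z \<in> ssets M" "z \<in> Z" "\<And>z. z \<in> Z \<Longrightarrow> le x z z \<and> \<not> isroot z \<and> (\<exists>y\<in>Z. le x y z \<and> y \<noteq> z)"
proof -
  have [ad]: "FD F \<Longrightarrow> FD (\<lambda>e. G (F e))" for F
    using FD_fun1 G unfolding path_def by blast
  \<comment> \<open>Length zero is excluded, since the embeddings that will be applied to these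
    nodes ignore the roots.\<close>
  define Q where "Q s \<longleftrightarrow> (\<exists>a b l. s = pr (pr a b) l \<and> l \<noteq> \<zero> \<and> (\<forall>j. j \<prec> l \<longrightarrow> beta a b j = G j))" for s
  have "AD (\<lambda>e. Q (e 0))" unfolding Q_def by (intro ad)
  then have Z: "{s. Q s} \<in> ssets M" by (rule comprehension)
  have ex: "\<exists>a b. \<forall>j. j \<prec> l \<longrightarrow> beta a b j = G j" for l
    using G beta_exists unfolding path_def by blast
  have isn: "isnode N cls x (pr (pr a b) l)" if "\<And>j. j \<prec> l \<Longrightarrow> beta a b j = G j" for a b l
    using path_nodes[OF G that] unfolding isnode_def by blast
  obtain a b where ab: "\<forall>j. j \<prec> \<one> \<longrightarrow> beta a b j = G j" using ex by blast
  show ?thesis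
  proof (rule that[OF Z])
    from ab have "Q (pr (pr a b) \<one>)" unfolding Q_def by (metis num.zero_neq_one)
    then show "pr (pr a b) \<one> \<in> {s. Q s}" by simp
  next
    fix z assume "z \<in> {s. Q s}"
    then obtain a b l where z: "z = pr (pr a b) l" "l \<noteq> \<zero>" "\<And>j. j \<prec> l \<Longrightarrow> beta a b j = G j"
      unfolding Q_def by blast
    obtain a' b' where ab': "\<And>j. j \<prec> l \<oplus> \<one> \<Longrightarrow> beta a' b' j = G j" using ex by blast
    let ?y = "pr (pr a' b') (l \<oplus> \<one>)"
    have "Q ?y" unfolding Q_def using ab' succ_ne by metis
    have lt: "l \<prec> l \<oplus> \<one>" by (simp add: less_succ)
    have "j \<prec> l \<oplus> \<one>" if "j \<prec> l" for j using that lt by (rule num.less_trans)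
    then have "kb ?y z"
      unfolding z(1) kb_iff using lt less_irrefl z(3) ab' by (intro exI[of _ l]) auto
    then have "le x ?y z" unfolding ord_def using isn[OF ab'] isn[OF z(3)] z(1) by blast
    moreover have "?y \<noteq> z" unfolding z(1) pr_inj using lt less_irrefl by metis
    moreover have "\<not> isroot z" unfolding isroot_def z(1) pr_inj using z(2) by blast
    ultimately show "le x z z \<and> \<not> isroot z \<and> (\<exists>y\<in>{s. Q s}. le x y z \<and> y \<noteq> z)"
      using ord_refl \<open>Q ?y\<close> by blast
  qed
qed

end

section \<open>Kleene normal form\<close>

text \<open>
  A truth table for the subformulas of an arithmetical formula is a function on numbers: at the code
  of a subformula together with a tuple of values it returns \<open>0\<close> for true, and for a false universal
  formula one plus a counterexample.  Being such a table is a universal condition.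
\<close>

primrec mb :: "fm \<Rightarrow> nat" where
  "mb (Eq s t) = max (bd_tm s) (bd_tm t)"
| "mb (Less s t) = max (bd_tm s) (bd_tm t)"
| "mb (Mem t i) = bd_tm t"
| "mb (Neg p) = mb p"
| "mb (Imp p q) = max (mb p) (mb q)"
| "mb (All0 p) = mb p"
| "mb (All1 p) = mb p"

lemma bd0_le_mb: "bd0 p \<le> mb p"
  by (induction p) auto

primrec tup :: "tm list \<Rightarrow> tm" where
  "tup [] = Zero"
| "tup (t # ts) = qpair t (tup ts)"

text \<open>The successor keeps tag 0 free for the set: the entry at the pair of 0 and
  \<open>t\<close> is zero exactly when \<open>t\<close> is a member.\<close>

definition tag :: "fm \<Rightarrow> tm" where "tag q = num (Suc (fcode q))"
definition idx :: "fm \<Rightarrow> tm list \<Rightarrow> tm" where "idx q ts = qpair (tag q) (tup ts)"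
definition BIff :: "bfm \<Rightarrow> bfm \<Rightarrow> bfm" where "BIff b c = BConj (BImp b c) (BImp c b)"
definition BZ :: "nat \<Rightarrow> bfm" where "BZ i = BEq (Var i) Zero"

abbreviation vars :: "nat \<Rightarrow> tm list" where "vars D \<equiv> map Var [0..<D]"

text \<open>The first \<open>D\<close> variables hold the values of the number variables, variable
  \<open>D\<close> holds an instance of a quantifier, and the next three hold the table entries that
  are looked up; variable \<open>D + 4\<close> is kept for the parameter. In the quantifier case the
  instance is put in front of the tuple and the last value is dropped, which is safe because
  \<open>mb\<close> counts the variables under quantifiers too.\<close>

primrec cls :: "nat \<Rightarrow> fm \<Rightarrow> clause list" where
  "cls D (Eq s t) = [([(idx (Eq s t) (vars D), Var (D + 1))], BIff (BZ (D + 1)) (BEq s t))]"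
| "cls D (Less s t) = [([(idx (Less s t) (vars D), Var (D + 1))], BIff (BZ (D + 1)) (BLess s t))]"
| "cls D (Mem t i) = [([(idx (Mem t i) (vars D), Var (D + 1)), (qpair Zero t, Var (D + 2))],
     BIff (BZ (D + 1)) (BZ (D + 2)))]"
| "cls D (Neg p) = ([(idx (Neg p) (vars D), Var (D + 1)), (idx p (vars D), Var (D + 2))],
     BIff (BZ (D + 1)) (BNeg (BZ (D + 2)))) # cls D p"
| "cls D (Imp p q) = ([(idx (Imp p q) (vars D), Var (D + 1)), (idx p (vars D), Var (D + 2)),
     (idx q (vars D), Var (D + 3))], BIff (BZ (D + 1)) (BImp (BZ (D + 2)) (BZ (D + 3)))) # cls D p @ cls D q"
| "cls D (All0 p) = ([(idx (All0 p) (vars D), Var (D + 1)), (idx p (Var D # vars (D - 1)), Var (D + 2))],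
     BConj (BImp (BZ (D + 1)) (BZ (D + 2)))
       (BImp (BEq (Var (D + 1)) (Add (Var D) One)) (BNeg (BZ (D + 2))))) # cls D p"
| "cls D (All1 p) = []"

text \<open>The leading clause makes \<open>p\<close> false at the parameter. The paths are thus the
  counterexamples, each consisting of a set together with a table of truth values.\<close>

definition KN :: "nat \<Rightarrow> fm \<Rightarrow> clause list" where
  "KN D p = ([(idx p (Var (D + 4) # replicate (D - 1) Zero), Var (D + 1))], BNeg (BZ (D + 1))) # cls D p"

lemma bd_tm_num [simp]: "bd_tm (num n) = 0"
  by (induction n) auto

lemma bd_tm_qpair [simp]: "bd_tm (qpair s t) = max (bd_tm s) (bd_tm t)"
  by (auto simp: qpair_def)

lemma bd_tm_tup: "bd_tm (tup ts) \<le> n \<longleftrightarrow> (\<forall>t\<in>set ts. bd_tm t \<le> n)"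
  by (induction ts) auto

lemma bd_tm_idx: "bd_tm (idx q ts) \<le> n \<longleftrightarrow> (\<forall>t\<in>set ts. bd_tm t \<le> n)"
  by (simp add: idx_def tag_def bd_tm_tup)

lemma bdb_simps [simp]:
  "bdb (BIff b c) = max (bdb b) (bdb c)" "bdb (BZ i) = i + 1" "bdb (BConj b c) = max (bdb b) (bdb c)"
  "bdb (BEq s t) = max (bd_tm s) (bd_tm t)"
  by (auto simp: BIff_def BZ_def BConj_def BEq_def)

lemma cls_bd: "mb q \<le> D \<Longrightarrow> \<forall>c\<in>set (cls D q). clause_bd (D + 5) c"
  by (induction q) (auto simp: clause_bd_def bd_tm_idx)

lemma KN_bd: "mb p \<le> D \<Longrightarrow> \<forall>c\<in>set (KN D p). clause_bd (Suc (D + 4)) c"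
proof -
  assume p: "mb p \<le> D"
  have eq: "Suc (D + 4) = D + 5" by simp
  have "clause_bd (D + 5) ([(idx p (Var (D + 4) # replicate (D - 1) Zero), Var (D + 1))], BNeg (BZ (D + 1)))"
    by (simp add: clause_bd_def bd_tm_idx)
  then show ?thesis unfolding eq KN_def using cls_bd[OF p] by simp
qed

primrec subs :: "fm \<Rightarrow> fm set" where
  "subs (Eq s t) = {Eq s t}"
| "subs (Less s t) = {Less s t}"
| "subs (Mem t i) = {Mem t i}"
| "subs (Neg p) = insert (Neg p) (subs p)"
| "subs (Imp p q) = insert (Imp p q) (subs p \<union> subs q)"
| "subs (All0 p) = insert (All0 p) (subs p)"
| "subs (All1 p) = {}"

lemma finite_subs: "finite (subs p)"
  by (induction p) auto

lemma subs_self: "arithmetical p \<Longrightarrow> p \<in> subs p"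
  by (cases p) auto

lemma subs_arithmetical: "q \<in> subs p \<Longrightarrow> arithmetical p \<Longrightarrow> arithmetical q"
  by (induction p) auto

context aca
begin

lemma least_ex:
  assumes "AD (\<lambda>e. P (e 0))" "P x" shows "\<exists>y. P y \<and> (\<forall>z. z \<prec> y \<longrightarrow> \<not> P z)"
  using least[OF assms] by metis

definition nm :: "nat \<Rightarrow> 'a" where "nm n = ev M (\<lambda>_. \<zero>) (num n)"

lemma ev_num [simp]: "ev M e (num n) = nm n"
  unfolding nm_def by (induction n) auto

lemma nm_simps: "nm 0 = \<zero>" "nm (Suc n) = nm n \<oplus> \<one>"
  unfolding nm_def by (simp_all del: ev_num)

lemma nm_inj: "nm i = nm j \<longleftrightarrow> i = j"
proof
  show "nm i = nm j \<Longrightarrow> i = j"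
  proof (induction i arbitrary: j)
    case 0
    then show ?case using succ_ne by (cases j) (auto simp: nm_simps)
  next
    case (Suc i)
    then show ?case using succ_ne succ_inj by (cases j) (auto simp: nm_simps)
  qed
qed simp

primrec tupv :: "'a list \<Rightarrow> 'a" where
  "tupv [] = \<zero>"
| "tupv (t # ts) = pr t (tupv ts)"

lemma ev_tup [simp]: "ev M e (tup ts) = tupv (map (ev M e) ts)"
  by (induction ts) auto

lemma ev_idx: "ev M e (idx q ts) = pr (nm (Suc (fcode q))) (tupv (map (ev M e) ts))"
  by (simp add: idx_def tag_def del: num.simps)

lemma satb_BIff [simp]: "satb e (BIff b c) \<longleftrightarrow> (satb e b \<longleftrightarrow> satb e c)"
  "satb e (BZ i) \<longleftrightarrow> e i = \<zero>"
  by (auto simp: BIff_def BZ_def)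

definition uf :: "'a \<Rightarrow> 'a" where "uf e = (if \<exists>a b. e = pr a b then (SOME a. \<exists>b. e = pr a b) else \<zero>)"
definition us :: "'a \<Rightarrow> 'a" where "us e = (if \<exists>a b. e = pr a b then (SOME b. \<exists>a. e = pr a b) else \<zero>)"

lemma uf_us_pr [simp]: "uf (pr a b) = a" "us (pr a b) = b"
  by (auto simp: uf_def us_def pr_inj)

text \<open>Zero is the pair of zeros, so a position beyond the end of a tuple reads as
  zero.\<close>

lemma uf_us_0 [simp]: "uf \<zero> = \<zero>" "us \<zero> = \<zero>"
proof -
  have "\<zero> = pr \<zero> \<zero>" by (simp add: pr_def mul_0 add_0)
  then show "uf \<zero> = \<zero>" "us \<zero> = \<zero>" by (metis uf_us_pr)+
qed

lemma FD_uf [ad]: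
  assumes "FD F" shows "FD (\<lambda>e. uf (F e))"
proof (rule FD_fun1[OF _ assms])
  have "(\<lambda>e :: nat \<Rightarrow> 'a. e 0 = uf (e 1)) =
      (\<lambda>e. (\<exists>b. e 1 = pr (e 0) b) \<or> \<not> (\<exists>a b. e 1 = pr a b) \<and> e 0 = \<zero>)"
  proof
    fix e :: "nat \<Rightarrow> 'a"
    show "(e 0 = uf (e 1)) = ((\<exists>b. e 1 = pr (e 0) b) \<or> \<not> (\<exists>a b. e 1 = pr a b) \<and> e 0 = \<zero>)"
    proof (cases "\<exists>a b. e 1 = pr a b")
      case True
      then obtain a b where "e 1 = pr a b" by blast
      then show ?thesis using pr_inj by auto
    qed (auto simp: uf_def)
  qed
  then show "AD (\<lambda>e. e 0 = uf (e 1))" by (simp only:) (intro ad)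
qed

lemma FD_us [ad]:
  assumes "FD F" shows "FD (\<lambda>e. us (F e))"
proof (rule FD_fun1[OF _ assms])
  have "(\<lambda>e :: nat \<Rightarrow> 'a. e 0 = us (e 1)) =
      (\<lambda>e. (\<exists>b. e 1 = pr b (e 0)) \<or> \<not> (\<exists>a b. e 1 = pr a b) \<and> e 0 = \<zero>)"
  proof
    fix e :: "nat \<Rightarrow> 'a"
    show "(e 0 = us (e 1)) = ((\<exists>b. e 1 = pr b (e 0)) \<or> \<not> (\<exists>a b. e 1 = pr a b) \<and> e 0 = \<zero>)"
    proof (cases "\<exists>a b. e 1 = pr a b")
      case True
      then obtain a b where "e 1 = pr a b" by blast
      then show ?thesis using pr_inj by auto
    qed (auto simp: us_def)
  qed
  then show "AD (\<lambda>e. e 0 = us (e 1))" by (simp only:) (intro ad)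
qed

primrec co :: "nat \<Rightarrow> 'a \<Rightarrow> 'a" where
  "co 0 e = uf e"
| "co (Suc i) e = co i (us e)"

lemma FD_co [ad]: "FD F \<Longrightarrow> FD (\<lambda>e. co i (F e))"
proof (induction i arbitrary: F)
  case 0
  then show ?case by (simp add: FD_uf)
next
  case (Suc i)
  have "FD (\<lambda>e. us (F e))" by (rule FD_us[OF Suc.prems])
  from Suc.IH[OF this] show ?case by simp
qed

lemma co_pr: "co i (pr n e) = (case i of 0 \<Rightarrow> n | Suc j \<Rightarrow> co j e)"
  by (cases i) auto

lemma co_tupv: "co i (tupv V) = (if i < length V then V ! i else \<zero>)"
proof (induction V arbitrary: i)
  case Nil
  show ?case by (induction i) auto
next
  case (Cons v V)
  then show ?case by (cases i) auto
qed

lemma FD_ev: "(\<And>i. FD (F i)) \<Longrightarrow> FD (\<lambda>e. ev M (\<lambda>i. F i e) t)"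
  by (induction t) (simp_all add: FD_const FD_add FD_mul)

text \<open>The recursion on \<open>q\<close> takes place outside the model, since \<open>q\<close>
  is an actual formula. In this way the truth of its subformulas at coded tuples becomes definable,
  although truth in general is not.\<close>

lemma AD_sats_fun:
  assumes E: "\<And>i. E i \<in> ssets M"
  shows "arithmetical q \<Longrightarrow> (\<And>i. FD (F i)) \<Longrightarrow> AD (\<lambda>e. sats M (\<lambda>i. F i e) E q)"
proof (induction q arbitrary: F)
  case (All0 q)
  define F' where "F' i = (case i of 0 \<Rightarrow> (\<lambda>e. e 0) | Suc j \<Rightarrow> (\<lambda>e. F j (\<lambda>i. e (Suc i))))" for i
  have "FD (F' i)" for i
    using All0.prems(2) by (cases i) (auto simp: F'_def intro: FD_var FD_ren)
  then have "AD (\<lambda>e. sats M (\<lambda>i. F' i e) E q)" using All0 by simp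
  moreover have "(\<lambda>i. F' i e) = case_nat (e 0) (\<lambda>i. F i (\<lambda>i. e (Suc i)))" for e
    by (auto simp: F'_def fun_eq_iff split: nat.splits)
  ultimately have "AD (\<lambda>e. \<forall>n. sats M (case_nat n (\<lambda>i. F i e)) E q)"
    by (intro AD_all) simp
  then show ?case by simp
qed (auto intro!: AD_eq AD_less AD_memb AD_neg AD_imp FD_ev E)

lemma AD_finite_ex: "finite S \<Longrightarrow> (\<And>q. q \<in> S \<Longrightarrow> AD (P q)) \<Longrightarrow> AD (\<lambda>e. \<exists>q\<in>S. P q e)"
proof (induction S rule: finite_induct)
  case empty
  then show ?case using AD_bool[of False] by simp
next
  case (insert q S)
  then have "AD (\<lambda>e. P q e \<or> (\<exists>q\<in>S. P q e))" by (intro AD_disj) auto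
  then show ?case by simp
qed

lemma app4 [simp]:
  assumes "length V = D"
  shows "app (V @ [n, a, b, c]) f D = n" "app (V @ [n, a, b, c]) f (Suc D) = a"
    "app (V @ [n, a, b, c]) f (D + 1) = a"
    "app (V @ [n, a, b, c]) f (D + 2) = b" "app (V @ [n, a, b, c]) f (D + 3) = c"
    "app (V @ [n, a, b, c]) f (D + 4) = f 0"
    "app (V @ [n, a, b, c]) f (Suc (Suc D)) = b" "app (V @ [n, a, b, c]) f (Suc (Suc (Suc D))) = c"
    "app (V @ [n, a, b, c]) f (Suc (Suc (Suc (Suc D)))) = f 0" "i < D \<Longrightarrow> app (V @ [n, a, b, c]) f i = V ! i"
    "map (app (V @ [n, a, b, c]) f) [0..<D] = V"
  using assms by (auto simp: app_def nth_append list_eq_iff_nth_eq numeral_eq_Suc)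

text \<open>The set is read off from the entries with tag 0. Induction on the subformulas then shows
  that an entry is zero exactly where the subformula is true, so the leading clause refutes
  \<open>p\<close>.\<close>

theorem KN_sound:
  assumes path: "path (D + 4) (KN D p) x G" and p: "arithmetical p" "mb p \<le> D" "0 < D" "bd0 p \<le> 1" "bd1 p \<le> 1"
  shows "\<exists>X\<in>ssets M. \<not> sats M (case_nat x e) (case_nat X E) p"
proof -
  define X where "X = {t. G (pr \<zero> t) = \<zero>}"
  have AG: "AD (\<lambda>e. e 0 = G (e 1))" using path unfolding path_def by blast
  have "AD (\<lambda>e. G (pr \<zero> (e 0)) = \<zero>)" by (intro ad FD_fun1[OF AG])
  then have X: "X \<in> ssets M" unfolding X_def by (rule comprehension)
  define W where "W q V = G (pr (nm (Suc (fcode q))) (tupv V))" for q V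
  have clause: "satb (app (V @ [n, a, b, c]) (\<lambda>_. x)) r"
    if "(ps, r) \<in> set (KN D p)" "length V = D"
      "\<forall>(t, v)\<in>set ps. ev M (app (V @ [n, a, b, c]) (\<lambda>_. x)) v = G (ev M (app (V @ [n, a, b, c]) (\<lambda>_. x)) t)"
    for ps r V n a b c
    using path that unfolding path_def by simp
  have W: "ev M (app (V @ [n, a, b, c]) f) (idx q (vars D)) = pr (nm (Suc (fcode q))) (tupv V)"
    if "length V = D" for V n a b c f q
    using that by (simp add: ev_idx o_def del: upt_Suc)
  let ?f = "\<lambda>_ :: nat. x"
  have evV: "ev M (app (V @ [n, a, b, c]) ?f) t = ev M (app V ?f) t" if "length V = D" "bd_tm t \<le> D" for V n a b c t
    using that by (intro ev_cong) (auto simp: app_def nth_append)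
  have truth: "W q V = \<zero> \<longleftrightarrow> sats M (app V ?f) (\<lambda>_. X) q"
    if "arithmetical q" "mb q \<le> D" "set (cls D q) \<subseteq> set (KN D p)" "length V = D" for q V
    using that
  proof (induction q arbitrary: V)
    case (Eq s t)
    have mem: "([(idx (Eq s t) (vars D), Var (D + 1))], BIff (BZ (D + 1)) (BEq s t)) \<in> set (KN D p)"
      using Eq(3) by simp
    have "satb (app (V @ [x, W (Eq s t) V, x, x]) ?f) (BIff (BZ (D + 1)) (BEq s t))"
      by (rule clause[OF mem]) (use Eq in \<open>simp_all add: W W_def del: fcode.simps\<close>)
    then show ?case using Eq by (simp add: evV)
  next
    case (Less s t)
    have mem: "([(idx (Less s t) (vars D), Var (D + 1))], BIff (BZ (D + 1)) (BLess s t)) \<in> set (KN D p)"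
      using Less(3) by simp
    have "satb (app (V @ [x, W (Less s t) V, x, x]) ?f) (BIff (BZ (D + 1)) (BLess s t))"
      by (rule clause[OF mem]) (use Less in \<open>simp_all add: W W_def del: fcode.simps\<close>)
    then show ?case using Less by (simp add: evV)
  next
    case (Mem t i)
    have mem: "([(idx (Mem t i) (vars D), Var (D + 1)), (qpair Zero t, Var (D + 2))], BIff (BZ (D + 1)) (BZ (D + 2))) \<in> set (KN D p)"
      using Mem(3) by simp
    have "satb (app (V @ [x, W (Mem t i) V, G (pr \<zero> (ev M (app V ?f) t)), x]) ?f) (BIff (BZ (D + 1)) (BZ (D + 2)))"
      by (rule clause[OF mem]) (use Mem in \<open>simp_all add: W W_def evV del: fcode.simps\<close>)
    then show ?case using Mem by (simp add: X_def)
  next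
    case (Neg q)
    have mem: "([(idx (Neg q) (vars D), Var (D + 1)), (idx q (vars D), Var (D + 2))], BIff (BZ (D + 1)) (BNeg (BZ (D + 2)))) \<in> set (KN D p)"
      using Neg.prems(3) by simp
    have "satb (app (V @ [x, W (Neg q) V, W q V, x]) ?f) (BIff (BZ (D + 1)) (BNeg (BZ (D + 2))))"
      by (rule clause[OF mem]) (use Neg.prems in \<open>simp_all add: W W_def del: fcode.simps\<close>)
    then show ?case using Neg by simp
  next
    case (Imp q r)
    have mem: "([(idx (Imp q r) (vars D), Var (D + 1)), (idx q (vars D), Var (D + 2)), (idx r (vars D), Var (D + 3))], BIff (BZ (D + 1)) (BImp (BZ (D + 2)) (BZ (D + 3)))) \<in> set (KN D p)"
      using Imp.prems(3) by simp
    have "satb (app (V @ [x, W (Imp q r) V, W q V, W r V]) ?f)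
        (BIff (BZ (D + 1)) (BImp (BZ (D + 2)) (BZ (D + 3))))"
      by (rule clause[OF mem]) (use Imp.prems in \<open>simp_all add: W W_def del: fcode.simps\<close>)
    then show ?case using Imp by simp
  next
    case (All0 q)
    let ?V = "\<lambda>n. n # take (D - 1) V"
    have len: "length (?V n) = D" for n using All0.prems(4) p(3) by simp
    have vars: "map (ev M (app (V @ [n, a, b, c]) ?f)) (Var D # vars (D - 1)) = ?V n" for n a b c
      using All0.prems(4) by (auto simp: list_eq_iff_nth_eq nth_Cons split: nat.splits)
    have cl: "satb (app (V @ [n, W (All0 q) V, W q (?V n), x]) ?f)
      (BConj (BImp (BZ (D + 1)) (BZ (D + 2))) (BImp (BEq (Var (D + 1)) (Add (Var D) One)) (BNeg (BZ (D + 2)))))" for n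
    proof (rule clause)
      show "([(idx (All0 q) (vars D), Var (D + 1)), (idx q (Var D # vars (D - 1)), Var (D + 2))],
        BConj (BImp (BZ (D + 1)) (BZ (D + 2))) (BImp (BEq (Var (D + 1)) (Add (Var D) One)) (BNeg (BZ (D + 2)))))
        \<in> set (KN D p)" using All0.prems(3) by simp
      show "length V = D" by (rule All0.prems(4))
      have 1: "ev M (app (V @ [n, a, b, c]) ?f) (idx q (Var D # vars (D - 1))) =
          pr (nm (Suc (fcode q))) (tupv (?V n))" for a b c
        unfolding ev_idx vars ..
      show "\<forall>(t, v)\<in>set [(idx (All0 q) (vars D), Var (D + 1)), (idx q (Var D # vars (D - 1)), Var (D + 2))].
        ev M (app (V @ [n, W (All0 q) V, W q (?V n), x]) ?f) v =
        G (ev M (app (V @ [n, W (All0 q) V, W q (?V n), x]) ?f) t)"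
        using All0.prems(4) by (simp add: 1 W W_def del: fcode.simps One_nat_def)
    qed
    then have cl: "(W (All0 q) V = \<zero> \<longrightarrow> W q (?V n) = \<zero>) \<and> (W (All0 q) V = n \<oplus> \<one> \<longrightarrow> W q (?V n) \<noteq> \<zero>)" for n
      using All0.prems(4) by simp
    have IH: "W q (?V n) = \<zero> \<longleftrightarrow> sats M (case_nat n (app V ?f)) (\<lambda>_. X) q" for n
    proof -
      have "W q (?V n) = \<zero> \<longleftrightarrow> sats M (app (?V n) ?f) (\<lambda>_. X) q"
        by (rule All0.IH) (use All0.prems len in auto)
      also have "\<dots> \<longleftrightarrow> sats M (case_nat n (app V ?f)) (\<lambda>_. X) q"
        using All0.prems(2,4) bd0_le_mb[of q] p(3)
        by (intro sats_cong refl) (auto simp: app_def nth_Cons split: nat.splits)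
      finally show ?thesis .
    qed
    show ?case
    proof (cases "W (All0 q) V = \<zero>")
      case True
      then show ?thesis using cl IH by simp
    next
      case False
      \<comment> \<open>A nonzero entry names its own counterexample: the second half of the clause
        applies at the predecessor.\<close>
      then obtain n where "W (All0 q) V = n \<oplus> \<one>" using zero_or_succ by blast
      then have "\<not> sats M (case_nat n (app V ?f)) (\<lambda>_. X) q" using cl IH by blast
      then show ?thesis using False by auto
    qed
  qed simp
  let ?V = "x # replicate (D - 1) \<zero>"
  have len: "length ?V = D" using p(3) by simp
  have "map (ev M (app (?V @ [x, a, x, x]) ?f)) (Var (D + 4) # replicate (D - 1) Zero) = ?V" for a
    using len by (simp add: map_replicate_const del: append_Cons)
  then have "satb (app (?V @ [x, W p ?V, x, x]) ?f) (BNeg (BZ (D + 1)))"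
    using len by (intro clause[of "[(idx p (Var (D + 4) # replicate (D - 1) Zero), Var (D + 1))]"])
      (simp_all add: KN_def ev_idx W_def del: append_Cons list.map)
  then have "W p ?V \<noteq> \<zero>" using len by (simp del: append_Cons)
  then have "\<not> sats M (app ?V ?f) (\<lambda>_. X) p"
    using truth[OF p(1,2) _ len] by (auto simp: KN_def)
  moreover have "sats M (app ?V ?f) (\<lambda>_. X) p = sats M (case_nat x e) (case_nat X E) p"
  proof (rule sats_cong)
    fix i assume "i < bd0 p"
    then have "i = 0" using p(4) by simp
    then show "app ?V ?f i = case_nat x e i" by (simp add: app_def)
  qed (use p(5) in \<open>auto split: nat.splits\<close>)
  ultimately show ?thesis using X by blast
qed

text \<open>Here the table is built from a counterexample. For a false universal subformula the
  least failing instance is entered, so that no choice is involved and the table is arithmetically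
  definable in the set.\<close>

theorem KN_complete:
  assumes X: "X \<in> ssets M" and false: "\<not> sats M (case_nat x e) (case_nat X E) p"
    and p: "arithmetical p" "mb p \<le> D" "0 < D" "bd0 p \<le> 1" "bd1 p \<le> 1"
  shows "\<exists>G. path (D + 4) (KN D p) x G"
proof -
  define T where "T q c \<longleftrightarrow> sats M (\<lambda>i. co i c) (\<lambda>_. X) q" for q c
  define VR where "VR q c v \<longleftrightarrow> T q c \<and> v = \<zero> \<or> \<not> T q c \<and> (case q of
      All0 r \<Rightarrow> (\<exists>n. v = n \<oplus> \<one> \<and> \<not> T r (pr n c) \<and> (\<forall>m. m \<prec> n \<longrightarrow> T r (pr m c))) | _ \<Rightarrow> v = \<one>)" for q c v
  have T: "AD (\<lambda>e. T q (F e))" if "arithmetical q" "FD F" for q F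
    unfolding T_def using that X by (intro AD_sats_fun FD_co) auto
  have VR: "AD (\<lambda>e. VR q (F e) (H e))" if "arithmetical q" "FD F" "FD H" for q F H
  proof (cases "\<exists>r. q = All0 r")
    case True
    then obtain r where q: "q = All0 r" by blast
    have "AD (\<lambda>e. VR q (e 0) (e 1))"
      unfolding VR_def q fm.case using that(1) by (intro ad T) (auto simp: q)
    then show ?thesis using that(2,3) by (rule AD_rel2)
  next
    case False
    then have "VR q c v \<longleftrightarrow> T q c \<and> v = \<zero> \<or> \<not> T q c \<and> v = \<one>" for c v
      unfolding VR_def by (cases q) auto
    then show ?thesis using that by (simp only:) (intro ad T)
  qed
  have T_All0: "T (All0 r) c \<longleftrightarrow> (\<forall>n. T r (pr n c))" for r c
  proof -
    have "(\<lambda>i. co i (pr n c)) = case_nat n (\<lambda>i. co i c)" for n by (simp add: co_pr fun_eq_iff)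
    then show ?thesis by (simp add: T_def)
  qed
  have VR_ex: "\<exists>v. VR q c v" if q: "arithmetical q" for q c
  proof (cases "\<exists>r. q = All0 r \<and> \<not> T q c")
    case True
    then obtain r where "q = All0 r" "\<not> T q c" by blast
    moreover from this obtain n where "\<not> T r (pr n c)" using T_All0 by blast
    ultimately have r: "q = All0 r" "\<not> T q c" "\<not> T r (pr n c)" by blast+
    have "AD (\<lambda>e. \<not> T r (pr (e 0) c))" using q r(1) by (intro ad T) auto
    from least_ex[where P = "\<lambda>n. \<not> T r (pr n c)", OF this r(3)]
    obtain k where "\<not> T r (pr k c)" "\<forall>m. m \<prec> k \<longrightarrow> T r (pr m c)" by blast
    then have "VR q c (k \<oplus> \<one>)" unfolding VR_def r(1) fm.case using r(1,2) by blast
    then show ?thesis ..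
  next
    case False
    then show ?thesis unfolding VR_def by (cases q) auto
  qed
  have VR_zero: "v = \<zero> \<longleftrightarrow> T q c" if "VR q c v" for q c v
    using that succ_ne num.zero_neq_one unfolding VR_def by (cases q) auto
  have VR_uniq: "v = w" if vw: "VR q c v" "VR q c w" for q c v w
  proof (cases "\<exists>r. q = All0 r \<and> \<not> T q c")
    case True
    then obtain r where r: "q = All0 r" "\<not> T q c" by blast
    have "\<exists>n. v = n \<oplus> \<one> \<and> \<not> T r (pr n c) \<and> (\<forall>m. m \<prec> n \<longrightarrow> T r (pr m c))" if "VR q c v" for v
      using that r unfolding VR_def r(1) fm.case by blast
    from this[OF vw(1)] this[OF vw(2)]
    obtain n k where nk: "v = n \<oplus> \<one>" "\<not> T r (pr n c)" "\<And>m. m \<prec> n \<Longrightarrow> T r (pr m c)"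
      "w = k \<oplus> \<one>" "\<not> T r (pr k c)" "\<And>m. m \<prec> k \<Longrightarrow> T r (pr m c)"
      by blast
    then show ?thesis using num.less_linear by metis
  next
    case False
    then show ?thesis using that unfolding VR_def by (cases q) auto
  qed
  define tg where "tg q = nm (Suc (fcode q))" for q
  have tg: "tg q \<noteq> \<zero>" "tg q = tg r \<longleftrightarrow> q = r" for q r
    unfolding tg_def nm_inj using fcode_inj nm_inj[of "Suc (fcode q)" 0] by (auto simp: nm_simps(1))
  \<comment> \<open>Positions that no clause looks up receive 0, to make the table a total
    function.\<close>
  define Gr where "Gr i v \<longleftrightarrow> (\<exists>t. i = pr \<zero> t \<and> v = (if t \<in> X then \<zero> else \<one>)) \<or>
     (\<exists>q\<in>subs p. \<exists>c. i = pr (tg q) c \<and> VR q c v) \<or>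
     \<not> ((\<exists>t. i = pr \<zero> t) \<or> (\<exists>q\<in>subs p. \<exists>c. i = pr (tg q) c)) \<and> v = \<zero>" for i v
  have sub: "arithmetical q" if "q \<in> subs p" for q using subs_arithmetical[OF that p(1)] .
  have Gr_set: "Gr (pr \<zero> t) v \<longleftrightarrow> v = (if t \<in> X then \<zero> else \<one>)" for t v
    unfolding Gr_def pr_inj by (simp add: tg(1) tg(1)[THEN not_sym])
  have Gr_sub: "Gr (pr (tg q) c) v \<longleftrightarrow> VR q c v" if "q \<in> subs p" for q c v
    unfolding Gr_def pr_inj tg(2) using that by (auto simp: tg(1))
  have Gr_ex: "\<exists>v. Gr i v" for i
  proof -
    consider t where "i = pr \<zero> t" | q c where "q \<in> subs p" "i = pr (tg q) c"
      | "\<not> ((\<exists>t. i = pr \<zero> t) \<or> (\<exists>q\<in>subs p. \<exists>c. i = pr (tg q) c))" by blast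
    then show ?thesis
    proof cases
      case 1 then show ?thesis using Gr_set by simp
    next
      case 2
      obtain v where "VR q c v" using VR_ex[OF sub[OF 2(1)]] by blast
      then show ?thesis using 2 Gr_sub by blast
    next
      case 3
      then have "Gr i \<zero>" unfolding Gr_def by blast
      then show ?thesis ..
    qed
  qed
  have Gr_uniq: "v = w" if vw: "Gr i v" "Gr i w" for i v w
  proof -
    consider t where "i = pr \<zero> t" | q c where "q \<in> subs p" "i = pr (tg q) c"
      | "\<not> ((\<exists>t. i = pr \<zero> t) \<or> (\<exists>q\<in>subs p. \<exists>c. i = pr (tg q) c))" by blast
    then show ?thesis
    proof cases
      case 1 then show ?thesis using vw Gr_set by simp
    next
      case 2 then show ?thesis using vw VR_uniq[of q c v w] Gr_sub[OF 2(1)] by simp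
    next
      case 3 then show ?thesis using vw unfolding Gr_def by blast
    qed
  qed
  define G where "G i = (THE v. Gr i v)" for i
  have G: "v = G i \<longleftrightarrow> Gr i v" for v i
  proof -
    obtain w where w: "Gr i w" using Gr_ex by blast
    then have "G i = w" unfolding G_def using Gr_uniq[OF _ w] by (rule the_equality)
    then show ?thesis using w Gr_uniq by blast
  qed
  have "AD (\<lambda>e. e 0 = G (e 1))"
    unfolding G Gr_def by (intro ad X AD_finite_ex finite_subs VR sub)
  moreover have "satb u r" if u: "u (D + 4) = x" and c: "(ps, r) \<in> set (KN D p)"
    and prem: "\<forall>(t, v)\<in>set ps. ev M u v = G (ev M u t)" for u ps r
  proof -
    let ?c = "tupv (map u [0..<D])" and ?c' = "tupv (u D # map u [0..<D - 1])"
    have look: "VR q (tupv (map (ev M u) ts)) (ev M u v)" if "q \<in> subs p" "(idx q ts, v) \<in> set ps" for q ts v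
    proof -
      have "ev M u v = G (ev M u (idx q ts))" using bspec[OF prem that(2)] by simp
      then have "Gr (pr (tg q) (tupv (map (ev M u) ts))) (ev M u v)"
        unfolding G unfolding ev_idx tg_def .
      then show ?thesis unfolding Gr_sub[OF that(1)] .
    qed
    have T_c: "T q ?c \<longleftrightarrow> sats M u (\<lambda>_. X) q" if "mb q \<le> D" for q
      unfolding T_def using that bd0_le_mb[of q] by (intro sats_cong) (auto simp: co_tupv)
    have T_c': "T q ?c' \<longleftrightarrow> T q (pr (u D) ?c)" if "mb q \<le> D" for q
      unfolding T_def using that bd0_le_mb[of q] p(3)
      by (intro sats_cong) (auto simp: co_tupv co_pr split: nat.splits)
    have ev_vars: "map (ev M u \<circ> Var) is = map u is" for "is" by simp
    have "satb u r" if "(ps, r) \<in> set (cls D q)" "subs q \<subseteq> subs p" "mb q \<le> D" for q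
      using that
    proof (induction q)
      case (Eq s t)
      have "VR (Eq s t) ?c (u (D + 1))" using look[of "Eq s t" "vars D" "Var (D + 1)"] Eq ev_vars by simp
      then show ?case using VR_zero T_c[OF Eq(3)] Eq(1) by auto
    next
      case (Less s t)
      have "VR (Less s t) ?c (u (D + 1))" using look[of "Less s t" "vars D" "Var (D + 1)"] Less ev_vars by simp
      then show ?case using VR_zero T_c[OF Less(3)] Less(1) by auto
    next
      case (Mem t i)
      have 1: "VR (Mem t i) ?c (u (D + 1))" using look[of "Mem t i" "vars D" "Var (D + 1)"] Mem ev_vars by simp
      have "(qpair Zero t, Var (D + 2)) \<in> set ps" using Mem(1) by simp
      from bspec[OF prem this] have "Gr (pr \<zero> (ev M u t)) (u (D + 2))" by (simp add: G)
      then have "u (D + 2) = \<zero> \<longleftrightarrow> ev M u t \<in> X" unfolding Gr_set by simp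
      then show ?case using VR_zero[OF 1] T_c[OF Mem(3)] Mem(1) by auto
    next
      case (Neg q)
      show ?case
      proof (cases "(ps, r) \<in> set (cls D q)")
        case True
        then show ?thesis using Neg by simp
      next
        case False
        then have ps: "ps = [(idx (Neg q) (vars D), Var (D + 1)), (idx q (vars D), Var (D + 2))]"
          and r: "r = BIff (BZ (D + 1)) (BNeg (BZ (D + 2)))" using Neg.prems(1) by simp_all
        have q: "Neg q \<in> subs p" "q \<in> subs p"
          using Neg.prems(2) sub[of "Neg q"] subs_self[of q] by auto
        have "VR (Neg q) ?c (u (D + 1))" "VR q ?c (u (D + 2))"
          using look[of "Neg q" "vars D" "Var (D + 1)"] look[of q "vars D" "Var (D + 2)"] q ps ev_vars by simp_all
        then show ?thesis using VR_zero T_c[of q] T_c[of "Neg q"] Neg.prems(3) by (auto simp: r)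
      qed
    next
      case (Imp q s)
      show ?case
      proof (cases "(ps, r) \<in> set (cls D q) \<union> set (cls D s)")
        case True
        then show ?thesis using Imp by auto
      next
        case False
        then have ps: "ps = [(idx (Imp q s) (vars D), Var (D + 1)), (idx q (vars D), Var (D + 2)),
              (idx s (vars D), Var (D + 3))]"
          and r: "r = BIff (BZ (D + 1)) (BImp (BZ (D + 2)) (BZ (D + 3)))" using Imp.prems(1) by auto
        have q: "Imp q s \<in> subs p" "q \<in> subs p" "s \<in> subs p"
          using Imp.prems(2) sub[of "Imp q s"] subs_self[of q] subs_self[of s] by auto
        have "VR (Imp q s) ?c (u (D + 1))" "VR q ?c (u (D + 2))" "VR s ?c (u (D + 3))"
          using look[of "Imp q s" "vars D" "Var (D + 1)"] look[of q "vars D" "Var (D + 2)"]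
            look[of s "vars D" "Var (D + 3)"] q ps ev_vars by simp_all
        then show ?thesis using VR_zero T_c[of q] T_c[of s] T_c[of "Imp q s"] Imp.prems(3) by (auto simp: r)
      qed
    next
      case (All0 q)
      show ?case
      proof (cases "(ps, r) \<in> set (cls D q)")
        case True
        then show ?thesis using All0 by simp
      next
        case False
        then have ps: "ps = [(idx (All0 q) (vars D), Var (D + 1)), (idx q (Var D # vars (D - 1)), Var (D + 2))]"
          and r: "r = BConj (BImp (BZ (D + 1)) (BZ (D + 2)))
            (BImp (BEq (Var (D + 1)) (Add (Var D) One)) (BNeg (BZ (D + 2))))" using All0.prems(1) by simp_all
        have q: "All0 q \<in> subs p" "q \<in> subs p"
          using All0.prems(2) sub[of "All0 q"] subs_self[of q] by auto
        have V: "VR (All0 q) ?c (u (D + 1))" "VR q ?c' (u (D + 2))"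
          using look[of "All0 q" "vars D" "Var (D + 1)"] look[of q "Var D # vars (D - 1)" "Var (D + 2)"]
            q ps ev_vars by simp_all
        have z: "u (D + 2) = \<zero> \<longleftrightarrow> T q (pr (u D) ?c)" using VR_zero[OF V(2)] T_c' All0.prems(3) by simp
        have "u (D + 1) = \<zero> \<longrightarrow> u (D + 2) = \<zero>"
          using VR_zero[OF V(1)] T_All0[of q ?c] z by blast
        moreover have "u (D + 1) = u D \<oplus> \<one> \<longrightarrow> u (D + 2) \<noteq> \<zero>"
        proof
          assume eq: "u (D + 1) = u D \<oplus> \<one>"
          then obtain n where "u (D + 1) = n \<oplus> \<one>" "\<not> T q (pr n ?c)"
            using V(1) succ_ne unfolding VR_def fm.case by metis
          then show "u (D + 2) \<noteq> \<zero>" using z eq succ_inj by metis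
        qed
        ultimately show ?thesis by (simp add: r)
      qed
    qed simp
    then have rec: "satb u r" if "(ps, r) \<in> set (cls D p)" using that p(2) by blast
    show ?thesis
    proof (cases "(ps, r) \<in> set (cls D p)")
      case False
      then have ps: "ps = [(idx p (Var (D + 4) # replicate (D - 1) Zero), Var (D + 1))]"
        and r: "r = BNeg (BZ (D + 1))" using c by (auto simp: KN_def)
      have V: "VR p (tupv (x # replicate (D - 1) \<zero>)) (u (D + 1))"
        using look[of p "Var (D + 4) # replicate (D - 1) Zero" "Var (D + 1)"] subs_self[OF p(1)] u
        by (simp add: ps map_replicate_const)
      have "T p (tupv (x # replicate (D - 1) \<zero>)) = sats M (case_nat x e) (case_nat X E) p"
        unfolding T_def
      proof (rule sats_cong)
        fix i assume "i < bd0 p"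
        then have "i = 0" using p(4) by simp
        then show "co i (tupv (x # replicate (D - 1) \<zero>)) = case_nat x e i" by simp
      qed (use p(5) in \<open>auto split: nat.splits\<close>)
      then show ?thesis using VR_zero[OF V] false by (simp add: r)
    qed (rule rec)
  qed
  ultimately show ?thesis unfolding path_def by blast
qed

end

section \<open>Contraction of set quantifiers\<close>

primrec contr :: "fm \<Rightarrow> fm" where
  "contr (Eq s t) = Eq s t"
| "contr (Less s t) = Less s t"
| "contr (Mem t j) = Mem (qpair (num j) t) 0"
| "contr (Neg p) = Neg (contr p)"
| "contr (Imp p q) = Imp (contr p) (contr q)"
| "contr (All0 p) = All0 (contr p)"
| "contr (All1 p) = All1 p"

lemma contr_simps:
  "arithmetical p \<Longrightarrow> arithmetical (contr p)" "arithmetical p \<Longrightarrow> bd0 (contr p) = bd0 p"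
  "arithmetical p \<Longrightarrow> bd1 (contr p) \<le> 1"
  by (induction p) auto

context aca
begin

lemma sats_contr: "arithmetical p \<Longrightarrow>
   sats M e (case_nat Z E) (contr p) \<longleftrightarrow> sats M e (\<lambda>j. {t. pr (nm j) t \<in> Z}) p"
  by (induction p arbitrary: e) auto

lemma section_in: "Z \<in> ssets M \<Longrightarrow> {t. pr c t \<in> Z} \<in> ssets M"
  by (rule comprehension) (intro ad)

lemma collect_sets:
  assumes "\<And>j. E j \<in> ssets M"
  shows "\<exists>Z\<in>ssets M. \<forall>j<m. {t. pr (nm j) t \<in> Z} = E j"
proof -
  have "AD (\<lambda>e. \<exists>j\<in>{..<m}. \<exists>t. e 0 = pr (nm j) t \<and> t \<in> E j)"
    by (intro AD_finite_ex ad assms) auto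
  then have "{z. \<exists>j\<in>{..<m}. \<exists>t. z = pr (nm j) t \<and> t \<in> E j} \<in> ssets M" by (rule comprehension)
  then show ?thesis by (rule bexI[rotated]) (auto simp: pr_inj nm_inj)
qed

text \<open>Every set variable is read as a section of one set, and finitely many sets can be
  collected into one. A formula with several existential set quantifiers is thereby brought into the
  shape demanded by \<open>Sigma11\<close>.\<close>

lemma sats_contr_iff:
  assumes p: "arithmetical p"
  shows "(\<exists>Z\<in>ssets M. sats M e (case_nat Z E') (contr p)) \<longleftrightarrow> (\<exists>E. (\<forall>j. E j \<in> ssets M) \<and> sats M e E p)"
proof
  assume "\<exists>E. (\<forall>j. E j \<in> ssets M) \<and> sats M e E p"
  then obtain E where E: "\<And>j. E j \<in> ssets M" "sats M e E p" by blast
  from collect_sets[where E = E and m = "bd1 p", OF E(1)]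
  obtain Z where Z: "Z \<in> ssets M" "\<forall>j<bd1 p. {t. pr (nm j) t \<in> Z} = E j" ..
  have "sats M e (\<lambda>j. {t. pr (nm j) t \<in> Z}) p = sats M e E p"
    by (rule sats_cong) (use Z(2) in simp_all)
  with E(2) have "sats M e (\<lambda>j. {t. pr (nm j) t \<in> Z}) p" by simp
  then show "\<exists>Z\<in>ssets M. sats M e (case_nat Z E') (contr p)"
    using Z(1) sats_contr[OF p] by blast
next
  assume "\<exists>Z\<in>ssets M. sats M e (case_nat Z E') (contr p)"
  then obtain Z where Z: "Z \<in> ssets M" "sats M e (\<lambda>j. {t. pr (nm j) t \<in> Z}) p"
    using sats_contr[OF p] by blast
  then show "\<exists>E. (\<forall>j. E j \<in> ssets M) \<and> sats M e E p"
    by (intro exI[of _ "\<lambda>j. {t. pr (nm j) t \<in> Z}"] conjI allI section_in)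
qed

end

section \<open>Well-orders of trees and embeddings between them\<close>

lemma bdb_le [simp]:
  "bdb (BConj p q) \<le> n \<longleftrightarrow> bdb p \<le> n \<and> bdb q \<le> n"
  "bdb (BDisj p q) \<le> n \<longleftrightarrow> bdb p \<le> n \<and> bdb q \<le> n"
  "bdb (BEx t p) \<le> n \<longleftrightarrow> bd_tm t \<le> n \<and> bdb p \<le> Suc n"
  "bdb (BAll t p) \<le> n \<longleftrightarrow> bd_tm t \<le> n \<and> bdb p \<le> Suc n"
  by (auto simp: BConj_def BDisj_def BEx_def)

declare bdb.simps(4) [simp del]

lemma bdb_BConjs: "(\<And>p. p \<in> set ps \<Longrightarrow> bdb p \<le> n) \<Longrightarrow> bdb (BConjs ps) \<le> n"
  by (induction ps) (auto simp: BConjs_def)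

lemma bd_lift: "bd_tm t \<le> n \<Longrightarrow> bd_tm (lift_tm 0 t) \<le> Suc n"
  using bd_tm_lift[of t] by simp

lemma bdb_Bbeta: "bd_tm a \<le> n \<Longrightarrow> bd_tm b \<le> n \<Longrightarrow> bd_tm i \<le> n \<Longrightarrow> bd_tm v \<le> n \<Longrightarrow> bdb (Bbeta a b i v) \<le> n"
  using bd_lift[of a n] bd_lift[of b n] bd_lift[of i n] bd_lift[of v n]
  by (simp add: Bbeta_def Bmod_def)

lemma bdb_Bcmp:
  assumes "bd_tm a \<le> n" "bd_tm b \<le> n" "bd_tm a' \<le> n" "bd_tm b' \<le> n" "bd_tm j \<le> n"
    and "bdb (r (Var 1) (Var 0)) \<le> 2"
  shows "bdb (Bcmp r a b a' b' j) \<le> n"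
  using assms bd_lift[OF assms(1)] bd_lift[OF assms(2)] bd_lift[OF bd_lift[OF assms(3)]]
    bd_lift[OF bd_lift[OF assms(4)]] bd_lift[OF assms(5)] bd_lift[OF bd_lift[OF assms(5)]] bd_lift[OF assms(4)]
  unfolding Bcmp_def by (simp add: Bmod_def bdb_Bbeta)

lemma bdb_ball: "j < n \<Longrightarrow> bdb p \<le> n + k \<Longrightarrow> bdb (ball k j p) \<le> n"
  by (induction k arbitrary: j n) auto

lemma bdb_clauseF:
  assumes "clause_bd m c" "m \<le> n" "a < n" "b < n" "l < n" shows "bdb (clauseF a b l c) \<le> n"
proof -
  obtain ps r where c: "c = (ps, r)" by (cases c)
  have "bdb (BConjs (map (\<lambda>(t, v). BConj (BLess t (Var l)) (Bbeta (Var a) (Var b) t v)) ps)) \<le> n"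
  proof (rule bdb_BConjs)
    fix q assume "q \<in> set (map (\<lambda>(t, v). BConj (BLess t (Var l)) (Bbeta (Var a) (Var b) t v)) ps)"
    then obtain t v where tv: "(t, v) \<in> set ps" "q = BConj (BLess t (Var l)) (Bbeta (Var a) (Var b) t v)" by auto
    then have "bd_tm t \<le> n" "bd_tm v \<le> n" using assms(1,2) unfolding c clause_bd_def by fastforce+
    then show "bdb q \<le> n" using assms(3-5) by (simp add: tv(2) bdb_Bbeta)
  qed
  moreover have "bdb r \<le> n" using assms(1,2) by (simp add: c clause_bd_def)
  ultimately show ?thesis by (simp add: c clauseF_def)
qed

lemma bdb_nodeF:
  assumes "\<forall>c\<in>set cs. clause_bd (Suc N) c" "x < n" "a < n" "b < n" "l < n"
  shows "bdb (nodeF N cs x a b l) \<le> n"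
proof -
  have "bdb (BConjs (map (clauseF (N + Suc a) (N + Suc b) (N + Suc l)) cs)) \<le> Suc n + N"
    using assms by (intro bdb_BConjs) (auto intro!: bdb_clauseF[where m = "Suc N"])
  then show ?thesis using assms(2,5) unfolding nodeF_def by (simp add: bdb_ball)
qed

lemma bdb_ordF: "\<forall>c\<in>set cs. clause_bd (Suc N) c \<Longrightarrow> bdb (ordF N cs) \<le> 3"
  unfolding ordF_def BDec_def
  by (simp, intro bdb_BConjs) (auto simp: bdb_nodeF intro!: bdb_BConjs bdb_Bcmp)

section \<open>Kleene-Brouwer orders as programs, embeddings as sets\<close>

primrec numf :: "nat \<Rightarrow> recf" where
  "numf 0 = ZeroF"
| "numf (Suc n) = Comp SuccF [numf n]"

text \<open>One more than \<open>mb p\<close> keeps the tuple nonempty. The four further variables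
  are the quantifier instance and the three table entries of \<open>cls\<close>, so the parameter
  gets the index \<open>width p\<close>.\<close>

definition width :: "fm \<Rightarrow> nat" where "width p = Suc (mb p) + 4"
definition tree :: "fm \<Rightarrow> clause list" where "tree p = KN (Suc (mb p)) p"

lemma tree_bd: "\<forall>c\<in>set (tree p). clause_bd (Suc (width p)) c"
  using KN_bd[of p "Suc (mb p)"] by (simp add: tree_def width_def)

text \<open>\<open>WO_fm\<close> speaks about a program in two arguments, so the parameter is built
  in as a constant program. Nonstandard parameters are reached only through
  \<open>ordfm\<close>.\<close>

definition prog :: "fm \<Rightarrow> nat \<Rightarrow> recf" where
  "prog p n = Comp (comp_bfm (ordF (width p) (tree p))) [numf n, Proj 0, Proj 1]"

definition matrix :: "fm \<Rightarrow> bool" where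
  "matrix p \<longleftrightarrow> arithmetical p \<and> bd0 p \<le> 1 \<and> bd1 p \<le> 1"

definition rootF :: "tm \<Rightarrow> fm" where
  "rootF t = Ex0 (Ex0 (Eq (up 2 t) (qpair (qpair (Var 1) (Var 0)) Zero)))"

definition ordfm :: "fm \<Rightarrow> tm list \<Rightarrow> fm" where
  "ordfm p ts = psub (app ts Var) (\<lambda>i. i) (to_fm (ordF (width p) (tree p)))"

text \<open>
  The set variable codes, for each \<open>x\<close> with property \<open>C\<close>, an embedding of the Kleene-Brouwer order of the
  tree for \<open>p\<close> at \<open>x\<close>, with the roots removed, into the order decided by \<open>g\<close>.
\<close>

definition embF :: "fm \<Rightarrow> fm \<Rightarrow> recf \<Rightarrow> fm" where
  "embF p C g = All0 (Imp C (Conj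
     (All0 (Imp (Conj (ordfm p [Var 1, Var 0, Var 0]) (Neg (rootF (Var 0))))
       (Ex0 (Conj (Mem (qpair (qpair (Var 2) (Var 1)) (Var 0)) 0) (graph_fm g [Var 0, Var 0] One)))))
     (All0 (All0 (All0 (All0 (Imp (conjs [ordfm p [Var 4, Var 3, Var 2], Neg (Eq (Var 3) (Var 2)),
         Neg (rootF (Var 2)), Mem (qpair (qpair (Var 4) (Var 3)) (Var 1)) 0,
         Mem (qpair (qpair (Var 4) (Var 2)) (Var 0)) 0])
       (Conj (graph_fm g [Var 1, Var 0] One) (Neg (Eq (Var 1) (Var 0)))))))))))"

lemma arithmetical_embF: "arithmetical C \<Longrightarrow> arithmetical (embF p C g)"
  by (simp add: embF_def rootF_def ordfm_def)

context aca
begin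

lemma kb: "kb_tree M (width p) (tree p)"
  using tree_bd by (intro kb_tree.intro aca_axioms kb_tree_axioms.intro)

lemma rep_numf: "rep (numf n) k (\<lambda>ts. nm n)"
proof (induction n)
  case 0
  show ?case using rep_ZeroF by (simp add: nm_simps)
next
  case (Suc n)
  show ?case using rep_Comp1[OF rep_SuccF Suc] by (simp add: nm_simps)
qed

abbreviation "tord p \<equiv> ord (width p) (tree p)"

lemma gr_prog: "gr (prog p n) [s, t] v \<longleftrightarrow> v = bool01 (tord p (nm n) s t)"
proof -
  have b: "rep (comp_bfm (ordF (width p) (tree p))) 3 (\<lambda>ts. bool01 (satb (app ts (\<lambda>_. \<zero>)) (ordF (width p) (tree p))))"
    using bdb_ordF[OF tree_bd] by (rule rep_comp_bfm)
  have n: "gr (numf n) [s, t] w \<longleftrightarrow> w = nm n" for w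
    using rep_numf[of n 2] by (simp add: rep_def)
  have "gr (prog p n) [s, t] v \<longleftrightarrow> gr (comp_bfm (ordF (width p) (tree p))) [nm n, s, t] v"
    by (simp add: prog_def list_all2_Cons1 n)
  also have "\<dots> \<longleftrightarrow> v = bool01 (tord p (nm n) s t)"
    using b by (simp add: rep_def satb_ordF[OF tree_bd] app_def)
  finally show ?thesis .
qed

lemma sats_WO_fm:
  "sats M e E (WO_fm f) \<longleftrightarrow>
    (\<forall>a b c. (gr f [a, b] \<one> \<longrightarrow> gr f [a, a] \<one> \<and> gr f [b, b] \<one>) \<and>
      (gr f [a, b] \<one> \<and> gr f [b, c] \<one> \<longrightarrow> gr f [a, c] \<one>) \<and>
      (gr f [a, b] \<one> \<and> gr f [b, a] \<one> \<longrightarrow> a = b) \<and>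
      (gr f [a, a] \<one> \<and> gr f [b, b] \<one> \<longrightarrow> gr f [a, b] \<one> \<or> gr f [b, a] \<one>)) \<and>
    (\<forall>X\<in>ssets M. (\<exists>x. x \<in> X \<and> gr f [x, x] \<one>) \<longrightarrow>
      (\<exists>x. (x \<in> X \<and> gr f [x, x] \<one>) \<and> (\<forall>y. y \<in> X \<and> gr f [y, y] \<one> \<longrightarrow> gr f [x, y] \<one>)))"
  by (simp add: WO_fm_def LO_fm_def WF_fm_def Let_def del: gr.simps)

text \<open>Linearity holds in every model, whether or not \<open>p\<close> is true. A set of nodes
  without least element would give a path and hence a set falsifying \<open>p\<close>.\<close>

theorem WO_prog:
  assumes p: "matrix p" and true: "\<And>X. X \<in> ssets M \<Longrightarrow> sats M (case_nat (nm n) e) (case_nat X E) p"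
  shows "sats M e' E' (WO_fm (prog p n))"
proof -
  have gr: "gr (prog p n) [s, t] \<one> \<longleftrightarrow> tord p (nm n) s t" for s t
    unfolding gr_prog by simp
  note k = kb[of p]
  have wf: "\<exists>x. (x \<in> X \<and> tord p (nm n) x x) \<and> (\<forall>y. y \<in> X \<and> tord p (nm n) y y \<longrightarrow> tord p (nm n) x y)"
    if X: "X \<in> ssets M" and ne: "\<exists>x. x \<in> X \<and> tord p (nm n) x x" for X
  proof (rule ccontr)
    assume no: "\<not> ?thesis"
    obtain z where z: "z \<in> X" "tord p (nm n) z z" using ne by blast
    have nomin: "\<exists>y\<in>X. tord p (nm n) y y \<and> \<not> tord p (nm n) s y" if "s \<in> X" "tord p (nm n) s s" for s
      using no that by blast
    obtain G where "path (width p) (tree p) (nm n) G"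
      using kb_tree.path_if_no_least[OF k X z nomin] by blast
    then show False
      using KN_sound[of "Suc (mb p)" p "nm n" G e E] p true
      unfolding width_def tree_def matrix_def by auto
  qed
  show ?thesis
    unfolding sats_WO_fm gr
  proof (intro conjI allI ballI)
    fix a b c
    let ?R = "tord p (nm n)"
    show "?R a b \<longrightarrow> ?R a a \<and> ?R b b" using kb_tree.ord_refl[OF k, of "nm n" a b] by blast
    show "?R a b \<and> ?R b c \<longrightarrow> ?R a c" using kb_tree.ord_trans[OF k, of "nm n" a b c] by blast
    show "?R a b \<and> ?R b a \<longrightarrow> a = b" using kb_tree.ord_antisym[OF k, of "nm n" a b] by blast
    show "?R a a \<and> ?R b b \<longrightarrow> ?R a b \<or> ?R b a" using kb_tree.ord_total[OF k, of "nm n" a b] by blast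
  qed (rule impI, rule wf)
qed

lemma sats_rootF [simp]: "sats M e E (rootF t) \<longleftrightarrow> (\<exists>a b. ev M e t = pr (pr a b) \<zero>)"
  by (simp add: rootF_def)

lemma sats_ordfm [simp]: "sats M e E (ordfm p [s, t, u]) \<longleftrightarrow> tord p (ev M e s) (ev M e t) (ev M e u)"
  by (simp add: ordfm_def sats_psub satb_ordF[OF tree_bd] app_def)

definition embeds :: "fm \<Rightarrow> recf \<Rightarrow> 'a set \<Rightarrow> 'a \<Rightarrow> bool" where
  "embeds p g F x \<longleftrightarrow>
    (\<forall>s. tord p x s s \<and> (\<forall>a b. s \<noteq> pr (pr a b) \<zero>) \<longrightarrow> (\<exists>c. pr (pr x s) c \<in> F \<and> gr g [c, c] \<one>)) \<and>
    (\<forall>s t c d. tord p x s t \<and> s \<noteq> t \<and> (\<forall>a b. t \<noteq> pr (pr a b) \<zero>) \<and> pr (pr x s) c \<in> F \<and> pr (pr x t) d \<in> F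
       \<longrightarrow> gr g [c, d] \<one> \<and> c \<noteq> d)"

lemma sats_embF: "sats M e (case_nat F E) (embF p C g) \<longleftrightarrow>
    (\<forall>x. sats M (case_nat x e) (case_nat F E) C \<longrightarrow> embeds p g F x)"
  unfolding embF_def embeds_def by (simp del: gr.simps)

text \<open>A counterexample gives a path, and the nonempty initial segments of the path descend.
  Their images under \<open>F\<close> would form a set without least element in the order of
  \<open>g\<close>.\<close>

theorem embeds_true:
  assumes p: "matrix p" and F: "F \<in> ssets M" and emb: "embeds p g F x"
    and WO: "sats M e' E' (WO_fm g)" and X: "X \<in> ssets M"
  shows "sats M (case_nat x e) (case_nat X E) p"
proof (rule ccontr)
  assume "\<not> ?thesis"
  then obtain G where "path (width p) (tree p) x G"
    using KN_complete[OF X, of x e E p "Suc (mb p)"] p unfolding width_def tree_def matrix_def by auto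
  from kb_tree.path_descends[OF kb this] obtain Z z where Z: "Z \<in> ssets M" "z \<in> Z"
    "\<And>z. z \<in> Z \<Longrightarrow> tord p x z z \<and> \<not> kb_tree.isroot M z \<and> (\<exists>y\<in>Z. tord p x y z \<and> y \<noteq> z)" by blast
  have root: "kb_tree.isroot M s \<longleftrightarrow> (\<exists>a b. s = pr (pr a b) \<zero>)" for s
    by (rule kb_tree.isroot_def[OF kb])
  define W where "W = {c. \<exists>s. s \<in> Z \<and> pr (pr x s) c \<in> F}"
  have "AD (\<lambda>e. \<exists>s. s \<in> Z \<and> pr (pr x s) (e 0) \<in> F)" by (intro ad Z F)
  then have W: "W \<in> ssets M" unfolding W_def by (rule comprehension)
  have img: "\<exists>c. pr (pr x s) c \<in> F \<and> gr g [c, c] \<one>" if "s \<in> Z" for s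
    using emb Z(3)[OF that] unfolding embeds_def root by blast
  have "\<exists>c. c \<in> W \<and> gr g [c, c] \<one>" using img[OF Z(2)] Z(2) unfolding W_def by blast
  from HOL.mp[OF bspec[OF WO[unfolded sats_WO_fm, THEN conjunct2] W] this]
  obtain c where c: "c \<in> W" "\<And>y. y \<in> W \<Longrightarrow> gr g [y, y] \<one> \<Longrightarrow> gr g [c, y] \<one>"
    by blast
  then obtain s where s: "s \<in> Z" "pr (pr x s) c \<in> F" unfolding W_def by blast
  obtain t where t: "t \<in> Z" "tord p x t s" "t \<noteq> s" using Z(3)[OF s(1)] by blast
  obtain d where d: "pr (pr x t) d \<in> F" "gr g [d, d] \<one>" using img[OF t(1)] by blast
  have "gr g [d, c] \<one> \<and> d \<noteq> c"
    using emb Z(3)[OF s(1)] t s(2) d(1) unfolding embeds_def root by blast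
  moreover have "gr g [c, d] \<one>" using c(2)[of d] d t(1) unfolding W_def by blast
  moreover have "gr g [c, d] \<one> \<and> gr g [d, c] \<one> \<longrightarrow> c = d"
    using WO[unfolded sats_WO_fm, THEN conjunct1] by blast
  ultimately show False by blast
qed

end

section \<open>Programs and formalized provability in the standard model\<close>

abbreviation "ngr \<equiv> aca.gr std"
abbreviation "nbeta \<equiv> aca.beta std"

lemmas ngr_simps = aca.gr.simps[OF aca_std, unfolded std_simps]

text \<open>The standard model contains all sets, so the graph of every function is available as a
  parameter.\<close>

lemma std_AD2: "aca.AD std (\<lambda>e. e 0 = (g :: nat \<Rightarrow> nat) (e 1))"
proof -
  let ?X = "{aca.pr std v i | v i. v = g i}"
  have "aca.AD std (\<lambda>e. aca.pr std (e 0) (e 1) \<in> ?X)"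
    by (rule aca.AD_memb[OF aca_std _ aca.FD_pr[OF aca_std aca.FD_var[OF aca_std] aca.FD_var[OF aca_std]]]) simp
  moreover have "aca.pr std v i \<in> ?X \<longleftrightarrow> v = g i" for v i
    using aca.pr_inj[OF aca_std] by auto
  ultimately show ?thesis by simp
qed

lemma nbeta_exists: "\<exists>a b. \<forall>i<n. nbeta a b i = (g :: nat \<Rightarrow> nat) i"
  using aca.beta_exists[OF aca_std std_AD2[of g], of n] by simp

lemma ngr_computes: "ngr f xs v \<Longrightarrow> computes f xs v"
proof (induction f arbitrary: xs v)
  case ZeroF
  then show ?case by (auto simp: ngr_simps intro: computes.intros)
next
  case SuccF
  then show ?case by (auto simp: ngr_simps intro: computes.intros)
next
  case (Proj i)
  then show ?case by (auto simp: ngr_simps intro: computes.intros)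
next
  case (Comp f gs)
  then obtain zs where zs: "list_all2 (\<lambda>g. ngr g xs) gs zs" "ngr f zs v"
    by (auto simp: ngr_simps list.rel_map)
  have "list_all2 (\<lambda>g. computes g xs) gs zs"
    using zs(1) Comp.IH(2) by (auto simp: list_all2_conv_all_nth)
  then show ?case using Comp.IH(1)[OF zs(2)] by (rule computes.intros)
next
  case (PrimRec f g)
  then obtain t us a b where xs: "xs = t # us" and v: "v = nbeta a b t" "ngr f us (nbeta a b 0)"
    "\<And>i. i < t \<Longrightarrow> ngr g (i # nbeta a b i # us) (nbeta a b (Suc i))"
    by (auto simp: ngr_simps)
  have "i \<le> t \<Longrightarrow> computes (PrimRec f g) (i # us) (nbeta a b i)" for i
  proof (induction i)
    case 0
    then show ?case using PrimRec.IH(1)[OF v(2)] by (intro computes.intros)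
  next
    case (Suc i)
    then show ?case using PrimRec.IH(2)[OF v(3)[of i]] by (auto intro: computes.intros)
  qed
  then show ?case unfolding xs v(1) by simp
next
  case (Mu f)
  then have "ngr f (v # xs) 0" "\<And>i. i < v \<Longrightarrow> \<exists>l>0. ngr f (i # xs) l" by (auto simp: ngr_simps)
  then show ?case using Mu.IH by (intro computes.intros) blast+
qed

lemma computes_ngr: "computes f xs v \<Longrightarrow> ngr f xs v"
proof (induction rule: computes.induct)
  case (4 xs gs ys f n)
  then show ?case by (auto simp: ngr_simps list.rel_map list_all2_conv_all_nth)
next
  case (5 f xs n g)
  obtain a b where "\<forall>i<1. nbeta a b i = n" using nbeta_exists[of 1 "\<lambda>_. n"] by blast
  then have "n = nbeta a b 0" by simp
  then show ?case using 5 by (auto simp: ngr_simps)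
next
  case (6 f g i xs n l)
  then obtain a b where v: "n = nbeta a b i" "ngr f xs (nbeta a b 0)"
    "\<And>j. j < i \<Longrightarrow> ngr g (j # nbeta a b j # xs) (nbeta a b (Suc j))"
    by (auto simp: ngr_simps)
  obtain a' b' where ab: "\<And>j. j < Suc (Suc i) \<Longrightarrow> nbeta a' b' j = (if j = Suc i then l else nbeta a b j)"
    using nbeta_exists[of "Suc (Suc i)" "\<lambda>j. if j = Suc i then l else nbeta a b j"] by blast
  have "ngr g (j # nbeta a' b' j # xs) (nbeta a' b' (Suc j))" if "j < Suc i" for j
    using that 6(4) v(1) v(3)[of j] by (cases "j = i") (simp_all add: ab)
  moreover have "ngr f xs (nbeta a' b' 0)" using v(2) by (simp add: ab)
  moreover have "l = nbeta a' b' (Suc i)" by (simp add: ab)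
  ultimately show ?case by (auto simp: ngr_simps)
qed (auto simp: ngr_simps)

lemma computes_iff: "computes f xs v \<longleftrightarrow> ngr f xs v"
  using ngr_computes computes_ngr by blast

section \<open>Derivability from finitely many rules\<close>

inductive der :: "rule list \<Rightarrow> nat \<Rightarrow> bool" for rs where
  "(c, ps, s) \<in> set rs \<Longrightarrow> (\<And>p. p \<in> set ps \<Longrightarrow> der rs (evalt V p)) \<Longrightarrow> sat V (\<lambda>_. {}) s \<Longrightarrow> der rs (evalt V c)"

definition rule_ok :: "rule \<Rightarrow> bool" where
  "rule_ok r = (case r of (c, ps, s) \<Rightarrow> bd_tm c \<le> 8 \<and> (\<forall>p\<in>set ps. bd_tm p \<le> 8) \<and> bd0 s \<le> 8 \<and> bd1 s = 0)"

definition follows :: "rule list \<Rightarrow> (nat \<Rightarrow> nat) \<Rightarrow> nat \<Rightarrow> bool" where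
  "follows rs h i \<longleftrightarrow> (\<exists>V c ps s. (c, ps, s) \<in> set rs \<and> h i = evalt V c \<and> sat V (\<lambda>_. {}) s \<and>
     (\<forall>p\<in>set ps. \<exists>j<i. h j = evalt V p))"

lemma follows_der:
  assumes "\<And>i. i < n \<Longrightarrow> follows rs h i" shows "i < n \<Longrightarrow> der rs (h i)"
proof (induction i rule: less_induct)
  case (less i)
  obtain V c ps s where r: "(c, ps, s) \<in> set rs" "h i = evalt V c" "sat V (\<lambda>_. {}) s"
    "\<forall>p\<in>set ps. \<exists>j<i. h j = evalt V p"
    using assms[OF less.prems] unfolding follows_def by blast
  have prem: "der rs (evalt V p)" if "p \<in> set ps" for p
  proof -
    obtain j where "j < i" "h j = evalt V p" using r(4) \<open>p \<in> set ps\<close> by blast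
    then show ?thesis using less.IH[of j] less.prems by simp
  qed
  show ?case unfolding r(2) by (rule der.intros[OF r(1) prem r(3)])
qed

definition chain :: "rule list \<Rightarrow> nat list \<Rightarrow> bool" where
  "chain rs xs \<longleftrightarrow> (\<forall>i<length xs. follows rs (\<lambda>j. xs ! j) i)"

lemma chain_append: "chain rs xs \<Longrightarrow> chain rs ys \<Longrightarrow> chain rs (xs @ ys)"
  unfolding chain_def
proof (intro allI impI)
  fix i assume x: "\<forall>i<length xs. follows rs ((!) xs) i" and y: "\<forall>i<length ys. follows rs ((!) ys) i"
    and i: "i < length (xs @ ys)"
  show "follows rs ((!) (xs @ ys)) i"
  proof (cases "i < length xs")
    case True
    then obtain V c ps s where r: "(c, ps, s) \<in> set rs" "xs ! i = evalt V c" "sat V (\<lambda>_. {}) s"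
      "\<forall>p\<in>set ps. \<exists>j<i. xs ! j = evalt V p" using x unfolding follows_def by blast
    have "\<exists>j<i. (xs @ ys) ! j = evalt V p" if "p \<in> set ps" for p
    proof -
      obtain j where "j < i" "xs ! j = evalt V p" using r(4) \<open>p \<in> set ps\<close> by blast
      then show ?thesis using True by (intro exI[of _ j]) (simp add: nth_append)
    qed
    then show ?thesis unfolding follows_def using r(1-3) True
      by (intro exI[of _ V] exI[of _ c] exI[of _ ps] exI[of _ s]) (simp add: nth_append)
  next
    case False
    then have "i - length xs < length ys" using i by auto
    then obtain V c ps s where r: "(c, ps, s) \<in> set rs" "ys ! (i - length xs) = evalt V c" "sat V (\<lambda>_. {}) s"
      "\<forall>p\<in>set ps. \<exists>j<i - length xs. ys ! j = evalt V p" using y unfolding follows_def by blast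
    have "\<exists>j<i. (xs @ ys) ! j = evalt V p" if "p \<in> set ps" for p
    proof -
      obtain j where "j < i - length xs" "ys ! j = evalt V p" using r(4) \<open>p \<in> set ps\<close> by blast
      then show ?thesis by (intro exI[of _ "length xs + j"]) auto
    qed
    then show ?thesis unfolding follows_def using r(1-3) False
      by (intro exI[of _ V] exI[of _ c] exI[of _ ps] exI[of _ s]) (simp add: nth_append)
  qed
qed

text \<open>The derivation tree is flattened by concatenating the sequences obtained for its
  premises. No entry loses its justification, since it only has to find its premises somewhere
  before it.\<close>

lemma der_chain: "der rs x \<Longrightarrow> \<exists>xs. chain rs xs \<and> x \<in> set xs"
proof (induction rule: der.induct)
  case (1 c ps s V)
  have "\<exists>xs. chain rs xs \<and> (\<forall>p\<in>set qs. evalt V p \<in> set xs)" if "set qs \<subseteq> set ps" for qs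
    using that
  proof (induction qs)
    case Nil
    show ?case by (intro exI[of _ "[]"]) (simp add: chain_def)
  next
    case (Cons q qs)
    obtain xs where xs: "chain rs xs" "\<forall>p\<in>set qs. evalt V p \<in> set xs" using Cons by auto
    obtain ys where ys: "chain rs ys" "evalt V q \<in> set ys" using "1.IH"[of q] Cons.prems by auto
    show ?case using chain_append[OF xs(1) ys(1)] xs(2) ys(2) by (intro exI[of _ "xs @ ys"]) auto
  qed
  then obtain xs where xs: "chain rs xs" "\<forall>p\<in>set ps. evalt V p \<in> set xs" by blast
  have "follows rs ((!) (xs @ [evalt V c])) (length xs)"
    unfolding follows_def
  proof (intro exI conjI)
    show "(c, ps, s) \<in> set rs" "sat V (\<lambda>_. {}) s" by fact+
    show "(xs @ [evalt V c]) ! length xs = evalt V c" by simp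
    show "\<forall>p\<in>set ps. \<exists>j<length xs. (xs @ [evalt V c]) ! j = evalt V p"
      using xs(2) by (fastforce simp: in_set_conv_nth nth_append)
  qed
  moreover have "follows rs ((!) (xs @ [y])) i" if ix: "i < length xs" for i y
  proof -
    obtain V c ps s where r: "(c, ps, s) \<in> set rs" "xs ! i = evalt V c" "sat V (\<lambda>_. {}) s"
      "\<forall>p\<in>set ps. \<exists>j<i. xs ! j = evalt V p" using xs(1) ix unfolding chain_def follows_def by blast
    have "\<exists>j<i. (xs @ [y]) ! j = evalt V p" if "p \<in> set ps" for p
    proof -
      obtain j where "j < i" "xs ! j = evalt V p" using r(4) \<open>p \<in> set ps\<close> by blast
      then show ?thesis using \<open>i < length xs\<close> by (intro exI[of _ j]) (simp add: nth_append)
    qed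
    then show ?thesis unfolding follows_def using r(1-3) \<open>i < length xs\<close>
      by (intro exI[of _ V] exI[of _ c] exI[of _ ps] exI[of _ s]) (simp add: nth_append)
  qed
  ultimately have "chain rs (xs @ [evalt V c])" unfolding chain_def by (auto simp: less_Suc_eq)
  then show ?case by (intro exI[of _ "xs @ [evalt V c]"]) simp
qed

lemma sat_beta_fm [simp]: "sat e E (beta_fm a b i v) \<longleftrightarrow> nbeta (evalt e a) (evalt e b) (evalt e i) = evalt e v"
  using aca.sats_beta_fm[OF aca_std, of e E a b i v] by auto

lemmas sat_conjs [simp] = sats_conjs[of std, unfolded sats_std]
lemmas sat_disjs [simp] = sats_disjs[of std, unfolded sats_std]
lemmas evalt_up [simp] = ev_up[of std, unfolded ev_std]

lemma sat_steps:
  assumes ok: "\<forall>r\<in>set rs. rule_ok r"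
  shows "sat (case_nat i (case_nat l (case_nat b (case_nat a e)))) E ((Ex0 ^^ 8) (disjs (map step_fm rs)))
     \<longleftrightarrow> follows rs (nbeta a b) i"
proof -
  let ?e = "case_nat i (case_nat l (case_nat b (case_nat a e)))"
  have step: "sat (app zs ?e) E (step_fm (c, ps, s)) \<longleftrightarrow> nbeta a b i = evalt (app zs ?e) c \<and> sat (app zs ?e) (\<lambda>_. {}) s \<and>
     (\<forall>p\<in>set ps. \<exists>j<i. nbeta a b j = evalt (app zs ?e) p)" if zs: "length zs = 8" and r: "(c, ps, s) \<in> set rs" for zs c ps s
  proof -
    have v: "app zs ?e 8 = i" "app zs ?e 9 = l" "app zs ?e 10 = b" "app zs ?e 11 = a"
      using zs by (simp_all add: app_def)
    have "bd1 s = 0" using ok r by (auto simp: rule_ok_def)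
    then have "sat (app zs ?e) E s \<longleftrightarrow> sat (app zs ?e) (\<lambda>_. {}) s"
      using sats_cong[of s "app zs ?e" "app zs ?e" E "\<lambda>_. {}" std] by simp
    then show ?thesis by (auto simp: step_fm_def prev_fm_def v)
  qed
  have "sat ?e E ((Ex0 ^^ 8) (disjs (map step_fm rs))) \<longleftrightarrow>
      (\<exists>zs. length zs = 8 \<and> (\<exists>r\<in>set rs. sat (app zs ?e) E (step_fm r)))"
    using sats_Ex0_power[of std ?e E 8 "disjs (map step_fm rs)"] by simp
  also have "\<dots> \<longleftrightarrow> follows rs (nbeta a b) i"
  proof
    assume "\<exists>zs. length zs = 8 \<and> (\<exists>r\<in>set rs. sat (app zs ?e) E (step_fm r))"
    then obtain zs r where z: "length zs = 8" "r \<in> set rs" "sat (app zs ?e) E (step_fm r)" by blast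
    obtain c ps s where r: "r = (c, ps, s)" by (cases r)
    show "follows rs (nbeta a b) i"
      unfolding follows_def using step[OF z(1)] z(2,3) unfolding r by blast
  next
    assume "follows rs (nbeta a b) i"
    then obtain V c ps s where r: "(c, ps, s) \<in> set rs" "nbeta a b i = evalt V c" "sat V (\<lambda>_. {}) s"
      "\<forall>p\<in>set ps. \<exists>j<i. nbeta a b j = evalt V p" unfolding follows_def by blast
    have bd: "bd_tm c \<le> 8" "\<forall>p\<in>set ps. bd_tm p \<le> 8" "bd0 s \<le> 8" using ok r(1) by (auto simp: rule_ok_def)
    \<comment> \<open>Rules mention only the first eight variables, so the valuation may be cut off
      there.\<close>
    let ?zs = "map V [0..<8]"
    have eq: "app ?zs ?e k = V k" if "k < 8" for k using that by (simp add: app_def)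
    have ev: "evalt (app ?zs ?e) t = evalt V t" if "bd_tm t \<le> 8" for t
      using ev_cong[of t "app ?zs ?e" V std] eq that by simp
    have "sat (app ?zs ?e) (\<lambda>_. {}) s = sat V (\<lambda>_. {}) s"
      using sats_cong[of s "app ?zs ?e" V "\<lambda>_. {}" "\<lambda>_. {}" std] eq bd(3) by simp
    then have "sat (app ?zs ?e) E (step_fm (c, ps, s))"
      using r(2-4) bd(1,2) step[of ?zs, OF _ r(1)] by (simp add: ev)
    then show "\<exists>zs. length zs = 8 \<and> (\<exists>r\<in>set rs. sat (app zs ?e) E (step_fm r))"
      using r(1) by (intro exI[of _ ?zs]) (auto simp del: upt_Suc)
  qed
  finally show ?thesis .
qed

theorem sat_der_fm:
  assumes "\<forall>r\<in>set rs. rule_ok r"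
  shows "sat e E (der_fm rs t) \<longleftrightarrow> der rs (evalt e t)"
proof -
  have "sat e E (der_fm rs t) \<longleftrightarrow> (\<exists>a b l. nbeta a b l = evalt e t \<and> (\<forall>i<Suc l. follows rs (nbeta a b) i))"
    unfolding der_fm_def sat_connectives(1,4) sat.simps sat_steps[OF assms] by simp
  also have "\<dots> \<longleftrightarrow> der rs (evalt e t)"
  proof
    assume "\<exists>a b l. nbeta a b l = evalt e t \<and> (\<forall>i<Suc l. follows rs (nbeta a b) i)"
    then obtain a b l where l: "nbeta a b l = evalt e t" "\<And>i. i < Suc l \<Longrightarrow> follows rs (nbeta a b) i" by blast
    show "der rs (evalt e t)" using follows_der[of "Suc l" rs "nbeta a b" l] l by simp
  next
    assume "der rs (evalt e t)"
    then obtain xs where xs: "chain rs xs" "evalt e t \<in> set xs" using der_chain by blast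
    then obtain l where l: "l < length xs" "xs ! l = evalt e t" by (auto simp: in_set_conv_nth)
    obtain a b where ab: "\<And>i. i < length xs \<Longrightarrow> nbeta a b i = xs ! i"
      using nbeta_exists[of "length xs" "(!) xs"] by blast
    have "follows rs (nbeta a b) i" if "i < Suc l" for i
    proof -
      have i: "i < length xs" using that l(1) by simp
      then obtain V c ps s where r: "(c, ps, s) \<in> set rs" "xs ! i = evalt V c" "sat V (\<lambda>_. {}) s"
        "\<forall>p\<in>set ps. \<exists>j<i. xs ! j = evalt V p" using xs(1) unfolding chain_def follows_def by blast
      have "\<exists>j<i. nbeta a b j = evalt V p" if "p \<in> set ps" for p
      proof -
        obtain j where "j < i" "xs ! j = evalt V p" using r(4) \<open>p \<in> set ps\<close> by blast
        then show ?thesis using i ab[of j] by (intro exI[of _ j]) simp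
      qed
      then show ?thesis unfolding follows_def using r(1-3) ab[OF i]
        by (intro exI[of _ V] exI[of _ c] exI[of _ ps] exI[of _ s]) simp
    qed
    then show "\<exists>a b l. nbeta a b l = evalt e t \<and> (\<forall>i<Suc l. follows rs (nbeta a b) i)"
      using ab[OF l(1)] l(2) by (intro exI[of _ a] exI[of _ b] exI[of _ l]) simp
  qed
  finally show ?thesis .
qed

section \<open>Correctness of the provability formula\<close>

lemma evalt_num [simp]: "evalt e (num n) = n"
  by (induction n) auto

lemma evalt_qpair [simp]: "evalt e (qpair s t) = pair (evalt e s) (evalt e t)"
  by (simp add: qpair_def pair_def)

lemmas code_defs = qVar_def qZero_def qOne_def qAdd_def qMul_def qEq_def qLess_def qMem_def qNeg_def
  qImp_def qAll0_def qAll1_def jT_def jF_def jLT_def jST_def jL0_def jS0_def jL1_def jS1_def jP_def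

lemma tcode_eq:
  "pair 0 x = tcode t \<longleftrightarrow> t = Var x"
  "pair (Suc 0) 0 = tcode t \<longleftrightarrow> t = Zero"
  "pair 2 0 = tcode t \<longleftrightarrow> t = One"
  "pair 3 (pair x y) = tcode t \<longleftrightarrow> (\<exists>s u. t = Add s u \<and> x = tcode s \<and> y = tcode u)"
  "pair 4 (pair x y) = tcode t \<longleftrightarrow> (\<exists>s u. t = Mul s u \<and> x = tcode s \<and> y = tcode u)"
  by (cases t; auto simp: pair_inj)+

lemma fcode_eq:
  "pair 0 (pair x y) = fcode p \<longleftrightarrow> (\<exists>s u. p = Eq s u \<and> x = tcode s \<and> y = tcode u)"
  "pair (Suc 0) (pair x y) = fcode p \<longleftrightarrow> (\<exists>s u. p = Less s u \<and> x = tcode s \<and> y = tcode u)"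
  "pair 2 (pair x i) = fcode p \<longleftrightarrow> (\<exists>s. p = Mem s i \<and> x = tcode s)"
  "pair 3 x = fcode p \<longleftrightarrow> (\<exists>q. p = Neg q \<and> x = fcode q)"
  "pair 4 (pair x y) = fcode p \<longleftrightarrow> (\<exists>q r. p = Imp q r \<and> x = fcode q \<and> y = fcode r)"
  "pair 5 x = fcode p \<longleftrightarrow> (\<exists>q. p = All0 q \<and> x = fcode q)"
  "pair 6 x = fcode p \<longleftrightarrow> (\<exists>q. p = All1 q \<and> x = fcode q)"
  by (cases p; auto simp: pair_inj)+

text \<open>The meaning of the judgements, used as an invariant of the rules. Lifting and
  substitution are treated conditionally, because their rules do not check everywhere that the
  components code terms or formulas; for the logical axioms this is secured by the premises with
  \<open>jF\<close> and \<open>jT\<close>.\<close>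

definition ok :: "fm set \<Rightarrow> nat \<Rightarrow> bool" where
  "ok S j \<longleftrightarrow>
    (\<forall>n t. j = pair 0 (pair n t) \<longrightarrow> (\<exists>u. t = tcode u \<and> bd_tm u \<le> n)) \<and>
    (\<forall>c n m p. j = pair (Suc 0) (pair c (pair n (pair m p))) \<longrightarrow>
       (\<exists>q. p = fcode q \<and> bd0 q \<le> n \<and> bd1 q \<le> m \<and> (c = 0 \<longrightarrow> arithmetical q))) \<and>
    (\<forall>k t t'. j = pair 2 (pair k (pair t t')) \<longrightarrow> (\<forall>u. t = tcode u \<longrightarrow> t' = tcode (lift_tm k u))) \<and>
    (\<forall>k r t t'. j = pair 3 (pair k (pair r (pair t t'))) \<longrightarrow>
       (\<forall>v u. r = tcode v \<longrightarrow> t = tcode u \<longrightarrow> t' = tcode (subst_tm k v u))) \<and>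
    (\<forall>k p p'. j = pair 4 (pair k (pair p p')) \<longrightarrow> (\<forall>q. p = fcode q \<longrightarrow> p' = fcode (lift0 k q))) \<and>
    (\<forall>k r p p'. j = pair 5 (pair k (pair r (pair p p'))) \<longrightarrow>
       (\<forall>v q. r = tcode v \<longrightarrow> p = fcode q \<longrightarrow> p' = fcode (subst0 k v q))) \<and>
    (\<forall>k p p'. j = pair 6 (pair k (pair p p')) \<longrightarrow> (\<forall>q. p = fcode q \<longrightarrow> p' = fcode (lift1 k q))) \<and>
    (\<forall>k i p p'. j = pair 7 (pair k (pair i (pair p p'))) \<longrightarrow> (\<forall>q. p = fcode q \<longrightarrow> p' = fcode (subst1 k i q))) \<and>
    (\<forall>p. j = pair 8 p \<longrightarrow> (\<exists>q. p = fcode q \<and> S \<turnstile> q))"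

lemma ok_simps:
  "ok S (pair 0 (pair n t)) \<longleftrightarrow> (\<exists>u. t = tcode u \<and> bd_tm u \<le> n)"
  "ok S (pair (Suc 0) (pair c (pair n (pair m p)))) \<longleftrightarrow>
     (\<exists>q. p = fcode q \<and> bd0 q \<le> n \<and> bd1 q \<le> m \<and> (c = 0 \<longrightarrow> arithmetical q))"
  "ok S (pair 2 (pair k (pair t t'))) \<longleftrightarrow> (\<forall>u. t = tcode u \<longrightarrow> t' = tcode (lift_tm k u))"
  "ok S (pair 3 (pair k (pair r (pair t t')))) \<longleftrightarrow>
     (\<forall>v u. r = tcode v \<longrightarrow> t = tcode u \<longrightarrow> t' = tcode (subst_tm k v u))"
  "ok S (pair 4 (pair k (pair p p'))) \<longleftrightarrow> (\<forall>q. p = fcode q \<longrightarrow> p' = fcode (lift0 k q))"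
  "ok S (pair 5 (pair k (pair r (pair p p')))) \<longleftrightarrow>
     (\<forall>v q. r = tcode v \<longrightarrow> p = fcode q \<longrightarrow> p' = fcode (subst0 k v q))"
  "ok S (pair 6 (pair k (pair p p'))) \<longleftrightarrow> (\<forall>q. p = fcode q \<longrightarrow> p' = fcode (lift1 k q))"
  "ok S (pair 7 (pair k (pair i (pair p p')))) \<longleftrightarrow> (\<forall>q. p = fcode q \<longrightarrow> p' = fcode (subst1 k i q))"
  "ok S (pair 8 p) \<longleftrightarrow> (\<exists>q. p = fcode q \<and> S \<turnstile> q)"
  by (auto simp: ok_def pair_inj)

definition logic_rules :: "fm \<Rightarrow> rule list" where
  "logic_rules \<sigma> = drop (length form_rules + length subst_rules) (prv_rules \<sigma>)"

lemma prv_rules_split: "prv_rules \<sigma> = form_rules @ subst_rules @ logic_rules \<sigma>"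
  by (simp add: prv_rules_def logic_rules_def)

lemmas logic_rules_unfold = logic_rules_def prv_rules_def Let_def logic_rule_def

definition preserves :: "fm set \<Rightarrow> rule \<Rightarrow> bool" where
  "preserves S r = (case r of (c, ps, s) \<Rightarrow> \<forall>V. (\<forall>p\<in>set ps. ok S (evalt V p)) \<longrightarrow> sat V (\<lambda>_. {}) s \<longrightarrow> ok S (evalt V c))"

lemma form_preserves: "\<forall>r\<in>set form_rules. preserves S r"
  unfolding form_rules_def Let_def list.set ball_simps preserves_def split code_defs
  by (simp add: ok_simps) (auto simp: tcode_eq fcode_eq tcode_inj fcode_inj)

lemma subst_preserves: "\<forall>r\<in>set subst_rules. preserves S r"
  unfolding subst_rules_def Let_def list.set ball_simps preserves_def split code_defs
  by (simp add: ok_simps) (auto simp: tcode_eq fcode_eq tcode_inj fcode_inj)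

lemma sat_axioms_fm:
  assumes "defines_axioms \<sigma> S" shows "sat V E \<sigma> \<longleftrightarrow> V 0 \<in> fcode ` S"
  using assms case_nat_eta[of V] unfolding defines_axioms_def by metis

lemma logic_preserves:
  assumes "defines_axioms \<sigma> S" shows "\<forall>r\<in>set (logic_rules \<sigma>). preserves S r"
  unfolding logic_rules_unfold append_assoc[symmetric] length_append[symmetric]
  by (simp add: preserves_def code_defs ok_simps sat_axioms_fm[OF assms])
    (auto simp: tcode_eq fcode_eq fcode_inj tcode_inj
      intro: prv.Ax prv.K prv.S prv.N prv.All0E prv.All0D prv.All1E prv.All1D prv.Refl prv.Leib prv.Gen0 prv.Gen1
      dest: prv.MP)

lemma der_ok:
  assumes "\<forall>r\<in>set rs. preserves S r" shows "der rs j \<Longrightarrow> ok S j"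
proof (induction rule: der.induct)
  case (1 c ps s V)
  then show ?case using bspec[OF assms 1(1)] unfolding preserves_def by blast
qed

lemma der_closed:
  assumes "set rs' \<subseteq> set rs"
  shows "\<forall>r\<in>set rs'. case r of (c, ps, s) \<Rightarrow> (\<forall>p\<in>set ps. der rs (evalt V p)) \<longrightarrow> sat V (\<lambda>_. {}) s \<longrightarrow> der rs (evalt V c)"
  using assms by (auto intro: der.intros)

definition val :: "nat list \<Rightarrow> nat \<Rightarrow> nat" where "val vs = app vs (\<lambda>_. 0)"

lemma val_simps [simp]:
  "val [x, y, z, x', y', k, m, c] 0 = x" "val [x, y, z, x', y', k, m, c] (Suc 0) = y"
  "val [x, y, z, x', y', k, m, c] 2 = z" "val [x, y, z, x', y', k, m, c] 3 = x'"
  "val [x, y, z, x', y', k, m, c] 4 = y'" "val [x, y, z, x', y', k, m, c] 5 = k"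
  "val [x, y, z, x', y', k, m, c] 6 = m" "val [x, y, z, x', y', k, m, c] 7 = c"
  by (simp_all add: val_def app_def)

section \<open>Derivability of the correct judgements\<close>

context
  fixes rs :: "rule list"
  assumes form: "set form_rules \<subseteq> set rs"
begin

lemmas form_step = der_closed[OF form, unfolded form_rules_def Let_def list.set ball_simps split code_defs]

lemma der_T: "bd_tm t \<le> n \<Longrightarrow> der rs (pair 0 (pair n (tcode t)))"
proof (induction t)
  case (Var i)
  then show ?case using form_step[of "val [i, 0, 0, 0, 0, n, 0, 0]"] by simp
next
  case (Add s t)
  then show ?case using form_step[of "val [tcode s, tcode t, 0, 0, 0, n, 0, 0]"] by simp
next
  case (Mul s t)
  then show ?case using form_step[of "val [tcode s, tcode t, 0, 0, 0, n, 0, 0]"] by simp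
qed (use form_step[of "val [0, 0, 0, 0, 0, n, 0, 0]"] in simp_all)

lemma der_F:
  "c = 1 \<or> c = 0 \<and> arithmetical p \<Longrightarrow> bd0 p \<le> n \<Longrightarrow> bd1 p \<le> m \<Longrightarrow>
   der rs (pair (Suc 0) (pair c (pair n (pair m (fcode p)))))"
proof (induction p arbitrary: n m)
  case (Eq s t)
  then show ?case using der_T[of s n] der_T[of t n] form_step[of "val [tcode s, tcode t, 0, 0, 0, n, m, c]"] by simp
next
  case (Less s t)
  then show ?case using der_T[of s n] der_T[of t n] form_step[of "val [tcode s, tcode t, 0, 0, 0, n, m, c]"] by simp
next
  case (Mem t i)
  then show ?case using der_T[of t n] form_step[of "val [tcode t, i, 0, 0, 0, n, m, c]"] by simp
next
  case (Neg p)
  have "der rs (pair (Suc 0) (pair c (pair n (pair m (fcode p)))))"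
    using Neg.prems by (intro Neg.IH) auto
  then show ?case using form_step[of "val [fcode p, 0, 0, 0, 0, n, m, c]"] by simp
next
  case (Imp p q)
  have "der rs (pair (Suc 0) (pair c (pair n (pair m (fcode p)))))"
    "der rs (pair (Suc 0) (pair c (pair n (pair m (fcode q)))))"
    using Imp.prems by (intro Imp.IH; auto)+
  then show ?case using form_step[of "val [fcode p, fcode q, 0, 0, 0, n, m, c]"] by simp
next
  case (All0 p)
  have "der rs (pair (Suc 0) (pair c (pair (Suc n) (pair m (fcode p)))))"
    using All0.prems by (intro All0.IH) auto
  then show ?case using form_step[of "val [fcode p, 0, 0, 0, 0, n, m, c]"] by simp
next
  case (All1 p)
  have "der rs (pair (Suc 0) (pair c (pair n (pair (Suc m) (fcode p)))))"
    using All1.prems by (intro All1.IH) auto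
  then show ?case using All1.prems form_step[of "val [fcode p, 0, 0, 0, 0, n, m, c]"] by simp
qed

end

context
  fixes rs :: "rule list"
  assumes subst: "set subst_rules \<subseteq> set rs"
begin

lemmas subst_step = der_closed[OF subst, unfolded subst_rules_def Let_def list.set ball_simps split code_defs]

lemma der_LT: "der rs (pair 2 (pair k (pair (tcode t) (tcode (lift_tm k t)))))"
proof (induction t)
  case (Var i)
  then show ?case using subst_step[of "val [i, 0, 0, 0, 0, k, 0, 0]"] by simp
next
  case (Add s t)
  then show ?case
    using subst_step[of "val [tcode s, tcode t, 0, tcode (lift_tm k s), tcode (lift_tm k t), k, 0, 0]"] by simp
next
  case (Mul s t)
  then show ?case
    using subst_step[of "val [tcode s, tcode t, 0, tcode (lift_tm k s), tcode (lift_tm k t), k, 0, 0]"] by simp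
qed (use subst_step[of "val [0, 0, 0, 0, 0, k, 0, 0]"] in simp_all)

lemma der_ST: "der rs (pair 3 (pair k (pair (tcode r) (pair (tcode t) (tcode (subst_tm k r t))))))"
proof (induction t)
  case (Var i)
  then show ?case
    using subst_step[of "val [i, 0, 0, 0, 0, k, tcode r, 0]"] subst_step[of "val [i - 1, 0, 0, 0, 0, k, tcode r, 0]"]
    by (cases i k rule: linorder_cases) auto
next
  case (Add s t)
  then show ?case
    using subst_step[of "val [tcode s, tcode t, 0, tcode (subst_tm k r s), tcode (subst_tm k r t), k, tcode r, 0]"] by simp
next
  case (Mul s t)
  then show ?case
    using subst_step[of "val [tcode s, tcode t, 0, tcode (subst_tm k r s), tcode (subst_tm k r t), k, tcode r, 0]"] by simp
qed (use subst_step[of "val [0, 0, 0, 0, 0, k, tcode r, 0]"] in simp_all)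

lemma der_L0: "der rs (pair 4 (pair k (pair (fcode p) (fcode (lift0 k p)))))"
proof (induction p arbitrary: k)
  case (Eq s t)
  then show ?case using der_LT[of k s] der_LT[of k t]
      subst_step[of "val [tcode s, tcode t, 0, tcode (lift_tm k s), tcode (lift_tm k t), k, 0, 0]"] by simp
next
  case (Less s t)
  then show ?case using der_LT[of k s] der_LT[of k t]
      subst_step[of "val [tcode s, tcode t, 0, tcode (lift_tm k s), tcode (lift_tm k t), k, 0, 0]"] by simp
next
  case (Mem t i)
  then show ?case using der_LT[of k t] subst_step[of "val [tcode t, i, 0, tcode (lift_tm k t), 0, k, 0, 0]"] by simp
next
  case (Neg p)
  show ?case using Neg[of k] subst_step[of "val [fcode p, 0, 0, fcode (lift0 k p), 0, k, 0, 0]"] by simp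
next
  case (Imp p q)
  show ?case using Imp[of k]
      subst_step[of "val [fcode p, fcode q, 0, fcode (lift0 k p), fcode (lift0 k q), k, 0, 0]"] by simp
next
  case (All0 p)
  show ?case using All0[of "Suc k"] subst_step[of "val [fcode p, 0, 0, fcode (lift0 (Suc k) p), 0, k, 0, 0]"] by simp
next
  case (All1 p)
  show ?case using All1[of k] subst_step[of "val [fcode p, 0, 0, fcode (lift0 k p), 0, k, 0, 0]"] by simp
qed

lemma der_S0: "der rs (pair 5 (pair k (pair (tcode r) (pair (fcode p) (fcode (subst0 k r p))))))"
proof (induction p arbitrary: k r)
  case (Eq s t)
  then show ?case using der_ST[of k r s] der_ST[of k r t]
      subst_step[of "val [tcode s, tcode t, 0, tcode (subst_tm k r s), tcode (subst_tm k r t), k, tcode r, 0]"] by simp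
next
  case (Less s t)
  then show ?case using der_ST[of k r s] der_ST[of k r t]
      subst_step[of "val [tcode s, tcode t, 0, tcode (subst_tm k r s), tcode (subst_tm k r t), k, tcode r, 0]"] by simp
next
  case (Mem t i)
  then show ?case using der_ST[of k r t] subst_step[of "val [tcode t, i, 0, tcode (subst_tm k r t), 0, k, tcode r, 0]"] by simp
next
  case (Neg p)
  show ?case using Neg[of k r] subst_step[of "val [fcode p, 0, 0, fcode (subst0 k r p), 0, k, tcode r, 0]"] by simp
next
  case (Imp p q)
  show ?case using Imp[of k r]
      subst_step[of "val [fcode p, fcode q, 0, fcode (subst0 k r p), fcode (subst0 k r q), k, tcode r, 0]"] by simp
next
  case (All0 p)
  show ?case using All0[of "Suc k" "lift_tm 0 r"] der_LT[of 0 r]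
      subst_step[of "val [fcode p, 0, tcode (lift_tm 0 r), fcode (subst0 (Suc k) (lift_tm 0 r) p), 0, k, tcode r, 0]"]
    by simp
next
  case (All1 p)
  show ?case using All1[of k r] subst_step[of "val [fcode p, 0, 0, fcode (subst0 k r p), 0, k, tcode r, 0]"] by simp
qed

lemma der_L1: "der rs (pair 6 (pair k (pair (fcode p) (fcode (lift1 k p)))))"
proof (induction p arbitrary: k)
  case (Eq s t)
  then show ?case using subst_step[of "val [tcode s, tcode t, 0, 0, 0, k, 0, 0]"] by simp
next
  case (Less s t)
  then show ?case using subst_step[of "val [tcode s, tcode t, 0, 0, 0, k, 0, 0]"] by simp
next
  case (Mem t i)
  then show ?case using subst_step[of "val [tcode t, i, 0, 0, 0, k, 0, 0]"] by simp
next
  case (Neg p)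
  show ?case using Neg[of k] subst_step[of "val [fcode p, 0, 0, fcode (lift1 k p), 0, k, 0, 0]"] by simp
next
  case (Imp p q)
  show ?case using Imp[of k]
      subst_step[of "val [fcode p, fcode q, 0, fcode (lift1 k p), fcode (lift1 k q), k, 0, 0]"] by simp
next
  case (All0 p)
  show ?case using All0[of k] subst_step[of "val [fcode p, 0, 0, fcode (lift1 k p), 0, k, 0, 0]"] by simp
next
  case (All1 p)
  show ?case using All1[of "Suc k"] subst_step[of "val [fcode p, 0, 0, fcode (lift1 (Suc k) p), 0, k, 0, 0]"] by simp
qed

lemma der_S1: "der rs (pair 7 (pair k (pair j (pair (fcode p) (fcode (subst1 k j p))))))"
proof (induction p arbitrary: k j)
  case (Eq s t)
  then show ?case using subst_step[of "val [tcode s, tcode t, 0, 0, 0, k, j, 0]"] by simp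
next
  case (Less s t)
  then show ?case using subst_step[of "val [tcode s, tcode t, 0, 0, 0, k, j, 0]"] by simp
next
  case (Mem t i)
  then show ?case
    using subst_step[of "val [tcode t, i, 0, 0, 0, k, j, 0]"] subst_step[of "val [tcode t, i - 1, 0, 0, 0, k, j, 0]"]
    by (cases i k rule: linorder_cases) auto
next
  case (Neg p)
  show ?case using Neg[of k j] subst_step[of "val [fcode p, 0, 0, fcode (subst1 k j p), 0, k, j, 0]"] by simp
next
  case (Imp p q)
  show ?case using Imp[of k j]
      subst_step[of "val [fcode p, fcode q, 0, fcode (subst1 k j p), fcode (subst1 k j q), k, j, 0]"] by simp
next
  case (All0 p)
  show ?case using All0[of k j] subst_step[of "val [fcode p, 0, 0, fcode (subst1 k j p), 0, k, j, 0]"] by simp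
next
  case (All1 p)
  show ?case using All1[of "Suc k" "Suc j"]
      subst_step[of "val [fcode p, 0, 0, fcode (subst1 (Suc k) (Suc j) p), 0, k, j, 0]"] by simp
qed

end

lemma der_P:
  assumes def: "defines_axioms \<sigma> S" and S: "is_theory S"
  shows "S \<turnstile> p \<Longrightarrow> der (prv_rules \<sigma>) (pair 8 (fcode p))"
proof -
  define rs where "rs = prv_rules \<sigma>"
  have fr: "set form_rules \<subseteq> set rs" and sr: "set subst_rules \<subseteq> set rs" and lr: "set (logic_rules \<sigma>) \<subseteq> set rs"
    by (auto simp: prv_rules_split rs_def)
  have ls: "\<forall>r\<in>set (logic_rules \<sigma>). case r of (c, ps, s) \<Rightarrow>
      (\<forall>p\<in>set ps. der rs (evalt (val vs) p)) \<longrightarrow> sat (val vs) (\<lambda>_. {}) s \<longrightarrow> der rs (evalt (val vs) c)" for vs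
    by (rule der_closed[OF lr])
  note ls = ls[unfolded logic_rules_unfold, simplified, simplified code_defs sat_axioms_fm[OF def], simplified]
  note F = der_F[OF fr, of 1, simplified]
  show "S \<turnstile> p \<Longrightarrow> der (prv_rules \<sigma>) (pair 8 (fcode p))"
    unfolding rs_def[symmetric]
  proof (induction rule: prv.induct)
    case (Ax p)
    then have "sentence p" using S by (simp add: is_theory_def)
    then show ?case using Ax F[of p 0 0] ls[of "[fcode p, 0, 0, 0, 0, 0, 0, 0]"] by (simp add: sentence_def)
  next
    case (K p q)
    let ?p = "Imp p (Imp q p)"
    show ?case using F[of ?p "bd0 ?p" "bd1 ?p"] ls[of "[fcode p, fcode q, 0, 0, 0, bd0 ?p, bd1 ?p, 0]"] by simp
  next
    case (S p q r)
    let ?p = "Imp (Imp p (Imp q r)) (Imp (Imp p q) (Imp p r))"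
    show ?case using F[of ?p "bd0 ?p" "bd1 ?p"] ls[of "[fcode p, fcode q, fcode r, 0, 0, bd0 ?p, bd1 ?p, 0]"] by simp
  next
    case (N p q)
    let ?p = "Imp (Imp (Neg p) (Neg q)) (Imp q p)"
    show ?case using F[of ?p "bd0 ?p" "bd1 ?p"] ls[of "[fcode p, fcode q, 0, 0, 0, bd0 ?p, bd1 ?p, 0]"] by simp
  next
    case (All0E p t)
    let ?p = "Imp (All0 p) (subst0 0 t p)"
    \<comment> \<open>The bound has to cover \<open>t\<close> as well, whose variables need not
      occur in the instance.\<close>
    have "der rs (pair 0 (pair (bd0 ?p + bd_tm t) (tcode t)))" using der_T[OF fr, of t "bd0 ?p + bd_tm t"] by simp
    then show ?case using F[of ?p "bd0 ?p + bd_tm t" "bd1 ?p"] der_S0[OF sr, of 0 t p]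
        ls[of "[fcode p, tcode t, 0, fcode (subst0 0 t p), 0, bd0 ?p + bd_tm t, bd1 ?p, 0]"] by simp
  next
    case (All0D p q)
    let ?p = "Imp (All0 (Imp (lift0 0 p) q)) (Imp p (All0 q))"
    show ?case using F[of ?p "bd0 ?p" "bd1 ?p"] der_L0[OF sr, of 0 p]
        ls[of "[fcode p, fcode q, 0, fcode (lift0 0 p), 0, bd0 ?p, bd1 ?p, 0]"] by simp
  next
    case (All1E p j)
    let ?p = "Imp (All1 p) (subst1 0 j p)"
    show ?case using F[of ?p "bd0 ?p" "bd1 ?p"] der_S1[OF sr, of 0 j p]
        ls[of "[fcode p, j, 0, fcode (subst1 0 j p), 0, bd0 ?p, bd1 ?p, 0]"] by simp
  next
    case (All1D p q)
    let ?p = "Imp (All1 (Imp (lift1 0 p) q)) (Imp p (All1 q))"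
    show ?case using F[of ?p "bd0 ?p" "bd1 ?p"] der_L1[OF sr, of 0 p]
        ls[of "[fcode p, fcode q, 0, fcode (lift1 0 p), 0, bd0 ?p, bd1 ?p, 0]"] by simp
  next
    case (Refl t)
    show ?case using F[of "Eq t t" "bd_tm t" 0] ls[of "[tcode t, 0, 0, 0, 0, bd_tm t, 0, 0]"] by simp
  next
    case (Leib s t p)
    let ?p = "Imp (Eq s t) (Imp (subst0 0 s p) (subst0 0 t p))"
    \<comment> \<open>Only two instances of the pattern \<open>p\<close> appear in the axiom, so the
      bounds of \<open>p\<close> itself are added.\<close>
    let ?k = "bd0 ?p + bd0 p" and ?m = "bd1 ?p + bd1 p"
    have "der rs (pair (Suc 0) (pair (Suc 0) (pair ?k (pair ?m (fcode ?p)))))"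
      "der rs (pair (Suc 0) (pair (Suc 0) (pair (Suc ?k) (pair ?m (fcode p)))))"
      using F[of ?p ?k ?m] F[of p "Suc ?k" ?m] by simp_all
    then show ?case using der_S0[OF sr, of 0 s p] der_S0[OF sr, of 0 t p]
        ls[of "[tcode s, tcode t, fcode p, fcode (subst0 0 s p), fcode (subst0 0 t p), ?k, ?m, 0]"] by simp
  next
    case (MP p q)
    then show ?case using ls[of "[fcode p, fcode q, 0, 0, 0, 0, 0, 0]"] by simp
  next
    case (Gen0 p)
    then show ?case using ls[of "[fcode p, 0, 0, 0, 0, 0, 0, 0]"] by simp
  next
    case (Gen1 p)
    then show ?case using ls[of "[fcode p, 0, 0, 0, 0, 0, 0, 0]"] by simp
  qed
qed

lemma bd_connectives [simp]:
  "bd0 (Conj p q) = max (bd0 p) (bd0 q)" "bd1 (Conj p q) = max (bd1 p) (bd1 q)"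
  "bd0 (Disj p q) = max (bd0 p) (bd0 q)" "bd1 (Disj p q) = max (bd1 p) (bd1 q)"
  "bd0 (Ex0 p) = bd0 p - 1" "bd1 (Ex0 p) = bd1 p"
  "bd0 Top = 0" "bd1 Top = 0" "bd0 Bot = 0" "bd1 Bot = 0"
  by (simp_all add: Conj_def Disj_def Ex0_def Top_def Bot_def)

lemma form_ok: "\<forall>r\<in>set form_rules. rule_ok r"
  by (simp add: form_rules_def Let_def rule_ok_def code_defs)

lemma prv_ok:
  assumes "defines_axioms \<sigma> S" shows "\<forall>r\<in>set (prv_rules \<sigma>). rule_ok r"
proof -
  have "\<forall>r\<in>set subst_rules. rule_ok r"
    by (simp add: subst_rules_def Let_def rule_ok_def code_defs)
  moreover have "\<forall>r\<in>set (logic_rules \<sigma>). rule_ok r"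
    using assms by (simp add: logic_rules_unfold rule_ok_def code_defs defines_axioms_def)
  ultimately show ?thesis using form_ok by (auto simp: prv_rules_split)
qed

theorem sat_Prv_fm:
  assumes "defines_axioms \<sigma> S" and "is_theory S"
  shows "sat e E (Prv_fm \<sigma> t) \<longleftrightarrow> (\<exists>p. evalt e t = fcode p \<and> S \<turnstile> p)"
proof -
  have "sat e E (Prv_fm \<sigma> t) \<longleftrightarrow> der (prv_rules \<sigma>) (pair 8 (evalt e t))"
    unfolding Prv_fm_def sat_der_fm[OF prv_ok[OF assms(1)]] by (simp add: jP_def)
  also have "\<dots> \<longleftrightarrow> (\<exists>p. evalt e t = fcode p \<and> S \<turnstile> p)"
  proof
    assume "der (prv_rules \<sigma>) (pair 8 (evalt e t))"
    moreover have "\<forall>r\<in>set (prv_rules \<sigma>). preserves S r"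
      using form_preserves subst_preserves logic_preserves[OF assms(1)] by (auto simp: prv_rules_split)
    ultimately have "ok S (pair 8 (evalt e t))" by (rule der_ok[rotated])
    then show "\<exists>p. evalt e t = fcode p \<and> S \<turnstile> p" by (simp add: ok_simps)
  qed (use der_P[OF assms] in auto)
  finally show ?thesis .
qed

theorem sat_Pi11_sentence_fm:
  "sat e E (Pi11_sentence_fm t) \<longleftrightarrow> (\<exists>p\<in>Pi11. sentence p \<and> evalt e t = fcode p)"
proof -
  have "sat e E (Pi11_sentence_fm t) \<longleftrightarrow>
      (\<exists>x. evalt e t = pair 6 x \<and> der form_rules (pair (Suc 0) (pair 0 (pair 0 (pair (Suc 0) x)))))"
    unfolding Pi11_sentence_fm_def by (simp add: sat_der_fm[OF form_ok] jF_def qAll1_def)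
  also have "\<dots> \<longleftrightarrow> (\<exists>x. evalt e t = pair 6 x \<and> (\<exists>q. x = fcode q \<and> bd0 q \<le> 0 \<and> bd1 q \<le> Suc 0 \<and> arithmetical q))"
  proof -
    have "der form_rules (pair (Suc 0) (pair 0 (pair 0 (pair (Suc 0) x)))) \<longleftrightarrow>
        (\<exists>q. x = fcode q \<and> bd0 q \<le> 0 \<and> bd1 q \<le> Suc 0 \<and> arithmetical q)" for x
      using der_ok[OF form_preserves, of _ "{}"] der_F[OF order_refl, of 0 _ 0 "Suc 0"] ok_simps(2)[of "{}" 0 0 "Suc 0" x]
      by auto
    then show ?thesis by simp
  qed
  also have "\<dots> \<longleftrightarrow> (\<exists>p\<in>Pi11. sentence p \<and> evalt e t = fcode p)"
    by (auto simp: Pi11_def sentence_def pair_inj fcode_inj)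
  finally show ?thesis .
qed

section \<open>Models of theories extending arithmetical comprehension\<close>

text \<open>Instantiating at \<open>Var 0\<close> would leave the other variables shifted down. The
  formula is therefore shifted up beforehand, by a substitution under which the theorems of
  \<open>T\<close> are closed.\<close>

lemma prv_All0D:
  assumes T: "is_theory T" and p: "T \<turnstile> All0 p" shows "T \<turnstile> p"
proof -
  have "psub (ups (\<lambda>i. Var (Suc i))) (\<lambda>i. i) p = lift0 1 p"
    unfolding lift0_psub by (rule psub_cong) (auto simp: ups_def split: nat.splits)
  then have "T \<turnstile> All0 (lift0 1 p)" using prv_psub[OF p T, of "\<lambda>i. Var (Suc i)" "\<lambda>i. i"] by simp
  from prv.MP[OF prv.All0E this, of "Var 0"] show ?thesis by (simp only: subst0_lift0_1)
qed

lemma prv_All1D: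
  assumes T: "is_theory T" and p: "T \<turnstile> All1 p" shows "T \<turnstile> p"
proof -
  have "psub Var (upj Suc) p = lift1 1 p"
    unfolding lift1_psub by (rule psub_cong) (auto simp: upj_def split: nat.splits)
  then have "T \<turnstile> All1 (lift1 1 p)" using prv_psub[OF p T, of Var Suc] by simp
  from prv.MP[OF prv.All1E this, of 0] show ?thesis by (simp only: subst1_lift1_1)
qed

lemma prv_closure: 
  assumes T: "is_theory T" shows "T \<turnstile> closure p \<Longrightarrow> T \<turnstile> p"
proof -
  have "T \<turnstile> (All0 ^^ n) q \<Longrightarrow> T \<turnstile> q" "T \<turnstile> (All1 ^^ n) q \<Longrightarrow> T \<turnstile> q" for n q
    by (induction n) (auto dest: prv_All0D[OF T] prv_All1D[OF T])
  then show "T \<turnstile> closure p \<Longrightarrow> T \<turnstile> p" unfolding closure_def by blast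
qed

lemma sentence_closure: "sentence (closure p)"
proof -
  have "bd0 ((All0 ^^ n) q) = bd0 q - n" "bd1 ((All0 ^^ n) q) = bd1 q"
    "bd1 ((All1 ^^ n) q) = bd1 q - n" "bd0 ((All1 ^^ n) q) = bd0 q" for n q
    by (induction n) auto
  then show ?thesis by (simp add: sentence_def closure_def)
qed

text \<open>It suffices to argue in an arbitrary countable model with at least one set, where
  everything proved in \<open>aca\<close> applies; the universal closure takes care of free
  variables.\<close>

theorem prv_by_models:
  assumes T: "is_theory T" and ACA: "ACA0 \<subseteq> T"
    and models: "\<And>M :: nat str. aca M \<Longrightarrow> (\<And>q. q \<in> T \<Longrightarrow> valid M q) \<Longrightarrow> valid M p"
  shows "T \<turnstile> p"
proof (rule prv_closure[OF T], rule completeness[OF T ACA sentence_closure])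
  fix M :: "nat str" assume M: "\<And>q. q \<in> T \<Longrightarrow> valid M q"
  show "valid M (closure p)"
  proof (cases "ssets M = {}")
    case True
    then show ?thesis by (simp add: valid_def)
  next
    case False
    then have "aca M" using M ACA by unfold_locales auto
    then show ?thesis using models M by (simp add: valid_closure)
  qed
qed

lemma valid_sats: "aca M \<Longrightarrow> valid M p \<Longrightarrow> sentence p \<Longrightarrow> sats M e E p"
  using aca.some_env[of M] sats_sentence[of p M e E] unfolding valid_def by blast

lemma validI: "(\<And>e E. (\<And>i. E i \<in> ssets M) \<Longrightarrow> sats M e E p) \<Longrightarrow> valid M p"
  by (simp add: valid_def)

text \<open>Leftover variables are collapsed: number variables become \<open>Zero\<close>, set
  variables become variable 0. The result is the matrix of a sentence with one set quantifier; the
  formulas to which this is applied do not depend on the collapsed variables.\<close>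

definition clo :: "fm \<Rightarrow> fm" where "clo q = psub (\<lambda>_. Zero) (\<lambda>_. 0) q"

lemma bd_tm_tsub: "(\<And>i. bd_tm (s i) \<le> n) \<Longrightarrow> bd_tm (tsub s t) \<le> n"
  by (induction t) auto

lemma bd0_psub: "(\<And>i. bd_tm (s i) \<le> n) \<Longrightarrow> bd0 (psub s j p) \<le> n"
proof (induction p arbitrary: s j n)
  case (All0 p)
  have "bd0 (psub (ups s) j p) \<le> Suc n"
    using All0.prems by (intro All0.IH) (auto simp: ups_def intro: bd_lift split: nat.splits)
  then show ?case by simp
qed (auto simp: bd_tm_tsub)

lemma bd1_psub: "(\<And>i. j i < m) \<Longrightarrow> bd1 (psub s j p) \<le> m"
proof (induction p arbitrary: s j m)
  case (All1 p)
  have "bd1 (psub s (upj j) p) \<le> Suc m"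
    using All1.prems by (intro All1.IH) (auto simp: upj_def split: nat.splits)
  then show ?case by simp
next
  case (Mem t i)
  then show ?case by (simp add: Suc_leI)
qed auto

lemma clo_simps [simp]:
  "arithmetical (clo q) = arithmetical q" "bd0 (clo q) = 0" "bd1 (clo q) \<le> Suc 0"
  "sats M e (case_nat F E) (clo q) = sats M (\<lambda>_. szero M) (\<lambda>_. F) q"
  using bd0_psub[of "\<lambda>_. Zero" 0 "\<lambda>_. 0" q] bd1_psub[of "\<lambda>_. 0" 1 "\<lambda>_. Zero" q]
  by (simp_all add: clo_def sats_psub)

lemma bd_tm_up: "bd_tm t \<le> n \<Longrightarrow> bd_tm (up k t) \<le> n + k"
  unfolding up_def by (induction k) (use bd_lift in auto)

lemma bd_beta_fm:
  assumes "bd_tm a \<le> n" "bd_tm b \<le> n" "bd_tm i \<le> n" "bd_tm v \<le> n"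
  shows "bd0 (beta_fm a b i v) \<le> n" "bd1 (beta_fm a b i v) = 0"
  using assms bd_lift[OF assms(1)] bd_lift[OF assms(2)] bd_lift[OF assms(3)] bd_lift[OF assms(4)]
  by (auto simp: beta_fm_def Let_def up_def)

lemma bd_lists:
  "(\<And>p. p \<in> set ps \<Longrightarrow> bd0 p \<le> n \<and> bd1 p = 0) \<Longrightarrow> bd0 (conjs ps) \<le> n \<and> bd1 (conjs ps) = 0"
  "(\<And>p. p \<in> set ps \<Longrightarrow> bd0 p \<le> n \<and> bd1 p = 0) \<Longrightarrow> bd0 (disjs ps) \<le> n \<and> bd1 (disjs ps) = 0"
  by (induction ps) (auto simp: conjs_def disjs_def)

lemma bd_step_fm:
  assumes "rule_ok r" shows "bd0 (step_fm r) \<le> 12 \<and> bd1 (step_fm r) = 0"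
proof -
  obtain c ps s where r: "r = (c, ps, s)" by (cases r)
  have bd: "bd_tm c \<le> 8" "\<And>p. p \<in> set ps \<Longrightarrow> bd_tm p \<le> 8" "bd0 s \<le> 8" "bd1 s = 0"
    using assms by (auto simp: rule_ok_def r)
  have "bd0 (prev_fm p) \<le> 12 \<and> bd1 (prev_fm p) = 0" if "p \<in> set ps" for p
  proof -
    have "bd_tm (up 1 p) \<le> 13" using bd_tm_up[OF bd(2)[OF that], of 1] by simp
    then show ?thesis using bd_beta_fm[of "Var 12" 13 "Var 11" "Var 0" "up 1 p"] by (simp add: prev_fm_def)
  qed
  then have "bd0 (conjs (map prev_fm ps)) \<le> 12 \<and> bd1 (conjs (map prev_fm ps)) = 0"
    by (intro bd_lists) auto
  then show ?thesis using bd bd_beta_fm[of "Var 11" 12 "Var 10" "Var 8" c] by (simp add: step_fm_def r)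
qed

lemma bd_Ex0_power: "bd0 ((Ex0 ^^ k) p) = bd0 p - k" "bd1 ((Ex0 ^^ k) p) = bd1 p"
  by (induction k) auto

lemma bd_der_fm:
  assumes "\<forall>r\<in>set rs. rule_ok r" and "bd_tm t \<le> n"
  shows "bd0 (der_fm rs t) \<le> n" "bd1 (der_fm rs t) = 0"
proof -
  have "bd0 (disjs (map step_fm rs)) \<le> 12 \<and> bd1 (disjs (map step_fm rs)) = 0"
    using assms(1) bd_step_fm by (intro bd_lists) auto
  moreover have "bd_tm (up 3 t) \<le> n + 3" using bd_tm_up[OF assms(2)] .
  moreover note bd_beta_fm[of "Var 2" "n + 3" "Var 1" "Var 0" "up 3 t"]
  ultimately show "bd0 (der_fm rs t) \<le> n" "bd1 (der_fm rs t) = 0"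
    unfolding der_fm_def by (simp_all add: bd_Ex0_power) arith
qed

lemma arithmetical_der_fm:
  assumes "\<forall>(c, ps, s)\<in>set rs. arithmetical s" shows "arithmetical (der_fm rs t)"
  using assms by (auto simp: der_fm_def step_fm_def prev_fm_def)

lemma arithmetical_formulas [simp]:
  "arithmetical (Pi11_sentence_fm t)" "arithmetical \<sigma> \<Longrightarrow> arithmetical (Prv_fm \<sigma> t)"
proof -
  have f: "\<forall>(c, ps, s)\<in>set form_rules. arithmetical s" "\<forall>(c, ps, s)\<in>set subst_rules. arithmetical s"
    by (simp_all add: form_rules_def subst_rules_def Let_def)
  show "arithmetical (Pi11_sentence_fm t)"
    using arithmetical_der_fm[OF f(1)] by (simp add: Pi11_sentence_fm_def)
  assume "arithmetical \<sigma>"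
  then have "\<forall>(c, ps, s)\<in>set (logic_rules \<sigma>). arithmetical s"
    by (simp add: logic_rules_unfold)
  then show "arithmetical (Prv_fm \<sigma> t)"
    unfolding Prv_fm_def prv_rules_split using f by (intro arithmetical_der_fm) auto
qed

lemma bd_Pi11_sentence_fm: "bd0 (Pi11_sentence_fm (Var 0)) \<le> 1" "bd1 (Pi11_sentence_fm (Var 0)) = 0"
  using bd_der_fm[OF form_ok, of "jF Zero Zero One (Var 0)" 1]
  by (simp_all add: Pi11_sentence_fm_def up_def jF_def qAll1_def)

lemma bd_Prv_fm:
  assumes "defines_axioms \<sigma> S" shows "bd0 (Prv_fm \<sigma> (Var 0)) \<le> 1" "bd1 (Prv_fm \<sigma> (Var 0)) = 0"
  using bd_der_fm[OF prv_ok[OF assms], of "jP (Var 0)" 1] by (simp_all add: Prv_fm_def jP_def)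

lemma sentence_RFN:
  assumes "defines_axioms \<sigma> S" "universal_Pi11 U" shows "sentence (RFN_Pi11 U \<sigma>)"
  using bd_Pi11_sentence_fm bd_Prv_fm[OF assms(1)] assms(2)
  by (simp add: sentence_def RFN_Pi11_def universal_Pi11_def)

section \<open>Upward absoluteness of existential formulas\<close>

inductive sig :: "fm \<Rightarrow> bool" where
  "sig (Eq s t)"
| "sig (Less s t)"
| "sig (Neg (Less s t))"
| "sig Top"
| "sig Bot"
| "sig p \<Longrightarrow> sig q \<Longrightarrow> sig (Conj p q)"
| "sig p \<Longrightarrow> sig q \<Longrightarrow> sig (Disj p q)"
| "sig p \<Longrightarrow> sig (Ex0 p)"
| "sig p \<Longrightarrow> sig (All0 (Imp (Less (Var 0) (lift_tm 0 t)) p))"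

context aca
begin

lemma nm_hom: "nm (i + j) = nm i \<oplus> nm j" "nm (i * j) = nm i \<otimes> nm j" "nm (pair i j) = pr (nm i) (nm j)"
proof -
  show add: "nm (i + j) = nm i \<oplus> nm j" for i j
    by (induction j) (simp_all add: nm_simps add_0 add_succ)
  show mul: "nm (i * j) = nm i \<otimes> nm j" for i j
    by (induction j) (simp_all add: nm_simps mul_0 mul_succ add ring)
  show "nm (pair i j) = pr (nm i) (nm j)" by (simp add: pair_def pr_def add mul)
qed

lemma nm_1: "nm (Suc 0) = \<one>" by (simp add: nm_simps zero_add)

lemma ev_nm: "ev M (\<lambda>i. nm (e i)) t = nm (evalt e t)"
  by (induction t) (simp_all add: nm_hom nm_simps nm_1)

lemma less_nm: "x \<prec> nm n \<longleftrightarrow> (\<exists>i<n. x = nm i)"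
  by (induction n) (auto simp: nm_simps not_less_0 less_succ less_Suc_eq)

text \<open>By \<open>less_nm\<close> the standard numbers form an initial segment of the model. A
  bounded quantifier with a standard bound thus meets standard numbers only, and standard witnesses
  of existential quantifiers persist.\<close>

lemma sig_upward: "sig p \<Longrightarrow> sat e E p \<Longrightarrow> sats M (\<lambda>i. nm (e i)) E' p"
proof (induction arbitrary: e rule: sig.induct)
  case (1 s t)
  then show ?case by (simp add: ev_nm)
next
  case (2 s t)
  then show ?case by (auto simp: ev_nm less_nm)
next
  case (3 s t)
  then show ?case by (auto simp: ev_nm less_nm nm_inj)
next
  case (8 p)
  then obtain n where "sat (case_nat n e) E p" by auto
  from 8(2)[OF this] have "sats M (case_nat (nm n) (\<lambda>i. nm (e i))) E' p"
    by (rule back_subst[where P = "\<lambda>e. sats M e E' p"]) (auto simp: fun_eq_iff split: nat.splits)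
  then show ?case by auto
next
  case (9 p t)
  have "sats M (case_nat (nm n) (\<lambda>i. nm (e i))) E' p" if "n < evalt e t" for n
  proof -
    have "evalt (case_nat n e) (lift_tm 0 t) = evalt e t" using ev_lift[of std n e t] unfolding ev_std .
    then have "sat (case_nat n e) E p" using 9(3) that by auto
    from 9(2)[OF this] show ?thesis
      by (rule back_subst[where P = "\<lambda>e. sats M e E' p"]) (auto simp: fun_eq_iff split: nat.splits)
  qed
  then show ?case by (auto simp: ev_nm less_nm)
qed auto

end

lemma sig_lists: "(\<And>p. p \<in> set ps \<Longrightarrow> sig p) \<Longrightarrow> sig (conjs ps)"
  "(\<And>p. p \<in> set ps \<Longrightarrow> sig p) \<Longrightarrow> sig (disjs ps)"
  by (induction ps) (auto simp: conjs_def disjs_def intro: sig.intros)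

lemma sig_Ex0_power: "sig p \<Longrightarrow> sig ((Ex0 ^^ k) p)"
  by (induction k) (auto intro: sig.intros)

lemma sig_beta_fm: "sig (beta_fm a b i v)"
  by (simp add: beta_fm_def Let_def sig.intros)

lemma sig_der_fm:
  assumes "\<forall>(c, ps, s)\<in>set rs. sig s" shows "sig (der_fm rs t)"
proof -
  have "sig (step_fm r)" if "r \<in> set rs" for r
  proof -
    obtain c ps s where r: "r = (c, ps, s)" by (cases r)
    have "sig s" using assms that r by auto
    moreover have "sig (prev_fm p)" for p by (simp add: prev_fm_def sig.intros sig_beta_fm)
    ultimately show ?thesis by (auto simp: r step_fm_def intro!: sig.intros sig_beta_fm sig_lists)
  qed
  then have "sig ((Ex0 ^^ 8) (disjs (map step_fm rs)))"
    by (intro sig_Ex0_power sig_lists) auto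
  from sig.intros(9)[OF this, of "Add (Var 0) One"]
  have "sig (All0 (Imp (Less (Var 0) (Add (Var 1) One)) ((Ex0 ^^ 8) (disjs (map step_fm rs)))))" by simp
  then show ?thesis unfolding der_fm_def by (intro sig.intros sig_beta_fm)
qed

lemma sig_Pi11_sentence_fm: "sig (Pi11_sentence_fm t)"
proof -
  have "\<forall>(c, ps, s)\<in>set form_rules. sig s"
    by (simp add: form_rules_def Let_def sig.intros)
  then show ?thesis unfolding Pi11_sentence_fm_def by (intro sig.intros sig_der_fm)
qed

section \<open>A theory does not prove its own reflection from a true existential sentence\<close>

text \<open>Variable 0 is the code of the numeral for variable 1, certified by the sequence of the
  codes of all numerals up to it.\<close>

definition numcode_fm :: fm where
  "numcode_fm = Ex0 (Ex0 (Conj (beta_fm (Var 1) (Var 0) Zero qZero)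
     (Conj (beta_fm (Var 1) (Var 0) (Var 3) (Var 2))
       (All0 (Imp (Less (Var 0) (Var 4)) (Ex0 (Conj (beta_fm (Var 3) (Var 2) (Var 1) (Var 0))
          (beta_fm (Var 3) (Var 2) (Add (Var 1) One) (qAdd (Var 0) qOne)))))))))"

text \<open>In arbitrary models only uniqueness is used, because the diagonal sentence quantifies
  universally over the code of the numeral. Existence is used in the standard model alone.\<close>

lemma (in aca) numcode_unique:
  assumes "sats M (case_nat t (case_nat (nm n) e)) E numcode_fm"
  shows "t = nm (tcode (num n))"
proof -
  from assms obtain a b where ab: "nm (pair 1 0) = beta a b \<zero>" "t = beta a b (nm n)"
    "\<And>i. i \<prec> nm n \<Longrightarrow> beta a b (i \<oplus> \<one>) = pr (nm 3) (pr (beta a b i) (nm (pair 2 0)))"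
    unfolding numcode_fm_def by (auto simp: qZero_def qAdd_def qOne_def nm_hom eq_commute simp del: num.simps)
  have "i \<le> n \<Longrightarrow> beta a b (nm i) = nm (tcode (num i))" for i
  proof (induction i)
    case 0
    then show ?case using ab(1) by (simp add: nm_simps)
  next
    case (Suc i)
    then have "i < n" by simp
    then have "nm i \<prec> nm n" unfolding less_nm by blast
    from ab(3)[OF this] Suc show ?case by (simp add: nm_simps(2)[symmetric] nm_hom del: nm_simps)
  qed
  then show ?thesis using ab(2) by simp
qed

lemma numcode_exists: "sat (case_nat (tcode (num n)) (case_nat n e)) E numcode_fm"
proof -
  obtain a b where ab: "\<And>i. i < Suc n \<Longrightarrow> nbeta a b i = tcode (num i)"
    using nbeta_exists[of "Suc n" "\<lambda>i. tcode (num i)"] by blast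
  have b0: "nbeta a b 0 = pair (Suc 0) 0" using ab[of 0] by simp
  show ?thesis
    unfolding numcode_fm_def sat_connectives
    by (rule exI[of _ a], rule exI[of _ b])
      (simp add: ab b0 qZero_def qAdd_def qOne_def)
qed

text \<open>The diagonal sentence \<open>p\<close> says that \<open>p\<close> is unprovable in
  \<open>S\<close> if \<open>q\<close> has a witness. In a model of \<open>S\<close> where
  \<open>q\<close> has a witness and \<open>p\<close> counts as provable, reflection makes
  \<open>p\<close> true, hence \<open>p\<close> unprovable. So \<open>S\<close> proves
  \<open>p\<close>. By soundness \<open>p\<close> is true, and since \<open>q\<close> really has a
  witness, \<open>p\<close> is unprovable. With \<open>q\<close> under a universal set quantifier as
  an antecedent, \<open>p\<close> is Pi11.\<close>

theorem no_self_reflection: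
  assumes S: "is_theory S" "ACA0 \<subseteq> S" and \<sigma>: "defines_axioms \<sigma> S" and sound: "sound_for Pi11 S"
    and U: "universal_Pi11 U"
    and q: "arithmetical q" "bd0 q = 0" "bd1 q \<le> 1" and true: "true_std (Ex1 q)"
    and refl: "insert (Ex1 q) S \<turnstile> RFN_Pi11 U \<sigma>"
  shows False
proof -
  \<comment> \<open>Diagonalization without a substitution function: instead of inserting the
    numeral of \<open>g\<close> into \<open>p0\<close>, the sentence \<open>p\<close> quantifies
    over a number equal to it. The code of \<open>p\<close> is then a polynomial in \<open>g\<close>
    and the code of that numeral, so \<open>B\<close>, in which the free variable stands for
    \<open>g\<close>, can mention it by a term.\<close>
  define B where "B = All0 (Imp numcode_fm (All0 (Imp
    (Eq (Var 0) (qAll1 (qAll0 (qImp (qEq (qVar (num 0)) (Var 1)) (Var 2))))) (Neg (Prv_fm \<sigma> (Var 0))))))"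
  \<comment> \<open>Identifying all number variables with variable 0, and all set variables
    likewise, keeps the meaning of \<open>q\<close> and \<open>B\<close> and makes the bounds on the
    free variables evident.\<close>
  define p0 where "p0 = psub (\<lambda>_. Var 0) (\<lambda>_. 0) (Imp q B)"
  define g where "g = fcode p0"
  define p where "p = All1 (All0 (Imp (Eq (Var 0) (num g)) p0))"
  have arB: "arithmetical B"
    using \<sigma> by (simp add: B_def numcode_fm_def defines_axioms_def)
  have "bd0 p0 \<le> 1" "bd1 p0 \<le> 1"
    using bd0_psub[of "\<lambda>_. Var 0" 1 "\<lambda>_. 0" "Imp q B"] bd1_psub[of "\<lambda>_. 0" 1 "\<lambda>_. Var 0" "Imp q B"]
    by (simp_all add: p0_def)
  then have p: "p \<in> Pi11" "sentence p"
    using q(1) arB by (auto simp: p_def Pi11_def sentence_def p0_def)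
  have code: "fcode p = pair 6 (pair 5 (pair 4 (pair (pair 0 (pair (pair 0 0) (tcode (num g)))) g)))"
    by (simp add: p_def g_def)
  have q_any: "sats M e E q = sats M e' (case_nat (E 0) E') q" for M :: "nat str" and e e' E E'
  proof (rule sats_cong)
    fix i assume "i < bd1 q"
    then show "E i = case_nat (E 0) E' i" using q(3) by (cases i) auto
  qed (simp add: q(2))
  have sats_p: "sats M e E p \<longleftrightarrow> (\<forall>X\<in>ssets M. sats M e (case_nat X E) q \<longrightarrow>
      sats M (\<lambda>_. aca.nm M g) (\<lambda>_. X) B)" if M: "aca M" for M :: "nat str" and e E
    unfolding p_def sats.simps ev.simps
    by (simp add: p0_def sats_psub aca.ev_num[OF M] q_any[of M "\<lambda>_. aca.nm M g" "\<lambda>_. _" e E])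
  have "S \<turnstile> p"
  proof (rule prv_by_models[OF S])
    fix M :: "nat str" assume M: "aca M" and MS: "\<And>r. r \<in> S \<Longrightarrow> valid M r"
    interpret aca M by (rule M)
    show "valid M p"
    proof (rule validI)
      fix e E assume E: "\<And>i :: nat. E i \<in> ssets M"
      show "sats M e E p"
        unfolding sats_p[OF M]
      proof (intro ballI impI)
        fix X assume X: "X \<in> ssets M" and qX: "sats M e (case_nat X E) q"
        have qX': "sats M e' (case_nat X E') q" for e' E'
          using qX q_any[of M e "case_nat X E" e' E'] by simp
        then have "valid M (Ex1 q)" using X by (intro validI) auto
        then have RFN: "valid M (RFN_Pi11 U \<sigma>)"
          using soundness[OF refl] MS by blast
        show "sats M (\<lambda>_. nm g) (\<lambda>_. X) B"
          unfolding B_def sats.simps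
        proof (intro allI impI notI)
          fix t y
          let ?e = "case_nat t (\<lambda>_. nm g)"
          assume t: "sats M ?e (\<lambda>_. X) numcode_fm"
            and y: "ev M (case_nat y ?e) (Var 0) = ev M (case_nat y ?e) (qAll1 (qAll0 (qImp (qEq (qVar (num 0)) (Var 1)) (Var 2))))"
            and Prv: "sats M (case_nat y ?e) (\<lambda>_. X) (Prv_fm \<sigma> (Var 0))"
          have "(\<lambda>_ :: nat. nm g) = case_nat (nm g) (\<lambda>_. nm g)" by (auto split: nat.splits)
          with t have tt: "t = nm (tcode (num g))" using numcode_unique by metis
          have yc: "y = nm (fcode p)"
            using y unfolding code tt
            by (simp add: qAll1_def qAll0_def qImp_def qEq_def qVar_def nm_hom nm_simps(1) del: num.simps)
          have env: "case_nat y ?e = (\<lambda>i. nm (case_nat (fcode p) (case_nat (tcode (num g)) (\<lambda>_. g)) i))"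
            unfolding yc tt by (auto simp: fun_eq_iff split: nat.splits)
          \<comment> \<open>The code of \<open>p\<close> is standard, so the true existential fact
            that it codes a Pi11-sentence passes to the model. \<open>Prv_fm\<close> need not be
            existential; its truth in the model is the assumption to be refuted.\<close>
          have "sats M (case_nat y ?e) (\<lambda>_. X) (Pi11_sentence_fm (Var 0))"
            unfolding env using p
            by (intro sig_upward[OF sig_Pi11_sentence_fm, where E = "\<lambda>_. {}"]) (auto simp: sat_Pi11_sentence_fm)
          moreover have "sats M ?e (\<lambda>_. X) (RFN_Pi11 U \<sigma>)"
            by (rule valid_sats[OF M RFN sentence_RFN[OF \<sigma> U]])
          ultimately have "sats M (case_nat y ?e) (\<lambda>_. X) U"
            using Prv unfolding RFN_Pi11_def by simp
          moreover have "valid M (Iff p (subst0 0 (num (fcode p)) U))"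
            using U p unfolding universal_Pi11_def by (meson ACA0_valid soundness)
          then have "sats M ?e (\<lambda>_. X) (Iff p (subst0 0 (num (fcode p)) U))"
            using X by (simp add: valid_def del: sats_connectives fcode.simps)
          ultimately have "sats M ?e (\<lambda>_. X) p" by (simp add: sats_subst0 yc del: fcode.simps)
          then have "sats M (\<lambda>_. nm g) (\<lambda>_. X) B" using X qX' unfolding sats_p[OF M] by blast
          then show False using t y Prv unfolding B_def sats.simps by blast
        qed
      qed
    qed
  qed
  then have "true_std p" using sound p unfolding sound_for_def by blast
  then have "sats std (\<lambda>_. 0) (\<lambda>_. {}) p" by (simp add: true_std_def)
  moreover obtain X where X: "sat (\<lambda>_. 0) (case_nat X (\<lambda>_. {})) q"
    using true by (auto simp: true_std_def)
  ultimately have "sats std (\<lambda>_. aca.nm std g) (\<lambda>_. X) B"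
    unfolding sats_p[OF aca_std] by simp
  moreover have "aca.nm std n = n" for n
    using aca.ev_num[OF aca_std, of "\<lambda>_. 0" n] by simp
  ultimately have B: "sat (\<lambda>_. g) (\<lambda>_. X) B" by simp
  have env: "(\<lambda>_ :: nat. g) = case_nat g (\<lambda>_. g)" by (auto split: nat.splits)
  have "sat (case_nat (tcode (num g)) (\<lambda>_. g)) (\<lambda>_. X) numcode_fm"
    using numcode_exists[of g "\<lambda>_. g" "\<lambda>_. X"] unfolding env[symmetric] .
  moreover have "evalt (case_nat (fcode p) (case_nat (tcode (num g)) (\<lambda>_. g)))
      (qAll1 (qAll0 (qImp (qEq (qVar (num 0)) (Var 1)) (Var 2)))) = fcode p"
    unfolding code by (simp add: qAll1_def qAll0_def qImp_def qEq_def qVar_def)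
  ultimately have "\<not> sat (case_nat (fcode p) (case_nat (tcode (num g)) (\<lambda>_. g))) (\<lambda>_. X) (Prv_fm \<sigma> (Var 0))"
    using B unfolding B_def sat.simps by (metis evalt.simps(1) nat.case(1))
  then show False using \<open>S \<turnstile> p\<close> by (auto simp: sat_Prv_fm[OF \<sigma> S(1)])
qed

section \<open>Comparison of countable well-orders\<close>

lemma Well_orderI:
  fixes r :: "'a rel"
  assumes refl: "\<And>a b. (a, b) \<in> r \<Longrightarrow> (a, a) \<in> r \<and> (b, b) \<in> r"
    and trans: "\<And>a b c. (a, b) \<in> r \<Longrightarrow> (b, c) \<in> r \<Longrightarrow> (a, c) \<in> r"
    and antisym: "\<And>a b. (a, b) \<in> r \<Longrightarrow> (b, a) \<in> r \<Longrightarrow> a = b"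
    and total: "\<And>a b. (a, a) \<in> r \<Longrightarrow> (b, b) \<in> r \<Longrightarrow> (a, b) \<in> r \<or> (b, a) \<in> r"
    and least: "\<And>X x. x \<in> X \<Longrightarrow> (x, x) \<in> r \<Longrightarrow>
      \<exists>y\<in>X. (y, y) \<in> r \<and> (\<forall>z\<in>X. (z, z) \<in> r \<longrightarrow> (y, z) \<in> r)"
  shows "Well_order r"
proof -
  have F: "a \<in> Field r \<longleftrightarrow> (a, a) \<in> r" for a using refl unfolding Field_def by blast
  have "wf (r - Id)"
  proof (rule wfI_min)
    fix x :: 'a and Q :: "'a set" assume x: "x \<in> Q"
    show "\<exists>z\<in>Q. \<forall>y. (y, z) \<in> r - Id \<longrightarrow> y \<notin> Q"
    proof (cases "(x, x) \<in> r")
      case True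
      from least[OF x True] show ?thesis using refl antisym by blast
    next
      case False
      then show ?thesis using x refl by blast
    qed
  qed
  moreover have "r \<subseteq> Field r \<times> Field r" by (auto simp: Field_def)
  moreover from this have "refl_on (Field r) r" unfolding refl_on_def using F by blast
  moreover have "trans r" by (rule transI) (rule trans)
  moreover have "antisym r" by (rule antisymI) (rule antisym)
  moreover have "total_on (Field r) r" unfolding total_on_def using F total by blast
  ultimately show ?thesis
    unfolding well_order_on_def linear_order_on_def partial_order_on_def preorder_on_def by simp
qed

lemma Well_orderD:
  assumes "Well_order r"
  shows "a \<in> Field r \<Longrightarrow> (a, a) \<in> r" "(a, b) \<in> r \<Longrightarrow> (b, c) \<in> r \<Longrightarrow> (a, c) \<in> r"
    "(a, b) \<in> r \<Longrightarrow> (b, a) \<in> r \<Longrightarrow> a = b" "a \<in> Field r \<Longrightarrow> b \<in> Field r \<Longrightarrow> (a, b) \<in> r \<or> (b, a) \<in> r"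
proof -
  have rt: "refl_on (Field r) r" "trans r" "antisym r" "total_on (Field r) r"
    using assms by (simp_all add: well_order_on_def linear_order_on_def partial_order_on_def preorder_on_def)
  show "a \<in> Field r \<Longrightarrow> (a, a) \<in> r" using rt(1) by (rule refl_onD)
  show "(a, b) \<in> r \<Longrightarrow> (b, c) \<in> r \<Longrightarrow> (a, c) \<in> r" using rt(2) by (rule transD)
  show "(a, b) \<in> r \<Longrightarrow> (b, a) \<in> r \<Longrightarrow> a = b" using rt(3) by (rule antisymD)
  show "a \<in> Field r \<Longrightarrow> b \<in> Field r \<Longrightarrow> (a, b) \<in> r \<or> (b, a) \<in> r"
    using rt(1,4) by (cases "a = b") (auto simp: refl_on_def total_on_def)
qed

lemma Well_order_least:
  assumes r: "Well_order r" and x: "x \<in> X" "x \<in> Field r"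
  obtains y where "y \<in> X" "y \<in> Field r" "\<And>z. z \<in> X \<Longrightarrow> z \<in> Field r \<Longrightarrow> (y, z) \<in> r"
proof -
  have "wf (r - Id)" using r by (simp add: well_order_on_def)
  then obtain y where y: "y \<in> X \<inter> Field r" "\<And>z. (z, y) \<in> r - Id \<Longrightarrow> z \<notin> X \<inter> Field r"
    using x wfE_min[of "r - Id" x "X \<inter> Field r"] by blast
  have "(y, z) \<in> r" if "z \<in> X" "z \<in> Field r" for z
  proof (cases "z = y")
    case True
    then show ?thesis using Well_orderD(1)[OF r that(2)] by simp
  next
    case False
    then have "(z, y) \<notin> r" using y(2)[of z] that by blast
    then show ?thesis using Well_orderD(4)[OF r, of y z] y(1) that(2) by blast
  qed
  with y(1) show ?thesis by (intro that) auto
qed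

text \<open>
  Otherwise \<open>s\<close> embeds onto a proper initial segment of \<open>r\<close>; after that embedding \<open>h\<close> would be a strictly
  increasing self-map of \<open>r\<close> that moves the end of the segment down.
\<close>

lemma ordLeq_by_mono:
  assumes r: "Well_order r" and s: "Well_order s"
    and fld: "\<And>a. a \<in> Field r \<Longrightarrow> h a \<in> Field s"
    and mono: "\<And>a b. (a, b) \<in> r \<Longrightarrow> a \<noteq> b \<Longrightarrow> (h a, h b) \<in> s \<and> h a \<noteq> h b"
  shows "(r, s) \<in> ordLeq"
proof (rule ccontr)
  assume "\<not> ?thesis"
  then have "(s, r) \<in> ordLess" using ordLess_or_ordLeq[OF s r] by simp
  then obtain f where f: "embed s r f" "\<not> bij_betw f (Field s) (Field r)"
    unfolding ordLess_def embedS_def by blast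
  have inj: "inj_on f (Field s)" using embed_inj_on[OF s f(1)] .
  have fil: "wo_rel.ofilter r (f ` Field s)" using embed_Field_ofilter[OF s r f(1)] .
  have neq: "f ` Field s \<noteq> Field r" using f(2) inj by (simp add: bij_betw_def)
  have "wo_rel r" using r by (simp add: wo_rel_def)
  from iffD1[OF wo_rel.ofilter_underS_Field[OF this] fil]
  have "\<exists>b\<in>Field r. f ` Field s = underS r b"
  proof
    assume "f ` Field s = Field r"
    with neq show ?thesis ..
  qed
  then obtain b where b: "b \<in> Field r" "f ` Field s = underS r b" by blast
  define g where "g a = f (h a)" for a
  have g: "g a \<in> Field r" "(a', c) \<in> r \<Longrightarrow> a' \<noteq> c \<Longrightarrow> (g a', g c) \<in> r \<and> g a' \<noteq> g c" if "a \<in> Field r" for a a' c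
  proof -
    show "g a \<in> Field r" unfolding g_def using embed_in_Field[OF f(1) fld[OF that]] .
    assume "(a', c) \<in> r" "a' \<noteq> c"
    then have "(h a', h c) \<in> s" "h a' \<noteq> h c" "h a' \<in> Field s" "h c \<in> Field s"
      using mono fld by (auto intro: FieldI1 FieldI2)
    moreover from this have "(f (h a'), f (h c)) \<in> r"
      using embed_compat[OF f(1)] unfolding compat_def by blast
    ultimately show "(g a', g c) \<in> r \<and> g a' \<noteq> g c"
      using inj_onD[OF inj] unfolding g_def by blast
  qed
  have "f (h b) \<in> underS r b" using b fld by blast
  then have gb: "(g b, b) \<in> r" "g b \<noteq> b" by (auto simp: g_def underS_def)
  let ?X = "{a. (g a, a) \<in> r \<and> g a \<noteq> a}"
  obtain y where y: "y \<in> ?X" "y \<in> Field r" "\<And>z. z \<in> ?X \<Longrightarrow> z \<in> Field r \<Longrightarrow> (y, z) \<in> r"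
    using Well_order_least[OF r, of b ?X] gb b(1) by blast
  then have "(g (g y), g y) \<in> r \<and> g (g y) \<noteq> g y" using g(2)[OF b(1)] by blast
  then have "(y, g y) \<in> r" using y g(1) by blast
  then show False using y(1) Well_orderD(3)[OF r] by blast
qed

lemma ordLeq_mono:
  assumes "(r, s) \<in> ordLeq"
  obtains h where "\<And>a. a \<in> Field r \<Longrightarrow> h a \<in> Field s"
    "\<And>a b. (a, b) \<in> r \<Longrightarrow> a \<noteq> b \<Longrightarrow> (h a, h b) \<in> s \<and> h a \<noteq> h b"
proof -
  obtain f where f: "embed r s f" and r: "Well_order r" using assms unfolding ordLeq_def by blast
  have "(f a, f b) \<in> s \<and> f a \<noteq> f b" if "(a, b) \<in> r" "a \<noteq> b" for a b
    using that embed_compat[OF f] embed_inj_on[OF r f] FieldI1[OF that(1)] FieldI2[OF that(1)]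
    unfolding compat_def inj_on_def by blast
  then show ?thesis using that embed_in_Field[OF f] by blast
qed

lemma ordertype_le: "Well_order r \<Longrightarrow> Well_order s \<Longrightarrow> ordertype r \<le> ordertype s \<longleftrightarrow> (r, s) \<in> ordLeq"
  unfolding ordertype_def by (rule less_eq_cord.abs_eq) (rule ordIso_reflexive, assumption)+

lemma ordertype_less: "Well_order r \<Longrightarrow> Well_order s \<Longrightarrow> ordertype r < ordertype s \<longleftrightarrow> (r, s) \<in> ordLess"
  unfolding ordertype_def by (rule less_cord.abs_eq) (rule ordIso_reflexive, assumption)+

text \<open>The orders are placed one after another along an enumeration of the index type, and each
  embeds into this sum. The sum is again a well-order on numbers. Applied to all programs, this
  shows that the minimum defining \<open>pto\<close> exists.\<close>

lemma ordertype_bounded: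
  fixes r :: "'i :: countable \<Rightarrow> nat rel"
  assumes r: "\<And>i. Well_order (r i)"
  shows "\<exists>\<beta>. \<forall>i. ordertype (r i) \<le> \<beta>"
proof -
  define enc where "enc i a = prod_encode (to_nat i, a)" for i :: 'i and a
  have enc [simp]: "enc i a = enc j b \<longleftrightarrow> i = j \<and> a = b" for i j a b
    by (simp add: enc_def prod_encode_eq)
  define D where "D = {(s, t). \<exists>i a j b. s = enc i a \<and> t = enc j b \<and> a \<in> Field (r i) \<and> b \<in> Field (r j) \<and>
    (to_nat i < to_nat j \<or> i = j \<and> (a, b) \<in> r i)}"
  have D: "(enc i a, enc j b) \<in> D \<longleftrightarrow> a \<in> Field (r i) \<and> b \<in> Field (r j) \<and>
    (to_nat i < to_nat j \<or> i = j \<and> (a, b) \<in> r i)" for i a j b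
    by (auto simp: D_def)
  have ex: "\<exists>i a. s = enc i a \<and> a \<in> Field (r i)" "\<exists>j b. t = enc j b \<and> b \<in> Field (r j)" if "(s, t) \<in> D" for s t
    using that unfolding D_def by blast+
  have diag: "(enc i a, enc i a) \<in> D \<longleftrightarrow> a \<in> Field (r i)" for i a
    using Well_orderD(1)[OF r] by (auto simp: D)
  have wo: "Well_order D"
  proof (rule Well_orderI)
    fix s t u
    show "(s, s) \<in> D \<and> (t, t) \<in> D" if "(s, t) \<in> D"
      using ex[OF that] diag by blast
    show "(s, u) \<in> D" if st: "(s, t) \<in> D" and tu: "(t, u) \<in> D"
    proof -
      obtain i a j b k c where "s = enc i a" "t = enc j b" "u = enc k c"
        using ex[OF st] ex[OF tu] by blast
      with st tu show ?thesis using Well_orderD(2)[OF r] by (auto simp: D)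
    qed
    show "s = t" if st: "(s, t) \<in> D" and ts: "(t, s) \<in> D"
    proof -
      obtain i a j b where "s = enc i a" "t = enc j b" using ex[OF st] by blast
      with st ts show ?thesis using Well_orderD(3)[OF r] by (auto simp: D)
    qed
    show "(s, t) \<in> D \<or> (t, s) \<in> D" if ss: "(s, s) \<in> D" and tt: "(t, t) \<in> D"
    proof -
      obtain i a j b where st: "s = enc i a" "t = enc j b" "a \<in> Field (r i)" "b \<in> Field (r j)"
        using ex[OF ss] ex[OF tt] by blast
      moreover have "to_nat i < to_nat j \<or> to_nat j < to_nat i \<or> i = j"
        by (metis inj_to_nat injD linorder_neqE_nat)
      ultimately show ?thesis using Well_orderD(4)[OF r st(3)] unfolding st D by blast
    qed
  next
    fix X x assume x: "x \<in> X" "(x, x) \<in> D"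
    define P where "P i \<longleftrightarrow> (\<exists>a. a \<in> Field (r i) \<and> enc i a \<in> X)" for i
    obtain i0 a0 where x0: "x = enc i0 a0" "a0 \<in> Field (r i0)"
      using ex(1)[OF x(2)] by (elim exE conjE) (rule that)
    have "P i0" unfolding P_def using x0 x(1) by (intro exI[of _ a0]) simp
    from ex_has_least_nat[of P, OF this, of to_nat]
    obtain i where i: "P i" "\<forall>j. P j \<longrightarrow> to_nat i \<le> to_nat j" by (elim exE conjE) (rule that)
    obtain a where a: "a \<in> Field (r i)" "enc i a \<in> X"
      using i(1) unfolding P_def by (elim exE conjE) (rule that)
    have "a \<in> {b. enc i b \<in> X}" using a(2) by simp
    then obtain b where b: "b \<in> {b. enc i b \<in> X}" "b \<in> Field (r i)"
      "\<And>c. c \<in> {b. enc i b \<in> X} \<Longrightarrow> c \<in> Field (r i) \<Longrightarrow> (b, c) \<in> r i"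
      by (rule Well_order_least[OF r _ a(1)]) (rule that, assumption, assumption, blast)
    have "(enc i b, z) \<in> D" if z: "z \<in> X" "(z, z) \<in> D" for z
    proof -
      obtain j c where j: "z = enc j c" "c \<in> Field (r j)"
        using ex(1)[OF z(2)] by (elim exE conjE) (rule that)
      then have "P j" unfolding P_def using z(1) by (intro exI[of _ c]) simp
      with i(2) have "to_nat i \<le> to_nat j" by simp
      then consider "to_nat i < to_nat j" | "i = j" by (metis inj_to_nat injD le_neq_implies_less)
      then show ?thesis
      proof cases
        case 1
        then show ?thesis using b(2) j by (simp add: D)
      next
        case 2
        then show ?thesis using b j z(1) by (simp add: D)
      qed
    qed
    then show "\<exists>y\<in>X. (y, y) \<in> D \<and> (\<forall>z\<in>X. (z, z) \<in> D \<longrightarrow> (y, z) \<in> D)"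
      using b(1,2) diag by (intro bexI[of _ "enc i b"]) auto
  qed
  have "ordertype (r i) \<le> ordertype D" for i
    unfolding ordertype_le[OF r wo]
  proof (rule ordLeq_by_mono[OF r wo])
    show "enc i a \<in> Field D" if "a \<in> Field (r i)" for a
      using that diag by (blast intro: FieldI1)
    show "(enc i a, enc i b) \<in> D \<and> enc i a \<noteq> enc i b" if "(a, b) \<in> r i" "a \<noteq> b" for a b
      using that by (auto simp: D intro: FieldI1 FieldI2)
  qed
  then show ?thesis by blast
qed

instance recf :: countable by countable_datatype

lemma pto_bounded: "\<exists>\<beta>. \<forall>f. recursive_wo f \<and> T \<turnstile> WO_fm f \<longrightarrow> ordertype (rel_of f) \<le> \<beta>"
proof -
  have "Well_order (if recursive_wo f then rel_of f else {})" for f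
    using Well_orderI[of "{}"] by (simp add: recursive_wo_def)
  from ordertype_bounded[of "\<lambda>f. if recursive_wo f then rel_of f else {}", OF this]
  obtain \<beta> where \<beta>: "\<And>f. ordertype (if recursive_wo f then rel_of f else {}) \<le> \<beta>" by blast
  have "ordertype (rel_of f) \<le> \<beta>" if "recursive_wo f" for f using \<beta>[of f] that by simp
  then show ?thesis by blast
qed

lemma pto_upper: "recursive_wo f \<Longrightarrow> T \<turnstile> WO_fm f \<Longrightarrow> ordertype (rel_of f) \<le> pto T"
  using LeastI_ex[OF pto_bounded[of T]] unfolding pto_def by blast

lemma less_pto:
  assumes "\<beta> < pto T" obtains f where "recursive_wo f" "T \<turnstile> WO_fm f" "\<beta> < ordertype (rel_of f)"
  using not_less_Least[OF assms[unfolded pto_def]] that by (auto simp: not_le)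

section \<open>Kleene-Brouwer orders of true sentences\<close>

lemma nm_std [simp]: "aca.nm std n = n"
  using aca.ev_num[OF aca_std, of "\<lambda>_. 0" n] by simp

abbreviation "nord p \<equiv> aca.ord std (width p) (tree p)"
abbreviation "npr \<equiv> aca.pr std"

lemma rel_of_prog: "rel_of (prog p n) = {(s, t). nord p n s t}"
  unfolding rel_of_def computes_iff aca.gr_prog[OF aca_std] by simp

lemma decides_prog: "decides (prog p n)"
  unfolding decides_def computes_iff aca.gr_prog[OF aca_std] by simp

lemma Well_order_rel_of:
  assumes "sat e E (WO_fm f)" shows "Well_order (rel_of f)"
proof -
  have r: "ngr f [a, b] (sone std) \<longleftrightarrow> (a, b) \<in> rel_of f" for a b
    by (simp add: rel_of_def computes_iff)
  have "sats std e E (WO_fm f)" using assms by simp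
  note w = this[unfolded aca.sats_WO_fm[OF aca_std] r]
  show ?thesis
  proof (rule Well_orderI)
    fix X x assume "x \<in> X" "(x, x) \<in> rel_of f"
    then show "\<exists>y\<in>X. (y, y) \<in> rel_of f \<and> (\<forall>z\<in>X. (z, z) \<in> rel_of f \<longrightarrow> (y, z) \<in> rel_of f)"
      using bspec[OF conjunct2[OF w], of X] by auto
  qed (use conjunct1[OF w] in blast)+
qed

lemma recursive_wo_prog:
  assumes p: "matrix p" and true: "\<And>X. sat (case_nat n e) (case_nat X E) p"
  shows "recursive_wo (prog p n)"
proof -
  have "sats std e E (WO_fm (prog p n))"
    by (rule aca.WO_prog[OF aca_std p, where e = e and E = E]) (simp add: true)
  then show ?thesis using Well_order_rel_of decides_prog unfolding recursive_wo_def by simp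
qed

text \<open>Every nonempty node lies below the root \<open>z\<close> coded by zeros, hence within
  the proper initial segment below \<open>z\<close>. The restriction to that segment is strictly
  shorter and still contains all pairs whose upper node is not a root.\<close>

lemma nonroot_order:
  assumes wo: "Well_order (rel_of (prog p n))"
  obtains r where "Well_order r" "(r, rel_of (prog p n)) \<in> ordLess"
    "\<And>s t. nord p n s t \<Longrightarrow> (\<forall>a b. t \<noteq> npr (npr a b) 0) \<Longrightarrow> (s, t) \<in> r"
proof -
  let ?R = "rel_of (prog p n)"
  \<comment> \<open>A node of length 0 is tested against no values at all, because the width is
    positive and no number is below 0.\<close>
  have "False" if "\<forall>i<width p. u i < (0 :: nat)" for u
    using that[rule_format, of 0] by (simp add: width_def)
  then have "aca.node std (width p) (tree p) n 0 0 0"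
    unfolding aca.node_def[OF aca_std] std_simps by blast
  then have "aca.isnode std (width p) (tree p) n (npr (npr 0 0) 0)"
    unfolding aca.isnode_def[OF aca_std] by blast
  then have root: "nord p n (npr (npr 0 0) 0) (npr (npr 0 0) 0)"
    unfolding aca.ord_def[OF aca_std] by (simp add: aca.le_iff[OF aca_std])
  define z where "z = npr (npr 0 0) 0"
  have z: "z \<in> Field ?R" unfolding z_def by (rule FieldI1[of _ z]) (use root in \<open>simp add: rel_of_prog z_def\<close>)
  have sub: "(s, t) \<in> Restr ?R (underS ?R z)" if st: "nord p n s t" and t: "\<forall>a b. t \<noteq> npr (npr a b) 0" for s t
  proof -
    have node: "aca.isnode std (width p) (tree p) n t" using st unfolding aca.ord_def[OF aca_std] by blast
    then obtain a b l where l: "t = npr (npr a b) l" unfolding aca.isnode_def[OF aca_std] by blast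
    have "l \<noteq> 0"
    proof
      assume "l = 0"
      with l have "t = npr (npr a b) 0" by simp
      with t show False by blast
    qed
    have "aca.kb std t z"
      unfolding l z_def aca.kb_iff[OF aca_std] using \<open>l \<noteq> 0\<close> by (intro exI[of _ 0]) simp
    then have "nord p n t z" using node root unfolding aca.ord_def[OF aca_std] z_def by blast
    then have tz: "(t, z) \<in> ?R" and st': "(s, t) \<in> ?R" using st by (auto simp: rel_of_prog)
    have "t \<noteq> z" unfolding z_def using t by blast
    moreover have "s \<noteq> z" using Well_orderD(3)[OF wo st'] tz \<open>t \<noteq> z\<close> by blast
    moreover have "(s, z) \<in> ?R" using Well_orderD(2)[OF wo st' tz] .
    ultimately show ?thesis using st' tz by (simp add: underS_def)
  qed
  have less: "(Restr ?R (underS ?R z), ?R) \<in> ordLess"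
    by (rule underS_Restr_ordLess[OF wo]) (use z in auto)
  show ?thesis by (rule that[OF Well_order_Restr[OF wo] less sub])
qed

text \<open>The requirement at \<open>n\<close> concerns only the part of \<open>F\<close> tagged
  with \<open>n\<close>. The embeddings can therefore be chosen independently and glued into one
  set, which the standard model contains.\<close>

lemma embedding_exists:
  assumes g: "Well_order (rel_of g)"
    and ord: "\<And>n. n \<in> A \<Longrightarrow> \<exists>r. (r, rel_of g) \<in> ordLeq \<and>
      (\<forall>s t. nord p n s t \<and> (\<forall>a b. t \<noteq> npr (npr a b) 0) \<longrightarrow> (s, t) \<in> r)"
  shows "\<exists>F. \<forall>n\<in>A. aca.embeds std p g F n"
proof -
  have gr: "ngr g [a, b] (sone std) \<longleftrightarrow> (a, b) \<in> rel_of g" for a b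
    by (simp add: rel_of_def computes_iff)
  have "\<exists>h. \<forall>F. (\<forall>s c. npr (npr n s) c \<in> F \<longleftrightarrow> c = h s) \<longrightarrow> aca.embeds std p g F n" if "n \<in> A" for n
  proof -
    obtain r where r: "(r, rel_of g) \<in> ordLeq"
      "\<forall>s t. nord p n s t \<and> (\<forall>a b. t \<noteq> npr (npr a b) 0) \<longrightarrow> (s, t) \<in> r"
      using ord[OF \<open>n \<in> A\<close>] by (elim exE conjE) (rule that)
    obtain h where h: "\<And>a. a \<in> Field r \<Longrightarrow> h a \<in> Field (rel_of g)"
      "\<And>a b. (a, b) \<in> r \<Longrightarrow> a \<noteq> b \<Longrightarrow> (h a, h b) \<in> rel_of g \<and> h a \<noteq> h b"
      using ordLeq_mono[OF r(1)] by blast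
    have "aca.embeds std p g F n" if F: "\<And>s c. npr (npr n s) c \<in> F \<longleftrightarrow> c = h s" for F
      unfolding aca.embeds_def[OF aca_std] gr F unfolding std_simps
    proof (intro conjI allI impI; elim conjE)
      fix s assume "nord p n s s" "\<forall>a b. s \<noteq> npr (npr a b) 0"
      then have "h s \<in> Field (rel_of g)" using r(2) h(1) FieldI1 by metis
      then show "\<exists>c. c = h s \<and> (c, c) \<in> rel_of g" using Well_orderD(1)[OF g] by blast
    next
      fix s t c d assume "nord p n s t" "s \<noteq> t" "\<forall>a b. t \<noteq> npr (npr a b) 0" "c = h s" "d = h t"
      then show "(c, d) \<in> rel_of g" "c \<noteq> d" using r(2) h(2) by blast+
    qed
    then show ?thesis by blast
  qed
  then have "\<forall>n\<in>A. \<exists>h. \<forall>F. (\<forall>s c. npr (npr n s) c \<in> F \<longleftrightarrow> c = h s) \<longrightarrow> aca.embeds std p g F n"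
    by (rule ballI)
  from bchoice[OF this] obtain H
    where H: "\<forall>n\<in>A. \<forall>F. (\<forall>s c. npr (npr n s) c \<in> F \<longleftrightarrow> c = H n s) \<longrightarrow> aca.embeds std p g F n"
    by (elim exE) (rule that)
  let ?F = "{npr (npr n s) (H n s) | n s. True}"
  have mem: "npr (npr n s) c \<in> ?F \<longleftrightarrow> c = H n s" for n s c
    by (auto simp: aca.pr_inj[OF aca_std])
  have "aca.embeds std p g ?F n" if "n \<in> A" for n
    by (rule HOL.mp[OF spec[OF bspec[OF H that]]]) (intro allI mem)
  then show ?thesis by (intro exI[of _ ?F] ballI)
qed

section \<open>Ordinal comparison and reflection\<close>

lemma env_cong:
  assumes "bd0 p \<le> 1" "bd1 p \<le> 1" "0 < bd0 p \<Longrightarrow> e 0 = e' 0" "0 < bd1 p \<Longrightarrow> E 0 = E' 0"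
  shows "sats M e E p = sats M e' E' p"
proof (rule sats_cong)
  show "e i = e' i" if "i < bd0 p" for i using that assms(1,3) by (cases i) auto
  show "E i = E' i" if "i < bd1 p" for i using that assms(2,4) by (cases i) auto
qed

lemma sats_clo_embF:
  assumes M: "aca M"
  shows "sats M e (case_nat F E) (clo (embF p C g)) \<longleftrightarrow>
    (\<forall>x. sats M (case_nat x (\<lambda>_. szero M)) (\<lambda>_. F) C \<longrightarrow> aca.embeds M p g F x)"
proof -
  have "(\<lambda>_ :: nat. F) = case_nat F (\<lambda>_. F)" by (auto split: nat.splits)
  then show ?thesis unfolding clo_simps using aca.sats_embF[OF M, of "\<lambda>_. szero M" F "\<lambda>_. F" p C g] by simp
qed

lemma sats_clo_contr:
  assumes M: "aca M" and p: "arithmetical p"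
  shows "(\<exists>X\<in>ssets M. sats M e (case_nat X E) (clo (contr p))) \<longleftrightarrow>
    (\<exists>E. (\<forall>j. E j \<in> ssets M) \<and> sats M (\<lambda>_. szero M) E p)"
proof -
  have "sats M (\<lambda>_. szero M) (\<lambda>_. X) (contr p) = sats M (\<lambda>_. szero M) (case_nat X E) (contr p)" for X
  proof (rule sats_cong)
    show "X = case_nat X E i" if "i < bd1 (contr p)" for i
      using that contr_simps(3)[OF p] by (cases i) auto
  qed simp
  then show ?thesis unfolding clo_simps using aca.sats_contr_iff[OF M p, of "\<lambda>_. szero M" E] by simp
qed

lemma universal_sats:
  assumes U: "universal_Pi11 U" and q: "q \<in> Pi11" "sentence q" and M: "aca M"
    and E: "\<And>i. E i \<in> ssets M" and "sats M e E q"
  shows "sats M (case_nat (aca.nm M (fcode q)) e) E U"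
proof -
  have "ACA0 \<turnstile> Iff q (subst0 0 (num (fcode q)) U)" using U q unfolding universal_Pi11_def by blast
  then have "valid M (Iff q (subst0 0 (num (fcode q)) U))" by (rule soundness) (rule aca.ACA0_valid[OF M])
  then have "sats M e E (Iff q (subst0 0 (num (fcode q)) U))"
    using E by (simp add: valid_def del: sats_connectives)
  then show ?thesis using assms(6) by (simp add: sats_subst0 aca.ev_num[OF M])
qed

locale reflection =
  fixes S :: "fm set" and \<sigma> U u C
  assumes S: "is_theory S" "ACA0 \<subseteq> S" and \<sigma>: "defines_axioms \<sigma> S" and sound: "sound_for Pi11 S"
    and U: "universal_Pi11 U" and u: "U = All1 u" "arithmetical u"
    and C_def: "C = Conj (Pi11_sentence_fm (Var 0)) (Prv_fm \<sigma> (Var 0))"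
begin

lemma matrix_u: "matrix u"
  using U u by (auto simp: universal_Pi11_def matrix_def)

lemma C_bounds: "arithmetical C" "bd0 C \<le> 1" "bd1 C = 0"
  using bd_Pi11_sentence_fm bd_Prv_fm[OF \<sigma>] \<sigma> by (simp_all add: C_def defines_axioms_def bd_connectives)

lemma sats_RFN: "sats M e E (RFN_Pi11 U \<sigma>) \<longleftrightarrow>
    (\<forall>x. sats M (case_nat x e) E C \<longrightarrow> (\<forall>X\<in>ssets M. sats M (case_nat x e) (case_nat X E) u))"
  by (auto simp: RFN_Pi11_def C_def u(1))

lemma sat_C: "sat (case_nat n e) E C \<longleftrightarrow> (\<exists>q\<in>Pi11. sentence q \<and> S \<turnstile> q \<and> n = fcode q)"
  unfolding C_def by (auto simp: sat_Prv_fm[OF \<sigma> S(1)] sat_Pi11_sentence_fm fcode_inj)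

lemma C_cong: "sats M (case_nat x e) E C = sats M (case_nat x e') E' C"
  using C_bounds by (intro env_cong) auto

lemma u_true:
  assumes "q \<in> Pi11" "sentence q" "S \<turnstile> q" shows "sat (case_nat (fcode q) e) (case_nat X E) u"
proof -
  have "true_std q" using assms sound unfolding sound_for_def by blast
  then have "sats std e E q" by (simp add: true_std_def)
  from universal_sats[OF U assms(1,2) aca_std _ this] show ?thesis by (simp add: u(1))
qed

text \<open>Universality lets \<open>S\<close> replace its theorem \<open>q\<close> by the instance
  of \<open>U\<close> at the code of \<open>q\<close>, so that the single matrix \<open>u\<close>
  with a parameter serves all theorems.\<close>

lemma prv_WO:
  assumes "q \<in> Pi11" "sentence q" "S \<turnstile> q" shows "S \<turnstile> WO_fm (prog u (fcode q))"
proof (rule prv_by_models[OF S])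
  fix M :: "nat str" assume M: "aca M" and MS: "\<And>p. p \<in> S \<Longrightarrow> valid M p"
  show "valid M (WO_fm (prog u (fcode q)))"
  proof (rule validI)
    fix e E assume E: "\<And>i :: nat. E i \<in> ssets M"
    have "sats M e E q" using valid_sats[OF M soundness[OF assms(3)] assms(2)] MS by blast
    from universal_sats[OF U assms(1,2) M E this]
    show "sats M e E (WO_fm (prog u (fcode q)))"
      by (intro aca.WO_prog[OF M matrix_u, where e = e and E = E]) (simp add: u(1))
  qed
qed

text \<open>\<open>S\<close> proves the well-foundedness of the tree of each of its Pi11-theorems,
  so these trees have length at most \<open>pto S\<close> and embed into \<open>g\<close>. The added
  axiom speaks of all \<open>x\<close> with the property \<open>C\<close>, so in a model it covers
  nonstandard theorems too.\<close>

theorem reflection_if_less: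
  assumes T: "is_theory T" "ACA0 \<subseteq> T" and less: "pto S < pto T"
  shows "T \<turnstile>\<^bsub>Sigma11\<^esub> RFN_Pi11 U \<sigma>"
proof -
  obtain g where g: "recursive_wo g" "T \<turnstile> WO_fm g" "pto S < ordertype (rel_of g)"
    using less_pto[OF less] by blast
  then have wo: "Well_order (rel_of g)" by (simp add: recursive_wo_def)
  have "\<exists>r. (r, rel_of g) \<in> ordLeq \<and> (\<forall>s t. nord u n s t \<and> (\<forall>a b. t \<noteq> npr (npr a b) 0) \<longrightarrow> (s, t) \<in> r)"
    if n: "n \<in> {fcode q | q. q \<in> Pi11 \<and> sentence q \<and> S \<turnstile> q}" for n
  proof -
    obtain q where q: "n = fcode q" "q \<in> Pi11" "sentence q" "S \<turnstile> q" using n by blast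
    have rec: "recursive_wo (prog u n)"
      unfolding q(1) by (rule recursive_wo_prog[OF matrix_u]) (rule u_true[OF q(2-4)])
    from pto_upper[OF this prv_WO[OF q(2-4), folded q(1)]] g(3)
    have "ordertype (rel_of (prog u n)) < ordertype (rel_of g)" by (rule le_less_trans)
    then have "(rel_of (prog u n), rel_of g) \<in> ordLeq"
      using ordertype_less[OF _ wo] rec ordLess_imp_ordLeq unfolding recursive_wo_def by blast
    then show ?thesis by (intro exI[of _ "rel_of (prog u n)"]) (simp add: rel_of_prog)
  qed
  then have "\<exists>F. \<forall>n\<in>{fcode q | q. q \<in> Pi11 \<and> sentence q \<and> S \<turnstile> q}. aca.embeds std u g F n"
    by (rule embedding_exists[OF wo])
  then obtain F where F0: "\<forall>n\<in>{fcode q | q. q \<in> Pi11 \<and> sentence q \<and> S \<turnstile> q}. aca.embeds std u g F n"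
    by (elim exE) (rule that)
  have F: "aca.embeds std u g F (fcode q)" if "q \<in> Pi11" "sentence q" "S \<turnstile> q" for q
    by (rule bspec[OF F0]) (use that in blast)
  define q where "q = clo (embF u C g)"
  have q: "arithmetical q" "bd0 q = 0" "bd1 q \<le> 1"
    unfolding q_def using C_bounds(1) by (simp_all add: arithmetical_embF)
  have sent: "sentence (Ex1 q)" using q by (simp add: sentence_def Ex1_def)
  have "sats std e (case_nat F E) q" for e E
    unfolding q_def sats_clo_embF[OF aca_std] unfolding sats_std sat_C using F by blast
  then have true: "true_std (Ex1 q)" by (auto simp: true_std_def)
  have "insert (Ex1 q) T \<turnstile> RFN_Pi11 U \<sigma>"
  proof (rule prv_by_models)
    show "is_theory (insert (Ex1 q) T)" using T sent by (simp add: is_theory_def)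
    show "ACA0 \<subseteq> insert (Ex1 q) T" using T by blast
    fix M :: "nat str" assume M: "aca M" and MT: "\<And>p. p \<in> insert (Ex1 q) T \<Longrightarrow> valid M p"
    show "valid M (RFN_Pi11 U \<sigma>)"
    proof (rule validI)
      fix e E assume E: "\<And>i :: nat. E i \<in> ssets M"
      have "sats M e E (Ex1 q)" using valid_sats[OF M _ sent] MT by blast
      then obtain F where F: "F \<in> ssets M" "sats M e (case_nat F E) q" by auto
      have "valid M (WO_fm g)" using soundness[OF g(2)] MT by blast
      then have WO: "sats M e E (WO_fm g)" using E unfolding valid_def by blast
      show "sats M e E (RFN_Pi11 U \<sigma>)"
        unfolding sats_RFN
      proof (intro allI impI ballI)
        fix x X assume x: "sats M (case_nat x e) E C" and X: "X \<in> ssets M"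
        then have "aca.embeds M u g F x"
          using F(2) C_cong[of M x e E] unfolding q_def sats_clo_embF[OF M] by blast
        then show "sats M (case_nat x e) (case_nat X E) u"
          by (rule aca.embeds_true[OF M matrix_u F(1) _ WO X])
      qed
    qed
  qed
  then show ?thesis
    unfolding prv_with_def Sigma11_def using q(1) sent true by blast
qed

theorem less_if_reflection:
  assumes T: "is_theory T" "ACA0 \<subseteq> T" and refl: "T \<turnstile>\<^bsub>Sigma11\<^esub> RFN_Pi11 U \<sigma>"
  shows "pto S < pto T"
proof (rule ccontr)
  assume "\<not> pto S < pto T"
  then have le: "pto T \<le> pto S" by simp
  obtain q where q: "arithmetical q" "sentence (Ex1 q)" "true_std (Ex1 q)" "insert (Ex1 q) T \<turnstile> RFN_Pi11 U \<sigma>"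
    using refl unfolding prv_with_def Sigma11_def by blast
  then have q_bd: "bd0 q = 0" "bd1 q \<le> 1" by (simp_all add: sentence_def Ex1_def)
  have q_cong: "E 0 = E' 0 \<Longrightarrow> sats M e E q = sats M e' E' q" for M :: "nat str" and e e' E E'
    using q_bd by (intro env_cong) auto
  have u_cong: "E 0 = E' 0 \<Longrightarrow> sats M (case_nat x e) E u = sats M (case_nat x e') E' u"
    for M :: "nat str" and x e e' E E'
    using matrix_u unfolding matrix_def by (intro env_cong) auto
  \<comment> \<open>\<open>r\<close> is the matrix of the negated implication from
    \<open>Ex1 q\<close> to reflection: set variable 0 is a witness of \<open>q\<close>, set
    variable 1 a counterexample to \<open>u\<close>.\<close>
  define r where "r = Conj q (Ex0 (Conj C (Neg (psub Var Suc u))))"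
  have r: "arithmetical r" using q(1) C_bounds(1) u(2) by (simp add: r_def)
  \<comment> \<open>After contraction, \<open>p\<close> under one universal set quantifier expresses
    the implication. It has no free number variable; the parameter is set to 0 throughout.\<close>
  define p where "p = Neg (clo (contr r))"
  have p: "matrix p" using contr_simps(1)[OF r] by (simp add: p_def matrix_def)
  have sats_p: "(\<forall>X\<in>ssets M. sats M e (case_nat X E) p) \<longleftrightarrow> (sats M e0 E0 (Ex1 q) \<longrightarrow> sats M e0 E0 (RFN_Pi11 U \<sigma>))"
    if M: "aca M" for M :: "nat str" and e E e0 E0
  proof -
    let ?z = "\<lambda>_ :: nat. szero M"
    have "(\<exists>E. (\<forall>j. E j \<in> ssets M) \<and> sats M ?z E r) \<longleftrightarrow> sats M e0 E0 (Ex1 q) \<and> \<not> sats M e0 E0 (RFN_Pi11 U \<sigma>)"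
    proof
      assume "\<exists>E. (\<forall>j. E j \<in> ssets M) \<and> sats M ?z E r"
      then obtain E x where E: "\<And>j. E j \<in> ssets M" "sats M ?z E q" "sats M (case_nat x ?z) E C"
        "\<not> sats M (case_nat x ?z) (\<lambda>i. E (Suc i)) u"
        by (auto simp: r_def sats_psub)
      have "sats M e0 (case_nat (E 0) E0) q" using E(2) q_cong[of "case_nat (E 0) E0" E M e0 ?z] by simp
      moreover have "sats M (case_nat x e0) E0 C" using E(3) C_cong[of M x e0 E0 ?z E] by simp
      moreover have "\<not> sats M (case_nat x e0) (case_nat (E 1) E0) u"
        using E(4) u_cong[of "case_nat (E 1) E0" "\<lambda>i. E (Suc i)" M x e0 ?z] by simp
      ultimately show "sats M e0 E0 (Ex1 q) \<and> \<not> sats M e0 E0 (RFN_Pi11 U \<sigma>)"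
        unfolding sats_RFN sats_connectives using E(1) by blast
    next
      assume "sats M e0 E0 (Ex1 q) \<and> \<not> sats M e0 E0 (RFN_Pi11 U \<sigma>)"
      then obtain X x Y where X: "X \<in> ssets M" "sats M e0 (case_nat X E0) q" "sats M (case_nat x e0) E0 C"
        "Y \<in> ssets M" "\<not> sats M (case_nat x e0) (case_nat Y E0) u"
        unfolding sats_RFN sats_connectives by blast
      let ?E = "case_nat X (\<lambda>_. Y)"
      have "sats M ?z ?E q" using X(2) q_cong[of "case_nat X E0" ?E M e0 ?z] by simp
      moreover have "sats M (case_nat x ?z) ?E C" using X(3) C_cong[of M x e0 E0 ?z ?E] by simp
      moreover have "\<not> sats M (case_nat x ?z) (\<lambda>i. ?E (Suc i)) u"
        using X(5) u_cong[of "case_nat Y E0" "\<lambda>i. ?E (Suc i)" M x e0 ?z] by simp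
      ultimately have "sats M ?z ?E r" by (auto simp: r_def sats_psub)
      moreover have "\<forall>j. ?E j \<in> ssets M" using X(1,4) by (auto split: nat.splits)
      ultimately show "\<exists>E. (\<forall>j. E j \<in> ssets M) \<and> sats M ?z E r" by blast
    qed
    with sats_clo_contr[OF M r, of e E] show ?thesis unfolding p_def sats.simps by blast
  qed
  have RFN: "sats std e E (RFN_Pi11 U \<sigma>)" for e E
    unfolding sats_RFN sats_std sat_C using u_true by blast
  have "\<forall>X\<in>ssets std. sats std (case_nat 0 (\<lambda>_. 0)) (case_nat X (\<lambda>_. {})) p"
    unfolding sats_p[OF aca_std, of _ _ "\<lambda>_. 0" "\<lambda>_. {}"] using RFN by blast
  then have rec: "recursive_wo (prog p 0)"
    by (intro recursive_wo_prog[OF p, of 0 "\<lambda>_. 0" "\<lambda>_. {}"]) simp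
  have "T \<turnstile> WO_fm (prog p 0)"
  proof (rule prv_by_models[OF T])
    fix M :: "nat str" assume M: "aca M" and MT: "\<And>p. p \<in> T \<Longrightarrow> valid M p"
    show "valid M (WO_fm (prog p 0))"
    proof (rule validI)
      fix e E
      have "sats M e E (RFN_Pi11 U \<sigma>)" if "sats M e E (Ex1 q)"
      proof -
        have "valid M (Ex1 q)" using that sats_sentence[OF q(2), of M e E] unfolding valid_def by blast
        then have "valid M (RFN_Pi11 U \<sigma>)" using soundness[OF q(4)] MT by blast
        then show ?thesis by (rule valid_sats[OF M _ sentence_RFN[OF \<sigma> U]])
      qed
      then have "\<forall>X\<in>ssets M. sats M (case_nat (aca.nm M 0) e) (case_nat X E) p"
        unfolding sats_p[OF M, of _ _ e E] by blast
      then show "sats M e E (WO_fm (prog p 0))"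
        by (intro aca.WO_prog[OF M p, where e = e and E = E]) blast
    qed
  qed
  from order_trans[OF pto_upper[OF rec this] le]
  have r0: "ordertype (rel_of (prog p 0)) \<le> pto S" .
  have wo0: "Well_order (rel_of (prog p 0))" using rec by (simp add: recursive_wo_def)
  \<comment> \<open>\<open>S\<close> need not prove a well-order as long as \<open>pto S\<close>
    itself. Dropping the roots makes the order strictly shorter, so that some well-order provable in
    \<open>S\<close> exceeds it.\<close>
  obtain r1 where r1: "Well_order r1" "(r1, rel_of (prog p 0)) \<in> ordLess"
    "\<And>s t. nord p 0 s t \<Longrightarrow> (\<forall>a b. t \<noteq> npr (npr a b) 0) \<Longrightarrow> (s, t) \<in> r1"
    using nonroot_order[OF wo0] by blast
  then have "ordertype r1 < pto S" using ordertype_less[OF r1(1) wo0] r0 by (simp add: less_le_trans)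
  then obtain g where g: "recursive_wo g" "S \<turnstile> WO_fm g" "ordertype r1 < ordertype (rel_of g)"
    using less_pto by blast
  then have wo: "Well_order (rel_of g)" by (simp add: recursive_wo_def)
  have "(r1, rel_of g) \<in> ordLeq" using g(3) ordertype_less[OF r1(1) wo] ordLess_imp_ordLeq by blast
  then obtain F where F: "aca.embeds std p g F 0"
    using embedding_exists[OF wo, of "{0}" p] r1(3) by blast
  \<comment> \<open>Two existential claims are joined: set variable 0 embeds the tree for
    \<open>p\<close> at parameter 0 into \<open>g\<close>, and set variable 1 is the witness of
    \<open>q\<close>.\<close>
  define r' where "r' = Conj (embF p (Eq (Var 0) Zero) g) (psub Var Suc q)"
  have r': "arithmetical r'" using q(1) by (simp add: r'_def arithmetical_embF)
  define q' where "q' = clo (contr r')"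
  have q': "arithmetical q'" "bd0 q' = 0" "bd1 q' \<le> 1" using contr_simps(1)[OF r'] by (simp_all add: q'_def)
  have sent: "sentence (Ex1 q')" using q' by (simp add: sentence_def Ex1_def)
  obtain Y where "sats std (\<lambda>_. 0) (case_nat Y (\<lambda>_. {})) q" using q(3) by (auto simp: true_std_def)
  then have "sats std (\<lambda>_. 0) (\<lambda>_. Y) q"
    using q_cong[of "case_nat Y (\<lambda>_. {})" "\<lambda>_. Y" std "\<lambda>_. 0" "\<lambda>_. 0"] by simp
  then have "sats std (\<lambda>_. szero std) (case_nat F (\<lambda>_. Y)) r'"
    using F by (simp add: r'_def sats_psub aca.sats_embF[OF aca_std, unfolded sats_std])
  then have "\<exists>E. (\<forall>j. E j \<in> ssets std) \<and> sats std (\<lambda>_. szero std) E r'" by (intro exI[of _ "case_nat F (\<lambda>_. Y)"]) simp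
  then have "\<exists>X\<in>ssets std. sats std e (case_nat X E) q'" for e E
    unfolding q'_def sats_clo_contr[OF aca_std r'] .
  then have true: "true_std (Ex1 q')" by (simp add: true_std_def)
  have "insert (Ex1 q') S \<turnstile> RFN_Pi11 U \<sigma>"
  proof (rule prv_by_models)
    show "is_theory (insert (Ex1 q') S)" using S sent by (simp add: is_theory_def)
    show "ACA0 \<subseteq> insert (Ex1 q') S" using S by blast
    fix M :: "nat str" assume M: "aca M" and MS: "\<And>p. p \<in> insert (Ex1 q') S \<Longrightarrow> valid M p"
    show "valid M (RFN_Pi11 U \<sigma>)"
    proof (rule validI)
      fix e E assume E: "\<And>i :: nat. E i \<in> ssets M"
      have "sats M e E (Ex1 q')" using valid_sats[OF M _ sent] MS by blast
      then have "\<exists>X\<in>ssets M. sats M e (case_nat X E) q'" by simp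
      then obtain E' where E': "\<And>j :: nat. E' j \<in> ssets M" "sats M (\<lambda>_. szero M) E' r'"
        unfolding q'_def sats_clo_contr[OF M r'] by blast
      have "sats M (\<lambda>_. szero M) (case_nat (E' 0) (\<lambda>i. E' (Suc i))) (embF p (Eq (Var 0) Zero) g)"
        using E'(2) unfolding case_nat_eta r'_def by simp
      then have emb: "aca.embeds M p g (E' 0) (szero M)"
        unfolding aca.sats_embF[OF M] by simp
      have "sats M (\<lambda>_. szero M) (\<lambda>i. E' (Suc i)) q" using E'(2) by (simp add: r'_def sats_psub)
      then have "sats M e (case_nat (E' 1) E) q"
        using q_cong[of "case_nat (E' 1) E" "\<lambda>i. E' (Suc i)" M e "\<lambda>_. szero M"] by simp
      then have th: "sats M e E (Ex1 q)" using E'(1) by auto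
      have "valid M (WO_fm g)" using soundness[OF g(2)] MS by blast
      then have "sats M e E (WO_fm g)" using E unfolding valid_def by blast
      \<comment> \<open>The embedding and the well-order \<open>g\<close> yield the implication
        expressed by \<open>p\<close>; the witness of \<open>q\<close> supplies its premise.\<close>
      then have "\<forall>X\<in>ssets M. sats M (case_nat (szero M) e) (case_nat X E) p"
        using aca.embeds_true[OF M p E'(1) emb] by blast
      with th show "sats M e E (RFN_Pi11 U \<sigma>)" unfolding sats_p[OF M, of _ _ e E] by blast
    qed
  qed
  then show False by (rule no_self_reflection[OF S \<sigma> sound U q' true])
qed

end

theorem theorem1p10:
  fixes S T :: "fm set" and \<sigma> U :: fm
  assumes "is_theory S" and "is_theory T"
    and "ACA0 \<subseteq> S" and "ACA0 \<subseteq> T"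
    and "defines_axioms \<sigma> S" and "arith_definable T"
    and "sound_for Pi11 S" and "sound_for Pi11 T"
    and "universal_Pi11 U"
  shows "pto S < pto T \<longleftrightarrow> T \<turnstile>\<^bsub>Sigma11\<^esub> RFN_Pi11 U \<sigma>"
proof -
  obtain u where "U = All1 u" "arithmetical u" using assms(9) by (auto simp: universal_Pi11_def Pi11_def)
  then interpret reflection S \<sigma> U u "Conj (Pi11_sentence_fm (Var 0)) (Prv_fm \<sigma> (Var 0))"
    using assms by unfold_locales auto
  show ?thesis using reflection_if_less less_if_reflection assms(2,4) by blast
qed

end
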